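(* Let $J_\top$ be a simplicial set defined as a coproduct, pushout of a monomorphism, or countable composite of monomorphisms of simplicial sets, presented as the colimit of a diagram $J\colon\mathsf{J}^{\mathrm{op}}\to\mathcal{SS}et$ with colimit cocone components $\pi_c\colon Jc\to J_\top$. Let $A$ and $D$ be $\infty$-categories in an $\infty$-cosmos $\mathcal{K}$, let $d\colon D\to A^{J_\top}$ be a fixed diagram, and for each $c\in\mathsf{J}$ let $d_c\colon D\xrightarrow{d}A^{J_\top}\xrightarrow{A^{\pi_c}}A^{Jc}$ be the restricted diagram. Then the canonical cone $\Delta_{J_\top}\downarrow d\Rightarrow\Delta_{J_*}\downarrow d_*$, with legs the maps $\Delta_{J_\top}\downarrow d\to\Delta_{Jc}\downarrow d_c$ induced by $A^{\pi_c}$, displays $\Delta_{J_\top}\downarrow d$ as a limit of the diagram $\Delta_{J_*}\downarrow d_*\colon\mathsf{J}\to{}_D\mathrm{Mod}(\mathcal{K})_A$ in ${}_D\mathrm{Mod}(\mathcal{K})_A$.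
   Context: An $\infty$-cosmos is a simplicially enriched category $\mathcal{K}$ whose objects are called $\infty$-categories and whose hom simplicial sets $\mathrm{Fun}_{\mathcal{K}}(A,B)$ are quasi-categories (their vertices are called functors), equipped with a specified subcategory of isofibrations, such that: (a) as a simplicially enriched category, $\mathcal{K}$ has a terminal object $1$, small products, cotensors $A^U$ by all small simplicial sets $U$, limits of countable inverse sequences of isofibrations, and pullbacks of isofibrations along any functor; (b) the isofibrations contain the isomorphisms and all functors $A\to 1$, are stable under pullback along all functors, are closed under limits of countable inverse sequences; if $p\colon E\to B$ is an isofibration and $U\hookrightarrow V$ an inclusion of simplicial sets, then $E^V\to E^U\times_{B^U}B^V$ is an isofibration; and $\mathrm{Fun}_{\mathcal{K}}(X,p)$ is an isofibration of quasi-categories for any object $X$ and isofibration $p$. The slice $\mathcal{K}_{/B}$ is the $\infty$-cosmos whose objects are isofibrations with codomain $B$ and whose functor spaces are the fibres of $\mathrm{Fun}_{\mathcal{K}}(E,F)\to\mathrm{Fun}_{\mathcal{K}}(E,B)$ over the structure map. The dual $\mathcal{K}^{\mathrm{co}}$ has the same objects and $\mathrm{Fun}_{\mathcal{K}^{\mathrm{co}}}(A,B)=\mathrm{Fun}_{\mathcal{K}}(A,B)^{\mathrm{op}}$. The homotopy 2-category of $\mathcal{K}$ has hom-categories the homotopy categories of the $\mathrm{Fun}_{\mathcal{K}}(A,B)$; adjunctions refer to it. Write $A^{\mathbf 2}=A^{\Delta^1}$ with codomain and domain projections $p_1,p_0$. For $f\colon B\to A$, $g\colon C\to A$ the comma $f\downarrow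 g$ is the pullback of $(p_1,p_0)\colon A^{\mathbf 2}\to A\times A$ along $g\times f\colon C\times B\to A\times A$, with projection $(p_1,p_0)\colon f\downarrow g\to C\times B$; it is strictly functorial in commutative transformations of the cospan $(g,f)$. An isofibration $p\colon E\to B$ is a cocartesian fibration if $k\colon E^{\mathbf 2}\to p\downarrow B$, induced by $p_0$ and $p^{\mathbf 2}$, has a left adjoint right inverse (a left adjoint with invertible unit); cartesian fibrations are cocartesian fibrations in $\mathcal{K}^{\mathrm{co}}$. An object $E$ is groupoidal if all $\mathrm{Fun}_{\mathcal{K}}(X,E)$ are Kan complexes. A module from $A$ to $B$ is an isofibration $(q,p)\colon E\to A\times B$ such that (i) it is a cartesian fibration in $\mathcal{K}_{/A}$ from $q$ to the projection $A\times B\to A$; (ii) it is a cocartesian fibration in $\mathcal{K}_{/B}$ from $p$ to the projection $A\times B\to B$; (iii) it is groupoidal as an object of $\mathcal{K}_{/A\times B}$. ${}_A\mathrm{Mod}(\mathcal{K})_B$ is the full simplicial subcategory of $\mathcal{K}_{/A\times B}$ on the modules. The three cases for $J$: $\mathsf{J}$ is small discrete (coproduct); $\mathsf{J}$ is the cospan category, so $J$ is a span with one leg a monomorphism; $\mathsf{J}=\omega^{\mathrm{op}}$, so $J$ is a countable sequence of monomorphisms. $\Delta_U\colon A\to A^U$ denotes the constant diagram functor. The diagram $\Delta_{J_*}\downarrow d_*$ sends $c$ to the module $\Delta_{Jc}\downarrow d_c\to D\times A$ and $f\colon c\to c'$ to the map $\Delta_{Jc}\downarrow d_c\to\Delta_{Jc'}\downarrow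 d_{c'}$ over $D\times A$ induced on pullbacks by $A^{J(f)}\colon A^{Jc}\to A^{Jc'}$ (using $A^{J(f)}d_c=d_{c'}$, $A^{J(f)}\Delta_{Jc}=\Delta_{Jc'}$). The legs of the cone are likewise induced by $A^{\pi_c}\colon A^{J_\top}\to A^{Jc}$ and identities on $D$ and $A$. *)

theory Defs
  imports Main "HOL-Library.Infinite_Typeclass"
begin

section \<open>Simplicial sets\<close>

text \<open>A monotone map from [m] to [n] is the list of its m + 1 values, so that the m-simplices of
  the standard n-simplex are literally such lists. The simplicial operator \<open>act X n \<alpha>\<close> needs the
  degree n of its argument since the list does not determine n.\<close>

definition Delta :: "nat \<Rightarrow> nat \<Rightarrow> nat list set" where
  "Delta m n = {\<alpha>. length \<alpha> = Suc m \<and> sorted \<alpha> \<and> set \<alpha> \<subseteq> {..n}}"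

record 'a sset =
  simplices :: "nat \<Rightarrow> 'a set"
  act :: "nat \<Rightarrow> nat list \<Rightarrow> 'a \<Rightarrow> 'a"

definition simplicial_set :: "'a sset \<Rightarrow> bool" where
  "simplicial_set X \<longleftrightarrow>
     (\<forall>m n \<alpha> x. \<alpha> \<in> Delta m n \<longrightarrow> x \<in> simplices X n \<longrightarrow> act X n \<alpha> x \<in> simplices X m) \<and>
     (\<forall>n x. x \<in> simplices X n \<longrightarrow> act X n [0..<Suc n] x = x) \<and>
     (\<forall>k m n \<alpha> \<beta> x. \<beta> \<in> Delta k m \<longrightarrow> \<alpha> \<in> Delta m n \<longrightarrow> x \<in> simplices X n \<longrightarrow>
        act X m \<beta> (act X n \<alpha> x) = act X n (map (\<lambda>i. \<alpha> ! i) \<beta>) x)"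

text \<open>The image of a vertex under the degeneracy to degree n.\<close>

definition dg :: "'a sset \<Rightarrow> nat \<Rightarrow> 'a \<Rightarrow> 'a" where
  "dg X n x = act X 0 (replicate (Suc n) 0) x"

definition simplicial_map :: "'a sset \<Rightarrow> 'b sset \<Rightarrow> (nat \<Rightarrow> 'a \<Rightarrow> 'b) \<Rightarrow> bool" where
  "simplicial_map X Y \<phi> \<longleftrightarrow>
     (\<forall>n. \<forall>x\<in>simplices X n. \<phi> n x \<in> simplices Y n) \<and>
     (\<forall>m n. \<forall>\<alpha>\<in>Delta m n. \<forall>x\<in>simplices X n. \<phi> m (act X n \<alpha> x) = act Y n \<alpha> (\<phi> n x))"

definition simplicial_mono :: "'a sset \<Rightarrow> 'b sset \<Rightarrow> (nat \<Rightarrow> 'a \<Rightarrow> 'b) \<Rightarrow> bool" where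
  "simplicial_mono X Y \<phi> \<longleftrightarrow> simplicial_map X Y \<phi> \<and> (\<forall>n. inj_on (\<phi> n) (simplices X n))"

definition std :: "nat \<Rightarrow> nat list sset" where
  "std n = \<lparr>simplices = (\<lambda>m. Delta m n), act = (\<lambda>_ \<beta> \<alpha>. map (\<lambda>i. \<alpha> ! i) \<beta>)\<rparr>"

definition horn :: "nat \<Rightarrow> nat \<Rightarrow> nat list sset" where
  "horn n k = \<lparr>simplices = (\<lambda>m. {\<alpha> \<in> Delta m n. \<exists>i\<le>n. i \<noteq> k \<and> i \<notin> set \<alpha>}), act = act (std n)\<rparr>"

text \<open>The nerve of the groupoid with two objects 0, 1 and exactly one morphism between any two
  objects, and the inclusion of one of its objects.\<close>

definition free_iso :: "nat list sset" where
  "free_iso = \<lparr>simplices = (\<lambda>m. {\<alpha>. length \<alpha> = Suc m \<and> set \<alpha> \<subseteq> {0, 1}}),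
               act = (\<lambda>_ \<beta> \<alpha>. map (\<lambda>i. \<alpha> ! i) \<beta>)\<rparr>"

definition free_iso_pt :: "nat list sset" where
  "free_iso_pt = \<lparr>simplices = (\<lambda>m. {replicate (Suc m) 0}), act = act free_iso\<rparr>"

definition sprod :: "'a sset \<Rightarrow> 'b sset \<Rightarrow> ('a \<times> 'b) sset" where
  "sprod X Y = \<lparr>simplices = (\<lambda>n. simplices X n \<times> simplices Y n),
                act = (\<lambda>n \<alpha> (x, y). (act X n \<alpha> x, act Y n \<alpha> y))\<rparr>"

definition sop :: "'a sset \<Rightarrow> 'a sset" where
  "sop X = \<lparr>simplices = simplices X, act = (\<lambda>n \<alpha>. act X n (rev (map (\<lambda>i. n - i) \<alpha>)))\<rparr>"

text \<open>Below, U is a simplicial subset of V.\<close>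

definition extends_along :: "'b sset \<Rightarrow> 'a sset \<Rightarrow> 'a sset \<Rightarrow> bool" where
  "extends_along X U V \<longleftrightarrow>
     (\<forall>\<phi>. simplicial_map U X \<phi> \<longrightarrow>
        (\<exists>\<psi>. simplicial_map V X \<psi> \<and> (\<forall>m. \<forall>u\<in>simplices U m. \<psi> m u = \<phi> m u)))"

definition lifts_along ::
    "'b sset \<Rightarrow> 'c sset \<Rightarrow> (nat \<Rightarrow> 'b \<Rightarrow> 'c) \<Rightarrow> 'a sset \<Rightarrow> 'a sset \<Rightarrow> bool" where
  "lifts_along X Y \<pi> U V \<longleftrightarrow>
     (\<forall>\<phi> \<chi>. simplicial_map U X \<phi> \<longrightarrow> simplicial_map V Y \<chi> \<longrightarrow>
        (\<forall>m. \<forall>u\<in>simplices U m. \<pi> m (\<phi> m u) = \<chi> m u) \<longrightarrow>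
        (\<exists>\<psi>. simplicial_map V X \<psi> \<and> (\<forall>m. \<forall>u\<in>simplices U m. \<psi> m u = \<phi> m u) \<and>
             (\<forall>m. \<forall>v\<in>simplices V m. \<pi> m (\<psi> m v) = \<chi> m v)))"

definition quasi_category :: "'a sset \<Rightarrow> bool" where
  "quasi_category X \<longleftrightarrow>
     simplicial_set X \<and> (\<forall>n k. 0 < k \<longrightarrow> k < n \<longrightarrow> extends_along X (horn n k) (std n))"

definition kan_complex :: "'a sset \<Rightarrow> bool" where
  "kan_complex X \<longleftrightarrow>
     simplicial_set X \<and> (\<forall>n k. 1 \<le> n \<longrightarrow> k \<le> n \<longrightarrow> extends_along X (horn n k) (std n))"

definition qcat_isofibration :: "'a sset \<Rightarrow> 'b sset \<Rightarrow> (nat \<Rightarrow> 'a \<Rightarrow> 'b) \<Rightarrow> bool" where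
  "qcat_isofibration X Y \<pi> \<longleftrightarrow>
     quasi_category X \<and> quasi_category Y \<and> simplicial_map X Y \<pi> \<and>
     (\<forall>n k. 0 < k \<longrightarrow> k < n \<longrightarrow> lifts_along X Y \<pi> (horn n k) (std n)) \<and>
     lifts_along X Y \<pi> free_iso_pt free_iso"

subsection \<open>The homotopy category of a quasi-category\<close>

definition edge :: "'a sset \<Rightarrow> 'a \<Rightarrow> 'a \<Rightarrow> 'a \<Rightarrow> bool" where
  "edge Q x y e \<longleftrightarrow> e \<in> simplices Q 1 \<and> act Q 1 [0] e = x \<and> act Q 1 [1] e = y"

definition homotopic :: "'a sset \<Rightarrow> 'a \<Rightarrow> 'a \<Rightarrow> bool" where
  "homotopic Q e e' \<longleftrightarrow>
     (\<exists>\<sigma>\<in>simplices Q 2. act Q 2 [0, 1] \<sigma> = e \<and> act Q 2 [0, 2] \<sigma> = e' \<and>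
        act Q 2 [1, 2] \<sigma> = dg Q 1 (act Q 1 [1] e))"

definition hclass :: "'a sset \<Rightarrow> 'a \<Rightarrow> 'a set" where
  "hclass Q e = {e' \<in> simplices Q 1. homotopic Q e e'}"

text \<open>The composite of two homotopy classes of edges, \<open>\<alpha>\<close> first. In a quasi-category the long
  edges of all 2-simplices with short edges in \<open>\<alpha>\<close> and \<open>\<beta>\<close> make up exactly one homotopy class.\<close>

definition hcomp :: "'a sset \<Rightarrow> 'a set \<Rightarrow> 'a set \<Rightarrow> 'a set" where
  "hcomp Q \<beta> \<alpha> = {act Q 2 [0, 2] \<sigma> | \<sigma>. \<sigma> \<in> simplices Q 2 \<and> act Q 2 [0, 1] \<sigma> \<in> \<alpha> \<and> act Q 2 [1, 2] \<sigma> \<in> \<beta>}"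

definition hid :: "'a sset \<Rightarrow> 'a \<Rightarrow> 'a set" where
  "hid Q x = hclass Q (dg Q 1 x)"

definition hinvertible :: "'a sset \<Rightarrow> 'a \<Rightarrow> 'a \<Rightarrow> 'a \<Rightarrow> bool" where
  "hinvertible Q x y e \<longleftrightarrow> edge Q x y e \<and>
     (\<exists>e'. edge Q y x e' \<and> hcomp Q (hclass Q e') (hclass Q e) = hid Q x \<and>
           hcomp Q (hclass Q e) (hclass Q e') = hid Q y)"


section \<open>Simplicially enriched categories\<close>

text \<open>\<open>Cmp K A B C n g f\<close> is the composite of n-simplices g of Fun(B,C) and f of Fun(A,B).\<close>

record ('o, 's) scat =
  Obj :: "'o set"
  Fun :: "'o \<Rightarrow> 'o \<Rightarrow> 's sset"
  Cmp :: "'o \<Rightarrow> 'o \<Rightarrow> 'o \<Rightarrow> nat \<Rightarrow> 's \<Rightarrow> 's \<Rightarrow> 's"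
  Idt :: "'o \<Rightarrow> 's"

abbreviation functors :: "('o, 's, 'z) scat_scheme \<Rightarrow> 'o \<Rightarrow> 'o \<Rightarrow> 's set" where
  "functors K A B \<equiv> simplices (Fun K A B) 0"

abbreviation fcomp :: "('o, 's, 'z) scat_scheme \<Rightarrow> 'o \<Rightarrow> 'o \<Rightarrow> 'o \<Rightarrow> 's \<Rightarrow> 's \<Rightarrow> 's" where
  "fcomp K A B C g f \<equiv> Cmp K A B C 0 g f"

text \<open>Whiskering of n-simplices with a functor on the left, resp. on the right.\<close>

definition post ::
    "('o, 's, 'z) scat_scheme \<Rightarrow> 'o \<Rightarrow> 'o \<Rightarrow> 'o \<Rightarrow> 's \<Rightarrow> nat \<Rightarrow> 's \<Rightarrow> 's" where
  "post K A B C g n x = Cmp K A B C n (dg (Fun K B C) n g) x"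

definition pre ::
    "('o, 's, 'z) scat_scheme \<Rightarrow> 'o \<Rightarrow> 'o \<Rightarrow> 'o \<Rightarrow> 's \<Rightarrow> nat \<Rightarrow> 's \<Rightarrow> 's" where
  "pre K A B C f n x = Cmp K A B C n x (dg (Fun K A B) n f)"

definition simplicial_category :: "('o, 's, 'z) scat_scheme \<Rightarrow> bool" where
  "simplicial_category K \<longleftrightarrow>
     (\<forall>A\<in>Obj K. \<forall>B\<in>Obj K. simplicial_set (Fun K A B)) \<and>
     (\<forall>A\<in>Obj K. \<forall>B\<in>Obj K. \<forall>C\<in>Obj K.
        simplicial_map (sprod (Fun K B C) (Fun K A B)) (Fun K A C) (\<lambda>n (g, f). Cmp K A B C n g f)) \<and>
     (\<forall>A\<in>Obj K. Idt K A \<in> functors K A A) \<and>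
     (\<forall>A\<in>Obj K. \<forall>B\<in>Obj K. \<forall>n. \<forall>f\<in>simplices (Fun K A B) n.
        post K A B B (Idt K B) n f = f \<and> pre K A A B (Idt K A) n f = f) \<and>
     (\<forall>A\<in>Obj K. \<forall>B\<in>Obj K. \<forall>C\<in>Obj K. \<forall>D\<in>Obj K. \<forall>n.
        \<forall>f\<in>simplices (Fun K A B) n. \<forall>g\<in>simplices (Fun K B C) n. \<forall>h\<in>simplices (Fun K C D) n.
        Cmp K A B D n (Cmp K B C D n h g) f = Cmp K A C D n h (Cmp K A B C n g f))"

definition full_sub :: "('o, 's, 'z) scat_scheme \<Rightarrow> 'o set \<Rightarrow> ('o, 's) scat" where
  "full_sub K S = \<lparr>Obj = S, Fun = Fun K, Cmp = Cmp K, Idt = Idt K\<rparr>"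

definition isomorphism :: "('o, 's, 'z) scat_scheme \<Rightarrow> 'o \<Rightarrow> 'o \<Rightarrow> 's \<Rightarrow> bool" where
  "isomorphism K A B f \<longleftrightarrow> f \<in> functors K A B \<and>
     (\<exists>g\<in>functors K B A. fcomp K A B A g f = Idt K A \<and> fcomp K B A B f g = Idt K B)"

subsection \<open>Simplicially enriched limits\<close>

text \<open>All universal properties are enriched: they are stated for the n-simplices of the
  function complexes, for every n.\<close>

definition is_terminal :: "('o, 's, 'z) scat_scheme \<Rightarrow> 'o \<Rightarrow> bool" where
  "is_terminal K T \<longleftrightarrow> T \<in> Obj K \<and> (\<forall>X\<in>Obj K. \<forall>n. \<exists>!x. x \<in> simplices (Fun K X T) n)"

definition is_product ::
    "('o, 's, 'z) scat_scheme \<Rightarrow> 'i set \<Rightarrow> ('i \<Rightarrow> 'o) \<Rightarrow> 'o \<Rightarrow> ('i \<Rightarrow> 's) \<Rightarrow> bool" where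
  "is_product K I F P \<rho> \<longleftrightarrow> P \<in> Obj K \<and> (\<forall>i\<in>I. \<rho> i \<in> functors K P (F i)) \<and>
     (\<forall>X\<in>Obj K. \<forall>n x. (\<forall>i\<in>I. x i \<in> simplices (Fun K X (F i)) n) \<longrightarrow>
        (\<exists>!y. y \<in> simplices (Fun K X P) n \<and> (\<forall>i\<in>I. post K X P (F i) (\<rho> i) n y = x i)))"

definition is_bin_product ::
    "('o, 's, 'z) scat_scheme \<Rightarrow> 'o \<Rightarrow> 'o \<Rightarrow> 'o \<Rightarrow> 's \<Rightarrow> 's \<Rightarrow> bool" where
  "is_bin_product K A B P a b \<longleftrightarrow> P \<in> Obj K \<and> a \<in> functors K P A \<and> b \<in> functors K P B \<and>
     (\<forall>X\<in>Obj K. \<forall>n. \<forall>x\<in>simplices (Fun K X A) n. \<forall>y\<in>simplices (Fun K X B) n.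
        \<exists>!z. z \<in> simplices (Fun K X P) n \<and> post K X P A a n z = x \<and> post K X P B b n z = y)"

definition is_pullback ::
    "('o, 's, 'z) scat_scheme \<Rightarrow> 'o \<Rightarrow> 'o \<Rightarrow> 'o \<Rightarrow> 's \<Rightarrow> 's \<Rightarrow> 'o \<Rightarrow> 's \<Rightarrow> 's \<Rightarrow> bool" where
  "is_pullback K E C B p f P a b \<longleftrightarrow> P \<in> Obj K \<and> a \<in> functors K P E \<and> b \<in> functors K P C \<and>
     fcomp K P E B p a = fcomp K P C B f b \<and>
     (\<forall>X\<in>Obj K. \<forall>n. \<forall>x\<in>simplices (Fun K X E) n. \<forall>y\<in>simplices (Fun K X C) n.
        post K X E B p n x = post K X C B f n y \<longrightarrow>
        (\<exists>!z. z \<in> simplices (Fun K X P) n \<and> post K X P E a n z = x \<and> post K X P C b n z = y))"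

text \<open>The limit of the inverse sequence of functors p n from F (n + 1) to F n.\<close>

definition is_sequential_limit ::
    "('o, 's, 'z) scat_scheme \<Rightarrow> (nat \<Rightarrow> 'o) \<Rightarrow> (nat \<Rightarrow> 's) \<Rightarrow> 'o \<Rightarrow> (nat \<Rightarrow> 's) \<Rightarrow> bool" where
  "is_sequential_limit K F p L \<rho> \<longleftrightarrow> L \<in> Obj K \<and> (\<forall>i. \<rho> i \<in> functors K L (F i)) \<and>
     (\<forall>i. fcomp K L (F (Suc i)) (F i) (p i) (\<rho> (Suc i)) = \<rho> i) \<and>
     (\<forall>X\<in>Obj K. \<forall>n x. (\<forall>i. x i \<in> simplices (Fun K X (F i)) n) \<and>
        (\<forall>i. post K X (F (Suc i)) (F i) (p i) n (x (Suc i)) = x i) \<longrightarrow>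
        (\<exists>!y. y \<in> simplices (Fun K X L) n \<and> (\<forall>i. post K X L (F i) (\<rho> i) n y = x i)))"

text \<open>The cotensor P of A by U: its universal element is a simplicial map \<open>\<epsilon>\<close> from U to Fun(P,A), and
  an n-simplex of Fun(X,P) is the same as a simplicial map from the product of U with the standard
  n-simplex to Fun(X,A).\<close>

definition is_cotensor ::
    "('o, 's, 'z) scat_scheme \<Rightarrow> 'o \<Rightarrow> 'u sset \<Rightarrow> 'o \<Rightarrow> (nat \<Rightarrow> 'u \<Rightarrow> 's) \<Rightarrow> bool" where
  "is_cotensor K A U P \<epsilon> \<longleftrightarrow> P \<in> Obj K \<and> simplicial_map U (Fun K P A) \<epsilon> \<and>
     (\<forall>X\<in>Obj K. \<forall>n \<phi>. simplicial_map (sprod U (std n)) (Fun K X A) \<phi> \<longrightarrow>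
        (\<exists>!x. x \<in> simplices (Fun K X P) n \<and>
           (\<forall>m. \<forall>u\<in>simplices U m. \<forall>\<alpha>\<in>Delta m n.
              Cmp K X P A m (\<epsilon> m u) (act (Fun K X P) n \<alpha> x) = \<phi> m (u, \<alpha>))))"

subsection \<open>Chosen limits and induced functors\<close>

text \<open>Binary products, pullbacks and cotensors are determined up to unique isomorphism; we choose
  one of each.\<close>

definition prod_data :: "('o, 's, 'z) scat_scheme \<Rightarrow> 'o \<Rightarrow> 'o \<Rightarrow> 'o \<times> 's \<times> 's" where
  "prod_data K A B = (SOME (P, a, b). is_bin_product K A B P a b)"

definition prod_ob :: "('o, 's, 'z) scat_scheme \<Rightarrow> 'o \<Rightarrow> 'o \<Rightarrow> 'o" where
  "prod_ob K A B = fst (prod_data K A B)"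

definition proj1 :: "('o, 's, 'z) scat_scheme \<Rightarrow> 'o \<Rightarrow> 'o \<Rightarrow> 's" where
  "proj1 K A B = fst (snd (prod_data K A B))"

definition proj2 :: "('o, 's, 'z) scat_scheme \<Rightarrow> 'o \<Rightarrow> 'o \<Rightarrow> 's" where
  "proj2 K A B = snd (snd (prod_data K A B))"

text \<open>The functor (f, g) from X to the product of A and B.\<close>

definition pairing :: "('o, 's, 'z) scat_scheme \<Rightarrow> 'o \<Rightarrow> 'o \<Rightarrow> 'o \<Rightarrow> 's \<Rightarrow> 's \<Rightarrow> 's" where
  "pairing K X A B f g = (THE h. h \<in> functors K X (prod_ob K A B) \<and>
     fcomp K X (prod_ob K A B) A (proj1 K A B) h = f \<and>
     fcomp K X (prod_ob K A B) B (proj2 K A B) h = g)"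

text \<open>The product of g from C to C' and f from B to B'.\<close>

definition prod_map ::
    "('o, 's, 'z) scat_scheme \<Rightarrow> 'o \<Rightarrow> 'o \<Rightarrow> 'o \<Rightarrow> 'o \<Rightarrow> 's \<Rightarrow> 's \<Rightarrow> 's" where
  "prod_map K C C' B B' g f = pairing K (prod_ob K C B) C' B'
     (fcomp K (prod_ob K C B) C C' g (proj1 K C B)) (fcomp K (prod_ob K C B) B B' f (proj2 K C B))"

definition pullback_data ::
    "('o, 's, 'z) scat_scheme \<Rightarrow> 'o \<Rightarrow> 'o \<Rightarrow> 'o \<Rightarrow> 's \<Rightarrow> 's \<Rightarrow> 'o \<times> 's \<times> 's" where
  "pullback_data K E C B p f = (SOME (P, a, b). is_pullback K E C B p f P a b)"

definition cotensor_data ::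
    "('o, 's, 'z) scat_scheme \<Rightarrow> 'o \<Rightarrow> 'u sset \<Rightarrow> 'o \<times> (nat \<Rightarrow> 'u \<Rightarrow> 's)" where
  "cotensor_data K A U = (SOME (P, \<epsilon>). is_cotensor K A U P \<epsilon>)"

definition cotensor :: "('o, 's, 'z) scat_scheme \<Rightarrow> 'o \<Rightarrow> 'u sset \<Rightarrow> 'o" where
  "cotensor K A U = fst (cotensor_data K A U)"

definition cotensor_ev :: "('o, 's, 'z) scat_scheme \<Rightarrow> 'o \<Rightarrow> 'u sset \<Rightarrow> nat \<Rightarrow> 'u \<Rightarrow> 's" where
  "cotensor_ev K A U = snd (cotensor_data K A U)"

text \<open>The functor from X to the cotensor that corresponds to a simplicial map \<open>\<phi>\<close> from U to
  Fun(X,A).\<close>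

definition cotensor_lift ::
    "('o, 's, 'z) scat_scheme \<Rightarrow> 'o \<Rightarrow> 'u sset \<Rightarrow> 'o \<Rightarrow> (nat \<Rightarrow> 'u \<Rightarrow> 's) \<Rightarrow> 's" where
  "cotensor_lift K A U X \<phi> = (THE x. x \<in> functors K X (cotensor K A U) \<and>
     (\<forall>m. \<forall>u\<in>simplices U m. pre K X (cotensor K A U) A x m (cotensor_ev K A U m u) = \<phi> m u))"

text \<open>For i from U to V, the functor from \<open>A\<^sup>V\<close> to \<open>A\<^sup>U\<close>.\<close>

definition cotensor_restrict ::
    "('o, 's, 'z) scat_scheme \<Rightarrow> 'o \<Rightarrow> 'u sset \<Rightarrow> 'v sset \<Rightarrow> (nat \<Rightarrow> 'u \<Rightarrow> 'v) \<Rightarrow> 's" where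
  "cotensor_restrict K A U V i = cotensor_lift K A U (cotensor K A V) (\<lambda>m u. cotensor_ev K A V m (i m u))"

text \<open>For f from A to B, the functor from \<open>A\<^sup>U\<close> to \<open>B\<^sup>U\<close>.\<close>

definition cotensor_map :: "('o, 's, 'z) scat_scheme \<Rightarrow> 'o \<Rightarrow> 'o \<Rightarrow> 'u sset \<Rightarrow> 's \<Rightarrow> 's" where
  "cotensor_map K A B U f =
     cotensor_lift K B U (cotensor K A U) (\<lambda>m u. post K (cotensor K A U) A B f m (cotensor_ev K A U m u))"

definition constant_diagram :: "('o, 's, 'z) scat_scheme \<Rightarrow> 'o \<Rightarrow> 'u sset \<Rightarrow> 's" where
  "constant_diagram K A U = cotensor_lift K A U A (\<lambda>m u. dg (Fun K A A) m (Idt K A))"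

abbreviation arr_ob :: "('o, 's, 'z) scat_scheme \<Rightarrow> 'o \<Rightarrow> 'o" where
  "arr_ob K A \<equiv> cotensor K A (std 1)"

definition arr_dom :: "('o, 's, 'z) scat_scheme \<Rightarrow> 'o \<Rightarrow> 's" where
  "arr_dom K A = cotensor_ev K A (std 1) 0 [0]"

definition arr_cod :: "('o, 's, 'z) scat_scheme \<Rightarrow> 'o \<Rightarrow> 's" where
  "arr_cod K A = cotensor_ev K A (std 1) 0 [1]"

subsection \<open>Comma objects\<close>

text \<open>For f from B to A and g from C to A: the comma object, its functor to the arrow object of A,
  and its functor to the product of C and B.\<close>

definition comma_data ::
    "('o, 's, 'z) scat_scheme \<Rightarrow> 'o \<Rightarrow> 'o \<Rightarrow> 'o \<Rightarrow> 's \<Rightarrow> 's \<Rightarrow> 'o \<times> 's \<times> 's" where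
  "comma_data K A B C f g = pullback_data K (arr_ob K A) (prod_ob K C B) (prod_ob K A A)
     (pairing K (arr_ob K A) A A (arr_cod K A) (arr_dom K A)) (prod_map K C A B A g f)"

definition comma_ob :: "('o, 's, 'z) scat_scheme \<Rightarrow> 'o \<Rightarrow> 'o \<Rightarrow> 'o \<Rightarrow> 's \<Rightarrow> 's \<Rightarrow> 'o" where
  "comma_ob K A B C f g = fst (comma_data K A B C f g)"

definition comma_arr :: "('o, 's, 'z) scat_scheme \<Rightarrow> 'o \<Rightarrow> 'o \<Rightarrow> 'o \<Rightarrow> 's \<Rightarrow> 's \<Rightarrow> 's" where
  "comma_arr K A B C f g = fst (snd (comma_data K A B C f g))"

definition comma_proj :: "('o, 's, 'z) scat_scheme \<Rightarrow> 'o \<Rightarrow> 'o \<Rightarrow> 'o \<Rightarrow> 's \<Rightarrow> 's \<Rightarrow> 's" where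
  "comma_proj K A B C f g = snd (snd (comma_data K A B C f g))"

text \<open>For h from A to A', f' = h f and g' = h g: the induced functor between the comma objects that
  is the identity on B and C.\<close>

definition comma_map ::
    "('o, 's, 'z) scat_scheme \<Rightarrow> 'o \<Rightarrow> 'o \<Rightarrow> 'o \<Rightarrow> 's \<Rightarrow> 's \<Rightarrow> 'o \<Rightarrow> 's \<Rightarrow> 's \<Rightarrow> 's \<Rightarrow> 's" where
  "comma_map K A B C f g A' f' g' h =
     (let P = comma_ob K A B C f g; P' = comma_ob K A' B C f' g' in
      THE m. m \<in> functors K P P' \<and>
        fcomp K P P' (arr_ob K A') (comma_arr K A' B C f' g') m =
          fcomp K P (arr_ob K A) (arr_ob K A') (cotensor_map K A A' (std 1) h) (comma_arr K A B C f g) \<and>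
        fcomp K P P' (prod_ob K C B) (comma_proj K A' B C f' g') m = comma_proj K A B C f g)"

subsection \<open>Adjunctions in the homotopy 2-category\<close>

text \<open>The functor f from B to A is left adjoint to u from A to B. The 2-cells are the homotopy
  classes of the edges \<open>\<eta>\<close> and \<open>\<epsilon>\<close>.\<close>

definition adjunction ::
    "('o, 's, 'z) scat_scheme \<Rightarrow> 'o \<Rightarrow> 'o \<Rightarrow> 's \<Rightarrow> 's \<Rightarrow> 's \<Rightarrow> 's \<Rightarrow> bool" where
  "adjunction K A B f u \<eta> \<epsilon> \<longleftrightarrow> f \<in> functors K B A \<and> u \<in> functors K A B \<and>
     edge (Fun K B B) (Idt K B) (fcomp K B A B u f) \<eta> \<and>
     edge (Fun K A A) (fcomp K A B A f u) (Idt K A) \<epsilon> \<and>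
     hcomp (Fun K B A) (hclass (Fun K B A) (pre K B A A f 1 \<epsilon>))
       (hclass (Fun K B A) (post K B B A f 1 \<eta>)) = hid (Fun K B A) f \<and>
     hcomp (Fun K A B) (hclass (Fun K A B) (post K A A B u 1 \<epsilon>))
       (hclass (Fun K A B) (pre K A B B u 1 \<eta>)) = hid (Fun K A B) u"

definition has_lari :: "('o, 's, 'z) scat_scheme \<Rightarrow> 'o \<Rightarrow> 'o \<Rightarrow> 's \<Rightarrow> bool" where
  "has_lari K A B u \<longleftrightarrow> (\<exists>f \<eta> \<epsilon>. adjunction K A B f u \<eta> \<epsilon> \<and>
     hinvertible (Fun K B B) (Idt K B) (fcomp K B A B u f) \<eta>)"


section \<open>Infinity-cosmoi\<close>

record ('o, 's) cosmos = "('o, 's) scat" +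
  Isofib :: "'o \<Rightarrow> 'o \<Rightarrow> 's set"

text \<open>The type \<open>'u\<close> determines size: a set or simplicial set is small if its elements are drawn from
  \<open>'u\<close>. Since \<open>'u\<close> is infinite, this includes, up to isomorphism, all countable ones, in particular
  the standard simplices. For an inverse sequence, the leg to F 0 is required to be an isofibration;
  truncating the sequence gives the other legs.\<close>

definition infinity_cosmos :: "'u::infinite itself \<Rightarrow> ('o, 's) cosmos \<Rightarrow> bool" where
  "infinity_cosmos _ K \<longleftrightarrow>
     simplicial_category K \<and>
     (\<forall>A\<in>Obj K. \<forall>B\<in>Obj K. quasi_category (Fun K A B)) \<and>
     (\<forall>A\<in>Obj K. \<forall>B\<in>Obj K. Isofib K A B \<subseteq> functors K A B) \<and>
     (\<forall>A\<in>Obj K. Idt K A \<in> Isofib K A A) \<and>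
     (\<forall>A\<in>Obj K. \<forall>B\<in>Obj K. \<forall>C\<in>Obj K. \<forall>f\<in>Isofib K A B. \<forall>g\<in>Isofib K B C.
        fcomp K A B C g f \<in> Isofib K A C) \<and>
     (\<exists>T. is_terminal K T) \<and>
     (\<forall>(I :: 'u set) F. (\<forall>i\<in>I. F i \<in> Obj K) \<longrightarrow> (\<exists>P \<rho>. is_product K I F P \<rho>)) \<and>
     (\<forall>A\<in>Obj K. \<forall>U :: 'u sset. simplicial_set U \<longrightarrow> (\<exists>P \<epsilon>. is_cotensor K A U P \<epsilon>)) \<and>
     (\<forall>F p. (\<forall>i. F i \<in> Obj K) \<longrightarrow> (\<forall>i. p i \<in> Isofib K (F (Suc i)) (F i)) \<longrightarrow>
        (\<exists>L \<rho>. is_sequential_limit K F p L \<rho>)) \<and>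
     (\<forall>E\<in>Obj K. \<forall>B\<in>Obj K. \<forall>C\<in>Obj K. \<forall>p\<in>Isofib K E B. \<forall>f\<in>functors K C B.
        \<exists>P a b. is_pullback K E C B p f P a b) \<and>
     (\<forall>A\<in>Obj K. \<forall>B\<in>Obj K. \<forall>f. isomorphism K A B f \<longrightarrow> f \<in> Isofib K A B) \<and>
     (\<forall>A\<in>Obj K. \<forall>T. is_terminal K T \<longrightarrow> functors K A T \<subseteq> Isofib K A T) \<and>
     (\<forall>E\<in>Obj K. \<forall>B\<in>Obj K. \<forall>C\<in>Obj K. \<forall>p\<in>Isofib K E B. \<forall>f\<in>functors K C B.
        \<forall>P a b. is_pullback K E C B p f P a b \<longrightarrow> b \<in> Isofib K P C) \<and>
     (\<forall>F p L \<rho>. (\<forall>i. F i \<in> Obj K) \<longrightarrow> (\<forall>i. p i \<in> Isofib K (F (Suc i)) (F i)) \<longrightarrow>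
        is_sequential_limit K F p L \<rho> \<longrightarrow> \<rho> 0 \<in> Isofib K L (F 0)) \<and>
     (\<forall>E\<in>Obj K. \<forall>B\<in>Obj K. \<forall>p\<in>Isofib K E B. \<forall>(U :: 'u sset) (V :: 'u sset) i.
        simplicial_set U \<longrightarrow> simplicial_set V \<longrightarrow> simplicial_mono U V i \<longrightarrow>
        (\<forall>P a b m. is_pullback K (cotensor K E U) (cotensor K B V) (cotensor K B U)
             (cotensor_map K E B U p) (cotensor_restrict K B U V i) P a b \<longrightarrow>
           m \<in> functors K (cotensor K E V) P \<longrightarrow>
           fcomp K (cotensor K E V) P (cotensor K E U) a m = cotensor_restrict K E U V i \<longrightarrow>
           fcomp K (cotensor K E V) P (cotensor K B V) b m = cotensor_map K E B V p \<longrightarrow>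
           m \<in> Isofib K (cotensor K E V) P)) \<and>
     (\<forall>X\<in>Obj K. \<forall>E\<in>Obj K. \<forall>B\<in>Obj K. \<forall>p\<in>Isofib K E B.
        qcat_isofibration (Fun K X E) (Fun K X B) (post K X E B p))"

text \<open>An object of the slice over B is a pair of an object and its structure map. Its isofibrations
  are the functors over B that are isofibrations of K.\<close>

definition slice :: "('o, 's) cosmos \<Rightarrow> 'o \<Rightarrow> ('o \<times> 's, 's) cosmos" where
  "slice K B = \<lparr>
     Obj = {(E, p). E \<in> Obj K \<and> p \<in> Isofib K E B},
     Fun = (\<lambda>(E, p) (F, q). \<lparr>
       simplices = (\<lambda>n. {x \<in> simplices (Fun K E F) n. post K E F B q n x = dg (Fun K E B) n p}),
       act = act (Fun K E F)\<rparr>),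
     Cmp = (\<lambda>(E, p) (F, q) (G, r). Cmp K E F G),
     Idt = (\<lambda>(E, p). Idt K E),
     Isofib = (\<lambda>(E, p) (F, q). {f \<in> Isofib K E F. fcomp K E F B q f = p})\<rparr>"

definition co_dual :: "('o, 's) cosmos \<Rightarrow> ('o, 's) cosmos" where
  "co_dual K = K\<lparr>Fun := (\<lambda>A B. sop (Fun K A B))\<rparr>"

subsection \<open>Fibrations and modules\<close>

definition cocartesian_fibration :: "('o, 's) cosmos \<Rightarrow> 'o \<Rightarrow> 'o \<Rightarrow> 's \<Rightarrow> bool" where
  "cocartesian_fibration K E B p \<longleftrightarrow> E \<in> Obj K \<and> B \<in> Obj K \<and> p \<in> Isofib K E B \<and>
     (let P = comma_ob K B E B p (Idt K B) in
      \<exists>k\<in>functors K (arr_ob K E) P.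
        fcomp K (arr_ob K E) P (arr_ob K B) (comma_arr K B E B p (Idt K B)) k
          = cotensor_map K E B (std 1) p \<and>
        fcomp K (arr_ob K E) P (prod_ob K B E) (comma_proj K B E B p (Idt K B)) k
          = pairing K (arr_ob K E) B E (fcomp K (arr_ob K E) E B p (arr_cod K E)) (arr_dom K E) \<and>
        has_lari K (arr_ob K E) P k)"

definition cartesian_fibration :: "('o, 's) cosmos \<Rightarrow> 'o \<Rightarrow> 'o \<Rightarrow> 's \<Rightarrow> bool" where
  "cartesian_fibration K E B p \<longleftrightarrow> cocartesian_fibration (co_dual K) E B p"

definition groupoidal :: "('o, 's) cosmos \<Rightarrow> 'o \<Rightarrow> bool" where
  "groupoidal K E \<longleftrightarrow> (\<forall>X\<in>Obj K. kan_complex (Fun K X E))"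

definition is_module :: "('o, 's) cosmos \<Rightarrow> 'o \<Rightarrow> 'o \<Rightarrow> 'o \<Rightarrow> 's \<Rightarrow> bool" where
  "is_module K A B E r \<longleftrightarrow>
     (let AB = prod_ob K A B; q = fcomp K E AB A (proj1 K A B) r; p = fcomp K E AB B (proj2 K A B) r in
      E \<in> Obj K \<and> r \<in> Isofib K E AB \<and>
      cartesian_fibration (slice K A) (E, q) (AB, proj1 K A B) r \<and>
      cocartesian_fibration (slice K B) (E, p) (AB, proj2 K A B) r \<and>
      groupoidal (slice K AB) (E, r))"

definition Mod :: "('o, 's) cosmos \<Rightarrow> 'o \<Rightarrow> 'o \<Rightarrow> ('o \<times> 's, 's) scat" where
  "Mod K A B = full_sub (slice K (prod_ob K A B)) {(E, r). is_module K A B E r}"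


section \<open>Diagrams, limits and colimits\<close>

record ('j, 'm) cat =
  cobj :: "'j set"
  carr :: "'m set"
  cdom :: "'m \<Rightarrow> 'j"
  ccod :: "'m \<Rightarrow> 'j"
  ccomp :: "'m \<Rightarrow> 'm \<Rightarrow> 'm"
  cid :: "'j \<Rightarrow> 'm"

definition category :: "('j, 'm) cat \<Rightarrow> bool" where
  "category J \<longleftrightarrow>
     (\<forall>f\<in>carr J. cdom J f \<in> cobj J \<and> ccod J f \<in> cobj J) \<and>
     (\<forall>c\<in>cobj J. cid J c \<in> carr J \<and> cdom J (cid J c) = c \<and> ccod J (cid J c) = c) \<and>
     (\<forall>f\<in>carr J. \<forall>g\<in>carr J. ccod J f = cdom J g \<longrightarrow>
        ccomp J g f \<in> carr J \<and> cdom J (ccomp J g f) = cdom J f \<and> ccod J (ccomp J g f) = ccod J g) \<and>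
     (\<forall>f\<in>carr J. ccomp J f (cid J (cdom J f)) = f \<and> ccomp J (cid J (ccod J f)) f = f) \<and>
     (\<forall>f\<in>carr J. \<forall>g\<in>carr J. \<forall>h\<in>carr J. ccod J f = cdom J g \<longrightarrow> ccod J g = cdom J h \<longrightarrow>
        ccomp J (ccomp J h g) f = ccomp J h (ccomp J g f))"

definition diagram_in ::
    "('o, 's, 'z) scat_scheme \<Rightarrow> ('j, 'm) cat \<Rightarrow> ('j \<Rightarrow> 'o) \<Rightarrow> ('m \<Rightarrow> 's) \<Rightarrow> bool" where
  "diagram_in K J F Fm \<longleftrightarrow>
     (\<forall>c\<in>cobj J. F c \<in> Obj K) \<and>
     (\<forall>f\<in>carr J. Fm f \<in> functors K (F (cdom J f)) (F (ccod J f))) \<and>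
     (\<forall>c\<in>cobj J. Fm (cid J c) = Idt K (F c)) \<and>
     (\<forall>f\<in>carr J. \<forall>g\<in>carr J. ccod J f = cdom J g \<longrightarrow>
        Fm (ccomp J g f) = fcomp K (F (cdom J f)) (F (ccod J f)) (F (ccod J g)) (Fm g) (Fm f))"

definition is_cone ::
    "('o, 's, 'z) scat_scheme \<Rightarrow> ('j, 'm) cat \<Rightarrow> ('j \<Rightarrow> 'o) \<Rightarrow> ('m \<Rightarrow> 's) \<Rightarrow> 'o \<Rightarrow> nat \<Rightarrow> ('j \<Rightarrow> 's) \<Rightarrow> bool"
  where
  "is_cone K J F Fm X n x \<longleftrightarrow>
     (\<forall>c\<in>cobj J. x c \<in> simplices (Fun K X (F c)) n) \<and>
     (\<forall>f\<in>carr J. post K X (F (cdom J f)) (F (ccod J f)) (Fm f) n (x (cdom J f)) = x (ccod J f))"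

definition is_limit ::
    "('o, 's, 'z) scat_scheme \<Rightarrow> ('j, 'm) cat \<Rightarrow> ('j \<Rightarrow> 'o) \<Rightarrow> ('m \<Rightarrow> 's) \<Rightarrow> 'o \<Rightarrow> ('j \<Rightarrow> 's) \<Rightarrow> bool" where
  "is_limit K J F Fm L \<rho> \<longleftrightarrow>
     diagram_in K J F Fm \<and> L \<in> Obj K \<and> is_cone K J F Fm L 0 \<rho> \<and>
     (\<forall>X\<in>Obj K. \<forall>n x. is_cone K J F Fm X n x \<longrightarrow>
        (\<exists>!y. y \<in> simplices (Fun K X L) n \<and> (\<forall>c\<in>cobj J. post K X L (F c) (\<rho> c) n y = x c)))"

definition sset_diagram ::
    "('j, 'm) cat \<Rightarrow> ('j \<Rightarrow> 'u sset) \<Rightarrow> ('m \<Rightarrow> nat \<Rightarrow> 'u \<Rightarrow> 'u) \<Rightarrow> bool" where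
  "sset_diagram J S Sm \<longleftrightarrow>
     (\<forall>c\<in>cobj J. simplicial_set (S c)) \<and>
     (\<forall>f\<in>carr J. simplicial_map (S (ccod J f)) (S (cdom J f)) (Sm f)) \<and>
     (\<forall>c\<in>cobj J. \<forall>n. \<forall>x\<in>simplices (S c) n. Sm (cid J c) n x = x) \<and>
     (\<forall>f\<in>carr J. \<forall>g\<in>carr J. ccod J f = cdom J g \<longrightarrow>
        (\<forall>n. \<forall>x\<in>simplices (S (ccod J g)) n. Sm (ccomp J g f) n x = Sm f n (Sm g n x)))"

definition sset_cocone ::
    "('j, 'm) cat \<Rightarrow> ('j \<Rightarrow> 'u sset) \<Rightarrow> ('m \<Rightarrow> nat \<Rightarrow> 'u \<Rightarrow> 'u) \<Rightarrow> 'u sset \<Rightarrow>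
     ('j \<Rightarrow> nat \<Rightarrow> 'u \<Rightarrow> 'u) \<Rightarrow> bool" where
  "sset_cocone J S Sm T \<pi> \<longleftrightarrow> simplicial_set T \<and>
     (\<forall>c\<in>cobj J. simplicial_map (S c) T (\<pi> c)) \<and>
     (\<forall>f\<in>carr J. \<forall>n. \<forall>x\<in>simplices (S (ccod J f)) n. \<pi> (cdom J f) n (Sm f n x) = \<pi> (ccod J f) n x)"

definition sset_colimit ::
    "('j, 'm) cat \<Rightarrow> ('j \<Rightarrow> 'u sset) \<Rightarrow> ('m \<Rightarrow> nat \<Rightarrow> 'u \<Rightarrow> 'u) \<Rightarrow> 'u sset \<Rightarrow>
     ('j \<Rightarrow> nat \<Rightarrow> 'u \<Rightarrow> 'u) \<Rightarrow> bool" where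
  "sset_colimit J S Sm T \<pi> \<longleftrightarrow> sset_cocone J S Sm T \<pi> \<and>
     (\<forall>Y \<psi>. sset_cocone J S Sm Y \<psi> \<longrightarrow>
        (\<exists>\<phi>. simplicial_map T Y \<phi> \<and>
           (\<forall>c\<in>cobj J. \<forall>n. \<forall>x\<in>simplices (S c) n. \<phi> n (\<pi> c n x) = \<psi> c n x) \<and>
           (\<forall>\<phi>'. simplicial_map T Y \<phi>' \<and>
              (\<forall>c\<in>cobj J. \<forall>n. \<forall>x\<in>simplices (S c) n. \<phi>' n (\<pi> c n x) = \<psi> c n x) \<longrightarrow>
              (\<forall>n. \<forall>t\<in>simplices T n. \<phi>' n t = \<phi> n t))))"

text \<open>The three admissible shapes: J is discrete; J is the cospan category with objects a, b, c and
  arrows f from a to c and g from b to c; J is the opposite of the ordinal omega, enumerated by e.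
  The diagram is contravariant, so these give a coproduct, a span and a sequence.\<close>

definition coproduct_shape :: "('j, 'm) cat \<Rightarrow> bool" where
  "coproduct_shape J \<longleftrightarrow> (\<forall>f\<in>carr J. f = cid J (cdom J f))"

definition pushout_shape ::
    "('j, 'm) cat \<Rightarrow> ('j \<Rightarrow> 'u sset) \<Rightarrow> ('m \<Rightarrow> nat \<Rightarrow> 'u \<Rightarrow> 'u) \<Rightarrow> bool" where
  "pushout_shape J S Sm \<longleftrightarrow>
     (\<exists>a b c f g. distinct [a, b, c] \<and> cobj J = {a, b, c} \<and>
        carr J = {cid J a, cid J b, cid J c, f, g} \<and>
        cdom J f = a \<and> ccod J f = c \<and> cdom J g = b \<and> ccod J g = c \<and>
        simplicial_mono (S c) (S a) (Sm f))"

definition sequence_shape ::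
    "('j, 'm) cat \<Rightarrow> ('j \<Rightarrow> 'u sset) \<Rightarrow> ('m \<Rightarrow> nat \<Rightarrow> 'u \<Rightarrow> 'u) \<Rightarrow> bool" where
  "sequence_shape J S Sm \<longleftrightarrow>
     (\<exists>e :: nat \<Rightarrow> 'j. bij_betw e UNIV (cobj J) \<and>
        (\<forall>m n. m \<le> n \<longrightarrow> (\<exists>!f. f \<in> carr J \<and> cdom J f = e n \<and> ccod J f = e m)) \<and>
        (\<forall>m n. \<forall>f\<in>carr J. cdom J f = e n \<longrightarrow> ccod J f = e m \<longrightarrow> m \<le> n) \<and>
        (\<forall>n. \<forall>f\<in>carr J. cdom J f = e (Suc n) \<longrightarrow> ccod J f = e n \<longrightarrow>
           simplicial_mono (S (e n)) (S (e (Suc n))) (Sm f)))"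

subsection \<open>The comma modules of a diagram\<close>

definition restricted_diagram ::
    "('o, 's, 'z) scat_scheme \<Rightarrow> 'o \<Rightarrow> 'o \<Rightarrow> 'u sset \<Rightarrow> 'v sset \<Rightarrow> (nat \<Rightarrow> 'u \<Rightarrow> 'v) \<Rightarrow> 's \<Rightarrow> 's" where
  "restricted_diagram K A D U V i d = fcomp K D (cotensor K A V) (cotensor K A U) (cotensor_restrict K A U V i) d"

text \<open>The comma object of the constant diagram functor and of d from D to \<open>A\<^sup>U\<close>, as an object over
  the product of D and A.\<close>

definition cone_module ::
    "('o, 's, 'z) scat_scheme \<Rightarrow> 'o \<Rightarrow> 'o \<Rightarrow> 'u sset \<Rightarrow> 's \<Rightarrow> 'o \<times> 's" where
  "cone_module K A D U d =
     (comma_ob K (cotensor K A U) A D (constant_diagram K A U) d,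
      comma_proj K (cotensor K A U) A D (constant_diagram K A U) d)"

text \<open>For i from U to V, d from D to \<open>A\<^sup>V\<close> and its restriction e from D to \<open>A\<^sup>U\<close>.\<close>

definition cone_module_map ::
    "('o, 's, 'z) scat_scheme \<Rightarrow> 'o \<Rightarrow> 'o \<Rightarrow> 'u sset \<Rightarrow> 'v sset \<Rightarrow> (nat \<Rightarrow> 'u \<Rightarrow> 'v) \<Rightarrow> 's \<Rightarrow> 's \<Rightarrow> 's" where
  "cone_module_map K A D U V i d e =
     comma_map K (cotensor K A V) A D (constant_diagram K A V) d
       (cotensor K A U) (constant_diagram K A U) e (cotensor_restrict K A U V i)"

end

theory Submission
  imports Defs "HOL-Library.Countable"
begin

text \<open>Cotensoring with A turns colimits of simplicial sets into limits, so \<open>A\<^sup>T\<close> is the limit of the objects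
\<open>A\<^sup>S\<^sup>c\<close>. A functor into a comma object is a pair of functors to the two feet and a 2-cell between their images
in the vertex of the cospan; for the commas \<open>\<Delta> \<down> d\<^sub>c\<close> the feet D and A do not vary with c, so these commas form a limit over
D and A as soon as their vertices \<open>A\<^sup>S\<^sup>c\<close> do. A full subcategory inherits this limit if the commas lie in it.
All three shapes of diagram are covered by this one argument: \<open>cotensor_of_colimit\<close>, \<open>comma_limit\<close> and
\<open>comma_module_limit\<close> express the three steps.

The larger part of the proof shows that commas are modules (\<open>comma_is_module\<close>). Three facts enter.

A comma E of f from B to A and g from C to A is cocartesian over C, relative to B. Given an edge e of A from f to g and an edge of C out of
its target, a filler of an inner horn composes e with the image under g. For an isofibration p from E to B, an adjunction that exhibits
it as cocartesian unwinds to such lifts, to squares that compare a lift with any other edge over the same base, and to a triangle identity,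
which asks that a comparison of the lift with itself is homotopic to the identity (\<open>cocartesian_fibrationI\<close>). For commas, the lifts are
2-simplices, the comparisons are made of a 3-simplex, and the triangle identity of a 4-simplex of Fun(X,A); each is an inner horn filler
(\<open>lift_edge\<close>, \<open>lift_square\<close>, \<open>lift_cube\<close>). The argument uses only properties of a cosmos that are stable under
passing to the dual (\<open>arrow_cosmos\<close>), which gives the cartesian half.

The fibres of a comma over C and B are Kan complexes. A horn in such a fibre is an edge in the cotensor of A by the horn, with constant ends.
The horn contracts to the vertex k, so this edge is homotopic to a constant family. The constant family extends to the simplex, and the restriction
from the simplex to the horn is an isofibration, so the given family extends as well (\<open>comma_groupoidal\<close>).

Finally, the slices of an infinity-cosmos have the arrow objects on which the construction of the adjunction rests, and the map from the arrow object
of A to the square of A is an isofibration. Both are instances of the Leibniz axiom, for inclusions of a vertex and of the two endpoints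
into the 1-simplex.\<close>

section \<open>Monotone maps as lists\<close>

text \<open>The constant lists stand for the degenerate simplices on a vertex and should not be unfolded into their entries.\<close>

declare replicate_Suc [simp del]

abbreviation smap :: "'a sset \<Rightarrow> 'b sset \<Rightarrow> (nat \<Rightarrow> 'a \<Rightarrow> 'b) \<Rightarrow> bool" where
  "smap \<equiv> simplicial_map"

abbreviation const :: "nat \<Rightarrow> nat \<Rightarrow> nat list" where
  "const m v \<equiv> replicate (Suc m) v"

abbreviation reindex :: "nat list \<Rightarrow> nat list \<Rightarrow> nat list" (infixl "\<odot>" 75) where
  "\<alpha> \<odot> \<beta> \<equiv> map (\<lambda>i. \<alpha> ! i) \<beta>"

definition tab :: "nat \<Rightarrow> (nat \<Rightarrow> nat) \<Rightarrow> nat list" where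
  "tab m F = map F [0..<Suc m]"

lemma length_tab [simp]: "length (tab m F) = Suc m"
  by (simp add: tab_def del: upt_Suc)

lemma nth_tab [simp]: "l \<le> m ==> tab m F ! l = F l"
  by (simp add: tab_def del: upt_Suc)

lemma tab_eq_iff: "tab m F = tab m G \<longleftrightarrow> (\<forall>l\<le>m. F l = G l)"
  by (auto simp: tab_def less_Suc_eq_le simp del: upt_Suc)

lemma tab_cong: "(\<And>l. l \<le> m ==> F l = G l) ==> tab m F = tab m G"
  by (simp add: tab_eq_iff)

lemma replicate_tab: "const m v = tab m (\<lambda>_. v)"
  by (simp add: tab_def map_replicate_const del: upt_Suc)

lemma upt_tab: "[0..<Suc m] = tab m (\<lambda>l. l)"
  by (simp add: tab_def del: upt_Suc)

lemma set_tab: "set (tab m F) = F ` {..m}"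
  by (auto simp: tab_def less_Suc_eq_le simp del: upt_Suc)

lemma Delta_iff: "\<alpha> \<in> Delta m n \<longleftrightarrow>
    length \<alpha> = Suc m \<and> (\<forall>l\<le>m. \<forall>l'\<le>m. l \<le> l' \<longrightarrow> \<alpha> ! l \<le> \<alpha> ! l') \<and> (\<forall>l\<le>m. \<alpha> ! l \<le> n)"
proof -
  have "set \<alpha> \<subseteq> {..n} \<longleftrightarrow> (\<forall>l<length \<alpha>. \<alpha> ! l \<le> n)"
    by (auto simp: set_conv_nth)
  then show ?thesis
    unfolding Delta_def sorted_iff_nth_mono by (auto simp: less_Suc_eq_le)
qed

lemma tab_in_Delta: "tab m F \<in> Delta m n \<longleftrightarrow>
    (\<forall>l\<le>m. \<forall>l'\<le>m. l \<le> l' \<longrightarrow> F l \<le> F l') \<and> (\<forall>l\<le>m. F l \<le> n)"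
  by (auto simp: Delta_iff)

lemma Delta_eq_tab: "\<alpha> \<in> Delta m n ==> \<alpha> = tab m (\<lambda>l. \<alpha> ! l)"
  by (auto simp: Delta_iff less_Suc_eq_le intro: nth_equalityI)

lemma Delta_nth_le: "\<alpha> \<in> Delta m n ==> l \<le> m ==> \<alpha> ! l \<le> n"
  by (simp add: Delta_iff)

lemma Delta_mono: "\<alpha> \<in> Delta m n ==> l \<le> l' ==> l' \<le> m ==> \<alpha> ! l \<le> \<alpha> ! l'"
  by (simp add: Delta_iff)

lemma Delta_length: "\<alpha> \<in> Delta m n ==> length \<alpha> = Suc m"
  by (simp add: Delta_iff)

lemma Delta_eqI: "\<alpha> \<in> Delta m n ==> \<beta> \<in> Delta m n' ==> (\<And>l. l \<le> m ==> \<alpha> ! l = \<beta> ! l) ==> \<alpha> = \<beta>"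
  by (auto simp: Delta_iff less_Suc_eq_le intro: nth_equalityI)

lemma reindex_tab: "\<beta> \<in> Delta k m ==> \<alpha> \<odot> \<beta> = tab k (\<lambda>l. \<alpha> ! (\<beta> ! l))"
  by (auto simp: Delta_iff less_Suc_eq_le intro: nth_equalityI)

lemma tab_reindex: "\<beta> \<in> Delta k m ==> tab m F \<odot> \<beta> = tab k (\<lambda>l. F (\<beta> ! l))"
  by (auto simp: reindex_tab tab_eq_iff Delta_iff)

lemma reindex_tab2: "(\<And>l. l \<le> m ==> F l < length \<alpha>) ==> \<alpha> \<odot> tab m F = tab m (\<lambda>l. \<alpha> ! F l)"
  by (auto intro: nth_equalityI simp: less_Suc_eq_le)

lemma nth_reindex: "\<beta> \<in> Delta k m ==> l \<le> k ==> (\<alpha> \<odot> \<beta>) ! l = \<alpha> ! (\<beta> ! l)"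
  by (simp add: Delta_iff)

lemma Delta_reindex [simp, intro]: "\<beta> \<in> Delta k m ==> \<alpha> \<in> Delta m n ==> \<alpha> \<odot> \<beta> \<in> Delta k n"
  unfolding Delta_iff by auto

lemma Delta_id [simp, intro]: "[0..<Suc n] \<in> Delta n n"
  by (simp add: upt_tab tab_in_Delta del: upt_Suc)

lemma Delta_const [simp]: "const m v \<in> Delta m n \<longleftrightarrow> v \<le> n"
  by (auto simp add: replicate_tab tab_in_Delta)

lemma reindex_id_right [simp]: "\<alpha> \<in> Delta m n ==> \<alpha> \<odot> [0..<Suc m] = \<alpha>"
  by (metis Delta_length map_nth)

lemma reindex_id_left [simp]: "\<beta> \<in> Delta k m ==> [0..<Suc m] \<odot> \<beta> = \<beta>"
  unfolding upt_tab by (rule trans [OF tab_reindex Delta_eq_tab [symmetric]])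

lemma reindex_assoc: "\<beta> \<in> Delta k m ==> \<gamma> \<in> Delta l k ==> \<alpha> \<odot> \<beta> \<odot> \<gamma> = \<alpha> \<odot> (\<beta> \<odot> \<gamma>)"
  by (auto simp: Delta_def)

lemma const_reindex [simp]:
  "\<beta> \<in> Delta k m ==> const m v \<odot> \<beta> = const k v"
  by (simp add: replicate_tab tab_reindex)

lemma Delta_0_0: "\<alpha> \<in> Delta m 0 \<longleftrightarrow> \<alpha> = const m 0"
proof
  assume a: "\<alpha> \<in> Delta m 0"
  show "\<alpha> = const m 0"
    by (rule Delta_eqI [OF a, of _ 0]) (use a in \<open>auto simp: Delta_iff\<close>)
qed simp

section \<open>Simplicial sets\<close>

lemma ss_in: "simplicial_set X ==> \<alpha> \<in> Delta m n ==> x \<in> simplices X n ==> act X n \<alpha> x \<in> simplices X m"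
  by (simp add: simplicial_set_def)

lemma ss_id: "simplicial_set X ==> x \<in> simplices X n ==> act X n [0..<Suc n] x = x"
  by (simp add: simplicial_set_def del: upt_Suc)

lemma ss_comp: "simplicial_set X ==> \<beta> \<in> Delta k m ==> \<alpha> \<in> Delta m n ==> x \<in> simplices X n ==>
    act X m \<beta> (act X n \<alpha> x) = act X n (\<alpha> \<odot> \<beta>) x"
  by (simp add: simplicial_set_def)

lemma simplicial_setI:
  assumes "\<And>m n \<alpha> x. \<alpha> \<in> Delta m n ==> x \<in> simplices X n ==> act X n \<alpha> x \<in> simplices X m"
    and "\<And>n x. x \<in> simplices X n ==> act X n [0..<Suc n] x = x"
    and "\<And>k m n \<alpha> \<beta> x. \<beta> \<in> Delta k m ==> \<alpha> \<in> Delta m n ==> x \<in> simplices X n ==>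
      act X m \<beta> (act X n \<alpha> x) = act X n (\<alpha> \<odot> \<beta>) x"
  shows "simplicial_set X"
  unfolding simplicial_set_def by (intro conjI allI impI assms)

lemma dg_in: "simplicial_set X ==> x \<in> simplices X 0 ==> dg X n x \<in> simplices X n"
  unfolding dg_def by (rule ss_in) simp_all

lemma act_dg:
  assumes "simplicial_set X" "x \<in> simplices X 0" "\<alpha> \<in> Delta m n"
  shows "act X n \<alpha> (dg X n x) = dg X m x"
  using assms unfolding dg_def by (subst ss_comp) auto

lemma dg_0: "simplicial_set X ==> x \<in> simplices X 0 ==> dg X 0 x = x"
  using ss_id [of X x 0] by (simp add: dg_def replicate_Suc)

lemma act_const:
  assumes "simplicial_set X" "x \<in> simplices X n" "v \<le> n"
  shows "act X n (const m v) x = dg X m (act X n [v] x)"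
proof -
  have "[v] \<in> Delta 0 n" using assms by (simp add: Delta_def)
  then have "act X 0 (const m 0) (act X n [v] x) = act X n ([v] \<odot> const m 0) x"
    using assms by (intro ss_comp [where k = m]) simp_all
  then show ?thesis by (simp add: dg_def)
qed

lemma smap_in: "smap X Y \<phi> ==> x \<in> simplices X n ==> \<phi> n x \<in> simplices Y n"
  by (simp add: simplicial_map_def)

lemma smap_act: "smap X Y \<phi> ==> \<alpha> \<in> Delta m n ==> x \<in> simplices X n ==>
    \<phi> m (act X n \<alpha> x) = act Y n \<alpha> (\<phi> n x)"
  by (simp add: simplicial_map_def)

lemma smap_dg: "smap X Y \<phi> ==> x \<in> simplices X 0 ==> \<phi> m (dg X m x) = dg Y m (\<phi> 0 x)"
  unfolding dg_def by (rule smap_act) simp_all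

lemma simplicial_mapI:
  assumes "\<And>n x. x \<in> simplices X n ==> \<phi> n x \<in> simplices Y n"
    and "\<And>m n \<alpha> x. \<alpha> \<in> Delta m n ==> x \<in> simplices X n ==> \<phi> m (act X n \<alpha> x) = act Y n \<alpha> (\<phi> n x)"
  shows "smap X Y \<phi>"
  unfolding simplicial_map_def by (intro conjI allI ballI assms)

lemma smap_comp: "smap X Y \<phi> ==> smap Y Z \<psi> ==>
    smap X Z (\<lambda>n x. \<psi> n (\<phi> n x))"
  unfolding simplicial_map_def by simp

lemma simplices_std [simp]: "simplices (std n) m = Delta m n"
  by (simp add: std_def)

lemma act_std [simp]: "act (std n) m \<beta> \<alpha> = \<alpha> \<odot> \<beta>"
  by (simp add: std_def)

lemma simplicial_set_std [simp]: "simplicial_set (std n)"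
  by (rule simplicial_setI) (auto simp: reindex_assoc simp del: upt_Suc)

lemma simplices_sprod [simp]: "simplices (sprod X Y) n = simplices X n \<times> simplices Y n"
  by (simp add: sprod_def)

lemma act_sprod [simp]: "act (sprod X Y) n \<alpha> (x, y) = (act X n \<alpha> x, act Y n \<alpha> y)"
  by (simp add: sprod_def)

lemma simplicial_set_sprod [simp]:
  "simplicial_set X ==> simplicial_set Y ==> simplicial_set (sprod X Y)"
  by (rule simplicial_setI) (auto simp: ss_in ss_id ss_comp simp del: upt_Suc)

lemma simplices_horn [simp]:
  "simplices (horn n k) m = {\<alpha> \<in> Delta m n. \<exists>i\<le>n. i \<noteq> k \<and> i \<notin> set \<alpha>}"
  by (simp add: horn_def)

lemma act_horn [simp]: "act (horn n k) m \<beta> \<alpha> = \<alpha> \<odot> \<beta>"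
  by (simp add: horn_def)

lemma set_reindex_subset: "\<beta> \<in> Delta k m ==> \<alpha> \<in> Delta m n ==> set (\<alpha> \<odot> \<beta>) \<subseteq> set \<alpha>"
  by (auto simp: Delta_def intro: nth_mem)

definition simplicial_subset :: "'a sset \<Rightarrow> 'a sset \<Rightarrow> bool" where
  "simplicial_subset U V \<longleftrightarrow> simplicial_set V \<and> (\<forall>m. simplices U m \<subseteq> simplices V m) \<and> act U = act V \<and>
     (\<forall>m n \<alpha> x. \<alpha> \<in> Delta m n \<longrightarrow> x \<in> simplices U n \<longrightarrow> act U n \<alpha> x \<in> simplices U m)"

lemma simplicial_subset_set: "simplicial_subset U V ==> simplicial_set U"
  unfolding simplicial_subset_def simplicial_set_def by (metis subsetD)

lemma simplicial_subset_in: "simplicial_subset U V ==> u \<in> simplices U m ==> u \<in> simplices V m"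
  unfolding simplicial_subset_def by blast

lemma simplicial_subset_act: "simplicial_subset U V ==> act U = act V"
  unfolding simplicial_subset_def by blast

lemma horn_subset: "simplicial_subset (horn n k) (std n)"
  unfolding simplicial_subset_def
proof (intro conjI allI impI)
  fix m m' \<alpha> x assume "\<alpha> \<in> Delta m m'" "x \<in> simplices (horn n k) m'"
  then show "act (horn n k) m' \<alpha> x \<in> simplices (horn n k) m"
    using set_reindex_subset by fastforce
qed (auto simp: horn_def)

text \<open>This is one half of the Yoneda lemma.\<close>

lemma smap_of_simplex:
  "simplicial_set X ==> x \<in> simplices X n ==> smap (std n) X (\<lambda>m \<alpha>. act X n \<alpha> x)"
  by (rule simplicial_mapI) (auto simp: ss_in ss_comp)

lemma fst_smap: "smap (sprod X Y) X (\<lambda>m (x, y). x)"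
  by (rule simplicial_mapI) auto

lemma snd_smap: "smap (sprod X Y) Y (\<lambda>m (x, y). y)"
  by (rule simplicial_mapI) auto

subsection \<open>Horns from faces\<close>

text \<open>A map out of a horn is given by its values on the faces of the simplex. The face opposite to i is the coface list, and \<open>squash i\<close> is a
retraction onto it: a simplex that misses i factors through the face by squashing.\<close>

definition coface :: "nat \<Rightarrow> nat \<Rightarrow> nat list" where
  "coface n i = tab n (\<lambda>a. if a < i then a else Suc a)"

definition squash :: "nat \<Rightarrow> nat list \<Rightarrow> nat list" where
  "squash i \<alpha> = map (\<lambda>a. if i < a then a - 1 else a) \<alpha>"

lemma coface_in [simp]: "coface n i \<in> Delta n (Suc n)"
  by (auto simp: coface_def tab_in_Delta)

lemma squash_nth: "\<alpha> \<in> Delta m n ==> l \<le> m ==> squash i \<alpha> ! l = (if i < \<alpha> ! l then \<alpha> ! l - 1 else \<alpha> ! l)"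
  by (simp add: squash_def Delta_iff)

lemma squash_in: "\<alpha> \<in> Delta m (Suc n) ==> i \<le> Suc n ==> i \<notin> set \<alpha> ==> squash i \<alpha> \<in> Delta m n"
proof -
  assume a: "\<alpha> \<in> Delta m (Suc n)" "i \<le> Suc n" "i \<notin> set \<alpha>"
  have ne: "\<alpha> ! l \<noteq> i" if "l \<le> m" for l
    using a that by (metis Delta_length le_imp_less_Suc nth_mem)
  show ?thesis
    unfolding Delta_iff
  proof (intro conjI allI impI)
    fix l l' assume l: "l \<le> m" "l' \<le> m" "l \<le> l'"
    then have "\<alpha> ! l \<le> \<alpha> ! l'" using a Delta_mono by blast
    then show "squash i \<alpha> ! l \<le> squash i \<alpha> ! l'"
      using a l by (auto simp: squash_nth)
  next
    fix l assume l: "l \<le> m"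
    have "\<alpha> ! l \<le> Suc n" by (rule Delta_nth_le [OF a(1) l])
    then show "squash i \<alpha> ! l \<le> n" using ne [OF l] a l by (auto simp: squash_nth)
  qed (use a in \<open>simp add: squash_def Delta_length\<close>)
qed

lemma squash_reindex: "\<beta> \<in> Delta k m ==> \<alpha> \<in> Delta m n ==> squash i (\<alpha> \<odot> \<beta>) = squash i \<alpha> \<odot> \<beta>"
  unfolding squash_def Delta_def by auto

lemma coface_squash:
  assumes "\<alpha> \<in> Delta m (Suc n)" "i \<le> Suc n" "i \<notin> set \<alpha>"
  shows "coface n i \<odot> squash i \<alpha> = \<alpha>"
proof (rule Delta_eqI)
  show "coface n i \<odot> squash i \<alpha> \<in> Delta m (Suc n)" using squash_in [OF assms] by auto
  fix l assume l: "l \<le> m"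
  have "\<alpha> ! l \<noteq> i" using assms l by (metis Delta_length le_imp_less_Suc nth_mem)
  moreover have "\<alpha> ! l \<le> Suc n" by (rule Delta_nth_le [OF assms(1) l])
  ultimately show "(coface n i \<odot> squash i \<alpha>) ! l = \<alpha> ! l"
    using assms l squash_in [OF assms] by (auto simp: nth_reindex squash_nth coface_def)
qed (rule assms)

lemma squash_coface: "squash i (coface n i) = [0..<Suc n]"
  by (simp add: squash_def coface_def tab_def del: upt_Suc) (auto intro: nth_equalityI)

lemma missing_coface: "i \<notin> set (coface n i)"
  by (auto simp: coface_def set_tab)

lemma squash_squash:
  assumes "\<alpha> \<in> Delta m (Suc (Suc n))" "i < j" "j \<le> Suc (Suc n)" "i \<notin> set \<alpha>" "j \<notin> set \<alpha>"
  shows "squash j \<alpha> = coface n i \<odot> squash i (squash j \<alpha>)"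
    and "squash i \<alpha> = coface n (j - 1) \<odot> squash i (squash j \<alpha>)"
    and "squash i (squash j \<alpha>) \<in> Delta m n"
proof -
  have ne: "\<alpha> ! l \<noteq> i" "\<alpha> ! l \<noteq> j" if "l \<le> m" for l
    using assms that by (metis Delta_length le_imp_less_Suc nth_mem)+
  have "i \<notin> set (squash j \<alpha>)" using assms by (auto simp: squash_def split: if_splits)
  moreover have sj: "squash j \<alpha> \<in> Delta m (Suc n)" using assms by (intro squash_in) auto
  ultimately show "squash j \<alpha> = coface n i \<odot> squash i (squash j \<alpha>)"
    and d: "squash i (squash j \<alpha>) \<in> Delta m n"
    using coface_squash [OF sj, of i] squash_in [OF sj, of i] assms by simp_all
  have si: "squash i \<alpha> \<in> Delta m (Suc n)" using assms by (intro squash_in) auto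
  show "squash i \<alpha> = coface n (j - 1) \<odot> squash i (squash j \<alpha>)"
  proof (rule Delta_eqI [OF si, of _ "Suc n"])
    show "coface n (j - 1) \<odot> squash i (squash j \<alpha>) \<in> Delta m (Suc n)" using d by auto
    fix l assume l: "l \<le> m"
    have "\<alpha> ! l \<le> Suc (Suc n)" by (rule Delta_nth_le [OF assms(1) l])
    then show "squash i \<alpha> ! l = (coface n (j - 1) \<odot> squash i (squash j \<alpha>)) ! l"
      using ne [OF l] l assms d sj
      by (auto simp: nth_reindex squash_nth [OF sj] squash_nth [OF assms(1)] coface_def)
  qed
qed

text \<open>A simplex of the horn lies on some face i, through which it factors by \<open>squash i\<close>; the choice of i is immaterial because the
faces agree on their intersections.\<close>

lemma horn_map_of_faces:
  assumes X: "simplicial_set X"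
    and F: "\<And>i. i \<le> Suc (Suc n) ==> i \<noteq> k ==> F i \<in> simplices X (Suc n)"
    and compat: "\<And>i j. i < j ==> j \<le> Suc (Suc n) ==> i \<noteq> k ==> j \<noteq> k ==>
      act X (Suc n) (coface n i) (F j) = act X (Suc n) (coface n (j - 1)) (F i)"
  shows "\<exists>\<phi>. smap (horn (Suc (Suc n)) k) X \<phi> \<and>
    (\<forall>i\<le>Suc (Suc n). i \<noteq> k \<longrightarrow> \<phi> (Suc n) (coface (Suc n) i) = F i)"
proof -
  let ?N = "Suc (Suc n)"
  let ?ok = "\<lambda>i \<alpha>. i \<le> ?N \<and> i \<noteq> k \<and> i \<notin> set \<alpha>"
  let ?f = "\<lambda>i \<alpha>. act X (Suc n) (squash i \<alpha>) (F i)"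
  have lt: "?f i \<alpha> = ?f j \<alpha>" if "i < j" "?ok i \<alpha>" "?ok j \<alpha>" "\<alpha> \<in> Delta m ?N" for i j \<alpha> m
  proof -
    note s = squash_squash [OF that(4,1)]
    have "?f j \<alpha> = act X n (squash i (squash j \<alpha>)) (act X (Suc n) (coface n i) (F j))"
      using that s F X by (subst ss_comp [OF X]) auto
    also have "\<dots> = act X n (squash i (squash j \<alpha>)) (act X (Suc n) (coface n (j - 1)) (F i))"
      using compat that by simp
    also have "\<dots> = ?f i \<alpha>"
      using that s F X by (subst ss_comp [OF X]) auto
    finally show ?thesis by simp
  qed
  have eq: "?f i \<alpha> = ?f j \<alpha>" if "?ok i \<alpha>" "?ok j \<alpha>" "\<alpha> \<in> Delta m ?N" for i j \<alpha> m
  proof (cases i j rule: linorder_cases)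
    case less
    show ?thesis by (rule lt [OF less that])
  next
    case greater
    show ?thesis by (rule lt [OF greater that(2,1,3), symmetric])
  qed simp
  define \<phi> where "\<phi> = (\<lambda>(m::nat) \<alpha>. ?f (SOME i. ?ok i \<alpha>) \<alpha>)"
  have \<phi>: "\<phi> m \<alpha> = ?f i \<alpha>" if "?ok i \<alpha>" "\<alpha> \<in> Delta m ?N" for i \<alpha> m
    unfolding \<phi>_def by (rule eq [OF _ that]) (rule someI [of "\<lambda>i. ?ok i \<alpha>", OF that(1)])
  show ?thesis
  proof (intro exI conjI allI impI)
    show "smap (horn ?N k) X \<phi>"
    proof (rule simplicial_mapI)
      fix m \<alpha> assume "\<alpha> \<in> simplices (horn ?N k) m"
      then obtain i where i: "?ok i \<alpha>" "\<alpha> \<in> Delta m ?N" by auto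
      then show "\<phi> m \<alpha> \<in> simplices X m"
        using F X squash_in by (auto simp: \<phi> [OF i] intro!: ss_in)
    next
      fix l m \<beta> \<alpha> assume b: "\<beta> \<in> Delta l m" and "\<alpha> \<in> simplices (horn ?N k) m"
      then obtain i where i: "?ok i \<alpha>" "\<alpha> \<in> Delta m ?N" by auto
      have i': "?ok i (\<alpha> \<odot> \<beta>)" "\<alpha> \<odot> \<beta> \<in> Delta l ?N"
        using i b set_reindex_subset [OF b i(2)] by auto
      have "squash i \<alpha> \<in> Delta m (Suc n)" using i by (intro squash_in) auto
      then show "\<phi> l (act (horn ?N k) m \<beta> \<alpha>) = act X m \<beta> (\<phi> m \<alpha>)"
        using i b F by (simp add: \<phi> [OF i] \<phi> [OF i'] squash_reindex [OF b i(2)] ss_comp [OF X])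
    qed
  next
    fix i assume i: "i \<le> ?N" "i \<noteq> k"
    have "\<phi> (Suc n) (coface (Suc n) i) = ?f i (coface (Suc n) i)"
      using i by (intro \<phi>) (auto simp: missing_coface)
    then show "\<phi> (Suc n) (coface (Suc n) i) = F i"
      using F [OF i] X by (simp add: squash_coface ss_id del: upt_Suc)
  qed
qed

lemma coface_in_horn: "i \<le> Suc n ==> i \<noteq> k ==> coface n i \<in> simplices (horn (Suc n) k) n"
  using missing_coface by auto

lemma inner_horn_filler:
  assumes X: "quasi_category X" and n: "m = Suc n" "N = Suc m" and k: "0 < k" "k < N"
    and F: "\<And>i. i \<le> N ==> i \<noteq> k ==> F i \<in> simplices X m"
    and compat: "\<And>i j. i < j ==> j \<le> N ==> i \<noteq> k ==> j \<noteq> k ==>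
      act X m (coface n i) (F j) = act X m (coface n (j - 1)) (F i)"
  shows "\<exists>\<sigma>\<in>simplices X N. \<forall>i\<le>N. i \<noteq> k \<longrightarrow> act X N (coface m i) \<sigma> = F i"
proof -
  have X': "simplicial_set X" using X by (simp add: quasi_category_def)
  obtain \<phi> where \<phi>: "smap (horn N k) X \<phi>"
    "\<And>i. i \<le> N ==> i \<noteq> k ==> \<phi> m (coface m i) = F i"
    using horn_map_of_faces [OF X', of n k F, folded n, OF F compat] by auto
  have "extends_along X (horn N k) (std N)" using X k by (simp add: quasi_category_def)
  with \<phi>(1) obtain \<psi> where \<psi>: "smap (std N) X \<psi>"
    "\<And>m u. u \<in> simplices (horn N k) m ==> \<psi> m u = \<phi> m u"
    unfolding extends_along_def by (auto simp del: simplices_horn)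
  show ?thesis
  proof (intro bexI allI impI)
    show "\<psi> N [0..<Suc N] \<in> simplices X N"
      by (rule smap_in [OF \<psi>(1)]) (simp del: upt_Suc)
    fix i assume i: "i \<le> N" "i \<noteq> k"
    have c: "coface m i \<in> Delta m N" using n by simp
    then have "act X N (coface m i) (\<psi> N [0..<Suc N]) = \<psi> m (coface m i)"
      using smap_act [OF \<psi>(1), of "coface m i" m N "[0..<Suc N]"]
      by (simp del: upt_Suc)
    then show "act X N (coface m i) (\<psi> N [0..<Suc N]) = F i"
      using \<psi>(2) [of "coface m i" m] \<phi>(2) [OF i] coface_in_horn [of i m k] i n by simp
  qed
qed

lemma coface_eval:
  "coface 0 0 = [1]" "coface 0 1 = [0]"
  "coface 1 0 = [1, 2]" "coface 1 1 = [0, 2]" "coface 1 2 = [0, 1]"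
  "coface 2 0 = [1, 2, 3]" "coface 2 1 = [0, 2, 3]" "coface 2 2 = [0, 1, 3]" "coface 2 3 = [0, 1, 2]"
  "coface 3 0 = [1, 2, 3, 4]" "coface 3 1 = [0, 2, 3, 4]" "coface 3 2 = [0, 1, 3, 4]"
  "coface 3 3 = [0, 1, 2, 4]" "coface 3 4 = [0, 1, 2, 3]"
  by (simp_all add: coface_def tab_def numeral_eq_Suc)

lemma fill2:
  assumes X: "quasi_category X" and a: "a \<in> simplices X 1" "b \<in> simplices X 1" "act X 1 [1] a = act X 1 [0] b"
  shows "\<exists>\<sigma>\<in>simplices X 2. act X 2 [0, 1] \<sigma> = a \<and> act X 2 [1, 2] \<sigma> = b"
proof -
  have "\<exists>\<sigma>\<in>simplices X 2. \<forall>i\<le>2. i \<noteq> 1 \<longrightarrow> act X 2 (coface 1 i) \<sigma> = (if i = 0 then b else a)"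
  proof (rule inner_horn_filler [OF X, of 1 0])
    fix i j :: nat assume "i < j" "j \<le> 2" "i \<noteq> 1" "j \<noteq> 1"
    then have "i = 0" "j = 2" by auto
    then show "act X 1 (coface 0 i) (if j = 0 then b else a) =
        act X 1 (coface 0 (j - 1)) (if i = 0 then b else a)"
      using a(3) by (simp add: coface_eval [unfolded One_nat_def])
  qed (use a in auto)
  then obtain \<sigma> where "\<sigma> \<in> simplices X 2"
    "\<And>i. i \<le> 2 ==> i \<noteq> 1 ==> act X 2 (coface 1 i) \<sigma> = (if i = 0 then b else a)" by blast
  from this(1) this(2) [of 0] this(2) [of 2] show ?thesis
    unfolding coface_eval by auto
qed

lemma fill3:
  assumes X: "quasi_category X"
    and abc: "a \<in> simplices X 2" "b \<in> simplices X 2" "c \<in> simplices X 2"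
    and ab: "act X 2 [0, 1] a = act X 2 [0, 1] b" and ac: "act X 2 [1, 2] a = act X 2 [0, 1] c"
    and bc: "act X 2 [1, 2] b = act X 2 [0, 2] c"
  shows "\<exists>\<rho>\<in>simplices X 3. act X 3 [0, 1, 2] \<rho> = a \<and> act X 3 [0, 1, 3] \<rho> = b \<and> act X 3 [1, 2, 3] \<rho> = c"
proof -
  let ?F = "\<lambda>i::nat. if i = 0 then c else if i = 2 then b else a"
  have "\<exists>\<sigma>\<in>simplices X 3. \<forall>i\<le>3. i \<noteq> 1 \<longrightarrow> act X 3 (coface 2 i) \<sigma> = ?F i"
  proof (rule inner_horn_filler [OF X, of 2 1])
    fix i j :: nat assume "i < j" "j \<le> 3" "i \<noteq> 1" "j \<noteq> 1"
    then have "i = 0 \<and> j = 2 \<or> i = 0 \<and> j = 3 \<or> i = 2 \<and> j = 3" by auto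
    then show "act X 2 (coface 1 i) (?F j) = act X 2 (coface 1 (j - 1)) (?F i)"
      using ab ac bc by (elim disjE) (simp_all add: coface_eval [unfolded One_nat_def])
  qed (use abc in auto)
  then obtain \<sigma> where "\<sigma> \<in> simplices X 3"
    "\<And>i. i \<le> 3 ==> i \<noteq> 1 ==> act X 3 (coface 2 i) \<sigma> = ?F i" by blast
  from this(1) this(2) [of 0] this(2) [of 2] this(2) [of 3] show ?thesis
    unfolding coface_eval by auto
qed

lemma fill4:
  assumes X: "quasi_category X"
    and abce: "a \<in> simplices X 3" "b \<in> simplices X 3" "c \<in> simplices X 3" "e \<in> simplices X 3"
    and compat: "act X 3 [0, 1, 2] a = act X 3 [0, 1, 2] b" "act X 3 [0, 1, 3] a = act X 3 [0, 1, 2] c"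
      "act X 3 [1, 2, 3] a = act X 3 [0, 1, 2] e" "act X 3 [0, 1, 3] b = act X 3 [0, 1, 3] c"
      "act X 3 [1, 2, 3] b = act X 3 [0, 1, 3] e" "act X 3 [1, 2, 3] c = act X 3 [0, 2, 3] e"
  shows "\<exists>\<Theta>\<in>simplices X 4. act X 4 [0, 1, 2, 3] \<Theta> = a \<and> act X 4 [0, 1, 2, 4] \<Theta> = b \<and>
    act X 4 [0, 1, 3, 4] \<Theta> = c \<and> act X 4 [1, 2, 3, 4] \<Theta> = e"
proof -
  let ?F = "\<lambda>i::nat. if i = 0 then e else if i = 2 then c else if i = 3 then b else a"
  have "\<exists>\<sigma>\<in>simplices X 4. \<forall>i\<le>4. i \<noteq> 1 \<longrightarrow> act X 4 (coface 3 i) \<sigma> = ?F i"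
  proof (rule inner_horn_filler [OF X, of 3 2])
    fix i j :: nat assume "i < j" "j \<le> 4" "i \<noteq> 1" "j \<noteq> 1"
    then have "i = 0 \<and> j = 2 \<or> i = 0 \<and> j = 3 \<or> i = 0 \<and> j = 4 \<or> i = 2 \<and> j = 3 \<or> i = 2 \<and> j = 4 \<or> i = 3 \<and> j = 4"
      by auto
    then show "act X 3 (coface 2 i) (?F j) = act X 3 (coface 2 (j - 1)) (?F i)"
      using compat by (elim disjE) (simp_all add: coface_eval [unfolded One_nat_def])
  qed (use abce in auto)
  then obtain \<sigma> where "\<sigma> \<in> simplices X 4"
    "\<And>i. i \<le> 4 ==> i \<noteq> 1 ==> act X 4 (coface 3 i) \<sigma> = ?F i" by blast
  from this(1) this(2) [of 0] this(2) [of 2] this(2) [of 3] this(2) [of 4] show ?thesis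
    unfolding coface_eval by auto
qed

subsection \<open>Homotopic edges of a quasi-category\<close>

lemma quasi_category_set: "quasi_category Q ==> simplicial_set Q"
  by (simp add: quasi_category_def)

definition monotone_list :: "nat list \<Rightarrow> nat \<Rightarrow> bool" where
  "monotone_list \<alpha> n \<longleftrightarrow> \<alpha> \<noteq> [] \<and> sorted \<alpha> \<and> set \<alpha> \<subseteq> {..n}"

lemma act_act_list:
  assumes "simplicial_set X" "monotone_list \<beta> m" "monotone_list \<alpha> n" "length \<alpha> = Suc m"
    "x \<in> simplices X n"
  shows "act X m \<beta> (act X n \<alpha> x) = act X n (\<alpha> \<odot> \<beta>) x"
proof (rule ss_comp)
  show "\<beta> \<in> Delta (length \<beta> - 1) m" "\<alpha> \<in> Delta m n"
    using assms by (cases \<beta>; simp add: Delta_def monotone_list_def)+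
qed (use assms in auto)

lemma act_list_in:
  "simplicial_set X ==> x \<in> simplices X n ==> monotone_list \<alpha> n ==> length \<alpha> = Suc m ==>
    act X n \<alpha> x \<in> simplices X m"
  by (rule ss_in) (auto simp: monotone_list_def Delta_def)

lemma Delta_list: "length \<alpha> = Suc m ==> monotone_list \<alpha> n ==> \<alpha> \<in> Delta m n"
  by (simp add: monotone_list_def Delta_def)

lemmas Delta_eval = Delta_list monotone_list_def

lemma homotopic_iff:
  assumes "simplicial_set Q"
  shows "homotopic Q e e' \<longleftrightarrow> (\<exists>\<sigma>\<in>simplices Q 2. act Q 2 [0, 1] \<sigma> = e \<and> act Q 2 [0, 2] \<sigma> = e' \<and>
    act Q 2 [1, 2] \<sigma> = act Q 1 [1, 1] e)"
proof -
  have "dg Q 1 (act Q 1 [1] (act Q 2 [0, 1] \<sigma>)) = act Q 1 [1, 1] (act Q 2 [0, 1] \<sigma>)"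
    if "\<sigma> \<in> simplices Q 2" for \<sigma>
    using act_const [of Q "act Q 2 [0, 1] \<sigma>" 1 1 1] that assms
    by (simp add: act_list_in replicate_Suc monotone_list_def)
  then show ?thesis
    unfolding homotopic_def by (intro bex_cong) auto
qed

lemma homotopicI:
  assumes "simplicial_set Q" "\<sigma> \<in> simplices Q 2" "act Q 2 [0, 1] \<sigma> = e" "act Q 2 [0, 2] \<sigma> = e'"
    "act Q 2 [1, 2] \<sigma> = act Q 1 [1, 1] e"
  shows "homotopic Q e e'"
  unfolding homotopic_iff [OF assms(1)] using assms(2-) by (intro bexI conjI)

lemma homotopic_in:
  "simplicial_set Q ==> homotopic Q e e' ==> e \<in> simplices Q 1 \<and> e' \<in> simplices Q 1"
  unfolding homotopic_def by (auto simp: act_list_in monotone_list_def)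

lemma homotopic_ends:
  assumes Q: "simplicial_set Q" and e: "homotopic Q e e'"
  shows "act Q 1 [0, 0] e' = act Q 1 [0, 0] e" "act Q 1 [1, 1] e' = act Q 1 [1, 1] e"
proof -
  note ev = act_act_list [OF Q] act_list_in [OF Q] monotone_list_def
  obtain \<sigma> where \<sigma>: "\<sigma> \<in> simplices Q 2" "act Q 2 [0, 1] \<sigma> = e" "act Q 2 [0, 2] \<sigma> = e'"
    "act Q 2 [1, 2] \<sigma> = act Q 1 [1, 1] e"
    using e unfolding homotopic_iff [OF Q] by blast
  then have "act Q 1 [1, 1] (act Q 2 [1, 2] \<sigma>) = act Q 1 [1, 1] (act Q 1 [1, 1] (act Q 2 [0, 1] \<sigma>))"
    by simp
  then have "act Q 2 [2, 2] \<sigma> = act Q 2 [1, 1] \<sigma>"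
    using \<sigma>(1) by (simp add: ev)
  then show "act Q 1 [0, 0] e' = act Q 1 [0, 0] e" "act Q 1 [1, 1] e' = act Q 1 [1, 1] e"
    using \<sigma>(1) unfolding \<sigma>(2,3) [symmetric] by (simp_all add: ev)
qed

lemma homotopic_refl:
  assumes Q: "simplicial_set Q" "e \<in> simplices Q 1"
  shows "homotopic Q e e"
proof (rule homotopicI [OF Q(1)])
  have "act Q 1 [0, 1] e = e" using ss_id [OF Q] by simp
  then show "act Q 1 [0, 1, 1] e \<in> simplices Q 2" "act Q 2 [0, 1] (act Q 1 [0, 1, 1] e) = e"
    "act Q 2 [0, 2] (act Q 1 [0, 1, 1] e) = e" "act Q 2 [1, 2] (act Q 1 [0, 1, 1] e) = act Q 1 [1, 1] e"
    using Q by (simp_all add: act_act_list act_list_in monotone_list_def)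
qed

text \<open>Two triangles that share the edge opposite to their last vertex and whose other short edges agree have homotopic long edges, by filling a 3-dimensional
inner horn whose remaining face is degenerate.\<close>

lemma triangles_homotopic:
  assumes Q: "quasi_category Q" and \<sigma>: "\<sigma> \<in> simplices Q 2" and \<sigma>': "\<sigma>' \<in> simplices Q 2"
    and a: "act Q 2 [0, 1] \<sigma> = act Q 2 [0, 1] \<sigma>'"
    and b: "homotopic Q (act Q 2 [1, 2] \<sigma>) (act Q 2 [1, 2] \<sigma>')"
  shows "homotopic Q (act Q 2 [0, 2] \<sigma>) (act Q 2 [0, 2] \<sigma>')"
proof -
  note Q' = quasi_category_set [OF Q]
  note ev = act_act_list [OF Q'] act_list_in [OF Q'] monotone_list_def
  obtain \<tau> where \<tau>: "\<tau> \<in> simplices Q 2" "act Q 2 [0, 1] \<tau> = act Q 2 [1, 2] \<sigma>"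
    "act Q 2 [0, 2] \<tau> = act Q 2 [1, 2] \<sigma>'" "act Q 2 [1, 2] \<tau> = act Q 1 [1, 1] (act Q 2 [1, 2] \<sigma>)"
    using b unfolding homotopic_iff [OF Q'] by blast
  obtain \<rho> where \<rho>: "\<rho> \<in> simplices Q 3" "act Q 3 [0, 1, 2] \<rho> = \<sigma>" "act Q 3 [0, 1, 3] \<rho> = \<sigma>'"
    "act Q 3 [1, 2, 3] \<rho> = \<tau>"
    using fill3 [OF Q \<sigma> \<sigma>' \<tau>(1) a \<tau>(2) [symmetric] \<tau>(3) [symmetric]] by blast
  show ?thesis
  proof (rule homotopicI [OF Q', of "act Q 3 [0, 2, 3] \<rho>"])
    have "act Q 3 [2, 3] \<rho> = act Q 3 [2, 2] \<rho>"
      using \<tau>(4) \<rho>(1) unfolding \<rho>(2-4) [symmetric] by (simp add: ev)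
    then show "act Q 2 [1, 2] (act Q 3 [0, 2, 3] \<rho>) = act Q 1 [1, 1] (act Q 2 [0, 2] \<sigma>)"
      using \<rho>(1) unfolding \<rho>(2-4) [symmetric] by (simp add: ev)
  qed (use \<rho>(1) in \<open>simp_all add: ev flip: \<rho>(2-4)\<close>)
qed

lemma homotopic_cancel:
  assumes Q: "quasi_category Q" and e: "homotopic Q e e'" "homotopic Q e e''"
  shows "homotopic Q e' e''"
proof -
  note Q' = quasi_category_set [OF Q]
  obtain \<sigma> where \<sigma>: "\<sigma> \<in> simplices Q 2" "act Q 2 [0, 1] \<sigma> = e" "act Q 2 [0, 2] \<sigma> = e'"
    "act Q 2 [1, 2] \<sigma> = act Q 1 [1, 1] e"
    using e(1) unfolding homotopic_iff [OF Q'] by blast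
  obtain \<sigma>' where \<sigma>': "\<sigma>' \<in> simplices Q 2" "act Q 2 [0, 1] \<sigma>' = e" "act Q 2 [0, 2] \<sigma>' = e''"
    "act Q 2 [1, 2] \<sigma>' = act Q 1 [1, 1] e"
    using e(2) unfolding homotopic_iff [OF Q'] by blast
  have "act Q 1 [1, 1] e \<in> simplices Q 1"
    using homotopic_in [OF Q' e(1)] by (simp add: act_list_in [OF Q'] monotone_list_def)
  then have "homotopic Q (act Q 2 [1, 2] \<sigma>) (act Q 2 [1, 2] \<sigma>')"
    unfolding \<sigma>(4) \<sigma>'(4) by (rule homotopic_refl [OF Q'])
  then show ?thesis
    using triangles_homotopic [OF Q \<sigma>(1) \<sigma>'(1)] unfolding \<sigma> \<sigma>' by blast
qed

lemma homotopic_sym: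
  assumes Q: "quasi_category Q" and e: "homotopic Q e e'"
  shows "homotopic Q e' e"
proof -
  have "e \<in> simplices Q 1" using homotopic_in [OF quasi_category_set [OF Q] e] by simp
  then show ?thesis by (intro homotopic_cancel [OF Q e] homotopic_refl quasi_category_set [OF Q])
qed

lemma homotopic_trans:
  "quasi_category Q ==> homotopic Q e e' ==> homotopic Q e' e'' ==> homotopic Q e e''"
  by (rule homotopic_cancel [OF _ homotopic_sym])

lemma hclass_eq:
  assumes Q: "quasi_category Q" and e: "homotopic Q e e'"
  shows "hclass Q e = hclass Q e'"
  unfolding hclass_def using homotopic_cancel [OF Q e] homotopic_trans [OF Q e] by blast

text \<open>The triangle identities of the adjunctions below hold because both composites consist of identities, so this is the only composite of
homotopy classes that is ever computed.\<close>

lemma hcomp_hid: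
  assumes Q: "quasi_category Q" and x: "x \<in> simplices Q 0"
  shows "hcomp Q (hid Q x) (hid Q x) = hid Q x"
proof -
  note Q' = quasi_category_set [OF Q]
  note ev = act_act_list [OF Q'] act_list_in [OF Q'] monotone_list_def
  define i where "i = dg Q 1 x"
  have i: "i \<in> simplices Q 1" "act Q 1 [1, 1] i = i" "act Q 1 [0, 1] i = i" "act Q 1 [0, 0] i = i"
    using dg_in [OF Q' x] act_dg [OF Q' x, of "[1, 1]" 1 1] act_dg [OF Q' x, of "[0, 0]" 1 1] ss_id [OF Q', of i 1]
    by (simp_all add: i_def Delta_eval)
  define s where "s = act Q 1 [0, 1, 1] i"
  have s: "s \<in> simplices Q 2" "act Q 2 [0, 1] s = i" "act Q 2 [0, 2] s = i" "act Q 2 [1, 2] s = i"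
    using i by (simp_all add: s_def ev)
  have "homotopic Q i (act Q 2 [0, 2] \<sigma>)"
    if \<sigma>: "\<sigma> \<in> simplices Q 2" "homotopic Q i (act Q 2 [0, 1] \<sigma>)" "homotopic Q i (act Q 2 [1, 2] \<sigma>)" for \<sigma>
  proof -
    define a where "a = act Q 2 [0, 1] \<sigma>"
    have a: "a \<in> simplices Q 1" "act Q 1 [0, 1] a = a"
      using \<sigma>(1) by (simp_all add: a_def ev)
    have "act Q 1 [1, 1] a = i"
      using homotopic_ends(2) [OF Q' \<sigma>(2)] i(2) a_def by simp
    then have "homotopic Q (act Q 2 [1, 2] (act Q 1 [0, 1, 1] a)) (act Q 2 [1, 2] \<sigma>)"
      using \<sigma>(3) a by (simp add: ev)
    then have "homotopic Q (act Q 2 [0, 2] (act Q 1 [0, 1, 1] a)) (act Q 2 [0, 2] \<sigma>)"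
      by (rule triangles_homotopic [OF Q _ \<sigma>(1), rotated 2]) (use a in \<open>simp_all add: ev a_def\<close>)
    then have "homotopic Q a (act Q 2 [0, 2] \<sigma>)" using a by (simp add: ev)
    then show ?thesis by (rule homotopic_trans [OF Q \<sigma>(2) [folded a_def]])
  qed
  then show ?thesis
    unfolding hcomp_def hid_def hclass_def i_def [symmetric]
  proof (intro equalityI subsetI; clarsimp)
    fix \<sigma> assume "\<sigma> \<in> simplices Q 2"
    then show "act Q 2 [0, 2] \<sigma> \<in> simplices Q (Suc 0)" by (simp add: ev)
  next
    fix e assume e: "e \<in> simplices Q (Suc 0)" "homotopic Q i e"
    have "act Q 1 [0, 0] e = i" "act Q 1 [0, 1] e = e"
      using homotopic_ends(1) [OF Q' e(2)] i ss_id [OF Q', of e 1] e(1) by simp_all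
    then show "\<exists>\<sigma>. e = act Q 2 [0, 2] \<sigma> \<and> \<sigma> \<in> simplices Q 2 \<and> act Q 2 [0, Suc 0] \<sigma> \<in> simplices Q (Suc 0) \<and>
        homotopic Q i (act Q 2 [0, Suc 0] \<sigma>) \<and> act Q 2 [Suc 0, 2] \<sigma> \<in> simplices Q (Suc 0) \<and>
        homotopic Q i (act Q 2 [Suc 0, 2] \<sigma>)"
      using e i(1) homotopic_refl [OF Q' i(1)] by (intro exI [of _ "act Q 1 [0, 0, 1] e"]) (simp add: ev)
  qed
qed

text \<open>The two triangles of the square share the diagonal, to which both remaining edges are homotopic.\<close>

lemma square_homotopic:
  assumes Q: "quasi_category Q" and S: "smap (sprod (std 1) (std 1)) Q S"
    and deg: "\<And>m t. t \<in> Delta m 1 ==> S m (const m 0, t) = dg Q m x"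
      "\<And>m t. t \<in> Delta m 1 ==> S m (const m 1, t) = dg Q m y"
  shows "homotopic Q (S 1 ([0, 1], [0, 0])) (S 1 ([0, 1], [1, 1]))"
proof -
  note Q' = quasi_category_set [OF Q]
  note ev = act_act_list [OF Q'] act_list_in [OF Q'] monotone_list_def
  have S2: "S 2 (i, t) \<in> simplices Q 2" "\<beta> \<in> Delta 1 2 ==> act Q 2 \<beta> (S 2 (i, t)) = S 1 (i \<odot> \<beta>, t \<odot> \<beta>)"
    if "i \<in> Delta 2 1" "t \<in> Delta 2 1" for \<beta> i t
    using smap_act [OF S, of \<beta> 1 2 "(i, t)"] smap_in [OF S, of "(i, t)" 2] that by simp_all
  have S1: "act Q 1 [1, 1] (S 1 ([0, 1], [0, 0])) = S 1 ([1, 1], [0, 0])"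
    "S 1 ([0, 1], [1, 1]) \<in> simplices Q 1"
    using smap_act [OF S, of "[1, 1]" 1 1 "([0, 1], [0, 0])"] smap_in [OF S, of "([0, 1], [1, 1])" 1]
    by (simp_all add: Delta_eval)
  have d: "S 1 ([0, 0], t) = dg Q 1 x" "S 1 ([1, 1], t) = dg Q 1 y" if "t \<in> Delta 1 1" for t
    using deg [OF that] by (simp_all add: replicate_Suc)
  note ev2 = S2 Delta_eval
  have "homotopic Q (S 1 ([0, 1], [0, 0])) (S 1 ([0, 1], [0, 1]))"
    by (rule homotopicI [OF Q', of "S 2 ([0, 1, 1], [0, 0, 1])"])
      (use S1(1) d(2) [of "[0, 0]"] d(2) [of "[0, 1]"] in \<open>simp_all add: ev2\<close>)
  moreover have "homotopic Q (act Q 2 [0, 2] (S 2 ([0, 0, 1], [0, 1, 1])))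
      (act Q 2 [0, 2] (S 2 ([0, 0, 1], [1, 1, 1])))"
    by (rule triangles_homotopic [OF Q])
      (use homotopic_refl [OF Q' S1(2)] d(1) [of "[1, 1]"] d(1) [of "[0, 1]"] in \<open>simp_all add: ev2\<close>)
  then have "homotopic Q (S 1 ([0, 1], [0, 1])) (S 1 ([0, 1], [1, 1]))"
    by (simp add: ev2)
  ultimately show ?thesis by (rule homotopic_trans [OF Q])
qed

abbreviation res :: "('o, 's, 'z) scat_scheme \<Rightarrow> 'o \<Rightarrow> 'o \<Rightarrow> nat \<Rightarrow> nat list \<Rightarrow> 's \<Rightarrow> 's" where
  "res K A B \<equiv> act (Fun K A B)"

text \<open>The component of an n-simplex e of Fun(X,E) at an m-simplex \<open>(i, \<alpha>)\<close> of the product of the 1-simplex and the n-simplex.\<close>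

abbreviation cpt ::
    "('o, 's, 'z) scat_scheme \<Rightarrow> 'o \<Rightarrow> 'o \<Rightarrow> 'o \<Rightarrow> 's \<Rightarrow> nat \<Rightarrow> nat \<Rightarrow> nat list \<Rightarrow> nat list \<Rightarrow> 's \<Rightarrow> 's" where
  "cpt K X E A \<kappa> n m i \<alpha> e \<equiv> Cmp K X E A m (res K E A 1 i \<kappa>) (res K X E n \<alpha> e)"

section \<open>Simplicially enriched categories\<close>

locale enriched =
  fixes K :: "('o, 's, 'z) scat_scheme"
  assumes K: "simplicial_category K"
begin

abbreviation ob :: "'o \<Rightarrow> bool" where
  "ob A \<equiv> A \<in> Obj K"

abbreviation cells :: "'o \<Rightarrow> 'o \<Rightarrow> nat \<Rightarrow> 's set" where
  "cells A B n \<equiv> simplices (Fun K A B) n"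

lemma fun_set [simp]: "ob A ==> ob B ==> simplicial_set (Fun K A B)"
  using K by (simp add: simplicial_category_def)

lemma cmp_smap: "ob A ==> ob B ==> ob C ==>
    smap (sprod (Fun K B C) (Fun K A B)) (Fun K A C) (\<lambda>n (g, f). Cmp K A B C n g f)"
  using K by (simp add: simplicial_category_def)

lemma cmp_in [simp]: "ob A ==> ob B ==> ob C ==>
    g \<in> cells B C n ==> f \<in> cells A B n ==> Cmp K A B C n g f \<in> cells A C n"
  using smap_in [OF cmp_smap, of A B C "(g, f)" n] by simp

lemma act_cmp: "ob A ==> ob B ==> ob C ==> \<alpha> \<in> Delta m n ==>
    g \<in> cells B C n ==> f \<in> cells A B n ==>
    res K A C n \<alpha> (Cmp K A B C n g f) = Cmp K A B C m (res K B C n \<alpha> g) (res K A B n \<alpha> f)"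
  using smap_act [OF cmp_smap, of A B C \<alpha> m n "(g, f)"] by simp

lemma cmp_assoc: "ob A ==> ob B ==> ob C ==> ob D ==>
    f \<in> cells A B n ==> g \<in> cells B C n ==> h \<in> cells C D n ==>
    Cmp K A B D n (Cmp K B C D n h g) f = Cmp K A C D n h (Cmp K A B C n g f)"
  using K unfolding simplicial_category_def by blast

lemma idt_in [simp]: "ob A ==> Idt K A \<in> cells A A 0"
  using K by (simp add: simplicial_category_def)

lemma post_idt [simp]: "ob A ==> ob B ==> x \<in> cells A B n ==> post K A B B (Idt K B) n x = x"
  using K by (simp add: simplicial_category_def)

lemma pre_idt [simp]: "ob A ==> ob B ==> x \<in> cells A B n ==> pre K A A B (Idt K A) n x = x"
  using K by (simp add: simplicial_category_def)

lemma dg_cells [simp]: "ob A ==> ob B ==> x \<in> cells A B 0 ==> dg (Fun K A B) n x \<in> cells A B n"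
  by (simp add: dg_in)

lemma act_dg_cells: "ob A ==> ob B ==> x \<in> cells A B 0 ==> \<alpha> \<in> Delta m n ==>
    res K A B n \<alpha> (dg (Fun K A B) n x) = dg (Fun K A B) m x"
  by (simp add: act_dg)

lemma act_cells: "ob A ==> ob B ==> x \<in> cells A B n ==> \<alpha> \<in> Delta m n ==>
    res K A B n \<alpha> x \<in> cells A B m"
  by (simp add: ss_in)

lemma dg_cmp: "ob A ==> ob B ==> ob C ==> g \<in> cells B C 0 ==> f \<in> cells A B 0 ==>
    dg (Fun K A C) n (fcomp K A B C g f) = Cmp K A B C n (dg (Fun K B C) n g) (dg (Fun K A B) n f)"
  unfolding dg_def by (rule act_cmp) simp_all

lemma post_0: "ob A ==> ob B ==> ob C ==> g \<in> cells B C 0 ==> x \<in> cells A B 0 ==>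
    post K A B C g 0 x = fcomp K A B C g x"
  by (simp add: post_def dg_0)

lemma pre_0: "ob A ==> ob B ==> ob C ==> f \<in> cells A B 0 ==> x \<in> cells B C 0 ==>
    pre K A B C f 0 x = fcomp K A B C x f"
  by (simp add: pre_def dg_0)

lemma post_in [simp]: "ob A ==> ob B ==> ob C ==> g \<in> cells B C 0 ==> x \<in> cells A B n ==>
    post K A B C g n x \<in> cells A C n"
  by (simp add: post_def)

lemma pre_in [simp]: "ob A ==> ob B ==> ob C ==> f \<in> cells A B 0 ==> x \<in> cells B C n ==>
    pre K A B C f n x \<in> cells A C n"
  by (simp add: pre_def)

lemma act_post: "ob A ==> ob B ==> ob C ==> g \<in> cells B C 0 ==> x \<in> cells A B n ==>
    \<alpha> \<in> Delta m n ==>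
    res K A C n \<alpha> (post K A B C g n x) = post K A B C g m (res K A B n \<alpha> x)"
  by (simp add: post_def act_cmp act_dg_cells)

lemma act_pre: "ob A ==> ob B ==> ob C ==> f \<in> cells A B 0 ==> x \<in> cells B C n ==>
    \<alpha> \<in> Delta m n ==>
    res K A C n \<alpha> (pre K A B C f n x) = pre K A B C f m (res K B C n \<alpha> x)"
  by (simp add: pre_def act_cmp act_dg_cells)

lemma post_smap: "ob A ==> ob B ==> ob C ==> g \<in> cells B C 0 ==>
    smap (Fun K A B) (Fun K A C) (post K A B C g)"
  by (rule simplicial_mapI) (simp_all add: act_post)

lemma pre_smap: "ob A ==> ob B ==> ob C ==> f \<in> cells A B 0 ==>
    smap (Fun K B C) (Fun K A C) (pre K A B C f)"
  by (rule simplicial_mapI) (simp_all add: act_pre)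

lemma post_post: "ob A ==> ob B ==> ob C ==> ob D ==>
    g \<in> cells B C 0 ==> h \<in> cells C D 0 ==> x \<in> cells A B n ==>
    post K A C D h n (post K A B C g n x) = post K A B D (fcomp K B C D h g) n x"
  by (simp add: post_def dg_cmp cmp_assoc)

lemma pre_pre: "ob A ==> ob B ==> ob C ==> ob D ==>
    f \<in> cells A B 0 ==> g \<in> cells B C 0 ==> x \<in> cells C D n ==>
    pre K A B D f n (pre K B C D g n x) = pre K A C D (fcomp K A B C g f) n x"
  by (simp add: pre_def dg_cmp cmp_assoc)

lemma post_pre: "ob A ==> ob B ==> ob C ==> ob D ==>
    f \<in> cells A B 0 ==> h \<in> cells C D 0 ==> x \<in> cells B C n ==>
    post K A C D h n (pre K A B C f n x) = pre K A B D f n (post K B C D h n x)"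
  by (simp add: pre_def post_def cmp_assoc)

lemma post_dg: "ob A ==> ob B ==> ob C ==> g \<in> cells B C 0 ==> f \<in> cells A B 0 ==>
    post K A B C g n (dg (Fun K A B) n f) = dg (Fun K A C) n (fcomp K A B C g f)"
  by (simp add: post_def dg_cmp)

lemma pre_dg: "ob A ==> ob B ==> ob C ==> g \<in> cells B C 0 ==> f \<in> cells A B 0 ==>
    pre K A B C f n (dg (Fun K B C) n g) = dg (Fun K A C) n (fcomp K A B C g f)"
  by (simp add: pre_def dg_cmp)

lemma cmp_post: "ob A ==> ob B ==> ob C ==> ob D ==>
    h \<in> cells C D 0 ==> y \<in> cells B C n ==> x \<in> cells A B n ==>
    Cmp K A B D n (post K B C D h n y) x = post K A C D h n (Cmp K A B C n y x)"
  by (simp add: post_def cmp_assoc)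

lemma cmp_pre: "ob A ==> ob B ==> ob C ==> ob D ==>
    g \<in> cells B C 0 ==> y \<in> cells C D n ==> x \<in> cells A B n ==>
    Cmp K A B D n (pre K B C D g n y) x = Cmp K A C D n y (post K A B C g n x)"
  by (simp add: post_def pre_def cmp_assoc)

lemma pre_cmp: "ob A ==> ob B ==> ob C ==> ob D ==>
    f \<in> cells A B 0 ==> y \<in> cells C D n ==> x \<in> cells B C n ==>
    pre K A B D f n (Cmp K B C D n y x) = Cmp K A C D n y (pre K A B C f n x)"
  by (simp add: pre_def cmp_assoc)

lemma cmp_dg_left: "Cmp K A B C n (dg (Fun K B C) n g) x = post K A B C g n x"
  by (simp add: post_def)

lemma cmp_dg_right: "Cmp K A B C n y (dg (Fun K A B) n f) = pre K A B C f n y"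
  by (simp add: pre_def)

lemma fcomp_assoc: "ob A ==> ob B ==> ob C ==> ob D ==>
    f \<in> cells A B 0 ==> g \<in> cells B C 0 ==> h \<in> cells C D 0 ==>
    fcomp K A B D (fcomp K B C D h g) f = fcomp K A C D h (fcomp K A B C g f)"
  by (rule cmp_assoc)

lemma fcomp_idt [simp]: "ob A ==> ob B ==> f \<in> cells A B 0 ==> fcomp K A B B (Idt K B) f = f"
  "ob A ==> ob B ==> f \<in> cells A B 0 ==> fcomp K A A B f (Idt K A) = f"
  using post_idt [of A B f 0] pre_idt [of A B f 0] by (simp_all add: post_0 pre_0)

subsection \<open>Cotensors\<close>

lemma cotensorD:
  assumes "is_cotensor K A U P \<epsilon>"
  shows "ob P" "smap U (Fun K P A) \<epsilon>"
    "u \<in> simplices U m ==> \<epsilon> m u \<in> cells P A m"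
  using assms smap_in [of U "Fun K P A" \<epsilon> u m] unfolding is_cotensor_def by auto

lemma cotensor_transpose_smap:
  assumes P: "is_cotensor K A U P \<epsilon>" and obj: "ob A" "ob X"
    and \<theta>: "smap Z (Fun K X P) \<theta>"
  shows "smap (sprod U Z) (Fun K X A) (\<lambda>m (u, z). Cmp K X P A m (\<epsilon> m u) (\<theta> m z))"
  using cotensorD [OF P] obj smap_in [OF \<theta>]
  by (intro simplicial_mapI)
    (auto simp: smap_act [OF \<theta>] smap_act [OF cotensorD(2) [OF P]] act_cmp)

lemma cotensor_unique:
  assumes P: "is_cotensor K A U P \<epsilon>" and obj: "ob A" "ob X"
    and xy: "x \<in> cells X P n" "y \<in> cells X P n"
    and eq: "\<And>m u \<alpha>. u \<in> simplices U m ==> \<alpha> \<in> Delta m n ==>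
      Cmp K X P A m (\<epsilon> m u) (res K X P n \<alpha> x) = Cmp K X P A m (\<epsilon> m u) (res K X P n \<alpha> y)"
  shows "x = y"
proof -
  note D = cotensorD [OF P]
  let ?\<phi> = "\<lambda>m (u, \<alpha>). Cmp K X P A m (\<epsilon> m u) (res K X P n \<alpha> x)"
  have "smap (sprod U (std n)) (Fun K X A) ?\<phi>"
    using D obj xy by (intro cotensor_transpose_smap [OF P obj] smap_of_simplex) auto
  then have "\<exists>!z. z \<in> cells X P n \<and> (\<forall>m. \<forall>u\<in>simplices U m. \<forall>\<alpha>\<in>Delta m n.
      Cmp K X P A m (\<epsilon> m u) (res K X P n \<alpha> z) = ?\<phi> m (u, \<alpha>))" (is "\<exists>!z. ?p z")
    using P obj unfolding is_cotensor_def by blast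
  moreover have "?p x" "?p y" using xy eq by auto
  ultimately show ?thesis by blast
qed

text \<open>The universal property concerns simplices only. The transposes of the simplices of Z fit together because they are unique.\<close>

lemma cotensor_transpose:
  assumes P: "is_cotensor K A U P \<epsilon>" and obj: "ob A" "ob X" and Z: "simplicial_set Z"
    and \<phi>: "smap (sprod U Z) (Fun K X A) \<phi>"
  shows "\<exists>\<theta>. smap Z (Fun K X P) \<theta> \<and>
    (\<forall>m. \<forall>u\<in>simplices U m. \<forall>z\<in>simplices Z m. Cmp K X P A m (\<epsilon> m u) (\<theta> m z) = \<phi> m (u, z))"
proof -
  note D = cotensorD [OF P]
  let ?p = "\<lambda>n z x. x \<in> cells X P n \<and> (\<forall>m. \<forall>u\<in>simplices U m. \<forall>\<alpha>\<in>Delta m n.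
      Cmp K X P A m (\<epsilon> m u) (res K X P n \<alpha> x) = \<phi> m (u, act Z n \<alpha> z))"
  have ex: "\<exists>x. ?p n z x" if z: "z \<in> simplices Z n" for n z
  proof -
    have "smap (sprod U (std n)) (Fun K X A) (\<lambda>m (u, \<alpha>). \<phi> m (u, act Z n \<alpha> z))"
    proof (rule simplicial_mapI)
      fix m' m \<beta> and x :: "_ \<times> nat list" assume b: "\<beta> \<in> Delta m' m" "x \<in> simplices (sprod U (std n)) m"
      then obtain u \<alpha> where [simp]: "x = (u, \<alpha>)" "u \<in> simplices U m" "\<alpha> \<in> Delta m n" by auto
      have "(u, act Z n \<alpha> z) \<in> simplices (sprod U Z) m" using z Z by (simp add: ss_in)
      from smap_act [OF \<phi> b(1) this] show "(\<lambda>(u, \<alpha>). \<phi> m' (u, act Z n \<alpha> z)) (act (sprod U (std n)) m \<beta> x) =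
          res K X A m \<beta> ((\<lambda>(u, \<alpha>). \<phi> m (u, act Z n \<alpha> z)) x)"
        using b z Z by (simp add: ss_comp)
    qed (use z Z smap_in [OF \<phi>] in \<open>auto simp: ss_in\<close>)
    then have "\<exists>!x. x \<in> cells X P n \<and> (\<forall>m. \<forall>u\<in>simplices U m. \<forall>\<alpha>\<in>Delta m n.
      Cmp K X P A m (\<epsilon> m u) (res K X P n \<alpha> x) = (\<lambda>(u, \<alpha>). \<phi> m (u, act Z n \<alpha> z)) (u, \<alpha>))"
      using P obj unfolding is_cotensor_def by blast
    then show ?thesis by auto
  qed
  define \<theta> where "\<theta> n z = (SOME x. ?p n z x)" for n z
  have \<theta>: "?p n z (\<theta> n z)" if "z \<in> simplices Z n" for n z
    unfolding \<theta>_def by (rule someI_ex [OF ex [OF that]])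
  show ?thesis
  proof (intro exI [of _ \<theta>] conjI allI ballI)
    show "smap Z (Fun K X P) \<theta>"
    proof (rule simplicial_mapI)
      fix m n \<alpha> z assume a: "\<alpha> \<in> Delta m n" "z \<in> simplices Z n"
      have z': "act Z n \<alpha> z \<in> simplices Z m" using a Z by (simp add: ss_in)
      show "\<theta> m (act Z n \<alpha> z) = res K X P n \<alpha> (\<theta> n z)"
      proof (rule cotensor_unique [OF P obj])
        fix k u \<beta> assume b: "u \<in> simplices U k" "\<beta> \<in> Delta k m"
        then show "Cmp K X P A k (\<epsilon> k u) (res K X P m \<beta> (\<theta> m (act Z n \<alpha> z))) =
            Cmp K X P A k (\<epsilon> k u) (res K X P m \<beta> (res K X P n \<alpha> (\<theta> n z)))"
          using \<theta> [OF a(2)] \<theta> [OF z'] a D(1) obj Z by (simp add: ss_comp)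
      qed (use \<theta> [OF z'] \<theta> [OF a(2)] a D(1) obj in \<open>auto simp: act_cells\<close>)
    qed (use \<theta> in auto)
    fix m u z assume a: "u \<in> simplices U m" "z \<in> simplices Z m"
    have "Cmp K X P A m (\<epsilon> m u) (res K X P m [0..<Suc m] (\<theta> m z)) =
        \<phi> m (u, act Z m [0..<Suc m] z)"
      using \<theta> [OF a(2)] a(1) Delta_id by blast
    then show "Cmp K X P A m (\<epsilon> m u) (\<theta> m z) = \<phi> m (u, z)"
      using \<theta> [OF a(2)] a Z obj D(1) ss_id [OF Z a(2)] ss_id [OF fun_set, of X P "\<theta> m z" m]
      by (simp del: upt_Suc)
  qed
qed

lemma cotensor_cell:
  assumes P: "is_cotensor K A U P \<epsilon>" and obj: "ob A" "ob X"
    and \<phi>: "smap (sprod U (std n)) (Fun K X A) \<phi>"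
  shows "\<exists>x\<in>cells X P n. \<forall>m. \<forall>u\<in>simplices U m. \<forall>\<alpha>\<in>Delta m n.
      Cmp K X P A m (\<epsilon> m u) (res K X P n \<alpha> x) = \<phi> m (u, \<alpha>)"
proof -
  have "\<exists>!x. x \<in> cells X P n \<and> (\<forall>m. \<forall>u\<in>simplices U m. \<forall>\<alpha>\<in>Delta m n.
      Cmp K X P A m (\<epsilon> m u) (res K X P n \<alpha> x) = \<phi> m (u, \<alpha>))"
    using P obj \<phi> unfolding is_cotensor_def by blast
  then show ?thesis by blast
qed

lemma cotensor_end:
  assumes P: "is_cotensor K A U P \<epsilon>" and u: "u \<in> simplices U 0"
    and obj: "ob A" "ob X"
  shows "post K X P A (\<epsilon> 0 u) n x = Cmp K X P A n (\<epsilon> n (dg U n u)) x"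
  unfolding post_def smap_dg [OF cotensorD(2) [OF P] u] ..

subsection \<open>Products and pullbacks\<close>

lemma bin_productD:
  assumes "is_bin_product K A B P a b"
  shows "ob P" "a \<in> functors K P A" "b \<in> functors K P B"
  using assms unfolding is_bin_product_def by blast+

lemma bin_product_ex:
  assumes "is_bin_product K A B P a b" "ob X" "x \<in> cells X A n" "y \<in> cells X B n"
  shows "\<exists>z\<in>cells X P n. post K X P A a n z = x \<and> post K X P B b n z = y"
  using assms unfolding is_bin_product_def by blast

lemma bin_product_unique:
  assumes P: "is_bin_product K A B P a b" and X: "ob X" "ob A" "ob B"
    and z: "z \<in> cells X P n" "z' \<in> cells X P n"
    and eq: "post K X P A a n z = post K X P A a n z'" "post K X P B b n z = post K X P B b n z'"
  shows "z = z'"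
proof -
  have "post K X P A a n z' \<in> cells X A n" "post K X P B b n z' \<in> cells X B n"
    using bin_productD [OF P] X z by simp_all
  then have "\<exists>!w. w \<in> cells X P n \<and> post K X P A a n w = post K X P A a n z' \<and> post K X P B b n w = post K X P B b n z'"
    using P X unfolding is_bin_product_def by blast
  then show ?thesis by (rule ex1E) (use z eq in auto)
qed

lemma pullbackD:
  assumes "is_pullback K E C B p f P a b"
  shows "ob P" "a \<in> functors K P E" "b \<in> functors K P C" "fcomp K P E B p a = fcomp K P C B f b"
  using assms unfolding is_pullback_def by blast+

lemma pullback_ex:
  assumes "is_pullback K E C B p f P a b" "ob X" "x \<in> cells X E n" "y \<in> cells X C n"
    "post K X E B p n x = post K X C B f n y"
  shows "\<exists>z\<in>cells X P n. post K X P E a n z = x \<and> post K X P C b n z = y"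
  using assms unfolding is_pullback_def by blast

lemma pullback_square:
  assumes P: "is_pullback K E C B p f P a b" and obj: "ob X" "ob E" "ob C" "ob B"
    and pf: "p \<in> functors K E B" "f \<in> functors K C B" and z: "z \<in> cells X P n"
  shows "post K X E B p n (post K X P E a n z) = post K X C B f n (post K X P C b n z)"
  using pullbackD [OF P] obj pf z by (simp add: post_post)

lemma pullback_unique:
  assumes P: "is_pullback K E C B p f P a b" and obj: "ob X" "ob E" "ob C" "ob B"
    and pf: "p \<in> functors K E B" "f \<in> functors K C B"
    and z: "z \<in> cells X P n" "z' \<in> cells X P n"
    and eq: "post K X P E a n z = post K X P E a n z'" "post K X P C b n z = post K X P C b n z'"
  shows "z = z'"
proof -
  have "post K X P E a n z' \<in> cells X E n" "post K X P C b n z' \<in> cells X C n"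
    using pullbackD [OF P] obj z by simp_all
  moreover note pullback_square [OF P obj pf z(2)]
  ultimately have "\<exists>!w. w \<in> cells X P n \<and> post K X P E a n w = post K X P E a n z' \<and> post K X P C b n w = post K X P C b n z'"
    using P obj unfolding is_pullback_def by blast
  then show ?thesis by (rule ex1E) (use z eq in auto)
qed

end

subsection \<open>Comma objects\<close>

text \<open>This is the universal property of a comma object in terms of its 2-cell \<open>\<kappa>\<close>, for n-simplices of functors. Unlike the pullback of the arrow object, it
mentions neither cotensors nor products and is visibly self-dual. The value of \<open>\<kappa>\<close> on an n-simplex e of Fun(X,E) is a map from the
product of the 1-simplex and the n-simplex to Fun(X,A); it is called the component of e.\<close>

definition is_comma ::
    "('o, 's, 'z) scat_scheme \<Rightarrow> 'o \<Rightarrow> 'o \<Rightarrow> 'o \<Rightarrow> 's \<Rightarrow> 's \<Rightarrow> 'o \<Rightarrow> 's \<Rightarrow> 's \<Rightarrow> 's \<Rightarrow> bool" where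
  "is_comma K A B C f g E e0 e1 \<kappa> \<longleftrightarrow> E \<in> Obj K \<and> e0 \<in> functors K E B \<and> e1 \<in> functors K E C \<and>
     \<kappa> \<in> simplices (Fun K E A) 1 \<and>
     res K E A 1 [0] \<kappa> = fcomp K E B A f e0 \<and> res K E A 1 [1] \<kappa> = fcomp K E C A g e1 \<and>
     (\<forall>X\<in>Obj K. \<forall>n. \<forall>b\<in>simplices (Fun K X B) n. \<forall>c\<in>simplices (Fun K X C) n. \<forall>\<phi>.
        smap (sprod (std 1) (std n)) (Fun K X A) \<phi> \<longrightarrow>
        (\<forall>m. \<forall>\<alpha>\<in>Delta m n.
           \<phi> m (const m 0, \<alpha>) = res K X A n \<alpha> (post K X B A f n b) \<and>
           \<phi> m (const m 1, \<alpha>) = res K X A n \<alpha> (post K X C A g n c)) \<longrightarrow>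
        (\<exists>e\<in>simplices (Fun K X E) n. post K X E B e0 n e = b \<and> post K X E C e1 n e = c \<and>
           (\<forall>m. \<forall>i\<in>Delta m 1. \<forall>\<alpha>\<in>Delta m n.
              cpt K X E A \<kappa> n m i \<alpha> e = \<phi> m (i, \<alpha>)))) \<and>
     (\<forall>X\<in>Obj K. \<forall>n. \<forall>e\<in>simplices (Fun K X E) n. \<forall>e'\<in>simplices (Fun K X E) n.
        post K X E B e0 n e = post K X E B e0 n e' \<longrightarrow> post K X E C e1 n e = post K X E C e1 n e' \<longrightarrow>
        (\<forall>m. \<forall>i\<in>Delta m 1. \<forall>\<alpha>\<in>Delta m n.
              cpt K X E A \<kappa> n m i \<alpha> e =
              cpt K X E A \<kappa> n m i \<alpha> e') \<longrightarrow> e = e')"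

context enriched
begin

lemma commaD:
  assumes "is_comma K A B C f g E e0 e1 \<kappa>"
  shows "ob E" "e0 \<in> functors K E B" "e1 \<in> functors K E C" "\<kappa> \<in> cells E A 1"
    "res K E A 1 [0] \<kappa> = fcomp K E B A f e0" "res K E A 1 [1] \<kappa> = fcomp K E C A g e1"
  using assms unfolding is_comma_def by blast+

lemma comma_unique:
  assumes "is_comma K A B C f g E e0 e1 \<kappa>" "ob X" "e \<in> cells X E n" "e' \<in> cells X E n"
    "post K X E B e0 n e = post K X E B e0 n e'" "post K X E C e1 n e = post K X E C e1 n e'"
    "\<And>m i \<alpha>. i \<in> Delta m 1 ==> \<alpha> \<in> Delta m n ==>
      cpt K X E A \<kappa> n m i \<alpha> e =
      cpt K X E A \<kappa> n m i \<alpha> e'"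
  shows "e = e'"
  using assms unfolding is_comma_def by blast

lemma comma_ex:
  assumes E: "is_comma K A B C f g E e0 e1 \<kappa>" and X: "ob X" "b \<in> cells X B n" "c \<in> cells X C n"
    and \<phi>: "smap (sprod (std 1) (std n)) (Fun K X A) \<phi>"
    and ends: "\<And>m \<alpha>. \<alpha> \<in> Delta m n ==> \<phi> m (const m 0, \<alpha>) = res K X A n \<alpha> (post K X B A f n b)"
      "\<And>m \<alpha>. \<alpha> \<in> Delta m n ==> \<phi> m (const m 1, \<alpha>) = res K X A n \<alpha> (post K X C A g n c)"
  shows "\<exists>e\<in>cells X E n. post K X E B e0 n e = b \<and> post K X E C e1 n e = c \<and>
    (\<forall>m. \<forall>i\<in>Delta m 1. \<forall>\<alpha>\<in>Delta m n.
      cpt K X E A \<kappa> n m i \<alpha> e = \<phi> m (i, \<alpha>))"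
  using E X \<phi> ends unfolding is_comma_def by blast

lemma comma_ends:
  assumes E: "is_comma K A B C f g E e0 e1 \<kappa>" and obj: "ob A" "ob B" "ob C" "ob X"
    and fg: "f \<in> functors K B A" "g \<in> functors K C A" and e: "e \<in> cells X E n"
  shows "Cmp K X E A n (res K E A 1 (const n 0) \<kappa>) e = post K X B A f n (post K X E B e0 n e)"
    "Cmp K X E A n (res K E A 1 (const n 1) \<kappa>) e = post K X C A g n (post K X E C e1 n e)"
  using commaD [OF E] obj fg e
  by (simp_all add: act_const cmp_dg_left post_post del: One_nat_def)

lemma comma_cells:
  assumes E: "is_comma K A B C f g E e0 e1 \<kappa>" and obj: "ob A" "ob B" "ob C" "ob X"
    and fg: "f \<in> functors K B A" "g \<in> functors K C A" and Z: "simplicial_set Z"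
    and b: "smap Z (Fun K X B) b" and c: "smap Z (Fun K X C) c"
    and \<phi>: "smap (sprod (std 1) Z) (Fun K X A) \<phi>"
    and ends: "\<And>m z. z \<in> simplices Z m ==> \<phi> m (const m 0, z) = post K X B A f m (b m z)"
      "\<And>m z. z \<in> simplices Z m ==> \<phi> m (const m 1, z) = post K X C A g m (c m z)"
  shows "\<exists>\<theta>. smap Z (Fun K X E) \<theta> \<and> (\<forall>m. \<forall>z\<in>simplices Z m.
      post K X E B e0 m (\<theta> m z) = b m z \<and> post K X E C e1 m (\<theta> m z) = c m z \<and>
      (\<forall>i\<in>Delta m 1. Cmp K X E A m (res K E A 1 i \<kappa>) (\<theta> m z) = \<phi> m (i, z)))"
proof -
  note D = commaD [OF E]
  let ?p = "\<lambda>n z x. x \<in> cells X E n \<and> post K X E B e0 n x = b n z \<and> post K X E C e1 n x = c n z \<and>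
      (\<forall>m. \<forall>i\<in>Delta m 1. \<forall>\<alpha>\<in>Delta m n.
      cpt K X E A \<kappa> n m i \<alpha> x = \<phi> m (i, act Z n \<alpha> z))"
  have ex: "\<exists>x. ?p n z x" if z: "z \<in> simplices Z n" for n z
  proof -
    let ?\<phi> = "\<lambda>m (i, \<alpha>). \<phi> m (i, act Z n \<alpha> z)"
    have sm: "smap (sprod (std 1) (std n)) (Fun K X A) ?\<phi>"
    proof (rule simplicial_mapI)
      fix m' m \<beta> and x :: "_ \<times> nat list" assume b: "\<beta> \<in> Delta m' m" "x \<in> simplices (sprod (std 1) (std n)) m"
      then obtain u \<alpha> where x [simp]: "x = (u, \<alpha>)" and ua: "u \<in> Delta m 1" "\<alpha> \<in> Delta m n" by auto
      have "(u, act Z n \<alpha> z) \<in> simplices (sprod (std 1) Z) m" using z Z ua by (simp add: ss_in)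
      from smap_act [OF \<phi> b(1) this] show "?\<phi> m' (act (sprod (std 1) (std n)) m \<beta> x) =
          res K X A m \<beta> (?\<phi> m x)"
        using b z Z ua by (simp add: ss_comp)
    qed (use z Z smap_in [OF \<phi>] in \<open>auto simp: ss_in\<close>)
    have en: "?\<phi> m (const m 0, \<alpha>) = res K X A n \<alpha> (post K X B A f n (b n z)) \<and>
           ?\<phi> m (const m 1, \<alpha>) = res K X A n \<alpha> (post K X C A g n (c n z))"
      if "\<alpha> \<in> Delta m n" for m \<alpha>
      using that z Z obj fg smap_in [OF b z] smap_in [OF c z]
      by (simp add: ss_in ends act_post smap_act [OF b] smap_act [OF c] del: One_nat_def)
    have "\<exists>e\<in>simplices (Fun K X E) n. post K X E B e0 n e = b n z \<and> post K X E C e1 n e = c n z \<and>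
           (\<forall>m. \<forall>i\<in>Delta m 1. \<forall>\<alpha>\<in>Delta m n.
              cpt K X E A \<kappa> n m i \<alpha> e = ?\<phi> m (i, \<alpha>))"
      by (rule comma_ex [OF E obj(4) smap_in [OF b z] smap_in [OF c z] sm]) (use en in blast)+
    then show ?thesis by auto
  qed
  define \<theta> where "\<theta> n z = (SOME x. ?p n z x)" for n z
  have \<theta>: "?p n z (\<theta> n z)" if "z \<in> simplices Z n" for n z
    unfolding \<theta>_def by (rule someI_ex [OF ex [OF that]])
  show ?thesis
  proof (intro exI [of _ \<theta>] conjI allI ballI)
    show "smap Z (Fun K X E) \<theta>"
    proof (rule simplicial_mapI)
      fix m n \<alpha> z assume a: "\<alpha> \<in> Delta m n" "z \<in> simplices Z n"
      have z': "act Z n \<alpha> z \<in> simplices Z m" using a Z by (simp add: ss_in)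
      show "\<theta> m (act Z n \<alpha> z) = res K X E n \<alpha> (\<theta> n z)"
      proof (rule comma_unique [OF E obj(4)])
        fix k u \<beta> assume b: "u \<in> Delta k 1" "\<beta> \<in> Delta k m"
        then show "Cmp K X E A k (res K E A 1 u \<kappa>) (res K X E m \<beta> (\<theta> m (act Z n \<alpha> z))) =
            Cmp K X E A k (res K E A 1 u \<kappa>) (res K X E m \<beta> (res K X E n \<alpha> (\<theta> n z)))"
          using \<theta> [OF a(2)] \<theta> [OF z'] a D(1) obj Z by (simp add: ss_comp)
      qed (use \<theta> [OF z'] \<theta> [OF a(2)] a D obj in \<open>auto simp: act_cells smap_act [OF b] smap_act [OF c] simp flip: act_post\<close>)
    qed (use \<theta> in auto)
    fix m z assume a: "z \<in> simplices Z m"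
    show "post K X E B e0 m (\<theta> m z) = b m z" "post K X E C e1 m (\<theta> m z) = c m z"
      using \<theta> [OF a] by auto
    fix i assume i: "i \<in> Delta m 1"
    have "Cmp K X E A m (res K E A 1 i \<kappa>) (res K X E m [0..<Suc m] (\<theta> m z)) =
        \<phi> m (i, act Z m [0..<Suc m] z)"
      using \<theta> [OF a] i Delta_id by blast
    then show "Cmp K X E A m (res K E A 1 i \<kappa>) (\<theta> m z) = \<phi> m (i, z)"
      using \<theta> [OF a] ss_id [OF Z a] ss_id [OF fun_set, of X E "\<theta> m z" m] obj D(1)
      by (simp del: upt_Suc)
  qed
qed

lemma cotensor_component:
  assumes W: "is_cotensor K A (std 1) W \<epsilon>" and obj: "ob A" "ob E" "ob X"
    and a: "a \<in> functors K E W" and \<kappa>: "\<kappa> = pre K E W A a 1 (\<epsilon> 1 [0, 1])"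
    and i: "i \<in> Delta m 1" and \<alpha>: "\<alpha> \<in> Delta m n" and e: "e \<in> cells X E n"
  shows "cpt K X E A \<kappa> n m i \<alpha> e =
    Cmp K X W A m (\<epsilon> m i) (res K X W n \<alpha> (post K X E W a n e))"
proof -
  note D = cotensorD [OF W]
  have i0: "[0, 1] \<in> Delta 1 1" by (simp add: Delta_eval)
  then have \<epsilon>1: "\<epsilon> 1 [0, 1] \<in> cells W A 1" by (intro D(3)) simp
  have "[0, 1] \<odot> i = i"
    using reindex_id_left [OF i] by simp
  then have "res K W A 1 i (\<epsilon> 1 [0, 1]) = \<epsilon> m i"
    using smap_act [OF D(2) i, of "[0, 1]"] i0 by simp
  then have "res K E A 1 i \<kappa> = pre K E W A a m (\<epsilon> m i)"
    using act_pre [OF obj(2) D(1) obj(1) a \<epsilon>1 i] \<kappa> by simp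
  then show ?thesis
    using D(1) D(3) [of i m] obj a i \<alpha> e by (simp add: cmp_pre act_cells act_post)
qed

lemma std_dg: "dg (std k) n [v] = const n v"
  by (simp add: dg_def)

lemma cotensor_std_end:
  assumes W: "is_cotensor K A (std 1) W \<epsilon>" and obj: "ob A" "ob X" and v: "v \<le> 1"
  shows "post K X W A (\<epsilon> 0 [v]) n x = Cmp K X W A n (\<epsilon> n (const n v)) x"
  using cotensor_end [OF W _ obj, of "[v]"] v by (simp add: std_dg Delta_eval)

text \<open>The component of a simplex of the pullback is the transpose of its image in the arrow object, and the equation over the product
says that the ends of the component are the images of the two feet.\<close>

theorem comma_of_pullback:
  assumes W: "is_cotensor K A (std 1) W \<epsilon>" and AA: "is_bin_product K A A AA \<pi>1 \<pi>2"
    and CB: "is_bin_product K C B CB \<rho>1 \<rho>2" and obj: "ob A" "ob B" "ob C"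
    and fg: "f \<in> functors K B A" "g \<in> functors K C A"
    and pq: "pq \<in> functors K W AA" "fcomp K W AA A \<pi>1 pq = \<epsilon> 0 [1]" "fcomp K W AA A \<pi>2 pq = \<epsilon> 0 [0]"
    and gf: "gf \<in> functors K CB AA" "fcomp K CB AA A \<pi>1 gf = fcomp K CB C A g \<rho>1"
      "fcomp K CB AA A \<pi>2 gf = fcomp K CB B A f \<rho>2"
    and E: "is_pullback K W CB AA pq gf E a r"
  shows "is_comma K A B C f g E (fcomp K E CB B \<rho>2 r) (fcomp K E CB C \<rho>1 r) (pre K E W A a 1 (\<epsilon> 1 [0, 1]))"
proof -
  define \<kappa> where "\<kappa> = pre K E W A a 1 (\<epsilon> 1 [0, 1])"
  note DW = cotensorD [OF W] and DA = bin_productD [OF AA] and DC = bin_productD [OF CB]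
    and DE = pullbackD [OF E]
  note D = DW(1) DA DC DE(1-3) obj fg pq(1) gf(1)
  note comp = cotensor_component [OF W obj(1) DE(1) _ DE(2) \<kappa>_def]
  have v: "[v] \<in> Delta 0 1" "\<epsilon> 0 [v] \<in> cells W A 0" if "v \<le> 1" for v
    using that DW(3) [of "[v]" 0] by (simp_all add: Delta_eval)
  have \<epsilon>1: "\<epsilon> 1 [0, 1] \<in> cells W A 1" by (intro DW(3)) (simp add: Delta_eval)
  have pqX: "post K X AA A \<pi>1 n (post K X W AA pq n w) = post K X W A (\<epsilon> 0 [1]) n w"
    "post K X AA A \<pi>2 n (post K X W AA pq n w) = post K X W A (\<epsilon> 0 [0]) n w"
    if "ob X" "w \<in> cells X W n" for X n w
    using that D by (simp_all add: post_post pq)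
  have gfX: "post K X AA A \<pi>1 n (post K X CB AA gf n y) = post K X C A g n (post K X CB C \<rho>1 n y)"
    "post K X AA A \<pi>2 n (post K X CB AA gf n y) = post K X B A f n (post K X CB B \<rho>2 n y)"
    if "ob X" "y \<in> cells X CB n" for X n y
    using that D by (simp_all add: post_post gf)
  have eX: "post K X E B (fcomp K E CB B \<rho>2 r) n e = post K X CB B \<rho>2 n (post K X E CB r n e)"
    "post K X E C (fcomp K E CB C \<rho>1 r) n e = post K X CB C \<rho>1 n (post K X E CB r n e)"
    if "ob X" "e \<in> cells X E n" for X n e
    using that D by (simp_all add: post_post)
  have act0: "res K W A 1 [v] (\<epsilon> 1 [0, 1]) = \<epsilon> 0 [[0, 1] ! v]" if "v \<le> 1" for v
    using smap_act [OF DW(2) v(1) [OF that], of "[0, 1]"] by (simp add: Delta_eval)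
  have act1: "res K E A 1 [v] \<kappa> = fcomp K E W A (\<epsilon> 0 [[0, 1] ! v]) a" if "v \<le> 1" for v
    unfolding \<kappa>_def act_pre [OF DE(1) DW(1) obj(1) DE(2) \<epsilon>1 v(1) [OF that]] act0 [OF that]
    by (rule pre_0) (use that v D in \<open>cases v; simp\<close>)+
  have k0: "res K E A 1 [0] \<kappa> = fcomp K E B A f (fcomp K E CB B \<rho>2 r)"
    using act1 [of 0] D DE(4) by (simp add: pq(3) [symmetric] fcomp_assoc) (simp add: gf flip: fcomp_assoc)
  have k1: "res K E A 1 [1] \<kappa> = fcomp K E C A g (fcomp K E CB C \<rho>1 r)"
    using act1 [of 1] D DE(4) by (simp add: pq(2) [simplified, symmetric] fcomp_assoc) (simp add: gf flip: fcomp_assoc)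
  show ?thesis
    unfolding is_comma_def \<kappa>_def [symmetric]
  proof (intro conjI ballI allI impI)
    fix X n b c \<phi>
    assume X: "ob X" and b: "b \<in> cells X B n" and c: "c \<in> cells X C n"
      and \<phi>: "smap (sprod (std 1) (std n)) (Fun K X A) \<phi>"
      and ends: "\<forall>m. \<forall>\<alpha>\<in>Delta m n.
           \<phi> m (const m 0, \<alpha>) = res K X A n \<alpha> (post K X B A f n b) \<and>
           \<phi> m (const m 1, \<alpha>) = res K X A n \<alpha> (post K X C A g n c)"
    obtain w where w: "w \<in> cells X W n"
      "\<And>m u \<alpha>. u \<in> Delta m 1 ==> \<alpha> \<in> Delta m n ==> Cmp K X W A m (\<epsilon> m u) (res K X W n \<alpha> w) = \<phi> m (u, \<alpha>)"
      using cotensor_cell [OF W obj(1) X \<phi>] by auto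
    obtain y where y: "y \<in> cells X CB n" "post K X CB C \<rho>1 n y = c" "post K X CB B \<rho>2 n y = b"
      using bin_product_ex [OF CB X c b] by blast
    have wv: "post K X W A (\<epsilon> 0 [v]) n w = \<phi> n (const n v, [0..<Suc n])" if "v \<le> 1" for v
      using w(2) [of "const n v" n "[0..<Suc n]"] that X D w(1)
      by (simp add: cotensor_std_end [OF W obj(1) X] ss_id [OF fun_set] del: upt_Suc)
    have "post K X W AA pq n w = post K X CB AA gf n y"
    proof (rule bin_product_unique [OF AA X])
      show "post K X AA A \<pi>1 n (post K X W AA pq n w) = post K X AA A \<pi>1 n (post K X CB AA gf n y)"
        using ends X D y w(1) c by (simp add: pqX gfX wv ss_id [OF fun_set] del: upt_Suc One_nat_def)
      show "post K X AA A \<pi>2 n (post K X W AA pq n w) = post K X AA A \<pi>2 n (post K X CB AA gf n y)"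
        using ends X D y w(1) b by (simp add: pqX gfX wv ss_id [OF fun_set] del: upt_Suc One_nat_def)
    qed (use X D y w(1) in auto)
    then obtain e where e: "e \<in> cells X E n" "post K X E W a n e = w" "post K X E CB r n e = y"
      using pullback_ex [OF E X w(1) y(1)] by blast
    show "\<exists>e\<in>cells X E n. post K X E B (fcomp K E CB B \<rho>2 r) n e = b \<and>
        post K X E C (fcomp K E CB C \<rho>1 r) n e = c \<and>
        (\<forall>m. \<forall>i\<in>Delta m 1. \<forall>\<alpha>\<in>Delta m n.
           cpt K X E A \<kappa> n m i \<alpha> e = \<phi> m (i, \<alpha>))"
      by (rule bexI [of _ e]) (use e X y w(2) comp [OF X _ _ e(1)] in \<open>auto simp: eX\<close>)
  next
    fix X n e e'
    assume X: "ob X" and e: "e \<in> cells X E n" "e' \<in> cells X E n"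
      and eq: "post K X E B (fcomp K E CB B \<rho>2 r) n e = post K X E B (fcomp K E CB B \<rho>2 r) n e'"
        "post K X E C (fcomp K E CB C \<rho>1 r) n e = post K X E C (fcomp K E CB C \<rho>1 r) n e'"
        "\<forall>m. \<forall>i\<in>Delta m 1. \<forall>\<alpha>\<in>Delta m n.
              cpt K X E A \<kappa> n m i \<alpha> e =
              cpt K X E A \<kappa> n m i \<alpha> e'"
    show "e = e'"
    proof (rule pullback_unique [OF E X])
      show "post K X E W a n e = post K X E W a n e'"
        by (rule cotensor_unique [OF W obj(1) X]) (use eq(3) comp [OF X] e X D in auto)
      show "post K X E CB r n e = post K X E CB r n e'"
        by (rule bin_product_unique [OF CB X]) (use eq(1,2) e X D in \<open>auto simp: eX\<close>)
    qed (use D e in auto)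
  next
    show "\<kappa> \<in> cells E A 1" using \<epsilon>1 D unfolding \<kappa>_def by simp
  qed (use D k0 k1 in auto)
qed

end

section \<open>Chosen limits\<close>

context enriched
begin

text \<open>The objects selected by choice have their universal property as soon as one object has it.\<close>

lemma chosen_bin_product:
  "\<exists>P a b. is_bin_product K A B P a b ==> is_bin_product K A B (prod_ob K A B) (proj1 K A B) (proj2 K A B)"
  unfolding prod_ob_def proj1_def proj2_def prod_data_def
  using someI_ex [of "\<lambda>(P, a, b). is_bin_product K A B P a b"] by (simp add: case_prod_unfold)

lemma chosen_cotensor:
  "\<exists>P \<epsilon>. is_cotensor K A U P \<epsilon> ==> is_cotensor K A U (cotensor K A U) (cotensor_ev K A U)"
  unfolding cotensor_def cotensor_ev_def cotensor_data_def
  using someI_ex [of "\<lambda>(P, \<epsilon>). is_cotensor K A U P \<epsilon>"] by (simp add: case_prod_unfold)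

lemma pairing:
  assumes P: "is_bin_product K A B (prod_ob K A B) (proj1 K A B) (proj2 K A B)"
    and obj: "ob A" "ob B" "ob X" and fg: "f \<in> functors K X A" "g \<in> functors K X B"
  shows "pairing K X A B f g \<in> functors K X (prod_ob K A B)"
    "fcomp K X (prod_ob K A B) A (proj1 K A B) (pairing K X A B f g) = f"
    "fcomp K X (prod_ob K A B) B (proj2 K A B) (pairing K X A B f g) = g"
proof -
  note D = bin_productD [OF P]
  let ?p = "\<lambda>h. h \<in> functors K X (prod_ob K A B) \<and>
     fcomp K X (prod_ob K A B) A (proj1 K A B) h = f \<and> fcomp K X (prod_ob K A B) B (proj2 K A B) h = g"
  obtain h where h: "?p h"
    using bin_product_ex [OF P obj(3) fg] D obj by (auto simp: post_0)
  have "\<exists>!h. ?p h"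
  proof (rule ex1I [where P = ?p, OF h])
    fix h' assume "?p h'"
    then show "h' = h"
      using h D obj by (intro bin_product_unique [OF P obj(3) obj(1,2), of h' 0 h]) (auto simp: post_0)
  qed
  from theI' [OF this] show "pairing K X A B f g \<in> functors K X (prod_ob K A B)"
    "fcomp K X (prod_ob K A B) A (proj1 K A B) (pairing K X A B f g) = f"
    "fcomp K X (prod_ob K A B) B (proj2 K A B) (pairing K X A B f g) = g"
    unfolding pairing_def by blast+
qed

lemma prod_map:
  assumes P: "is_bin_product K C B (prod_ob K C B) (proj1 K C B) (proj2 K C B)"
    and P': "is_bin_product K C' B' (prod_ob K C' B') (proj1 K C' B') (proj2 K C' B')"
    and obj: "ob C" "ob B" "ob C'" "ob B'"
    and fg: "g \<in> functors K C C'" "f \<in> functors K B B'"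
  shows "prod_map K C C' B B' g f \<in> functors K (prod_ob K C B) (prod_ob K C' B')"
    "fcomp K (prod_ob K C B) (prod_ob K C' B') C' (proj1 K C' B') (prod_map K C C' B B' g f) =
      fcomp K (prod_ob K C B) C C' g (proj1 K C B)"
    "fcomp K (prod_ob K C B) (prod_ob K C' B') B' (proj2 K C' B') (prod_map K C C' B B' g f) =
      fcomp K (prod_ob K C B) B B' f (proj2 K C B)"
  unfolding prod_map_def using bin_productD [OF P] obj fg by (auto intro!: pairing [OF P'])

lemma chosen_comma_pullback:
  assumes "\<exists>P a r. is_pullback K (arr_ob K A) (prod_ob K C B) (prod_ob K A A)
     (pairing K (arr_ob K A) A A (arr_cod K A) (arr_dom K A)) (prod_map K C A B A g f) P a r"
  shows "is_pullback K (arr_ob K A) (prod_ob K C B) (prod_ob K A A)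
     (pairing K (arr_ob K A) A A (arr_cod K A) (arr_dom K A)) (prod_map K C A B A g f)
     (comma_ob K A B C f g) (comma_arr K A B C f g) (comma_proj K A B C f g)"
  unfolding comma_ob_def comma_arr_def comma_proj_def comma_data_def pullback_data_def
  using someI_ex [of "\<lambda>(P, a, b). is_pullback K (arr_ob K A) (prod_ob K C B) (prod_ob K A A)
     (pairing K (arr_ob K A) A A (arr_cod K A) (arr_dom K A)) (prod_map K C A B A g f) P a b"] assms
  by (simp add: case_prod_unfold)

definition comma_src where
  "comma_src A B C f g = fcomp K (comma_ob K A B C f g) (prod_ob K C B) B (proj2 K C B) (comma_proj K A B C f g)"

definition comma_tgt where
  "comma_tgt A B C f g = fcomp K (comma_ob K A B C f g) (prod_ob K C B) C (proj1 K C B) (comma_proj K A B C f g)"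

definition comma_edge where
  "comma_edge A B C f g = pre K (comma_ob K A B C f g) (arr_ob K A) A (comma_arr K A B C f g) 1 (cotensor_ev K A (std 1) 1 [0, 1])"

lemma arr_ends:
  assumes W: "is_cotensor K A (std 1) (arr_ob K A) (cotensor_ev K A (std 1))"
  shows "arr_dom K A \<in> functors K (arr_ob K A) A" "arr_cod K A \<in> functors K (arr_ob K A) A"
  unfolding arr_dom_def arr_cod_def using cotensorD(3) [OF W] by (simp_all add: Delta_eval)

lemma chosen_comma:
  assumes W: "is_cotensor K A (std 1) (arr_ob K A) (cotensor_ev K A (std 1))"
    and AA: "is_bin_product K A A (prod_ob K A A) (proj1 K A A) (proj2 K A A)"
    and CB: "is_bin_product K C B (prod_ob K C B) (proj1 K C B) (proj2 K C B)"
    and obj: "ob A" "ob B" "ob C" and fg: "f \<in> functors K B A" "g \<in> functors K C A"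
    and E: "is_pullback K (arr_ob K A) (prod_ob K C B) (prod_ob K A A)
     (pairing K (arr_ob K A) A A (arr_cod K A) (arr_dom K A)) (prod_map K C A B A g f)
     (comma_ob K A B C f g) (comma_arr K A B C f g) (comma_proj K A B C f g)"
  shows "is_comma K A B C f g (comma_ob K A B C f g) (comma_src A B C f g) (comma_tgt A B C f g) (comma_edge A B C f g)"
  unfolding comma_src_def comma_tgt_def comma_edge_def
  using pairing [OF AA obj(1,1) cotensorD(1) [OF W] arr_ends(2) [OF W] arr_ends(1) [OF W]]
    prod_map [OF CB AA obj(3,2,1,1) fg(2,1)]
  by (intro comma_of_pullback [OF W AA CB obj fg _ _ _ _ _ _ E]) (simp_all add: arr_cod_def arr_dom_def)

lemma cotensor_lift:
  assumes P: "is_cotensor K A U (cotensor K A U) (cotensor_ev K A U)" and obj: "ob A" "ob X"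
    and U: "simplicial_set U" and \<phi>: "smap U (Fun K X A) \<phi>"
  shows "cotensor_lift K A U X \<phi> \<in> functors K X (cotensor K A U)"
    "u \<in> simplices U m ==>
      pre K X (cotensor K A U) A (cotensor_lift K A U X \<phi>) m (cotensor_ev K A U m u) = \<phi> m u"
proof -
  let ?C = "cotensor K A U" and ?e = "cotensor_ev K A U"
  let ?p = "\<lambda>x. x \<in> functors K X ?C \<and> (\<forall>m. \<forall>u\<in>simplices U m. pre K X ?C A x m (?e m u) = \<phi> m u)"
  have iff: "(\<forall>u\<in>simplices U m. pre K X ?C A x m (?e m u) = \<phi> m u) \<longleftrightarrow>
      (\<forall>u\<in>simplices U m. \<forall>\<alpha>\<in>Delta m 0. Cmp K X ?C A m (?e m u) (act (Fun K X ?C) 0 \<alpha> x) = \<phi> m u)" for x m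
    by (auto simp add: Delta_0_0 pre_def dg_def)
  have "smap (sprod U (std 0)) (Fun K X A) (\<lambda>m (u, \<alpha>). \<phi> m u)"
    by (rule simplicial_mapI) (auto simp: smap_in [OF \<phi>] smap_act [OF \<phi>])
  then have "\<exists>!x. x \<in> functors K X ?C \<and> (\<forall>m. \<forall>u\<in>simplices U m. \<forall>\<alpha>\<in>Delta m 0.
      Cmp K X ?C A m (?e m u) (act (Fun K X ?C) 0 \<alpha> x) = (\<lambda>(u, \<alpha>). \<phi> m u) (u, \<alpha>))"
    using P obj unfolding is_cotensor_def by blast
  then have "\<exists>!x. ?p x" by (simp add: iff)
  from theI' [OF this]
  show "cotensor_lift K A U X \<phi> \<in> functors K X ?C"
    "u \<in> simplices U m ==> pre K X ?C A (cotensor_lift K A U X \<phi>) m (?e m u) = \<phi> m u"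
    unfolding cotensor_lift_def by blast+
qed

lemma cotensor_map:
  assumes P: "is_cotensor K A U (cotensor K A U) (cotensor_ev K A U)" and Q: "is_cotensor K B U (cotensor K B U) (cotensor_ev K B U)"
    and obj: "ob A" "ob B" and U: "simplicial_set U" and f: "f \<in> functors K A B"
  shows "cotensor_map K A B U f \<in> functors K (cotensor K A U) (cotensor K B U)"
    "u \<in> simplices U m ==> pre K (cotensor K A U) (cotensor K B U) B (cotensor_map K A B U f) m (cotensor_ev K B U m u) =
      post K (cotensor K A U) A B f m (cotensor_ev K A U m u)"
  unfolding cotensor_map_def
  using cotensor_lift [OF Q obj(2) cotensorD(1) [OF P] U smap_comp [OF cotensorD(2) [OF P] post_smap [OF cotensorD(1) [OF P] obj f]]]
  by simp_all

lemma cotensor_restrict: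
  assumes P: "is_cotensor K A U (cotensor K A U) (cotensor_ev K A U)" and Q: "is_cotensor K A V (cotensor K A V) (cotensor_ev K A V)"
    and A: "ob A" and U: "simplicial_set U" and i: "smap U V i"
  shows "cotensor_restrict K A U V i \<in> functors K (cotensor K A V) (cotensor K A U)"
    "u \<in> simplices U m ==> pre K (cotensor K A V) (cotensor K A U) A (cotensor_restrict K A U V i) m (cotensor_ev K A U m u) =
      cotensor_ev K A V m (i m u)"
  unfolding cotensor_restrict_def
  using cotensor_lift [OF P A cotensorD(1) [OF Q] U smap_comp [OF i cotensorD(2) [OF Q]]] by simp_all

lemma cotensor_functor:
  assumes P: "is_cotensor K A U P \<epsilon>" and obj: "ob A" "ob X"
    and \<phi>: "smap U (Fun K X A) \<phi>"
  shows "\<exists>x\<in>functors K X P. \<forall>m. \<forall>u\<in>simplices U m. pre K X P A x m (\<epsilon> m u) = \<phi> m u"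
proof -
  have "smap (sprod U (std 0)) (Fun K X A) (\<lambda>m (u, \<alpha>). \<phi> m u)"
    using smap_comp [OF fst_smap \<phi>] by (simp add: case_prod_unfold)
  then obtain x where x: "x \<in> functors K X P"
    "\<And>m u \<alpha>. u \<in> simplices U m ==> \<alpha> \<in> Delta m 0 ==> Cmp K X P A m (\<epsilon> m u) (res K X P 0 \<alpha> x) = \<phi> m u"
    using cotensor_cell [OF P obj] by fastforce
  have "pre K X P A x m (\<epsilon> m u) = \<phi> m u" if "u \<in> simplices U m" for m u
    using x(2) [OF that, of "const m 0"] by (simp add: pre_def dg_def)
  then show ?thesis using x(1) by blast
qed

lemma cotensor_functor_unique:
  assumes P: "is_cotensor K A U P \<epsilon>" and obj: "ob A" "ob X"
    and xy: "x \<in> functors K X P" "y \<in> functors K X P"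
    and eq: "\<And>m u. u \<in> simplices U m ==> pre K X P A x m (\<epsilon> m u) = pre K X P A y m (\<epsilon> m u)"
  shows "x = y"
proof (rule cotensor_unique [OF P obj xy])
  fix m u \<alpha> assume "u \<in> simplices U m" "\<alpha> \<in> Delta m 0"
  then show "Cmp K X P A m (\<epsilon> m u) (res K X P 0 \<alpha> x) = Cmp K X P A m (\<epsilon> m u) (res K X P 0 \<alpha> y)"
    using eq [of u m] Delta_0_0 [of \<alpha> m] by (simp add: pre_def dg_def)
qed

lemma cotensor_iso:
  assumes P: "is_cotensor K A U P \<epsilon>" and P': "is_cotensor K A U P' \<epsilon>'" and A: "ob A"
  shows "\<exists>j j'. j \<in> functors K P' P \<and> j' \<in> functors K P P' \<and> fcomp K P' P P' j' j = Idt K P' \<and> fcomp K P P' P j j' = Idt K P \<and>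
    (\<forall>m. \<forall>u\<in>simplices U m. pre K P' P A j m (\<epsilon> m u) = \<epsilon>' m u \<and> pre K P P' A j' m (\<epsilon>' m u) = \<epsilon> m u)"
proof -
  note D = cotensorD [OF P] and D' = cotensorD [OF P']
  obtain j where j: "j \<in> functors K P' P" "\<forall>m. \<forall>u\<in>simplices U m. pre K P' P A j m (\<epsilon> m u) = \<epsilon>' m u"
    using cotensor_functor [OF P A D'(1,2)] by blast
  obtain j' where j': "j' \<in> functors K P P'" "\<forall>m. \<forall>u\<in>simplices U m. pre K P P' A j' m (\<epsilon>' m u) = \<epsilon> m u"
    using cotensor_functor [OF P' A D(1,2)] by blast
  have "fcomp K P' P P' j' j = Idt K P'"
    by (rule cotensor_functor_unique [OF P' A D'(1)]) (use j j' A D D' in \<open>simp_all flip: pre_pre\<close>)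
  moreover have "fcomp K P P' P j j' = Idt K P"
    by (rule cotensor_functor_unique [OF P A D(1)]) (use j j' A D D' in \<open>simp_all flip: pre_pre\<close>)
  ultimately show ?thesis using j j' by blast
qed

text \<open>Chosen cotensors for different types of simplices are different objects, so squares have to be transported along isomorphisms.\<close>

lemma pullback_iso:
  assumes P: "is_pullback K E C B p f P a b" and obj: "ob E" "ob C" "ob B" "ob E'" "ob C'" "ob B'"
    and pf: "p \<in> functors K E B" "f \<in> functors K C B" "p' \<in> functors K E' B'" "f' \<in> functors K C' B'"
    and \<alpha>: "\<alpha> \<in> functors K E E'" "\<alpha>' \<in> functors K E' E" "fcomp K E E' E \<alpha>' \<alpha> = Idt K E" "fcomp K E' E E' \<alpha> \<alpha>' = Idt K E'"
    and \<gamma>: "\<gamma> \<in> functors K C C'" "\<gamma>' \<in> functors K C' C" "fcomp K C C' C \<gamma>' \<gamma> = Idt K C" "fcomp K C' C C' \<gamma> \<gamma>' = Idt K C'"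
    and \<beta>: "\<beta> \<in> functors K B B'" "\<beta>' \<in> functors K B' B" "fcomp K B B' B \<beta>' \<beta> = Idt K B"
    and sq: "fcomp K E E' B' p' \<alpha> = fcomp K E B B' \<beta> p" "fcomp K C C' B' f' \<gamma> = fcomp K C B B' \<beta> f"
  shows "is_pullback K E' C' B' p' f' P (fcomp K P E E' \<alpha> a) (fcomp K P C C' \<gamma> b)"
proof -
  note D = pullbackD [OF P] and DD = obj pf \<alpha>(1,2) \<gamma>(1,2) \<beta>(1,2)
  have "fcomp K P E' B' p' (fcomp K P E E' \<alpha> a) = fcomp K P C' B' f' (fcomp K P C C' \<gamma> b)"
    using D DD by (simp add: sq flip: fcomp_assoc) (simp add: fcomp_assoc D(4))
  moreover have "\<exists>!z. z \<in> cells X P n \<and> post K X P E' (fcomp K P E E' \<alpha> a) n z = x \<and> post K X P C' (fcomp K P C C' \<gamma> b) n z = y"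
    if X: "ob X" and x: "x \<in> cells X E' n" and y: "y \<in> cells X C' n"
      and xy: "post K X E' B' p' n x = post K X C' B' f' n y" for X n x y
  proof -
    define x0 where "x0 = post K X E' E \<alpha>' n x"
    define y0 where "y0 = post K X C' C \<gamma>' n y"
    have x0: "x0 \<in> cells X E n" "post K X E E' \<alpha> n x0 = x" and y0: "y0 \<in> cells X C n" "post K X C C' \<gamma> n y0 = y"
      using X x y DD \<alpha> \<gamma> by (simp_all add: x0_def y0_def post_post)
    have "post K X B B' \<beta> n (post K X E B p n x0) = post K X E' B' p' n x"
      using X DD x0 by (simp add: post_post flip: sq) (simp flip: post_post)
    also have "\<dots> = post K X B B' \<beta> n (post K X C B f n y0)"
      unfolding xy using X DD y0 by (simp add: post_post flip: sq) (simp flip: post_post)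
    finally have "post K X B' B \<beta>' n (post K X B B' \<beta> n (post K X E B p n x0)) =
        post K X B' B \<beta>' n (post K X B B' \<beta> n (post K X C B f n y0))" by simp
    then have "post K X E B p n x0 = post K X C B f n y0"
      using X DD x0 y0 by (simp add: post_post [of X B B' B] \<beta>(3))
    from pullback_ex [OF P X x0(1) y0(1) this]
    obtain z where z: "z \<in> cells X P n" "post K X P E a n z = x0" "post K X P C b n z = y0" by blast
    show ?thesis
    proof (rule ex1I [of _ z])
      show "z \<in> cells X P n \<and> post K X P E' (fcomp K P E E' \<alpha> a) n z = x \<and> post K X P C' (fcomp K P C C' \<gamma> b) n z = y"
        using X z D DD x0 y0 by (simp flip: post_post)
      fix z' assume z': "z' \<in> cells X P n \<and> post K X P E' (fcomp K P E E' \<alpha> a) n z' = x \<and> post K X P C' (fcomp K P C C' \<gamma> b) n z' = y"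
      then have z'': "z' \<in> cells X P n" "post K X E E' \<alpha> n (post K X P E a n z') = x"
        "post K X C C' \<gamma> n (post K X P C b n z') = y"
        using X D DD post_post [OF X D(1) obj(1,4) D(2) \<alpha>(1), of z' n] post_post [OF X D(1) obj(2,5) D(3) \<gamma>(1), of z' n]
        by auto
      then have "post K X E' E \<alpha>' n (post K X E E' \<alpha> n (post K X P E a n z')) = x0"
        "post K X C' C \<gamma>' n (post K X C C' \<gamma> n (post K X P C b n z')) = y0"
        by (simp_all add: x0_def y0_def)
      then have "post K X P E a n z' = x0" "post K X P C b n z' = y0"
        using X D DD z''(1) by (simp_all add: post_post [of X E E' E] post_post [of X C C' C] \<alpha>(3) \<gamma>(3))
      then show "z' = z"
        using z z''(1) by (intro pullback_unique [OF P X obj(1-3) pf(1,2) z''(1) z(1)]) simp_all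
    qed
  qed
  ultimately show ?thesis
    using D DD unfolding is_pullback_def by simp
qed

text \<open>In a slice, the map from the arrow object to the product is not known to be an isofibration, but each of the two projections is. For a comma with an
identity leg this suffices: the codomain of the arrow is free, so only the domain has to be pulled back.\<close>

lemma comma_of_domain_pullback:
  assumes W: "is_cotensor K A (std 1) W \<epsilon>" and W': "is_cotensor K A (std 1) (arr_ob K A) (cotensor_ev K A (std 1))"
    and AA: "is_bin_product K A A (prod_ob K A A) (proj1 K A A) (proj2 K A A)"
    and AB: "is_bin_product K A B (prod_ob K A B) (proj1 K A B) (proj2 K A B)"
    and obj: "ob A" "ob B" and f: "f \<in> functors K B A"
    and P: "is_pullback K W B A (\<epsilon> 0 [0]) f P a b"
  shows "is_pullback K (arr_ob K A) (prod_ob K A B) (prod_ob K A A)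
     (pairing K (arr_ob K A) A A (arr_cod K A) (arr_dom K A)) (prod_map K A A B A (Idt K A) f)
     (comma_ob K A B A f (Idt K A)) (comma_arr K A B A f (Idt K A)) (comma_proj K A B A f (Idt K A))"
proof -
  let ?W = "arr_ob K A" and ?AB = "prod_ob K A B" and ?AA = "prod_ob K A A"
  let ?q = "pairing K ?W A A (arr_cod K A) (arr_dom K A)" and ?n = "prod_map K A A B A (Idt K A) f"
  note DW = cotensorD [OF W] and DW' = cotensorD [OF W'] and DA = bin_productD [OF AA] and DB = bin_productD [OF AB]
  note dc = arr_ends [OF W'] and q = pairing [OF AA obj(1,1) DW'(1) arr_ends(2,1) [OF W']]
    and n = prod_map [OF AB AA obj(1,2,1,1) idt_in [OF obj(1)] f]
  have v: "[0] \<in> simplices (std 1) 0" by (simp add: Delta_eval)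
  obtain j k where j: "j \<in> functors K W ?W" "k \<in> functors K ?W W" "fcomp K W ?W W k j = Idt K W" "fcomp K ?W W ?W j k = Idt K ?W"
      "pre K W ?W A j 0 (cotensor_ev K A (std 1) 0 [0]) = \<epsilon> 0 [0]"
    using cotensor_iso [OF W' W obj(1)] v by blast
  have "fcomp K W ?W A (arr_dom K A) j = fcomp K W A A (Idt K A) (\<epsilon> 0 [0])"
    using j(1,5) DW(1) DW'(1) DW(3) [OF v] dc obj by (simp add: arr_dom_def pre_0)
  then have P': "is_pullback K ?W B A (arr_dom K A) f P (fcomp K P W ?W j a) (fcomp K P B B (Idt K B) b)"
    by (intro pullback_iso [OF P _ _ _ _ _ _ _ _ _ _ j(1-4) idt_in idt_in _ _ idt_in idt_in])
      (use DW(1) DW'(1) DW(3) [OF v] obj f dc in simp_all)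
  define w where "w = fcomp K P W ?W j a"
  define c where "c = fcomp K P B B (Idt K B) b"
  note P' = P' [folded w_def c_def]
  note D = pullbackD [OF P']
  have cw: "fcomp K P ?W A (arr_cod K A) w \<in> functors K P A" using D DW'(1) dc obj by simp
  let ?r = "pairing K P A B (fcomp K P ?W A (arr_cod K A) w) c"
  note r = pairing [OF AB obj D(1) cw D(3)]
  have "is_pullback K ?W ?AB ?AA ?q ?n P w ?r"
    unfolding is_pullback_def
  proof (intro conjI ballI allI impI)
    have "fcomp K P ?AA A (proj1 K A A) (fcomp K P ?W ?AA ?q w) = fcomp K P ?AA A (proj1 K A A) (fcomp K P ?AB ?AA ?n ?r)"
      "fcomp K P ?AA A (proj2 K A A) (fcomp K P ?W ?AA ?q w) = fcomp K P ?AA A (proj2 K A A) (fcomp K P ?AB ?AA ?n ?r)"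
    proof -
      have ass: "fcomp K P ?AA A p (fcomp K P Y ?AA h u) = fcomp K P Y A (fcomp K Y ?AA A p h) u"
        if "p \<in> functors K ?AA A" "h \<in> functors K Y ?AA" "u \<in> functors K P Y" "ob Y" for p h u Y
        by (rule fcomp_assoc [symmetric]) (use that D DA obj in simp_all)
      show "fcomp K P ?AA A (proj1 K A A) (fcomp K P ?W ?AA ?q w) = fcomp K P ?AA A (proj1 K A A) (fcomp K P ?AB ?AA ?n ?r)"
        unfolding ass [OF DA(2) q(1) D(2) DW'(1)] ass [OF DA(2) n(1) r(1) DB(1)] q(2) n(2) using DB obj r by simp
      have "fcomp K P ?AB A (fcomp K ?AB B A f (proj2 K A B)) ?r = fcomp K P B A f (fcomp K P ?AB B (proj2 K A B) ?r)"
        by (rule fcomp_assoc) (use D DB obj r f in simp_all)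
      then show "fcomp K P ?AA A (proj2 K A A) (fcomp K P ?W ?AA ?q w) = fcomp K P ?AA A (proj2 K A A) (fcomp K P ?AB ?AA ?n ?r)"
        unfolding ass [OF DA(3) q(1) D(2) DW'(1)] ass [OF DA(3) n(1) r(1) DB(1)] q(3) n(3) r(3) D(4) ..
    qed
    note e = this
    show "fcomp K P ?W ?AA ?q w = fcomp K P ?AB ?AA ?n ?r"
      by (rule bin_product_unique [OF AA D(1) obj(1,1), where n = 0]) (use e D(1-3) DW'(1) DA DB obj q(1) n(1) r(1) in \<open>simp_all add: post_0\<close>)
  next
    fix X m x y assume X: "ob X" and x: "x \<in> cells X ?W m" and y: "y \<in> cells X ?AB m"
      and xy: "post K X ?W ?AA ?q m x = post K X ?AB ?AA ?n m y"
    have c1: "post K X ?W A (arr_cod K A) m x = post K X ?AB A (proj1 K A B) m y"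
      and c2: "post K X ?W A (arr_dom K A) m x = post K X B A f m (post K X ?AB B (proj2 K A B) m y)"
      using arg_cong [OF xy, of "post K X ?AA A (proj1 K A A) m"] arg_cong [OF xy, of "post K X ?AA A (proj2 K A A) m"]
        X x y DW'(1) DA DB obj f q n by (simp_all add: post_post)
    obtain z where z: "z \<in> cells X P m" "post K X P ?W w m z = x" "post K X P B c m z = post K X ?AB B (proj2 K A B) m y"
      using pullback_ex [OF P' X x _ c2] X y DB obj by auto
    show "\<exists>!z. z \<in> cells X P m \<and> post K X P ?W w m z = x \<and> post K X P ?AB ?r m z = y"
    proof (rule ex1I [of _ z], intro conjI z(1,2))
      have "post K X P A (fcomp K P ?W A (arr_cod K A) w) m z = post K X ?W A (arr_cod K A) m (post K X P ?W w m z)"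
        using X z(1) D(1-3) DW'(1) dc obj by (simp add: post_post)
      note e = this
      show "post K X P ?AB ?r m z = y"
        by (rule bin_product_unique [OF AB X obj, where n = m]) (use e X z y D(1-3) DB obj r c1 in \<open>simp_all add: post_post\<close>)
      fix z' assume z': "z' \<in> cells X P m \<and> post K X P ?W w m z' = x \<and> post K X P ?AB ?r m z' = y"
      then have e: "post K X P B c m z' = post K X ?AB B (proj2 K A B) m y"
        using X D(1-3) DB obj r by (auto simp: post_post)
      show "z' = z"
        by (rule pullback_unique [OF P' X DW'(1) obj(2,1) dc(1) f, where n = m]) (use e z z' in simp_all)
    qed
  qed (use D(1-3) r(1) in simp_all)
  then show ?thesis by (intro chosen_comma_pullback exI)
qed

end

section \<open>Slices\<close>

lemma slice_simps [simp]:
  "Obj (slice K B) = {(E, p). E \<in> Obj K \<and> p \<in> Isofib K E B}"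
  "act (Fun (slice K B) X Y) = res K (fst X) (fst Y)"
  "Cmp (slice K B) X Y Z = Cmp K (fst X) (fst Y) (fst Z)"
  "Idt (slice K B) X = Idt K (fst X)"
  "Isofib (slice K B) X Y = {f \<in> Isofib K (fst X) (fst Y). fcomp K (fst X) (fst Y) B (snd Y) f = snd X}"
  by (simp_all add: slice_def case_prod_unfold)

lemma slice_simplices:
  "simplices (Fun (slice K B) X Y) n = {x \<in> simplices (Fun K (fst X) (fst Y)) n.
    post K (fst X) (fst Y) B (snd Y) n x = dg (Fun K (fst X) B) n (snd X)}"
  by (simp add: slice_def case_prod_unfold)

lemma slice_dg [simp]: "dg (Fun (slice K B) X Y) n x = dg (Fun K (fst X) (fst Y)) n x"
  by (simp add: dg_def)

lemma slice_post [simp]: "post (slice K B) X Y Z g n x = post K (fst X) (fst Y) (fst Z) g n x"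
  by (simp add: post_def)

lemma slice_pre [simp]: "pre (slice K B) X Y Z g n x = pre K (fst X) (fst Y) (fst Z) g n x"
  by (simp add: pre_def)

locale isofib_category = enriched K for K :: "('o, 's) cosmos" +
  assumes isofib_functor: "A \<in> Obj K ==> B \<in> Obj K ==> p \<in> Isofib K A B ==> p \<in> functors K A B"
begin

lemma slice_category:
  assumes B: "ob B"
  shows "simplicial_category (slice K B)"
proof -
  let ?S = "slice K B"
  have p: "p \<in> functors K E B" if "(E, p) \<in> Obj ?S" for E p
    using that B isofib_functor by auto
  have f0: "x \<in> cells (fst X) (fst Y) n" "post K (fst X) (fst Y) B (snd Y) n x = dg (Fun K (fst X) B) n (snd X)"
    if "x \<in> simplices (Fun ?S X Y) n" for X Y n x
    using that by (simp_all add: slice_simplices)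
  show ?thesis
    unfolding simplicial_category_def
  proof (intro conjI ballI allI)
    fix X Y assume X: "X \<in> Obj ?S" and Y: "Y \<in> Obj ?S"
    then show "simplicial_set (Fun ?S X Y)"
      using B p by (intro simplicial_setI) (auto simp: slice_simplices act_cells act_dg_cells ss_id [OF fun_set]
        ss_comp [OF fun_set] simp del: upt_Suc simp flip: act_post)
    fix n f assume f: "f \<in> simplices (Fun ?S X Y) n"
    show "post ?S X Y Y (Idt ?S Y) n f = f" "pre ?S X X Y (Idt ?S X) n f = f"
      using X Y f by (auto simp: slice_simplices)
  next
    fix X Y Z assume X: "X \<in> Obj ?S" and Y: "Y \<in> Obj ?S" and Z: "Z \<in> Obj ?S"
    show "smap (sprod (Fun ?S Y Z) (Fun ?S X Y)) (Fun ?S X Z) (\<lambda>n (g, f). Cmp ?S X Y Z n g f)"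
    proof (rule simplicial_mapI)
      fix n x assume "x \<in> simplices (sprod (Fun ?S Y Z) (Fun ?S X Y)) n"
      then obtain g f where [simp]: "x = (g, f)" and g: "g \<in> simplices (Fun ?S Y Z) n" and f: "f \<in> simplices (Fun ?S X Y) n"
        by auto
      have "post K (fst X) (fst Z) B (snd Z) n (Cmp K (fst X) (fst Y) (fst Z) n g f) =
          Cmp K (fst X) (fst Y) B n (post K (fst Y) (fst Z) B (snd Z) n g) f"
        using X Y Z B p f0(1) [OF f] f0(1) [OF g] by (auto simp: cmp_post)
      also have "\<dots> = post K (fst X) (fst Y) B (snd Y) n f"
        by (simp add: f0(2) [OF g] cmp_dg_left)
      finally show "(\<lambda>(g, f). Cmp ?S X Y Z n g f) x \<in> simplices (Fun ?S X Z) n"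
        using X Y Z B p f0 [OF f] f0(1) [OF g] by (auto simp: slice_simplices)
    qed (use X Y Z f0(1) in \<open>auto simp: act_cmp\<close>)
  next
    fix X assume X: "X \<in> Obj ?S"
    then show "Idt ?S X \<in> functors ?S X X"
      using B p by (auto simp: slice_simplices post_0 dg_0)
  next
    fix X Y Z V n f g h
    assume "X \<in> Obj ?S" "Y \<in> Obj ?S" "Z \<in> Obj ?S" "V \<in> Obj ?S" "f \<in> simplices (Fun ?S X Y) n"
      "g \<in> simplices (Fun ?S Y Z) n" "h \<in> simplices (Fun ?S Z V) n"
    then show "Cmp ?S X Y V n (Cmp ?S Y Z V n h g) f = Cmp ?S X Z V n h (Cmp ?S X Y Z n g f)"
      using f0(1) by (auto simp: cmp_assoc)
  qed
qed

lemma slice_isofib_category: "ob B ==> isofib_category (slice K B)"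
  by (intro isofib_category.intro enriched.intro slice_category isofib_category_axioms.intro)
    (auto simp: slice_simplices post_0 dg_0 isofib_functor)

lemma slice_functor: "ob B ==> X \<in> Obj (slice K B) ==> Y \<in> Obj (slice K B) ==>
    f \<in> functors (slice K B) X Y \<longleftrightarrow> f \<in> functors K (fst X) (fst Y) \<and> fcomp K (fst X) (fst Y) B (snd Y) f = snd X"
  using isofib_functor by (auto simp: slice_simplices post_0 dg_0)

text \<open>Products of a slice are pullbacks over the base.\<close>

lemma slice_bin_product:
  assumes B: "ob B" and X: "X \<in> Obj (slice K B)" and Y: "Y \<in> Obj (slice K B)"
    and P: "is_pullback K (fst X) (fst Y) B (snd X) (snd Y) P a b"
    and q: "q \<in> Isofib K P B" "q = fcomp K P (fst Y) B (snd Y) b"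
  shows "is_bin_product (slice K B) X Y (P, q) a b"
proof -
  have f: "fst X \<in> Obj K" "fst Y \<in> Obj K" "snd X \<in> functors K (fst X) B" "snd Y \<in> functors K (fst Y) B"
    using X Y B isofib_functor by auto
  note D = pullbackD [OF P]
  have PO: "(P, q) \<in> Obj (slice K B)" using D q by simp
  show ?thesis
    unfolding is_bin_product_def
  proof (intro conjI ballI allI)
    show "a \<in> functors (slice K B) (P, q) X" "b \<in> functors (slice K B) (P, q) Y"
      using slice_functor [OF B PO X, of a] slice_functor [OF B PO Y, of b] D q f by auto
  next
    fix Z n x y assume Z: "Z \<in> Obj (slice K B)" and x: "x \<in> simplices (Fun (slice K B) Z X) n"
      and y: "y \<in> simplices (Fun (slice K B) Z Y) n"
    have Z': "fst Z \<in> Obj K" using Z by auto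
    have xy: "x \<in> cells (fst Z) (fst X) n" "y \<in> cells (fst Z) (fst Y) n"
      "post K (fst Z) (fst X) B (snd X) n x = post K (fst Z) (fst Y) B (snd Y) n y"
      "post K (fst Z) (fst Y) B (snd Y) n y = dg (Fun K (fst Z) B) n (snd Z)"
      using x y by (simp_all add: slice_simplices)
    have "\<exists>!z. z \<in> cells (fst Z) P n \<and> post K (fst Z) P (fst X) a n z = x \<and> post K (fst Z) P (fst Y) b n z = y"
      using P Z' xy unfolding is_pullback_def by blast
    moreover have "post K (fst Z) P B q n z = dg (Fun K (fst Z) B) n (snd Z)"
      if "z \<in> cells (fst Z) P n" "post K (fst Z) P (fst Y) b n z = y" for z
      using that Z' f D B xy(4) unfolding q(2) by (simp flip: post_post)
    ultimately show "\<exists>!z. z \<in> simplices (Fun (slice K B) Z (P, q)) n \<and>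
        post (slice K B) Z (P, q) X a n z = x \<and> post (slice K B) Z (P, q) Y b n z = y"
      by (auto simp: slice_simplices)
  qed (rule PO)
qed

end

section \<open>Duality\<close>

text \<open>The dual of a simplicial set reverses the vertices of each simplex.\<close>

definition flip :: "nat \<Rightarrow> nat list \<Rightarrow> nat list" where
  "flip n \<alpha> = rev (map (\<lambda>i. n - i) \<alpha>)"

lemma simplices_sop [simp]: "simplices (sop X) = simplices X"
  by (simp add: sop_def)

lemma act_sop [simp]: "act (sop X) n \<alpha> = act X n (flip n \<alpha>)"
  by (simp add: sop_def flip_def)

lemma flip_nth: "\<alpha> \<in> Delta m n ==> l \<le> m ==> flip n \<alpha> ! l = n - \<alpha> ! (m - l)"
  by (simp add: flip_def rev_nth Delta_iff)

lemma flip_in [simp]: "\<alpha> \<in> Delta m n ==> flip n \<alpha> \<in> Delta m n"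
  unfolding Delta_iff [of "flip n \<alpha>"]
  by (auto simp: flip_nth) (auto simp: flip_def Delta_iff diff_le_mono2)

lemma flip_flip [simp]: "\<alpha> \<in> Delta m n ==> flip n (flip n \<alpha>) = \<alpha>"
  by (rule Delta_eqI [of _ m n _ n])
    (auto simp: flip_nth [of "flip n \<alpha>" m n] flip_nth [of \<alpha> m n] Delta_nth_le)

lemma flip_reindex:
  assumes "\<alpha> \<in> Delta m n" "\<beta> \<in> Delta k m"
  shows "flip n (\<alpha> \<odot> \<beta>) = flip n \<alpha> \<odot> flip m \<beta>"
proof (rule Delta_eqI [of _ k n _ n])
  fix l assume l: "l \<le> k"
  have "\<beta> ! (k - l) \<le> m" using assms by (simp add: Delta_nth_le)
  then show "flip n (\<alpha> \<odot> \<beta>) ! l = (flip n \<alpha> \<odot> flip m \<beta>) ! l"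
    using assms l by (simp add: flip_nth [OF Delta_reindex [OF assms(2,1)]] flip_nth [OF assms(2)]
      flip_nth [OF assms(1)] nth_reindex [OF assms(2)] nth_reindex [OF flip_in [OF assms(2)]])
qed (use assms in \<open>auto intro: Delta_reindex [of _ k m]\<close>)

lemma flip_const: "flip n (replicate k v) = replicate k (n - v)"
  by (simp add: flip_def)

lemma flip_id: "flip n [0..<Suc n] = [0..<Suc n]"
  by (rule Delta_eqI [of _ n n _ n]) (auto simp: flip_nth [OF Delta_id] simp del: upt_Suc)

lemma simplicial_set_sop [simp]: "simplicial_set X ==> simplicial_set (sop X)"
  by (rule simplicial_setI) (auto simp: ss_in ss_id ss_comp [OF _ flip_in flip_in] flip_id flip_reindex simp del: upt_Suc)

lemma sop_dg [simp]: "dg (sop X) n x = dg X n x"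
  by (simp add: dg_def flip_const)

lemma smap_sop: "smap X Y \<phi> ==> smap (sop X) (sop Y) \<phi>"
  by (rule simplicial_mapI) (auto simp: smap_in smap_act)

lemma smap_sop_left: "smap Z (sop Y) \<phi> ==> smap (sop Z) Y \<phi>"
  using smap_in [of Z "sop Y" \<phi>] smap_act [of Z "sop Y" \<phi>]
  by (intro simplicial_mapI) auto

lemma flip_smap: "smap (std n) (sop (std n)) (\<lambda>m. flip n)"
  by (rule simplicial_mapI) (auto simp: flip_reindex)

lemma quasi_category_sop:
  assumes X: "quasi_category X"
  shows "quasi_category (sop X)"
  unfolding quasi_category_def extends_along_def
proof (intro conjI allI impI)
  fix n k \<phi> assume nk: "0 < k" "k < n" and \<phi>: "smap (horn n k) (sop X) \<phi>"
  have h: "flip n u \<in> simplices (horn n (n - k)) m" if "u \<in> simplices (horn n k) m" "k \<le> n" for u m k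
  proof -
    from that(1) obtain i where i: "i \<le> n" "i \<noteq> k" "i \<notin> set u" and u: "u \<in> Delta m n"
      unfolding simplices_horn by blast
    have "n - i \<notin> set (flip n u)"
      using i u by (auto simp: flip_def Delta_def) (metis atMost_iff diff_diff_cancel subsetD)
    moreover have "n - i \<noteq> n - k" using i that(2) by arith
    ultimately show ?thesis
      unfolding simplices_horn using u by (intro CollectI conjI exI [of _ "n - i"]) auto
  qed
  have "smap (horn n (n - k)) (sop (horn n k)) (\<lambda>m. flip n)"
  proof (rule simplicial_mapI)
    fix m x assume "x \<in> simplices (horn n (n - k)) m"
    then show "flip n x \<in> simplices (sop (horn n k)) m" using h [of x "n - k" m] nk by simp
  qed (auto simp: flip_reindex)
  from smap_comp [OF this smap_sop_left [OF \<phi>]]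
  have "smap (horn n (n - k)) X (\<lambda>m u. \<phi> m (flip n u))" .
  moreover have "extends_along X (horn n (n - k)) (std n)"
    using X nk unfolding quasi_category_def by auto
  ultimately obtain \<psi> where \<psi>: "smap (std n) X \<psi>"
    "\<And>m u. u \<in> simplices (horn n (n - k)) m ==> \<psi> m u = \<phi> m (flip n u)"
    unfolding extends_along_def by (auto simp del: simplices_horn)
  show "\<exists>\<psi>. smap (std n) (sop X) \<psi> \<and> (\<forall>m. \<forall>u\<in>simplices (horn n k) m. \<psi> m u = \<phi> m u)"
  proof (rule exI, intro conjI allI ballI)
    show "smap (std n) (sop X) (\<lambda>m u. \<psi> m (flip n u))"
      by (rule smap_comp [OF flip_smap smap_sop [OF \<psi>(1)]])
    fix m u assume u: "u \<in> simplices (horn n k) m"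
    then show "\<psi> m (flip n u) = \<phi> m u"
      using \<psi>(2) [OF h [OF u]] nk by auto
  qed
qed (use X in \<open>simp add: quasi_category_def\<close>)

lemma co_dual_simps [simp]:
  "Obj (co_dual K) = Obj K" "Fun (co_dual K) A B = sop (Fun K A B)" "Cmp (co_dual K) = Cmp K"
  "Idt (co_dual K) = Idt K" "Isofib (co_dual K) = Isofib K"
  by (simp_all add: co_dual_def)

lemma co_dual_post [simp]: "post (co_dual K) = post K" "pre (co_dual K) = pre K"
  by (simp_all add: post_def pre_def fun_eq_iff)

lemma co_dual_slice: "co_dual (slice K B) = slice (co_dual K) B"
proof -
  have "post (K\<lparr>Fun := \<lambda>A B. sop (Fun K A B)\<rparr>) = post K" using co_dual_post [of K] by (simp add: co_dual_def)
  then show ?thesis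
    by (simp add: slice_def co_dual_def case_prod_unfold fun_eq_iff)
qed

lemma co_dual_bin_product:
  assumes "is_bin_product K A B P a b"
  shows "is_bin_product (co_dual K) B A P b a"
  unfolding is_bin_product_def co_dual_simps co_dual_post simplices_sop
proof (intro conjI ballI allI)
  fix X n x y assume "X \<in> Obj K" "x \<in> simplices (Fun K X B) n" "y \<in> simplices (Fun K X A) n"
  then have "\<exists>!z. z \<in> simplices (Fun K X P) n \<and> post K X P A a n z = y \<and> post K X P B b n z = x"
    using assms unfolding is_bin_product_def by blast
  then show "\<exists>!z. z \<in> simplices (Fun K X P) n \<and> post K X P B b n z = x \<and> post K X P A a n z = y"
    by (simp only: conj_ac)
qed (use assms in \<open>auto simp: is_bin_product_def\<close>)

lemma co_dual_pullback: "is_pullback (co_dual K) = is_pullback K"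
  unfolding is_pullback_def co_dual_simps co_dual_post simplices_sop by (simp add: fun_eq_iff)

lemma co_dual_category:
  assumes "simplicial_category K"
  shows "simplicial_category (co_dual K)"
proof -
  interpret enriched K by (rule enriched.intro [OF assms])
  have "smap (sprod (sop (Fun K B C)) (sop (Fun K A B))) (sop (Fun K A C)) (\<lambda>n (g, f). Cmp K A B C n g f)"
    if "A \<in> Obj K" "B \<in> Obj K" "C \<in> Obj K" for A B C
    by (rule simplicial_mapI) (use that in \<open>auto simp: act_cmp [OF _ _ _ flip_in]\<close>)
  moreover have "Cmp K A B D n (Cmp K B C D n h g) f = Cmp K A C D n h (Cmp K A B C n g f)"
    if "A \<in> Obj K" "B \<in> Obj K" "C \<in> Obj K" "D \<in> Obj K" "f \<in> cells A B n" "g \<in> cells B C n" "h \<in> cells C D n"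
    for A B C D n f g h by (rule cmp_assoc [OF that])
  ultimately show ?thesis
    unfolding simplicial_category_def co_dual_simps co_dual_post simplices_sop by simp
qed

lemma flip_prod_smap:
  assumes "smap (sprod (std a) (std b)) (sop Y) \<phi>"
  shows "smap (sprod (std a) (std b)) Y (\<lambda>m (u, \<alpha>). \<phi> m (flip a u, flip b \<alpha>))"
proof -
  have "smap (sprod (std a) (std b)) (sop (sprod (std a) (std b))) (\<lambda>m (u, \<alpha>). (flip a u, flip b \<alpha>))"
    by (rule simplicial_mapI) (auto simp: flip_reindex)
  from smap_comp [OF this smap_sop_left [OF assms]] show ?thesis
    by (simp add: case_prod_unfold)
qed

text \<open>The 1-simplex is isomorphic to its dual by exchanging its vertices, so arrow objects are preserved with domain and codomain exchanged.\<close>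

lemma co_dual_cotensor:
  assumes K: "simplicial_category K" and A: "A \<in> Obj K" and W: "is_cotensor K A (std 1) W \<epsilon>"
  shows "is_cotensor (co_dual K) A (std 1) W (\<lambda>m u. \<epsilon> m (flip 1 u))"
proof -
  interpret enriched K by (rule enriched.intro [OF K])
  note D = cotensorD [OF W]
  show ?thesis
    unfolding is_cotensor_def co_dual_simps
  proof (intro conjI ballI allI impI)
    show "smap (std 1) (sop (Fun K W A)) (\<lambda>m u. \<epsilon> m (flip 1 u))"
      by (rule smap_comp [OF flip_smap smap_sop [OF D(2)]])
  next
    fix X n \<phi> assume X: "X \<in> Obj K" and \<phi>: "smap (sprod (std 1) (std n)) (sop (Fun K X A)) \<phi>"
    have "\<exists>!x. x \<in> cells X W n \<and> (\<forall>m. \<forall>u\<in>Delta m 1. \<forall>\<alpha>\<in>Delta m n.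
        Cmp K X W A m (\<epsilon> m u) (res K X W n \<alpha> x) = (\<lambda>(u, \<alpha>). \<phi> m (flip 1 u, flip n \<alpha>)) (u, \<alpha>))"
      using W X flip_prod_smap [OF \<phi>] unfolding is_cotensor_def simplices_std by blast
    moreover have "(\<forall>u\<in>Delta m 1. \<forall>\<alpha>\<in>Delta m n.
        Cmp K X W A m (\<epsilon> m u) (res K X W n \<alpha> x) = (\<lambda>(u, \<alpha>). \<phi> m (flip 1 u, flip n \<alpha>)) (u, \<alpha>)) \<longleftrightarrow>
      (\<forall>u\<in>Delta m 1. \<forall>\<alpha>\<in>Delta m n.
        Cmp K X W A m (\<epsilon> m (flip 1 u)) (act (sop (Fun K X W)) n \<alpha> x) = \<phi> m (u, \<alpha>))" for m x
      by (auto dest: bspec [OF _ flip_in]) (metis flip_flip flip_in)+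
    ultimately show "\<exists>!x. x \<in> simplices (sop (Fun K X W)) n \<and> (\<forall>m. \<forall>u\<in>simplices (std 1) m. \<forall>\<alpha>\<in>Delta m n.
        Cmp K X W A m (\<epsilon> m (flip 1 u)) (act (sop (Fun K X W)) n \<alpha> x) = \<phi> m (u, \<alpha>))"
      by simp
  qed (rule D)
qed

lemma co_dual_comma:
  assumes K: "simplicial_category K" and obj: "A \<in> Obj K" "B \<in> Obj K" "C \<in> Obj K"
    and fg: "f \<in> functors K B A" "g \<in> functors K C A" and E: "is_comma K A B C f g E e0 e1 \<kappa>"
  shows "is_comma (co_dual K) A C B g f E e1 e0 \<kappa>"
proof -
  interpret enriched K by (rule enriched.intro [OF K])
  note D = commaD [OF E]
  show ?thesis
    unfolding is_comma_def co_dual_simps co_dual_post simplices_sop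
  proof (intro conjI ballI allI impI)
    show "act (sop (Fun K E A)) 1 [0] \<kappa> = fcomp K E C A g e1" "act (sop (Fun K E A)) 1 [1] \<kappa> = fcomp K E B A f e0"
      using D by (simp_all add: flip_def)
  next
    fix X n c b \<phi>
    assume X: "X \<in> Obj K" and c: "c \<in> cells X C n" and b: "b \<in> cells X B n"
      and \<phi>: "smap (sprod (std 1) (std n)) (sop (Fun K X A)) \<phi>"
      and ends: "\<forall>m. \<forall>\<alpha>\<in>Delta m n.
           \<phi> m (const m 0, \<alpha>) = act (sop (Fun K X A)) n \<alpha> (post K X C A g n c) \<and>
           \<phi> m (const m 1, \<alpha>) = act (sop (Fun K X A)) n \<alpha> (post K X B A f n b)"
    have "\<exists>e\<in>cells X E n. post K X E B e0 n e = b \<and> post K X E C e1 n e = c \<and>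
        (\<forall>m. \<forall>i\<in>Delta m 1. \<forall>\<alpha>\<in>Delta m n. cpt K X E A \<kappa> n m i \<alpha> e =
          (\<lambda>(u, \<alpha>). \<phi> m (flip 1 u, flip n \<alpha>)) (i, \<alpha>))"
    proof (rule comma_ex [OF E X b c flip_prod_smap [OF \<phi>]])
      fix m \<alpha> assume \<alpha>: "\<alpha> \<in> Delta m n"
      from ends [rule_format, OF flip_in [OF \<alpha>]] \<alpha>
      show "(\<lambda>(u, \<alpha>). \<phi> m (flip 1 u, flip n \<alpha>)) (const m 0, \<alpha>) = res K X A n \<alpha> (post K X B A f n b)"
        "(\<lambda>(u, \<alpha>). \<phi> m (flip 1 u, flip n \<alpha>)) (const m 1, \<alpha>) = res K X A n \<alpha> (post K X C A g n c)"
        by (simp_all add: flip_const)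
    qed
    then obtain e where e: "e \<in> cells X E n" "post K X E B e0 n e = b" "post K X E C e1 n e = c"
      "\<And>m i \<alpha>. i \<in> Delta m 1 ==> \<alpha> \<in> Delta m n ==>
        cpt K X E A \<kappa> n m i \<alpha> e = \<phi> m (flip 1 i, flip n \<alpha>)"
      by auto
    show "\<exists>e\<in>cells X E n. post K X E C e1 n e = c \<and> post K X E B e0 n e = b \<and>
        (\<forall>m. \<forall>i\<in>Delta m 1. \<forall>\<alpha>\<in>Delta m n.
          Cmp K X E A m (act (sop (Fun K E A)) 1 i \<kappa>) (act (sop (Fun K X E)) n \<alpha> e) = \<phi> m (i, \<alpha>))"
      by (rule bexI [of _ e]) (use e in \<open>auto simp: e(4) [OF flip_in flip_in]\<close>)
  next
    fix X n e e'
    assume X: "X \<in> Obj K" and e: "e \<in> cells X E n" "e' \<in> cells X E n"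
      "post K X E C e1 n e = post K X E C e1 n e'" "post K X E B e0 n e = post K X E B e0 n e'"
      and eq: "\<forall>m. \<forall>i\<in>Delta m 1. \<forall>\<alpha>\<in>Delta m n.
        Cmp K X E A m (act (sop (Fun K E A)) 1 i \<kappa>) (act (sop (Fun K X E)) n \<alpha> e) =
        Cmp K X E A m (act (sop (Fun K E A)) 1 i \<kappa>) (act (sop (Fun K X E)) n \<alpha> e')"
    show "e = e'"
    proof (rule comma_unique [OF E X e(1,2,4,3)])
      fix m i \<alpha> assume "i \<in> Delta m 1" "\<alpha> \<in> Delta m n"
      with eq [rule_format, OF flip_in flip_in, of i m \<alpha>]
      show "cpt K X E A \<kappa> n m i \<alpha> e =
        cpt K X E A \<kappa> n m i \<alpha> e'" by simp
    qed
  qed (use D in simp_all)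
qed

section \<open>Cocartesian fibrations from liftings\<close>

text \<open>The square \<open>\<theta>\<close>, with coordinates j and t, leads from the edge \<open>\<chi>\<close> at t = 0 to the edge \<open>\<omega>\<close> at t = 1. It is constant on the source x and
lies over the base edge of \<open>\<omega>\<close>. The last clause is what the triangle identity needs: wherever \<open>\<omega>\<close> and \<open>\<chi>\<close> become equal, the square becomes
homotopic to the constant square on \<open>\<omega>\<close>.\<close>

definition comparison_square ::
    "('o, 's, 'z) scat_scheme \<Rightarrow> 'o \<Rightarrow> 'o \<Rightarrow> 's \<Rightarrow> 'o \<Rightarrow> 's \<Rightarrow> 's \<Rightarrow> 's \<Rightarrow> (nat \<Rightarrow> nat list \<times> nat list \<Rightarrow> 's) \<Rightarrow> bool" where
  "comparison_square K E B p Y x \<chi> \<omega> \<theta> \<longleftrightarrow> smap (sprod (std 1) (std 1)) (Fun K Y E) \<theta> \<and>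
     (\<forall>m. \<forall>j\<in>Delta m 1. \<forall>t\<in>Delta m 1.
        \<theta> m (j, const m 0) = res K Y E 1 j \<chi> \<and> \<theta> m (j, const m 1) = res K Y E 1 j \<omega> \<and>
        \<theta> m (const m 0, t) = dg (Fun K Y E) m x \<and>
        post K Y E B p m (\<theta> m (j, t)) = res K Y B 1 j (post K Y E B p 1 \<omega>)) \<and>
     (\<forall>Z\<in>Obj K. \<forall>l\<in>functors K Z Y. pre K Z Y E l 1 \<omega> = pre K Z Y E l 1 \<chi> \<longrightarrow>
        (\<exists>\<xi>. smap (sprod (std 1) (std 2)) (Fun K Z E) \<xi> \<and>
           (\<forall>m. \<forall>j\<in>Delta m 1. \<forall>t\<in>Delta m 1.
              \<xi> m (j, [0, 1] \<odot> t) = pre K Z Y E l m (\<theta> m (j, t)) \<and>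
              \<xi> m (j, [0, 2] \<odot> t) = res K Z E 1 j (pre K Z Y E l 1 \<omega>) \<and>
              \<xi> m (j, [1, 2] \<odot> t) = res K Z E 1 j (pre K Z Y E l 1 \<omega>))))"

text \<open>A weak, element-wise form of a cocartesian fibration: every edge of B has a lift \<open>\<chi>\<close> with given source that compares to any other lift. The lift is
chosen once for the functor e, and the comparison may be made after any change of stage h.\<close>

definition cocartesian_lifting :: "('o, 's, 'z) scat_scheme \<Rightarrow> 'o \<Rightarrow> 'o \<Rightarrow> 's \<Rightarrow> bool" where
  "cocartesian_lifting K E B p \<longleftrightarrow>
     (\<forall>X\<in>Obj K. \<forall>e\<in>functors K X E. \<forall>u\<in>simplices (Fun K X B) 1.
        res K X B 1 [0] u = fcomp K X E B p e \<longrightarrow>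
        (\<exists>\<chi>\<in>simplices (Fun K X E) 1. res K X E 1 [0] \<chi> = e \<and> post K X E B p 1 \<chi> = u \<and>
           (\<forall>Y\<in>Obj K. \<forall>h\<in>functors K Y X. \<forall>\<omega>\<in>simplices (Fun K Y E) 1.
              res K Y E 1 [0] \<omega> = fcomp K Y X E e h \<longrightarrow> post K Y E B p 1 \<omega> = pre K Y X B h 1 u \<longrightarrow>
              (\<exists>\<theta>. comparison_square K E B p Y (fcomp K Y X E e h) (pre K Y X E h 1 \<chi>) \<omega> \<theta>))))"

context isofib_category
begin

lemma std_1_id: "[0, 1] \<odot> i = i" if "i \<in> Delta m 1"
  using reindex_id_left [OF that] by simp

lemma cotensor_std_act:
  assumes W: "is_cotensor K A (std 1) W \<epsilon>" and i: "i \<in> Delta m 1"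
  shows "\<epsilon> m i = res K W A 1 i (\<epsilon> 1 [0, 1])"
  using smap_act [OF cotensorD(2) [OF W] i, of "[0, 1]"] std_1_id [OF i]
  by (simp add: Delta_eval)

text \<open>The lifting property is applied to the universal edge over the comma P of p, which gives a functor l from P to the arrow object W of E with k l equal to the
identity. Its comparison with the universal edge of W is the counit. The unit is an identity. The counit is constant after k, and after l it is
homotopic to a constant edge by the last clause of the comparison.\<close>

lemma cocartesian_fibrationI:
  assumes obj: "ob E" "ob B" and p: "p \<in> Isofib K E B"
    and qc: "\<And>X Y. ob X ==> ob Y ==> quasi_category (Fun K X Y)"
    and WB: "is_cotensor K B (std 1) (arr_ob K B) (cotensor_ev K B (std 1))"
    and WE: "is_cotensor K E (std 1) (arr_ob K E) (cotensor_ev K E (std 1))"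
    and BB: "is_bin_product K B B (prod_ob K B B) (proj1 K B B) (proj2 K B B)"
    and BE: "is_bin_product K B E (prod_ob K B E) (proj1 K B E) (proj2 K B E)"
    and pb: "is_pullback K (arr_ob K B) (prod_ob K B E) (prod_ob K B B)
     (pairing K (arr_ob K B) B B (arr_cod K B) (arr_dom K B)) (prod_map K B B E B (Idt K B) p)
     (comma_ob K B E B p (Idt K B)) (comma_arr K B E B p (Idt K B)) (comma_proj K B E B p (Idt K B))"
    and lift: "cocartesian_lifting K E B p"
  shows "cocartesian_fibration K E B p"
proof -
  define W where "W = arr_ob K E"
  define P where "P = comma_ob K B E B p (Idt K B)"
  define eP where "eP = comma_src B E B p (Idt K B)"
  define cP where "cP = comma_tgt B E B p (Idt K B)"
  define uP where "uP = comma_edge B E B p (Idt K B)"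
  define ev where "ev = cotensor_ev K E (std 1)"
  define \<omega> where "\<omega> = ev 1 [0, 1]"
  have pf: "p \<in> functors K E B" "Idt K B \<in> functors K B B" using p obj isofib_functor by auto
  note pb = pb [folded P_def]
  have P: "is_comma K B E B p (Idt K B) P eP cP uP"
    unfolding P_def eP_def cP_def uP_def
    by (rule chosen_comma [OF WB BB BE obj(2,1,2) pf pb [unfolded P_def]])
  have W: "is_cotensor K E (std 1) W ev" using WE unfolding W_def ev_def .
  note DP = commaD [OF P] and DW = cotensorD [OF W] and Dpb = pullbackD [OF pb]
  have WO: "ob W" and PO: "ob P" using DP DW by auto
  have i01: "[0, 1] \<in> Delta 1 1" "[0] \<in> Delta 0 1" "[1] \<in> Delta 0 1" by (simp_all add: Delta_eval)
  have \<omega>: "\<omega> \<in> cells W E 1" unfolding \<omega>_def using i01 by (intro DW(3)) simp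
  have ev: "ev m i = res K W E 1 i \<omega>" if "i \<in> Delta m 1" for m i
    unfolding \<omega>_def by (rule cotensor_std_act [OF W that])
  have dom: "arr_dom K E = res K W E 1 [0] \<omega>" and cod: "arr_cod K E = res K W E 1 [1] \<omega>"
    unfolding arr_dom_def arr_cod_def ev_def [symmetric] using ev [OF i01(2)] ev [OF i01(3)] by auto
  define dom where "dom = arr_dom K E"
  define cod where "cod = arr_cod K E"
  have dc: "dom \<in> functors K W E" "cod \<in> functors K W E"
    unfolding dom_def cod_def dom cod using act_cells [OF WO obj(1) \<omega>] i01 by auto
  have ends: "ev m (const m 0) = dg (Fun K W E) m dom" "ev m (const m 1) = dg (Fun K W E) m cod" for m
    unfolding dom_def cod_def dom cod using act_const [OF fun_set [OF WO obj(1)] \<omega>, of 0 m]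
      act_const [OF fun_set [OF WO obj(1)] \<omega>, of 1 m] by (simp_all add: ev del: One_nat_def)
  (* the functor k from W to P, which sends an arrow to its domain and its image in B *)
  have p\<omega>: "post K W E B p 1 \<omega> \<in> cells W B 1" using \<omega> WO obj pf by simp
  have p\<omega>_act: "res K W B 1 i (post K W E B p 1 \<omega>) = post K W E B p m (ev m i)" if "i \<in> Delta m 1" for m i
    using act_post [OF WO obj pf(1) \<omega> that] ev [OF that] by simp
  let ?\<phi> = "\<lambda>m (i, \<alpha>). res K W B 1 i (post K W E B p 1 \<omega>)"
  have "\<exists>e\<in>cells W P 0. post K W P E eP 0 e = dom \<and> post K W P B cP 0 e = fcomp K W E B p cod \<and>
    (\<forall>m. \<forall>i\<in>Delta m 1. \<forall>\<alpha>\<in>Delta m 0.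
      Cmp K W P B m (res K P B 1 i uP) (res K W P 0 \<alpha> e) = ?\<phi> m (i, \<alpha>))"
  proof (rule comma_ex [OF P WO dc(1)])
    show "smap (sprod (std 1) (std 0)) (Fun K W B) ?\<phi>"
      by (rule simplicial_mapI) (use p\<omega> WO obj in \<open>auto simp: act_cells ss_comp [OF fun_set]\<close>)
    fix m \<alpha> assume "\<alpha> \<in> Delta m 0"
    then have \<alpha>: "\<alpha> = const m 0" using Delta_0_0 by blast
    show "?\<phi> m (const m 0, \<alpha>) = res K W B 0 \<alpha> (post K W E B p 0 dom)"
      "?\<phi> m (const m 1, \<alpha>) = res K W B 0 \<alpha> (post K W B B (Idt K B) 0 (fcomp K W E B p cod))"
      unfolding \<alpha> using WO obj pf dc ends [of m]
      by (simp_all add: p\<omega>_act [of _ m] post_dg post_0 flip: dg_def del: One_nat_def)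
  qed (use WO obj pf dc in simp)
  then obtain k where k: "k \<in> functors K W P" "post K W P E eP 0 k = dom" "post K W P B cP 0 k = fcomp K W E B p cod"
    "\<And>m i \<alpha>. i \<in> Delta m 1 ==> \<alpha> \<in> Delta m 0 ==>
      Cmp K W P B m (res K P B 1 i uP) (res K W P 0 \<alpha> k) = res K W B 1 i (post K W E B p 1 \<omega>)"
    by auto
  have ku: "pre K W P B k m (res K P B 1 i uP) = res K W B 1 i (post K W E B p 1 \<omega>)" if "i \<in> Delta m 1" for i m
    using k(4) [OF that, of "const m 0"] unfolding pre_def dg_def by simp
  have eu: "fcomp K W P E eP k = dom" "fcomp K W P B cP k = fcomp K W E B p cod" "pre K W P B k 1 uP = post K W E B p 1 \<omega>"
    using k(2,3) ku [OF i01(1)] WO PO obj DP k(1) p\<omega> ss_id [OF fun_set DP(4)] ss_id [OF fun_set p\<omega>]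
    by (simp_all add: post_0)
  note act0 = Delta_0_0 [THEN iffD1]
  have post0: "Cmp K X Y E' m x (res K X Y 0 \<alpha> f) = pre K X Y E' f m x" if "\<alpha> \<in> Delta m 0" for X Y E' m x \<alpha> f
    unfolding act0 [OF that] pre_def dg_def ..
  define ca where "ca = comma_arr K B E B p (Idt K B)"
  have ca: "ca \<in> functors K P (arr_ob K B)" using Dpb(2) by (simp add: ca_def)
  note DWB = cotensorD [OF WB]
  have k_arr: "fcomp K W P (arr_ob K B) ca k = cotensor_map K E B (std 1) p"
  proof (rule cotensor_unique [OF WB obj(2) WO])
    have cm: "smap (std 1) (Fun K W B) (\<lambda>m u. post K W E B p m (cotensor_ev K E (std 1) m u))"
      using smap_comp [OF DW(2) post_smap [OF WO obj pf(1)]] by (simp add: ev_def)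
    note cl = cotensor_lift [OF WB obj(2) WO simplicial_set_std cm, folded W_def cotensor_map_def]
    have cm_def: "cotensor_map K E B (std 1) p = cotensor_lift K B (std 1) W
        (\<lambda>m u. post K W E B p m (cotensor_ev K E (std 1) m u))"
      by (simp add: cotensor_map_def W_def)
    show "cotensor_map K E B (std 1) p \<in> functors K W (arr_ob K B)"
      unfolding cm_def by (rule cl)
    fix m u \<alpha> assume u: "u \<in> simplices (std 1) m" and \<alpha>: "\<alpha> \<in> Delta m 0"
    then have u': "u \<in> Delta m 1" by simp
    have "Cmp K W (arr_ob K B) B m (cotensor_ev K B (std 1) m u)
        (act (Fun K W (arr_ob K B)) 0 \<alpha> (fcomp K W P (arr_ob K B) ca k)) =
        Cmp K W P B m (res K P B 1 u uP) (res K W P 0 \<alpha> k)"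
      using cotensor_component [OF WB obj(2) PO WO ca _ u' \<alpha> k(1), of uP] WO PO k(1) ca DWB(1)
      by (simp add: uP_def comma_edge_def ca_def P_def post_0)
    also have "\<dots> = post K W E B p m (ev m u)"
      using k(4) [OF u' \<alpha>] p\<omega>_act [OF u'] by simp
    also have "\<dots> = Cmp K W (arr_ob K B) B m (cotensor_ev K B (std 1) m u)
        (act (Fun K W (arr_ob K B)) 0 \<alpha> (cotensor_map K E B (std 1) p))"
      using cl(2) [OF u] unfolding post0 [OF \<alpha>] cm_def ev_def by simp
    finally show "Cmp K W (arr_ob K B) B m (cotensor_ev K B (std 1) m u)
        (act (Fun K W (arr_ob K B)) 0 \<alpha> (fcomp K W P (arr_ob K B) ca k)) =
      Cmp K W (arr_ob K B) B m (cotensor_ev K B (std 1) m u)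
        (act (Fun K W (arr_ob K B)) 0 \<alpha> (cotensor_map K E B (std 1) p))" .
  qed (use WO PO k(1) ca DWB(1) in simp)
  define cp where "cp = comma_proj K B E B p (Idt K B)"
  have cp: "cp \<in> functors K P (prod_ob K B E)" using Dpb(3) by (simp add: cp_def)
  note DBE = bin_productD [OF BE]
  have pcod: "fcomp K W E B p cod \<in> functors K W B" using WO obj pf dc by simp
  note pr = pairing [OF BE obj(2,1) WO pcod dc(1)]
  have k_proj: "fcomp K W P (prod_ob K B E) cp k = pairing K W B E (fcomp K W E B p cod) dom"
  proof (rule bin_product_unique [OF BE WO obj(2,1), where n = 0])
    have "fcomp K P (prod_ob K B E) B (proj1 K B E) cp = cP" "fcomp K P (prod_ob K B E) E (proj2 K B E) cp = eP"
      unfolding cP_def eP_def comma_src_def comma_tgt_def P_def cp_def by simp_all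
    then show "post K W (prod_ob K B E) B (proj1 K B E) 0 (fcomp K W P (prod_ob K B E) cp k) =
        post K W (prod_ob K B E) B (proj1 K B E) 0 (pairing K W B E (fcomp K W E B p cod) dom)"
      "post K W (prod_ob K B E) E (proj2 K B E) 0 (fcomp K W P (prod_ob K B E) cp k) =
        post K W (prod_ob K B E) E (proj2 K B E) 0 (pairing K W B E (fcomp K W E B p cod) dom)"
      using eu WO PO obj k(1) cp DBE pr by (simp_all add: post_0 flip: fcomp_assoc)
  qed (use pr k(1) cp WO PO DBE in simp_all)
  (* lifting the universal edge uP at its source eP *)
  have uP: "res K P B 1 [0] uP = fcomp K P E B p eP" "res K P B 1 [1] uP = cP"
    using DP obj by simp_all
  obtain \<chi> where \<chi>: "\<chi> \<in> cells P E 1" "res K P E 1 [0] \<chi> = eP" "post K P E B p 1 \<chi> = uP"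
    and \<chi>_lift: "\<And>Y h \<omega>. ob Y ==> h \<in> functors K Y P ==> \<omega> \<in> cells Y E 1 ==>
              res K Y E 1 [0] \<omega> = fcomp K Y P E eP h ==> post K Y E B p 1 \<omega> = pre K Y P B h 1 uP ==>
              (\<exists>\<theta>. comparison_square K E B p Y (fcomp K Y P E eP h) (pre K Y P E h 1 \<chi>) \<omega> \<theta>)"
    using lift [unfolded cocartesian_lifting_def, rule_format, OF PO DP(2,4) uP(1)] by blast
  define l where "l = cotensor_lift K E (std 1) P (\<lambda>m j. res K P E 1 j \<chi>)"
  have l: "l \<in> functors K P W"
    and l_ev: "pre K P W E l m (ev m j) = res K P E 1 j \<chi>" if "j \<in> Delta m 1" for m j
    using cotensor_lift [OF WE obj(1) PO simplicial_set_std smap_of_simplex [OF fun_set [OF PO obj(1)] \<chi>(1)]] that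
    unfolding l_def ev_def W_def by auto
  have l\<omega>: "pre K P W E l 1 \<omega> = \<chi>"
    using l_ev [OF i01(1)] ss_id [OF fun_set [OF PO obj(1)] \<chi>(1)] by (simp add: \<omega>_def)
  have l0: "l \<in> functors K P W"
    using cotensor_lift(1) [OF WE obj(1) PO simplicial_set_std smap_of_simplex [OF fun_set [OF PO obj(1)] \<chi>(1)]]
    unfolding l_def W_def .
  have l_end: "fcomp K P W E dom l = eP" "fcomp K P W E cod l = res K P E 1 [1] \<chi>"
    using l\<omega> \<chi>(2) act_pre [OF PO WO obj(1) l0 \<omega> i01(2)] act_pre [OF PO WO obj(1) l0 \<omega> i01(3)] PO WO obj l0 dc
    unfolding dom_def cod_def dom cod by (simp_all add: pre_0)
  have kl: "fcomp K P W P k l = Idt K P"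
  proof (rule comma_unique [OF P PO])
    show "post K P P E eP 0 (fcomp K P W P k l) = post K P P E eP 0 (Idt K P)"
      using PO WO obj l0 k(1) DP l_end eu by (simp add: post_0 flip: fcomp_assoc)
    have "fcomp K P W B (fcomp K W E B p cod) l = cP"
      using PO WO obj l0 dc pf l_end \<chi> act_post [OF PO obj pf(1) \<chi>(1) i01(3)] uP act_cells [OF PO obj(1) \<chi>(1) i01(3)]
      by (simp add: fcomp_assoc post_0)
    then show "post K P P B cP 0 (fcomp K P W P k l) = post K P P B cP 0 (Idt K P)"
      using PO WO obj l0 k(1) DP eu by (simp add: post_0 flip: fcomp_assoc)
    fix m i \<alpha> assume i: "i \<in> Delta m 1" and \<alpha>: "\<alpha> \<in> Delta m 0"
    have ui: "res K P B 1 i uP \<in> cells P B m" using DP obj PO i by (intro act_cells) auto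
    have "pre K P P B (fcomp K P W P k l) m (res K P B 1 i uP) = pre K P W B l m (pre K W P B k m (res K P B 1 i uP))"
      using PO WO obj l0 k(1) ui by (simp add: pre_pre)
    also have "\<dots> = res K P B 1 i (pre K P W B l 1 (post K W E B p 1 \<omega>))"
      unfolding ku [OF i] using PO WO obj l0 p\<omega> i by (simp add: act_pre)
    also have "\<dots> = res K P B 1 i uP"
      using PO WO obj l0 pf \<omega> l\<omega> \<chi>(3) by (simp flip: post_pre)
    also have "\<dots> = pre K P P B (Idt K P) m (res K P B 1 i uP)"
      using PO obj ui by simp
    finally show "Cmp K P P B m (res K P B 1 i uP) (res K P P 0 \<alpha> (fcomp K P W P k l)) =
        Cmp K P P B m (res K P B 1 i uP) (res K P P 0 \<alpha> (Idt K P))"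
      unfolding post0 [OF \<alpha>] .
  qed (use PO WO l0 k(1) in simp_all)
  (* the counit is the transpose of the comparison of the lift of k with the universal edge of W *)
  have "res K W E 1 [0] \<omega> = fcomp K W P E eP k" using dom eu(1) dom_def by simp
  from \<chi>_lift [OF WO k(1) \<omega> this eu(3) [symmetric], unfolded eu(1) comparison_square_def]
  obtain \<theta> where \<theta>: "smap (sprod (std 1) (std 1)) (Fun K W E) \<theta>"
    "\<And>m j t. j\<in>Delta m 1 ==> t\<in>Delta m 1 ==>
      \<theta> m (j, const m 0) = res K W E 1 j (pre K W P E k 1 \<chi>) \<and>
      \<theta> m (j, const m 1) = res K W E 1 j \<omega> \<and>
      \<theta> m (const m 0, t) = dg (Fun K W E) m dom \<and>
      post K W E B p m (\<theta> m (j, t)) = res K W B 1 j (post K W E B p 1 \<omega>)"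
    and \<theta>_lift: "\<And>Z l. Z\<in>Obj K ==> l\<in>functors K Z W ==> pre K Z W E l 1 \<omega> = pre K Z W E l 1 (pre K W P E k 1 \<chi>) ==>
                    (\<exists>\<xi>. smap (sprod (std 1) (std 2)) (Fun K Z E) \<xi> \<and>
                       (\<forall>m. \<forall>j\<in>Delta m 1. \<forall>t\<in>Delta m 1.
                          \<xi> m (j, [0, 1] \<odot> t) = pre K Z W E l m (\<theta> m (j, t)) \<and>
                          \<xi> m (j, [0, 2] \<odot> t) = res K Z E 1 j (pre K Z W E l 1 \<omega>) \<and>
                          \<xi> m (j, [1, 2] \<odot> t) = res K Z E 1 j (pre K Z W E l 1 \<omega>)))"
    by blast
  have c01: "const m 0 \<in> Delta m 1" "const m 1 \<in> Delta m 1" for m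
    by simp_all
  obtain \<epsilon> where \<epsilon>: "\<epsilon> \<in> cells W W 1"
    "\<And>m j t. j \<in> Delta m 1 ==> t \<in> Delta m 1 ==> Cmp K W W E m (ev m j) (res K W W 1 t \<epsilon>) = \<theta> m (j, t)"
    using cotensor_cell [OF W obj(1) WO \<theta>(1)] by auto
  have \<epsilon>v: "Cmp K W W E m (ev m j) (res K W W 0 \<alpha> (res K W W 1 [v] \<epsilon>)) = \<theta> m (j, const m v)"
    if "j \<in> Delta m 1" "\<alpha> \<in> Delta m 0" "v \<le> 1" for m j \<alpha> v
    unfolding act0 [OF that(2)] using \<epsilon>(2) [OF that(1), of "const m v"] that(3)
    unfolding act_const [OF fun_set [OF WO WO] \<epsilon>(1) that(3)] by (simp add: dg_def)
  have \<epsilon>0: "res K W W 1 [0] \<epsilon> = fcomp K W P W l k"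
  proof (rule cotensor_unique [OF W obj(1) WO])
    fix m u \<alpha> assume "u \<in> simplices (std 1) m" and \<alpha>: "\<alpha> \<in> Delta m 0"
    then have u: "u \<in> Delta m 1" by simp
    have "pre K W W E (fcomp K W P W l k) m (ev m u) = pre K W P E k m (pre K P W E l m (ev m u))"
      using WO PO obj k(1) l0 DW(3) [of u m] u by (simp add: pre_pre)
    also have "\<dots> = res K W E 1 u (pre K W P E k 1 \<chi>)"
      using WO PO obj k(1) \<chi>(1) u by (simp add: l_ev act_pre)
    finally show "Cmp K W W E m (ev m u) (res K W W 0 \<alpha> (res K W W 1 [0] \<epsilon>)) =
      Cmp K W W E m (ev m u) (res K W W 0 \<alpha> (fcomp K W P W l k))"
      using \<epsilon>v [OF u \<alpha>, of 0] \<theta>(2) [OF u c01(1)] unfolding post0 [OF \<alpha>] by simp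
  qed (use WO PO k(1) l0 act_cells [OF WO WO \<epsilon>(1) i01(2)] in simp_all)
  have \<epsilon>1: "res K W W 1 [1] \<epsilon> = Idt K W"
  proof (rule cotensor_unique [OF W obj(1) WO])
    fix m u \<alpha> assume "u \<in> simplices (std 1) m" and \<alpha>: "\<alpha> \<in> Delta m 0"
    then have u: "u \<in> Delta m 1" by simp
    have "pre K W W E (Idt K W) m (ev m u) = res K W E 1 u \<omega>"
      using WO obj DW(3) [of u m] u by (simp add: ev)
    then show "Cmp K W W E m (ev m u) (res K W W 0 \<alpha> (res K W W 1 [1] \<epsilon>)) =
      Cmp K W W E m (ev m u) (res K W W 0 \<alpha> (Idt K W))"
      using \<epsilon>v [OF u \<alpha>, of 1] \<theta>(2) [OF u c01(1)] unfolding post0 [OF \<alpha>] by simp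
  qed (use WO act_cells [OF WO WO \<epsilon>(1) i01(3)] in simp_all)
  have \<epsilon>ends: "post K W W E dom 1 \<epsilon> = dg (Fun K W E) 1 dom"
    "post K W E B p 1 (post K W W E cod 1 \<epsilon>) = dg (Fun K W B) 1 (fcomp K W E B p cod)"
  proof -
    have e: "res K W W 1 [0..<Suc 1] \<epsilon> = \<epsilon>" by (rule ss_id [OF fun_set [OF WO WO] \<epsilon>(1)])
    have *: "post K W W E (ev 0 [v]) 1 \<epsilon> = \<theta> 1 (const 1 v, [0..<Suc 1])" if "v \<le> 1" for v
      using \<epsilon>(2) [of "const 1 v" 1 "[0..<Suc 1]"] that e
      by (simp add: cotensor_std_end [OF W obj(1) WO] del: upt_Suc)
    have "ev 0 [0] = dom" "ev 0 [1] = cod" by (simp_all add: dom_def cod_def arr_dom_def arr_cod_def ev_def)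
    with * [of 0] * [of 1] have "post K W W E dom 1 \<epsilon> = \<theta> 1 (const 1 0, [0..<Suc 1])"
      "post K W W E cod 1 \<epsilon> = \<theta> 1 (const 1 1, [0..<Suc 1])" by (simp_all del: upt_Suc)
    moreover have "res K W B 1 (const 1 1) (post K W E B p 1 \<omega>) = dg (Fun K W B) 1 (fcomp K W E B p cod)"
      using p\<omega>_act [OF c01(2), of 1] ends(2) [of 1] WO obj pf dc by (simp add: post_dg)
    ultimately show "post K W W E dom 1 \<epsilon> = dg (Fun K W E) 1 dom"
      "post K W E B p 1 (post K W W E cod 1 \<epsilon>) = dg (Fun K W B) 1 (fcomp K W E B p cod)"
      using \<theta>(2) [OF c01(1) Delta_id] \<theta>(2) [OF c01(2) Delta_id] by (simp_all del: upt_Suc)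
  qed
  have k\<epsilon>: "post K W W P k 1 \<epsilon> = dg (Fun K W P) 1 k"
  proof (rule comma_unique [OF P WO])
    show "post K W P E eP 1 (post K W W P k 1 \<epsilon>) = post K W P E eP 1 (dg (Fun K W P) 1 k)"
      using WO PO obj k(1) \<epsilon>(1) DP \<epsilon>ends(1) by (simp add: post_post post_dg eu)
    show "post K W P B cP 1 (post K W W P k 1 \<epsilon>) = post K W P B cP 1 (dg (Fun K W P) 1 k)"
      using WO PO obj k(1) \<epsilon>(1) DP \<epsilon>ends(2) pf dc by (simp add: post_post post_dg eu)
    fix m i t assume i: "i \<in> Delta m 1" and t: "t \<in> Delta m 1"
    have ui: "res K P B 1 i uP \<in> cells P B m" using DP obj PO i by (intro act_cells) auto
    have "Cmp K W P B m (res K P B 1 i uP) (res K W P 1 t (post K W W P k 1 \<epsilon>)) =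
        Cmp K W W B m (pre K W P B k m (res K P B 1 i uP)) (res K W W 1 t \<epsilon>)"
      using WO PO obj k(1) \<epsilon>(1) ui t by (simp add: act_post cmp_pre act_cells)
    also have "\<dots> = post K W E B p m (Cmp K W W E m (ev m i) (res K W W 1 t \<epsilon>))"
      unfolding ku [OF i] p\<omega>_act [OF i]
      using WO PO obj pf \<epsilon>(1) t DW(3) [of i m] i by (simp add: cmp_post act_cells)
    also have "\<dots> = res K W B 1 i (post K W E B p 1 \<omega>)"
      using \<epsilon>(2) [OF i t] \<theta>(2) [OF i t] by simp
    also have "\<dots> = pre K W P B k m (res K P B 1 i uP)" using ku [OF i] by simp
    also have "\<dots> = Cmp K W P B m (res K P B 1 i uP) (res K W P 1 t (dg (Fun K W P) 1 k))"
      using WO PO k(1) t by (simp add: act_dg_cells cmp_dg_right)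
    finally show "Cmp K W P B m (res K P B 1 i uP) (res K W P 1 t (post K W W P k 1 \<epsilon>)) =
        Cmp K W P B m (res K P B 1 i uP) (res K W P 1 t (dg (Fun K W P) 1 k))" .
  qed (use WO PO k(1) \<epsilon>(1) in simp_all)
  have \<epsilon>l: "homotopic (Fun K P W) (pre K P W W l 1 \<epsilon>) (dg (Fun K P W) 1 l)"
  proof -
    have "pre K P W E l 1 (pre K W P E k 1 \<chi>) = \<chi>"
      using PO WO obj l0 k(1) \<chi>(1) kl by (simp add: pre_pre)
    from \<theta>_lift [OF PO l0, unfolded this l\<omega>]
    obtain \<xi> where \<xi>: "smap (sprod (std 1) (std 2)) (Fun K P E) \<xi>"
      "\<And>m j t. j\<in>Delta m 1 ==> t\<in>Delta m 1 ==>
         \<xi> m (j, [0, 1] \<odot> t) = pre K P W E l m (\<theta> m (j, t)) \<and>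
         \<xi> m (j, [0, 2] \<odot> t) = res K P E 1 j \<chi> \<and> \<xi> m (j, [1, 2] \<odot> t) = res K P E 1 j \<chi>"
      by blast
    obtain \<Xi> where \<Xi>: "\<Xi> \<in> cells P W 2"
      "\<And>m j t. j \<in> Delta m 1 ==> t \<in> Delta m 2 ==> Cmp K P W E m (ev m j) (res K P W 2 t \<Xi>) = \<xi> m (j, t)"
      using cotensor_cell [OF W obj(1) PO \<xi>(1)] by auto
    have f: "Cmp K P W E m (ev m j) (res K P W 1 t (res K P W 2 s \<Xi>)) = \<xi> m (j, s \<odot> t)"
      if "j \<in> Delta m 1" "t \<in> Delta m 1" "s \<in> Delta 1 2" for m j t s
      using \<Xi>(2) [OF that(1), of "s \<odot> t"] that ss_comp [OF fun_set [OF PO WO] that(2,3) \<Xi>(1)] by auto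
    have s: "[0, 1] \<in> Delta 1 2" "[0, 2] \<in> Delta 1 2" "[1, 2] \<in> Delta 1 2"
      by (simp_all add: Delta_eval)
    have dgl: "Cmp K P W E m (ev m j) (res K P W 1 t (dg (Fun K P W) 1 l)) = res K P E 1 j \<chi>"
      if "j \<in> Delta m 1" "t \<in> Delta m 1" for m j t
      using that PO WO l0 by (simp add: act_dg_cells cmp_dg_right l_ev)
    have deg: "res K P W 2 s \<Xi> = dg (Fun K P W) 1 l" if "s = [0, 2] \<or> s = [1, 2]" for s
    proof (rule cotensor_unique [OF W obj(1) PO])
      fix m u t assume "u \<in> simplices (std 1) m" and t: "t \<in> Delta m 1"
      then have u: "u \<in> Delta m 1" by simp
      have "s \<in> Delta 1 2" "\<xi> m (u, s \<odot> t) = res K P E 1 u \<chi>" using that s \<xi>(2) [OF u t] by blast+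
      then show "Cmp K P W E m (ev m u) (res K P W 1 t (res K P W 2 s \<Xi>)) =
          Cmp K P W E m (ev m u) (res K P W 1 t (dg (Fun K P W) 1 l))"
        unfolding dgl [OF u t] using f [OF u t] by simp
    qed (use that s PO WO l0 \<Xi>(1) in \<open>auto simp: act_cells\<close>)
    have "res K P W 2 [0, 1] \<Xi> = pre K P W W l 1 \<epsilon>"
    proof (rule cotensor_unique [OF W obj(1) PO])
      fix m u t assume "u \<in> simplices (std 1) m" and t: "t \<in> Delta m 1"
      then have u: "u \<in> Delta m 1" by simp
      have "Cmp K P W E m (ev m u) (res K P W 1 t (pre K P W W l 1 \<epsilon>)) =
          pre K P W E l m (Cmp K W W E m (ev m u) (res K W W 1 t \<epsilon>))"
        using PO WO obj l0 \<epsilon>(1) t u DW(3) [of u m] by (simp add: act_pre pre_cmp act_cells)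
      then show "Cmp K P W E m (ev m u) (res K P W 1 t (res K P W 2 [0, 1] \<Xi>)) =
        Cmp K P W E m (ev m u) (res K P W 1 t (pre K P W W l 1 \<epsilon>))"
        using f [OF u t s(1)] \<xi>(2) [OF u t] \<epsilon>(2) [OF u t] by simp
    qed (use PO WO l0 \<epsilon>(1) \<Xi>(1) s in \<open>simp_all add: act_cells\<close>)
    moreover have "dg (Fun K P W) 1 (res K P W 1 [1] (pre K P W W l 1 \<epsilon>)) = dg (Fun K P W) 1 l"
      using PO WO l0 \<epsilon>(1) \<epsilon>1 i01(3) by (simp add: act_pre pre_0)
    ultimately show ?thesis
      unfolding homotopic_def using \<Xi>(1) deg by auto
  qed
  have lari: "has_lari K W P k"
    unfolding has_lari_def
  proof (intro exI conjI)
    let ?\<eta> = "dg (Fun K P P) 1 (Idt K P)"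
    have \<eta>: "edge (Fun K P P) (Idt K P) (fcomp K P W P k l) ?\<eta>"
      unfolding kl edge_def using PO act_dg_cells [OF PO PO idt_in [OF PO] i01(2)] act_dg_cells [OF PO PO idt_in [OF PO] i01(3)]
      by (simp add: dg_0)
    show "adjunction K W P l k ?\<eta> \<epsilon>"
      unfolding adjunction_def
    proof (intro conjI)
      show "edge (Fun K W W) (fcomp K W P W l k) (Idt K W) \<epsilon>"
        using \<epsilon>(1) \<epsilon>0 \<epsilon>1 by (simp add: edge_def)
      have "post K P P W l 1 ?\<eta> = dg (Fun K P W) 1 l" using PO WO l0 by (simp add: post_dg)
      moreover have "hclass (Fun K P W) (pre K P W W l 1 \<epsilon>) = hid (Fun K P W) l"
        unfolding hid_def by (rule hclass_eq [OF qc [OF PO WO] \<epsilon>l])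
      ultimately show "hcomp (Fun K P W) (hclass (Fun K P W) (pre K P W W l 1 \<epsilon>))
          (hclass (Fun K P W) (post K P P W l 1 ?\<eta>)) = hid (Fun K P W) l"
        using hcomp_hid [OF qc [OF PO WO] l0] by (simp add: hid_def)
      have "pre K W P P k 1 ?\<eta> = dg (Fun K W P) 1 k" using PO WO k(1) by (simp add: pre_dg)
      then show "hcomp (Fun K W P) (hclass (Fun K W P) (post K W W P k 1 \<epsilon>))
          (hclass (Fun K W P) (pre K W P P k 1 ?\<eta>)) = hid (Fun K W P) k"
        unfolding k\<epsilon> using hcomp_hid [OF qc [OF WO PO] k(1)] by (simp add: hid_def)
    qed (use l0 k(1) \<eta> in simp_all)
    show "hinvertible (Fun K P P) (Idt K P) (fcomp K P W P k l) ?\<eta>"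
      unfolding hinvertible_def kl
      using \<eta> [unfolded kl] hcomp_hid [OF qc [OF PO PO] idt_in [OF PO], unfolded hid_def]
      unfolding hid_def by (intro conjI exI [of _ ?\<eta>])
  qed
  show ?thesis
    unfolding cocartesian_fibration_def Let_def
    using obj p k(1) k_arr k_proj lari
    by (intro conjI bexI [of _ k]) (simp_all only: W_def P_def ca_def cp_def dom_def cod_def)
qed

end

context enriched
begin

lemma comma_component_smap:
  assumes "ob A" "ob X" "ob E" "\<kappa> \<in> cells E A 1" "smap Z (Fun K X E) \<theta>"
  shows "smap (sprod (std 1) Z) (Fun K X A) (\<lambda>m (i, z). Cmp K X E A m (res K E A 1 i \<kappa>) (\<theta> m z))"
  using assms smap_in [OF assms(5)]
  by (intro simplicial_mapI) (auto simp: act_cells smap_act [OF assms(5)] act_cmp ss_comp [OF fun_set])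

lemma comma_smap_unique:
  assumes E: "is_comma K A B C f g E e0 e1 \<kappa>" and obj: "ob A" "ob B" "ob C" "ob X"
    and Z: "simplicial_set Z" and \<theta>: "smap Z (Fun K X E) \<theta>" "smap Z (Fun K X E) \<theta>'"
    and e0: "\<And>m z. z \<in> simplices Z m ==> post K X E B e0 m (\<theta> m z) = post K X E B e0 m (\<theta>' m z)"
    and e1: "\<And>m z. z \<in> simplices Z m ==> post K X E C e1 m (\<theta> m z) = post K X E C e1 m (\<theta>' m z)"
    and \<kappa>: "\<And>m i z. i \<in> Delta m 1 ==> z \<in> simplices Z m ==>
      Cmp K X E A m (res K E A 1 i \<kappa>) (\<theta> m z) = Cmp K X E A m (res K E A 1 i \<kappa>) (\<theta>' m z)"
    and z: "z \<in> simplices Z n"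
  shows "\<theta> n z = \<theta>' n z"
proof (rule comma_unique [OF E obj(4) smap_in [OF \<theta>(1) z] smap_in [OF \<theta>(2) z] e0 [OF z] e1 [OF z]])
  fix m i \<alpha> assume i: "i \<in> Delta m 1" and \<alpha>: "\<alpha> \<in> Delta m n"
  show "Cmp K X E A m (res K E A 1 i \<kappa>) (res K X E n \<alpha> (\<theta> n z)) =
      Cmp K X E A m (res K E A 1 i \<kappa>) (res K X E n \<alpha> (\<theta>' n z))"
    using \<kappa> [OF i ss_in [OF Z \<alpha> z]] by (simp add: smap_act [OF \<theta>(1) \<alpha> z] smap_act [OF \<theta>(2) \<alpha> z])
qed

end

context isofib_category
begin

lemma slice_pullback:
  assumes B: "ob B" and X: "X \<in> Obj (slice K B)" and Y: "Y \<in> Obj (slice K B)" and Z: "Z \<in> Obj (slice K B)"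
    and p: "p \<in> functors (slice K B) X Z" and f: "f \<in> functors (slice K B) Y Z"
    and P: "is_pullback K (fst X) (fst Y) (fst Z) p f P a b"
    and q: "q \<in> Isofib K P B" "q = fcomp K P (fst Y) B (snd Y) b"
  shows "is_pullback (slice K B) X Y Z p f (P, q) a b"
proof -
  have o: "fst X \<in> Obj K" "fst Y \<in> Obj K" "fst Z \<in> Obj K" "snd X \<in> functors K (fst X) B"
    "snd Y \<in> functors K (fst Y) B" "snd Z \<in> functors K (fst Z) B"
    using X Y Z B isofib_functor by auto
  note D = pullbackD [OF P]
  have PO: "(P, q) \<in> Obj (slice K B)" using D q by simp
  have p': "p \<in> functors K (fst X) (fst Z)" "fcomp K (fst X) (fst Z) B (snd Z) p = snd X"
    and f': "f \<in> functors K (fst Y) (fst Z)" "fcomp K (fst Y) (fst Z) B (snd Z) f = snd Y"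
    using p f slice_functor [OF B X Z] slice_functor [OF B Y Z] by auto
  have "fcomp K P (fst X) B (snd X) a = fcomp K P (fst Z) B (snd Z) (fcomp K P (fst X) (fst Z) p a)"
    using p' o D B by (simp flip: p'(2) add: fcomp_assoc)
  also have "\<dots> = q" unfolding D(4) q(2) using f' o D B by (simp flip: fcomp_assoc)
  finally have qa: "fcomp K P (fst X) B (snd X) a = q" .
  show ?thesis
    unfolding is_pullback_def
  proof (intro conjI ballI allI impI)
    show "a \<in> functors (slice K B) (P, q) X" "b \<in> functors (slice K B) (P, q) Y"
      using slice_functor [OF B PO X, of a] slice_functor [OF B PO Y, of b] D q o qa by auto
  next
    fix V n x y assume V: "V \<in> Obj (slice K B)" and x: "x \<in> simplices (Fun (slice K B) V X) n"
      and y: "y \<in> simplices (Fun (slice K B) V Y) n" and xy: "post (slice K B) V X Z p n x = post (slice K B) V Y Z f n y"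
    have V': "fst V \<in> Obj K" using V by auto
    have xy': "x \<in> cells (fst V) (fst X) n" "y \<in> cells (fst V) (fst Y) n"
      "post K (fst V) (fst Y) B (snd Y) n y = dg (Fun K (fst V) B) n (snd V)"
      using x y by (simp_all add: slice_simplices)
    have "\<exists>!z. z \<in> cells (fst V) P n \<and> post K (fst V) P (fst X) a n z = x \<and> post K (fst V) P (fst Y) b n z = y"
      using P V' xy' xy unfolding is_pullback_def by simp
    moreover have "post K (fst V) P B q n z = dg (Fun K (fst V) B) n (snd V)"
      if "z \<in> cells (fst V) P n" "post K (fst V) P (fst Y) b n z = y" for z
      using that V' o D B xy'(3) unfolding q(2) by (simp flip: post_post)
    ultimately show "\<exists>!z. z \<in> simplices (Fun (slice K B) V (P, q)) n \<and>
        post (slice K B) V (P, q) X a n z = x \<and> post (slice K B) V (P, q) Y b n z = y"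
      by (auto simp: slice_simplices)
  qed (use PO D(4) in simp_all)
qed

end

section \<open>Cosmoi with arrow objects in slices\<close>

text \<open>The part of the structure of an infinity-cosmos that commas need in order to be cocartesian. Unlike the axioms, it is literally self-dual: both projections
of the arrow objects of a slice are required to be isofibrations (v = 0 and v = 1), and duality exchanges them.\<close>

locale arrow_cosmos = isofib_category +
  assumes hom_quasi: "A \<in> Obj K ==> B \<in> Obj K ==> quasi_category (Fun K A B)"
    and isofib_comp: "A \<in> Obj K ==> B \<in> Obj K ==> C \<in> Obj K ==> f \<in> Isofib K A B ==> g \<in> Isofib K B C ==>
      fcomp K A B C g f \<in> Isofib K A C"
    and isofib_pullback: "E \<in> Obj K ==> B \<in> Obj K ==> C \<in> Obj K ==> p \<in> Isofib K E B ==> f \<in> functors K C B ==>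
      \<exists>P a b. is_pullback K E C B p f P a b \<and> b \<in> Isofib K P C"
    and slice_quasi: "B \<in> Obj K ==> X \<in> Obj (slice K B) ==> Y \<in> Obj (slice K B) ==>
      quasi_category (Fun (slice K B) X Y)"
    and slice_arrows: "B \<in> Obj K ==> F \<in> Obj (slice K B) ==> v \<le> 1 ==>
      \<exists>W \<epsilon>. is_cotensor (slice K B) F (std 1) W \<epsilon> \<and> \<epsilon> 0 [v] \<in> Isofib K (fst W) (fst F)"
begin

lemma arrow_cosmos_co_dual: "arrow_cosmos (co_dual K)"
proof (unfold_locales)
  show "simplicial_category (co_dual K)" by (rule co_dual_category [OF K])
  fix B F v assume B: "B \<in> Obj (co_dual K)" "F \<in> Obj (slice (co_dual K) B)" and v: "v \<le> (1::nat)"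
  then have BF: "ob B" "F \<in> Obj (slice K B)" by auto
  obtain W \<epsilon> where W: "is_cotensor (slice K B) F (std 1) W \<epsilon>" "\<epsilon> 0 [1 - v] \<in> Isofib K (fst W) (fst F)"
    using slice_arrows [OF BF, of "1 - v"] by auto
  show "\<exists>W \<epsilon>. is_cotensor (slice (co_dual K) B) F (std 1) W \<epsilon> \<and> \<epsilon> 0 [v] \<in> Isofib (co_dual K) (fst W) (fst F)"
    unfolding co_dual_slice [symmetric]
    by (rule exI, rule exI, rule conjI, rule co_dual_cotensor [OF slice_category [OF BF(1)] BF(2) W(1)])
      (use W(2) v in \<open>simp add: flip_def\<close>)
next
  fix B X Y assume "B \<in> Obj (co_dual K)" "X \<in> Obj (slice (co_dual K) B)" "Y \<in> Obj (slice (co_dual K) B)"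
  then show "quasi_category (Fun (slice (co_dual K) B) X Y)"
    unfolding co_dual_slice [symmetric] co_dual_simps by (intro quasi_category_sop slice_quasi) auto
qed (use isofib_functor hom_quasi isofib_comp isofib_pullback in \<open>simp_all add: quasi_category_sop co_dual_pullback\<close>)

context
  fixes B assumes B: "ob B"
begin

interpretation S: isofib_category "slice K B" by (rule slice_isofib_category [OF B])

lemma slice_product:
  assumes X: "X \<in> Obj (slice K B)" and Y: "Y \<in> Obj (slice K B)"
  shows "is_bin_product (slice K B) X Y (prod_ob (slice K B) X Y) (proj1 (slice K B) X Y) (proj2 (slice K B) X Y)"
proof -
  have o: "fst X \<in> Obj K" "fst Y \<in> Obj K" "snd X \<in> Isofib K (fst X) B" "snd Y \<in> Isofib K (fst Y) B"
    using X Y by auto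
  obtain P a b where P: "is_pullback K (fst X) (fst Y) B (snd X) (snd Y) P a b" "b \<in> Isofib K P (fst Y)"
    using isofib_pullback [OF o(1) B o(2,3) isofib_functor [OF o(2) B o(4)]] by blast
  have "is_bin_product (slice K B) X Y (P, fcomp K P (fst Y) B (snd Y) b) a b"
    by (rule slice_bin_product [OF B X Y P(1) isofib_comp [OF pullbackD(1) [OF P(1)] o(2) B P(2) o(4)] refl])
  then show ?thesis by (intro S.chosen_bin_product) blast
qed

lemma slice_arrow_object:
  assumes "X \<in> Obj (slice K B)"
  shows "is_cotensor (slice K B) X (std 1) (arr_ob (slice K B) X) (cotensor_ev (slice K B) X (std 1))"
  using slice_arrows [OF B assms, of 0] by (intro S.chosen_cotensor) auto

lemma slice_domain_pullback:
  assumes E: "E \<in> Obj (slice K B)" and F: "F \<in> Obj (slice K B)" and r: "r \<in> functors (slice K B) E F"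
  shows "\<exists>W \<epsilon> P a b. is_cotensor (slice K B) F (std 1) W \<epsilon> \<and> is_pullback (slice K B) W E F (\<epsilon> 0 [0]) r P a b"
proof -
  have o: "fst E \<in> Obj K" "fst F \<in> Obj K" "snd E \<in> Isofib K (fst E) B" using E F by auto
  obtain W \<epsilon> where W: "is_cotensor (slice K B) F (std 1) W \<epsilon>" "\<epsilon> 0 [0] \<in> Isofib K (fst W) (fst F)"
    using slice_arrows [OF B F, of 0] by auto
  note DW = S.cotensorD [OF W(1)]
  have r': "r \<in> functors K (fst E) (fst F)" using r by (simp add: slice_simplices)
  have \<epsilon>: "\<epsilon> 0 [0] \<in> functors (slice K B) W F" by (intro DW(3)) (simp add: Delta_eval)
  have WO: "fst W \<in> Obj K" using DW(1) by auto
  obtain P a b where P: "is_pullback K (fst W) (fst E) (fst F) (\<epsilon> 0 [0]) r P a b" "b \<in> Isofib K P (fst E)"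
    using isofib_pullback [OF WO o(2,1) W(2) r'] by blast
  have "is_pullback (slice K B) W E F (\<epsilon> 0 [0]) r (P, fcomp K P (fst E) B (snd E) b) a b"
    by (rule slice_pullback [OF B DW(1) E F \<epsilon> r P(1) isofib_comp [OF pullbackD(1) [OF P(1)] o(1) B P(2) o(3)] refl])
  with W(1) show ?thesis by blast
qed

lemma slice_cocartesian_fibration:
  assumes E: "E \<in> Obj (slice K B)" and F: "F \<in> Obj (slice K B)" and r: "r \<in> Isofib (slice K B) E F"
    and lift: "cocartesian_lifting (slice K B) E F r"
  shows "cocartesian_fibration (slice K B) E F r"
proof -
  note rf = S.isofib_functor [OF E F r] and FF = slice_product [OF F F] and FE = slice_product [OF F E]
  obtain W \<epsilon> P a b where P: "is_cotensor (slice K B) F (std 1) W \<epsilon>" "is_pullback (slice K B) W E F (\<epsilon> 0 [0]) r P a b"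
    using slice_domain_pullback [OF E F rf] by blast
  show ?thesis
    by (rule S.cocartesian_fibrationI [OF E F r slice_quasi [OF B] slice_arrow_object [OF F] slice_arrow_object [OF E]
      FF FE S.comma_of_domain_pullback [OF P(1) slice_arrow_object [OF F] FF FE F E rf P(2)] lift])
qed

end

end

section \<open>Comma objects are cocartesian over the target\<close>

lemma reindex_tab_Delta:
  "s \<in> Delta n N ==> tab m F \<in> Delta m n ==> s \<odot> tab m F = tab m (\<lambda>l. s ! F l)"
  by (intro reindex_tab2) (auto simp: tab_in_Delta Delta_length less_Suc_eq_le)

lemma act_face:
  assumes "simplicial_set Q" "x \<in> simplices Q N" "s \<in> Delta n N" "tab m F \<in> Delta m n"
  shows "act Q n (tab m F) (act Q N s x) = act Q N (tab m (\<lambda>l. s ! F l)) x"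
  using ss_comp [OF assms(1,4,3,2)] reindex_tab_Delta [OF assms(3,4)] by simp

lemma bit: "i \<in> Delta m 1 ==> l \<le> m ==> i ! l = 0 \<or> i ! l = 1"
  using Delta_nth_le [of i m 1 l] by auto

text \<open>These lists are the monotone maps that collapse the i-coordinate 0 to a vertex: they exhibit the 2-simplex (3-simplex, 4-simplex) as a quotient of
a product of 1-simplices in which a component with constant source is determined by a simplex of A.\<close>

abbreviation prism_index :: "nat \<Rightarrow> nat list \<Rightarrow> nat list \<Rightarrow> nat list" where
  "prism_index m i j \<equiv> tab m (\<lambda>l. i ! l * (1 + j ! l))"

abbreviation cube_index :: "nat \<Rightarrow> nat list \<Rightarrow> nat list \<Rightarrow> nat list \<Rightarrow> nat list" where
  "cube_index m i j t \<equiv> tab m (\<lambda>l. i ! l * (1 + j ! l * (1 + t ! l)))"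

lemma prism_index_in: "i \<in> Delta m 1 ==> j \<in> Delta m N ==> prism_index m i j \<in> Delta m (Suc N)"
proof -
  assume i: "i \<in> Delta m 1" and j: "j \<in> Delta m N"
  have "i ! l * (1 + j ! l) \<le> 1 * (1 + N)" if "l \<le> m" for l
    using Delta_nth_le [OF i that] Delta_nth_le [OF j that] by (intro mult_le_mono) auto
  then show ?thesis
    using Delta_mono [OF i] Delta_mono [OF j] unfolding tab_in_Delta by (auto intro!: add_mono mult_le_mono)
qed

lemma cube_index_eq: "cube_index m i j t = prism_index m i (tab m (\<lambda>l. j ! l * (1 + t ! l)))"
  by (simp add: tab_eq_iff)

lemma cube_index_in: "i \<in> Delta m 1 ==> j \<in> Delta m 1 ==> t \<in> Delta m N ==> cube_index m i j t \<in> Delta m (Suc (Suc N))"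
  unfolding cube_index_eq by (intro prism_index_in)

lemma prism_index_smap: "smap (sprod (std 1) (std N)) (std (Suc N)) (\<lambda>m (i, j). prism_index m i j)"
proof (rule simplicial_mapI)
  fix m n \<alpha> x assume \<alpha>: "\<alpha> \<in> Delta m n" and "x \<in> simplices (sprod (std 1) (std N)) n"
  then show "(\<lambda>(i, j). prism_index m i j) (act (sprod (std 1) (std N)) n \<alpha> x) =
      act (std (Suc N)) n \<alpha> ((\<lambda>(i, j). prism_index n i j) x)"
    by (auto simp: tab_reindex [OF \<alpha>] tab_eq_iff nth_reindex [OF \<alpha>])
qed (use prism_index_in in auto)

lemma cube_index_smap:
  "smap (sprod (std 1) (sprod (std 1) (std N))) (std (Suc (Suc N))) (\<lambda>m (i, j, t). cube_index m i j t)"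
proof (rule simplicial_mapI)
  fix m n \<alpha> x assume \<alpha>: "\<alpha> \<in> Delta m n" and "x \<in> simplices (sprod (std 1) (sprod (std 1) (std N))) n"
  then show "(\<lambda>(i, j, t). cube_index m i j t) (act (sprod (std 1) (sprod (std 1) (std N))) n \<alpha> x) =
      act (std (Suc (Suc N))) n \<alpha> ((\<lambda>(i, j, t). cube_index n i j t) x)"
    by (auto simp: tab_reindex [OF \<alpha>] tab_eq_iff nth_reindex [OF \<alpha>])
qed (use cube_index_in in auto)

lemma end_smap: "v \<le> N ==> smap X (sprod X (std N)) (\<lambda>m x. (x, const m v))"
  by (rule simplicial_mapI) auto

lemma start_smap: "v \<le> N ==> smap X (sprod (std N) X) (\<lambda>m x. (const m v, x))"
  by (rule simplicial_mapI) auto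

lemma coord_smap:
  assumes s: "s \<in> Delta k N"
  shows "smap (sprod X (std k)) (sprod X (std N)) (\<lambda>m (x, t). (x, s \<odot> t))"
proof (rule simplicial_mapI)
  fix m n \<alpha> x assume "\<alpha> \<in> Delta m n" "x \<in> simplices (sprod X (std k)) n"
  then show "(\<lambda>(x, t). (x, s \<odot> t)) (act (sprod X (std k)) n \<alpha> x) =
      act (sprod X (std N)) n \<alpha> ((\<lambda>(x, t). (x, s \<odot> t)) x)"
    by (auto simp: reindex_assoc)
qed (use s in auto)

context enriched
begin

lemma dg_smap: "ob X ==> ob Y ==> x \<in> cells X Y 0 ==> smap Z (Fun K X Y) (\<lambda>m z. dg (Fun K X Y) m x)"
  by (rule simplicial_mapI) (auto simp: act_dg_cells)

end

text \<open>The comma E is considered as an object over B, by its source projection, with the functor r to the product of C and B over B. The claim is that r is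
a cocartesian fibration in the slice over B.\<close>

locale comma_slice = arrow_cosmos +
  fixes A B C f g E e0 e1 \<kappa> CB \<pi>1 \<pi>2 r
  assumes obj: "A \<in> Obj K" "B \<in> Obj K" "C \<in> Obj K" and fg: "f \<in> functors K B A" "g \<in> functors K C A"
    and E: "is_comma K A B C f g E e0 e1 \<kappa>"
    and CB: "is_bin_product K C B CB \<pi>1 \<pi>2"
    and r: "r \<in> Isofib K E CB" and r1: "fcomp K E CB C \<pi>1 r = e1" and r2: "fcomp K E CB B \<pi>2 r = e0"
    and e0: "e0 \<in> Isofib K E B" and \<pi>2: "\<pi>2 \<in> Isofib K CB B"
begin

abbreviation "S \<equiv> slice K B"
abbreviation "E' \<equiv> (E, e0)"
abbreviation "F' \<equiv> (CB, \<pi>2)"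

definition comp :: "'a \<Rightarrow> nat \<Rightarrow> nat list \<Rightarrow> 'b \<Rightarrow> 'b" where
  "comp X m i x = Cmp K X E A m (res K E A 1 i \<kappa>) x"

lemmas D = commaD(1-4) [OF E] bin_productD [OF CB] obj fg

lemma E'_F': "E' \<in> Obj S" "F' \<in> Obj S"
  using D e0 \<pi>2 by simp_all

lemma r_in: "r \<in> functors K E CB" "r \<in> Isofib S E' F'" "r \<in> functors S E' F'"
  using isofib_functor r D r2 slice_functor [OF obj(2) E'_F', of r] by auto

lemma cells_S:
  "x \<in> simplices (Fun S X E') n \<longleftrightarrow> x \<in> cells (fst X) E n \<and> post K (fst X) E B e0 n x = dg (Fun K (fst X) B) n (snd X)"
  "y \<in> simplices (Fun S X F') n \<longleftrightarrow> y \<in> cells (fst X) CB n \<and> post K (fst X) CB B \<pi>2 n y = dg (Fun K (fst X) B) n (snd X)"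
  by (simp_all add: slice_simplices)

lemma obj_S: "X \<in> Obj S ==> fst X \<in> Obj K \<and> snd X \<in> functors K (fst X) B"
  using isofib_functor obj by auto

lemma comp_smap:
  assumes "ob X" "smap Z (Fun K X E) \<theta>"
  shows "smap (sprod (std 1) Z) (Fun K X A) (\<lambda>m (i, z). comp X m i (\<theta> m z))"
  unfolding comp_def by (rule comma_component_smap) (use D assms in auto)

lemma comp_0:
  assumes X: "X \<in> Obj S" and x: "x \<in> simplices (Fun S X E') n"
  shows "comp (fst X) n (const n 0) x = dg (Fun K (fst X) A) n (fcomp K (fst X) B A f (snd X))"
  unfolding comp_def using comma_ends(1) [OF E obj _ fg, of "fst X" x n] obj_S [OF X] x D
  by (simp add: cells_S post_dg)

lemma comp_1:
  assumes X: "ob X" and x: "x \<in> cells X E n"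
  shows "comp X n (const n 1) x = post K X C A g n (post K X E C e1 n x)"
  unfolding comp_def by (rule comma_ends(2) [OF E obj X fg x])

text \<open>Over B the source of a simplex of E is prescribed, so a simplex consists of its target and its component.\<close>

lemma slice_cells_ex:
  assumes X: "X \<in> Obj S" and Z: "simplicial_set Z" and c: "smap Z (Fun K (fst X) C) c"
    and \<phi>: "smap (sprod (std 1) Z) (Fun K (fst X) A) \<phi>"
    and ends: "\<And>m z. z \<in> simplices Z m ==>
        \<phi> m (const m 0, z) = dg (Fun K (fst X) A) m (fcomp K (fst X) B A f (snd X))"
      "\<And>m z. z \<in> simplices Z m ==> \<phi> m (const m 1, z) = post K (fst X) C A g m (c m z)"
  shows "\<exists>\<theta>. smap Z (Fun S X E') \<theta> \<and> (\<forall>m. \<forall>z\<in>simplices Z m.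
      post K (fst X) E C e1 m (\<theta> m z) = c m z \<and> (\<forall>i\<in>Delta m 1. comp (fst X) m i (\<theta> m z) = \<phi> m (i, z)))"
proof -
  note X' = obj_S [OF X]
  obtain \<theta> where \<theta>: "smap Z (Fun K (fst X) E) \<theta>"
    "\<And>m z. z \<in> simplices Z m ==> post K (fst X) E B e0 m (\<theta> m z) = dg (Fun K (fst X) B) m (snd X) \<and>
      post K (fst X) E C e1 m (\<theta> m z) = c m z \<and> (\<forall>i\<in>Delta m 1. comp (fst X) m i (\<theta> m z) = \<phi> m (i, z))"
    using comma_cells [OF E obj _ fg Z dg_smap c \<phi>, of "snd X"] X' ends D
    unfolding comp_def by (auto simp: post_dg simp del: One_nat_def)
  have "smap Z (Fun S X E') \<theta>"
    by (rule simplicial_mapI) (use smap_in [OF \<theta>(1)] smap_act [OF \<theta>(1)] \<theta>(2) in \<open>auto simp: cells_S\<close>)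
  then show ?thesis using \<theta>(2) by blast
qed

lemma slice_smap:
  assumes "smap Z (Fun S X E') \<theta>"
  shows "smap Z (Fun K (fst X) E) \<theta>"
  by (rule simplicial_mapI) (use smap_in [OF assms] smap_act [OF assms] in \<open>auto simp: cells_S\<close>)

lemma slice_cells_unique:
  assumes X: "X \<in> Obj S" and Z: "simplicial_set Z"
    and \<theta>: "smap Z (Fun S X E') \<theta>" "smap Z (Fun S X E') \<theta>'"
    and e1: "\<And>m z. z \<in> simplices Z m ==> post K (fst X) E C e1 m (\<theta> m z) = post K (fst X) E C e1 m (\<theta>' m z)"
    and \<kappa>: "\<And>m i z. i \<in> Delta m 1 ==> z \<in> simplices Z m ==> comp (fst X) m i (\<theta> m z) = comp (fst X) m i (\<theta>' m z)"
    and z: "z \<in> simplices Z n"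
  shows "\<theta> n z = \<theta>' n z"
proof (rule comma_smap_unique [OF E obj _ Z slice_smap [OF \<theta>(1)] slice_smap [OF \<theta>(2)] _ e1 _ z])
  show "fst X \<in> Obj K" using obj_S [OF X] by simp
  fix m z assume z: "z \<in> simplices Z m"
  show "post K (fst X) E B e0 m (\<theta> m z) = post K (fst X) E B e0 m (\<theta>' m z)"
    using smap_in [OF \<theta>(1) z] smap_in [OF \<theta>(2) z] by (simp add: cells_S)
qed (use \<kappa> in \<open>simp_all add: comp_def\<close>)

lemma slice_set: "X \<in> Obj S ==> simplicial_set (Fun S X E')"
  using slice_category [OF obj(2)] E'_F' unfolding simplicial_category_def by blast

lemma simplex_smap: "X \<in> Obj S ==> x \<in> simplices (Fun S X E') n ==>
    smap (std n) (Fun S X E') (\<lambda>m \<alpha>. res K (fst X) E n \<alpha> x)"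
  using smap_of_simplex [OF slice_set, of X x n] by simp

lemma e1_r: "X \<in> Obj S ==> x \<in> simplices (Fun S X E') n ==>
    post K (fst X) CB C \<pi>1 n (post K (fst X) E CB r n x) = post K (fst X) E C e1 n x"
  using obj_S [of X] D r_in(1) by (simp add: cells_S post_post r1)

text \<open>The 2-simplex \<open>\<sigma>\<close> composes the 2-cell of e with the image under g of the edge of C. Read along \<open>prism_index\<close>, it is the component of an edge of E
from e to the composite.\<close>

lemma lift_edge:
  assumes X: "X \<in> Obj S" and e: "e \<in> functors S X E'" and u: "u \<in> simplices (Fun S X F') 1"
    and u0: "res K (fst X) CB 1 [0] u = fcomp K (fst X) E CB r e"
  shows "\<exists>\<sigma>\<in>cells (fst X) A 2. \<exists>\<chi>\<in>simplices (Fun S X E') 1.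
    res K (fst X) A 2 [0, 1] \<sigma> = pre K (fst X) E A e 1 \<kappa> \<and>
    res K (fst X) A 2 [1, 2] \<sigma> = post K (fst X) C A g 1 (post K (fst X) CB C \<pi>1 1 u) \<and>
    res K (fst X) E 1 [0] \<chi> = e \<and> post K (fst X) E CB r 1 \<chi> = u \<and>
    (\<forall>m. \<forall>i\<in>Delta m 1. \<forall>j\<in>Delta m 1.
      comp (fst X) m i (res K (fst X) E 1 j \<chi>) = res K (fst X) A 2 (prism_index m i j) \<sigma>)"
proof -
  define X0 where "X0 = fst X"
  let ?Q = "Fun K X0 A"
  have X0: "ob X0" "snd X \<in> functors K X0 B" using obj_S [OF X] by (simp_all add: X0_def)
  have e': "e \<in> functors K X0 E" "fcomp K X0 E B e0 e = snd X"
    using e slice_functor [OF obj(2) X E'_F'(1)] by (simp_all add: X0_def)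
  have u': "u \<in> cells X0 CB 1" using u by (simp add: cells_S X0_def)
  define \<gamma> where "\<gamma> = post K X0 CB C \<pi>1 1 u"
  have \<gamma>: "\<gamma> \<in> cells X0 C 1" using u' X0 D by (simp add: \<gamma>_def)
  have i01: "[0] \<in> Delta 0 1" "[1] \<in> Delta 0 1" by (simp_all add: Delta_eval)
  have Q: "quasi_category ?Q" "simplicial_set ?Q" using hom_quasi X0 obj by simp_all
  have \<alpha>0: "pre K X0 E A e 1 \<kappa> \<in> simplices ?Q 1" "post K X0 C A g 1 \<gamma> \<in> simplices ?Q 1"
    using X0 e' D \<gamma> by simp_all
  have \<gamma>0: "res K X0 C 1 [0] \<gamma> = fcomp K X0 E C e1 e"
    using act_post [OF X0(1) D(5) obj(3) D(6) u' i01(1)] u0 X0 D e' r_in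
    by (simp add: \<gamma>_def X0_def [symmetric] post_0 flip: fcomp_assoc r1)
  have "act ?Q 1 [1] (pre K X0 E A e 1 \<kappa>) = act ?Q 1 [0] (post K X0 C A g 1 \<gamma>)"
    unfolding act_pre [OF X0(1) D(1) obj(1) e'(1) D(4) i01(2)] act_post [OF X0(1) obj(3,1) fg(2) \<gamma> i01(1)] \<gamma>0
    using X0 D e' commaD(6) [OF E] by (simp add: pre_0 post_0 fcomp_assoc)
  from fill2 [OF Q(1) \<alpha>0 this]
  obtain \<sigma> where \<sigma>: "\<sigma> \<in> simplices ?Q 2" "act ?Q 2 [0, 1] \<sigma> = pre K X0 E A e 1 \<kappa>" "act ?Q 2 [1, 2] \<sigma> = post K X0 C A g 1 \<gamma>"
    by blast
  have dgf: "dg (Fun K X0 A) m (fcomp K X0 B A f (snd X)) = act ?Q 2 (const m 0) \<sigma>" for m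
  proof -
    have "act ?Q 2 [0] \<sigma> = act ?Q 1 [0] (act ?Q 2 [0, 1] \<sigma>)"
      using Q(2) \<sigma>(1) by (simp add: act_act_list monotone_list_def)
    also have "\<dots> = fcomp K X0 B A f (snd X)"
      unfolding \<sigma>(2) unfolding act_pre [OF X0(1) D(1) obj(1) e'(1) D(4) i01(1)]
      using X0 D e' commaD(5) [OF E] by (simp add: pre_0 fcomp_assoc)
    finally show ?thesis using act_const [OF Q(2) \<sigma>(1), of 0 m] by simp
  qed
  let ?\<phi> = "\<lambda>m (i, j). act ?Q 2 (prism_index m i j) \<sigma>"
  have \<phi>: "smap (sprod (std 1) (std 1)) ?Q ?\<phi>"
    using smap_comp [OF prism_index_smap, of 1, simplified Suc_1, OF smap_of_simplex [OF Q(2) \<sigma>(1)]]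
    by (simp add: case_prod_unfold numeral_2_eq_2)
  have c: "smap (std 1) (Fun K X0 C) (\<lambda>m j. res K X0 C 1 j \<gamma>)"
    using smap_of_simplex [OF fun_set [OF X0(1) obj(3)] \<gamma>] .
  have en0: "?\<phi> m (const m 0, j) = dg (Fun K X0 A) m (fcomp K X0 B A f (snd X))" for m j
    unfolding dgf by (simp add: replicate_tab tab_eq_iff cong: tab_cong)
  have en1: "?\<phi> m (const m 1, j) = post K X0 C A g m (res K X0 C 1 j \<gamma>)" if j: "j \<in> Delta m 1" for m j
  proof -
    have tj: "tab m (\<lambda>l. j ! l) = j" using Delta_eq_tab [OF j] by simp
    have "act ?Q 1 j (act ?Q 2 [1, 2] \<sigma>) = act ?Q 2 (tab m (\<lambda>l. [1, 2] ! (j ! l))) \<sigma>"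
      using act_face [OF Q(2) \<sigma>(1), of "[1, 2]" 1 m "\<lambda>l. j ! l"] j unfolding tj
      by (simp add: Delta_eval)
    also have "tab m (\<lambda>l. [1, 2] ! (j ! l)) = prism_index m (const m 1) j"
      unfolding tab_eq_iff replicate_tab using bit [OF j] by fastforce
    finally show ?thesis
      unfolding \<sigma>(3) unfolding act_post [OF X0(1) obj(3,1) fg(2) \<gamma> j] by simp
  qed
  obtain \<theta> where \<theta>: "smap (std 1) (Fun S X E') \<theta>"
    "\<And>m z. z \<in> Delta m 1 ==> post K X0 E C e1 m (\<theta> m z) = res K X0 C 1 z \<gamma> \<and>
        (\<forall>i\<in>Delta m 1. comp X0 m i (\<theta> m z) = act ?Q 2 (prism_index m i z) \<sigma>)"
    using slice_cells_ex [OF X simplicial_set_std, of 1, folded X0_def, OF c \<phi> en0 en1] by auto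
  define \<chi> where "\<chi> = \<theta> 1 [0, 1]"
  have i1: "[0, 1] \<in> Delta 1 1" by (simp add: Delta_eval)
  have \<chi>: "\<chi> \<in> simplices (Fun S X E') 1" unfolding \<chi>_def using smap_in [OF \<theta>(1)] i1 by simp
  have \<theta>\<chi>: "\<theta> m j = res K X0 E 1 j \<chi>" if "j \<in> Delta m 1" for m j
    using smap_act [OF \<theta>(1) that, of "[0, 1]"] i1 std_1_id [OF that] by (simp add: \<chi>_def X0_def)
  have \<chi>0: "res K X0 E 1 [0] \<chi> = e"
  proof -
    have "\<theta> 0 [0] = res K X0 E 0 [0] e"
    proof (rule slice_cells_unique [OF X, of "std 0" "\<lambda>m \<alpha>. \<theta> m \<alpha>" "\<lambda>m \<alpha>. res K X0 E 0 \<alpha> e" "[0]" 0])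
      have "x \<in> Delta m 1" if "x \<in> Delta m 0" for x m using that by (auto simp: Delta_def)
      then show "smap (std 0) (Fun S X E') (\<lambda>m \<alpha>. \<theta> m \<alpha>)"
        by (intro simplicial_mapI) (use smap_in [OF \<theta>(1)] smap_act [OF \<theta>(1)] in auto)
      show "smap (std 0) (Fun S X E') (\<lambda>m \<alpha>. res K X0 E 0 \<alpha> e)"
        using simplex_smap [OF X e] by (simp add: X0_def)
      fix m z assume "z \<in> simplices (std 0) m"
      then have z: "z = const m 0" using Delta_0_0 [of z m] by simp
      then have z1: "z \<in> Delta m 1" by simp
      have de: "res K X0 E 0 z e = dg (Fun K X0 E) m e" by (simp add: z dg_def)
      have "res K X0 C 1 z \<gamma> = dg (Fun K X0 C) m (fcomp K X0 E C e1 e)"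
        using act_const [OF fun_set [OF X0(1) obj(3)] \<gamma>, of 0 m] unfolding z \<gamma>0 by simp
      then show "post K (fst X) E C e1 m (\<theta> m z) = post K (fst X) E C e1 m (res K X0 E 0 z e)"
        unfolding de using \<theta>(2) [OF z1] X0 D e' by (simp add: post_dg flip: X0_def)
      fix i assume i: "i \<in> Delta m 1"
      have ti: "tab m (\<lambda>l. i ! l) = i" using Delta_eq_tab [OF i] by simp
      have "comp X0 m i (\<theta> m z) = act ?Q 2 (prism_index m i z) \<sigma>" using \<theta>(2) [OF z1] i by blast
      also have "prism_index m i z = tab m (\<lambda>l. [0, 1] ! (i ! l))"
        unfolding tab_eq_iff z replicate_tab using bit [OF i] by fastforce
      also have "act ?Q 2 \<dots> \<sigma> = act ?Q 1 i (act ?Q 2 [0, 1] \<sigma>)"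
        using act_face [OF Q(2) \<sigma>(1), of "[0, 1]" 1 m "\<lambda>l. i ! l"] i unfolding ti
        by (simp add: Delta_eval)
      also have "\<dots> = comp X0 m i (res K X0 E 0 z e)"
        unfolding \<sigma>(2) de comp_def unfolding act_pre [OF X0(1) D(1) obj(1) e'(1) D(4) i]
        by (simp add: cmp_dg_right)
      finally show "comp (fst X) m i (\<theta> m z) = comp (fst X) m i (res K X0 E 0 z e)"
        by (simp add: X0_def)
    qed (simp_all add: Delta_eval)
    moreover have "res K X0 E 0 [0] e = e"
      using ss_id [OF fun_set [OF X0(1) D(1)] e'(1)] by simp
    ultimately show ?thesis using \<theta>\<chi> [OF i01(1)] by simp
  qed
  have r\<chi>: "post K X0 E CB r 1 \<chi> = u"
  proof (rule bin_product_unique [OF CB X0(1) obj(3,2), where n = 1])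
    have "res K X0 C 1 [0, 1] \<gamma> = \<gamma>" using ss_id [OF fun_set [OF X0(1) obj(3)] \<gamma>] by simp
    then show "post K X0 CB C \<pi>1 1 (post K X0 E CB r 1 \<chi>) = post K X0 CB C \<pi>1 1 u"
      using \<theta>(2) [OF i1] e1_r [OF X \<chi>] by (simp add: \<gamma>_def X0_def \<chi>_def)
    show "post K X0 CB B \<pi>2 1 (post K X0 E CB r 1 \<chi>) = post K X0 CB B \<pi>2 1 u"
      using \<chi> u X0 D r_in(1) by (simp add: cells_S X0_def [symmetric] post_post r2)
  qed (use \<chi> u' X0 D r_in(1) in \<open>auto simp: cells_S X0_def\<close>)
  have "\<forall>m. \<forall>i\<in>Delta m 1. \<forall>j\<in>Delta m 1. comp X0 m i (res K X0 E 1 j \<chi>) = act ?Q 2 (prism_index m i j) \<sigma>"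
    using \<theta>(2) \<theta>\<chi> by metis
  then show ?thesis
    using \<sigma> \<chi> \<chi>0 r\<chi> unfolding X0_def \<gamma>_def by blast
qed

definition corner :: "nat \<Rightarrow> nat list \<Rightarrow> nat list \<Rightarrow> nat list \<Rightarrow> bool" where
  "corner m i j t \<longleftrightarrow> (\<exists>l\<le>m. i ! l = 0 \<and> j ! l = 1 \<and> t ! l = 1)"

lemma corner_after:
  assumes i: "i \<in> Delta m 1" and j: "j \<in> Delta m 1" and t: "t \<in> Delta m 1"
    and c: "corner m i j t" and l: "l \<le> m" "i ! l = 1"
  shows "j ! l = 1 \<and> t ! l = 1"
proof -
  obtain k where k: "k \<le> m" "i ! k = 0" "j ! k = 1" "t ! k = 1" using c by (auto simp: corner_def)
  have "k \<le> l" using Delta_mono [OF i, of l k] k l by (cases "k \<le> l") auto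
  then have "1 \<le> j ! l" "1 \<le> t ! l" using Delta_mono [OF j _ l(1), of k] Delta_mono [OF t _ l(1), of k] k by auto
  then show ?thesis using bit [OF j l(1)] bit [OF t l(1)] by auto
qed

lemma corner_reindex:
  assumes \<beta>: "\<beta> \<in> Delta k m" and c: "corner k (i \<odot> \<beta>) (j \<odot> \<beta>) (t \<odot> \<beta>)"
  shows "corner m i j t"
proof -
  obtain l where "l \<le> k" "(i \<odot> \<beta>) ! l = 0" "(j \<odot> \<beta>) ! l = 1" "(t \<odot> \<beta>) ! l = 1"
    using c unfolding corner_def by blast
  then show ?thesis
    unfolding corner_def using Delta_nth_le [OF \<beta>, of l] by (auto simp: nth_reindex [OF \<beta>] simp del: One_nat_def)
qed

lemma corner_index_in:
  assumes "i \<in> Delta m 1" "j \<in> Delta m 1" "t \<in> Delta m 1"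
  shows "tab m (\<lambda>l. i ! l + j ! l * t ! l) \<in> Delta m 2"
proof -
  have "i ! l + j ! l * t ! l \<le> 2" if "l \<le> m" for l
    using bit [OF assms(1) that] bit [OF assms(2) that] bit [OF assms(3) that] by auto
  then show ?thesis
    using Delta_mono [OF assms(1)] Delta_mono [OF assms(2)] Delta_mono [OF assms(3)]
    unfolding tab_in_Delta by (auto intro!: add_mono mult_le_mono)
qed

text \<open>The two halves of the component in \<open>lift_square\<close> meet where all of its vertices lie on one long edge.\<close>

lemma edge_of_triangle_and_tetrahedron:
  assumes Q: "simplicial_set Q" and \<tau>: "\<tau> \<in> simplices Q 2" and \<rho>: "\<rho> \<in> simplices Q 3"
    and eq: "act Q 2 [0, 2] \<tau> = act Q 3 [0, 3] \<rho>" and i: "i \<in> Delta m 1"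
  shows "act Q 2 (tab m (\<lambda>l. 2 * i ! l)) \<tau> = act Q 3 (tab m (\<lambda>l. 3 * i ! l)) \<rho>"
proof -
  have ti: "tab m (\<lambda>l. i ! l) = i" using Delta_eq_tab [OF i] by simp
  have "act Q 2 (tab m (\<lambda>l. 2 * i ! l)) \<tau> = act Q 2 (tab m (\<lambda>l. [0, 2] ! (i ! l))) \<tau>"
    using bit [OF i] by (intro arg_cong [where f = "\<lambda>a. act Q 2 a \<tau>"] tab_cong) fastforce
  also have "\<dots> = act Q 1 i (act Q 2 [0, 2] \<tau>)"
    using act_face [OF Q \<tau>, of "[0, 2]" 1 m "\<lambda>l. i ! l"] i unfolding ti by (simp add: Delta_eval)
  also have "\<dots> = act Q 3 (tab m (\<lambda>l. [0, 3] ! (i ! l))) \<rho>"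
    unfolding eq using act_face [OF Q \<rho>, of "[0, 3]" 1 m "\<lambda>l. i ! l"] i unfolding ti
    by (simp add: Delta_eval)
  also have "\<dots> = act Q 3 (tab m (\<lambda>l. 3 * i ! l)) \<rho>"
    using bit [OF i] by (intro arg_cong [where f = "\<lambda>a. act Q 3 a \<rho>"] tab_cong) fastforce
  finally show ?thesis .
qed

text \<open>A cube in the coordinates i, j, t is glued from a tetrahedron and a triangle. The triangle is used exactly for simplices with a vertex (0,1,1); such a simplex
has i = 1 only at the vertex (1,1,1) and, before the corner, i = 0. If a face of it avoids the corner, both prescriptions agree because the long
edges of the triangle and the tetrahedron coincide.\<close>

lemma corner_map:
  assumes Q: "simplicial_set Q" and \<tau>: "\<tau> \<in> simplices Q 2" and \<rho>: "\<rho> \<in> simplices Q 3"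
    and eq: "act Q 2 [0, 2] \<tau> = act Q 3 [0, 3] \<rho>"
  shows "smap (sprod (std 1) (sprod (std 1) (std 1))) Q (\<lambda>m (i, j, t).
    if corner m i j t then act Q 2 (tab m (\<lambda>l. i ! l + j ! l * t ! l)) \<tau> else act Q 3 (cube_index m i j t) \<rho>)"
    (is "smap _ _ ?\<phi>")
proof (rule simplicial_mapI)
  fix n x assume "x \<in> simplices (sprod (std 1) (sprod (std 1) (std 1))) n"
  then obtain i j t where x: "x = (i, j, t)" "i \<in> Delta n 1" "j \<in> Delta n 1" "t \<in> Delta n 1" by auto
  then show "?\<phi> n x \<in> simplices Q n"
    using ss_in [OF Q corner_index_in \<tau>] ss_in [OF Q cube_index_in [of i n j t 1], of \<rho>] \<rho> by (simp add: numeral_3_eq_3)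
next
  fix m n \<beta> x assume \<beta>: "\<beta> \<in> Delta m n" and "x \<in> simplices (sprod (std 1) (sprod (std 1) (std 1))) n"
  then obtain i j t where x: "x = (i, j, t)" "i \<in> Delta n 1" "j \<in> Delta n 1" "t \<in> Delta n 1" by auto
  have cu: "cube_index n i j t \<in> Delta n 3" using cube_index_in [OF x(2-4)] by (simp add: numeral_3_eq_3)
  note co = corner_index_in [OF x(2-4)]
  have cr: "cube_index n i j t \<odot> \<beta> = cube_index m (i \<odot> \<beta>) (j \<odot> \<beta>) (t \<odot> \<beta>)"
    "tab n (\<lambda>l. i ! l + j ! l * t ! l) \<odot> \<beta> = tab m (\<lambda>l. (i \<odot> \<beta>) ! l + (j \<odot> \<beta>) ! l * (t \<odot> \<beta>) ! l)"
    by (simp_all add: tab_reindex [OF \<beta>] tab_eq_iff nth_reindex [OF \<beta>])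
  have in': "i \<odot> \<beta> \<in> Delta m 1" "j \<odot> \<beta> \<in> Delta m 1" "t \<odot> \<beta> \<in> Delta m 1" using \<beta> x by auto
  show "?\<phi> m (act (sprod (std 1) (sprod (std 1) (std 1))) n \<beta> x) = act Q n \<beta> (?\<phi> n x)"
  proof (cases "corner n i j t")
    case False
    then have "\<not> corner m (i \<odot> \<beta>) (j \<odot> \<beta>) (t \<odot> \<beta>)" using corner_reindex [OF \<beta>] by blast
    then show ?thesis using False cr ss_comp [OF Q \<beta> cu \<rho>] by (simp add: x)
  next
    case True
    show ?thesis
    proof (cases "corner m (i \<odot> \<beta>) (j \<odot> \<beta>) (t \<odot> \<beta>)")
      case True
      then show ?thesis using \<open>corner n i j t\<close> cr ss_comp [OF Q \<beta> co \<tau>] by (simp add: x)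
    next
      case False
      have v: "(i \<odot> \<beta>) ! l = 1 ==> (j \<odot> \<beta>) ! l = 1 \<and> (t \<odot> \<beta>) ! l = 1" if "l \<le> m" for l
        using corner_after [OF x(2-4) True, of "\<beta> ! l"] Delta_nth_le [OF \<beta> that] that by (simp add: nth_reindex [OF \<beta>])
      have z: "(i \<odot> \<beta>) ! l = 0 ==> (j \<odot> \<beta>) ! l = 0 \<or> (t \<odot> \<beta>) ! l = 0" if "l \<le> m" for l
      proof -
        assume "(i \<odot> \<beta>) ! l = 0"
        with False that have "(j \<odot> \<beta>) ! l \<noteq> 1 \<or> (t \<odot> \<beta>) ! l \<noteq> 1" unfolding corner_def by meson
        then show ?thesis using bit [OF in'(2) that] bit [OF in'(3) that] by linarith
      qed
      have "tab m (\<lambda>l. (i \<odot> \<beta>) ! l + (j \<odot> \<beta>) ! l * (t \<odot> \<beta>) ! l) = tab m (\<lambda>l. 2 * (i \<odot> \<beta>) ! l)"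
        using v z bit [OF in'(1)] by (intro tab_cong) fastforce
      moreover have "cube_index m (i \<odot> \<beta>) (j \<odot> \<beta>) (t \<odot> \<beta>) = tab m (\<lambda>l. 3 * (i \<odot> \<beta>) ! l)"
        using v z bit [OF in'(1)] by (intro tab_cong) fastforce
      ultimately show ?thesis
        using True False cr(2) ss_comp [OF Q \<beta> co \<tau>] edge_of_triangle_and_tetrahedron [OF Q \<tau> \<rho> eq in'(1)]
        by (simp add: x)
    qed
  qed
qed

text \<open>The component of \<open>\<omega>\<close> is a square with diagonal, hence two triangles of A. One of them, the lift \<open>\<sigma>\<close> and a degenerate triangle are the faces 013, 012 and 123 of
an inner horn. Its filler \<open>\<rho>\<close> gives the part of the comparison that avoids the corner (0,1,1), and the other triangle of \<open>\<omega>\<close> gives the rest.\<close>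

lemma lift_square:
  assumes X: "X \<in> Obj S" and \<omega>: "\<omega> \<in> simplices (Fun S X E') 1" and \<sigma>: "\<sigma> \<in> cells (fst X) A 2"
    and \<sigma>01: "res K (fst X) A 2 [0, 1] \<sigma> = pre K (fst X) E A (res K (fst X) E 1 [0] \<omega>) 1 \<kappa>"
    and \<sigma>12: "res K (fst X) A 2 [1, 2] \<sigma> = post K (fst X) C A g 1 (post K (fst X) E C e1 1 \<omega>)"
  shows "\<exists>\<rho>\<in>cells (fst X) A 3. \<exists>\<theta>. smap (sprod (std 1) (std 1)) (Fun S X E') \<theta> \<and>
    res K (fst X) A 3 [0, 1, 2] \<rho> = \<sigma> \<and>
    res K (fst X) A 3 [0, 1, 3] \<rho> = comp (fst X) 2 [0, 1, 1] (res K (fst X) E 1 [0, 0, 1] \<omega>) \<and>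
    res K (fst X) A 3 [1, 2, 3] \<rho> =
      res K (fst X) A 1 [0, 1, 1] (post K (fst X) C A g 1 (post K (fst X) E C e1 1 \<omega>)) \<and>
    (\<forall>m. \<forall>j\<in>Delta m 1. \<forall>t\<in>Delta m 1.
      post K (fst X) E C e1 m (\<theta> m (j, t)) = res K (fst X) C 1 j (post K (fst X) E C e1 1 \<omega>) \<and>
      (\<forall>i\<in>Delta m 1. comp (fst X) m i (\<theta> m (j, t)) =
        (if corner m i j t
         then res K (fst X) A 2 (tab m (\<lambda>l. i ! l + j ! l * t ! l))
            (comp (fst X) 2 [0, 0, 1] (res K (fst X) E 1 [0, 1, 1] \<omega>))
         else res K (fst X) A 3 (cube_index m i j t) \<rho>)))"
proof -
  define X0 where "X0 = fst X"
  let ?Q = "Fun K X0 A"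
  have X0: "ob X0" "snd X \<in> functors K X0 B" using obj_S [OF X] by (simp_all add: X0_def)
  have Q: "quasi_category ?Q" "simplicial_set ?Q" using hom_quasi X0 obj by simp_all
  have \<omega>': "\<omega> \<in> cells X0 E 1" using \<omega> by (simp add: cells_S X0_def)
  define \<gamma> where "\<gamma> = post K X0 E C e1 1 \<omega>"
  have \<gamma>: "\<gamma> \<in> cells X0 C 1" using \<omega>' X0 D by (simp add: \<gamma>_def)
  have g\<gamma>: "post K X0 C A g 1 \<gamma> \<in> simplices ?Q 1" using \<gamma> X0 D by simp
  note \<sigma> = assms(3) [folded X0_def] and \<sigma>01 = \<sigma>01 [folded X0_def] and \<sigma>12 = \<sigma>12 [folded X0_def, folded \<gamma>_def]
  have \<omega>_smap: "smap (std 1) (Fun K X0 E) (\<lambda>m j. res K X0 E 1 j \<omega>)"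
    by (rule smap_of_simplex) (use X0 D \<omega>' in simp_all)
  define s where "s m i j = comp X0 m i (res K X0 E 1 j \<omega>)" for m i j
  have s_smap: "smap (sprod (std 1) (std 1)) ?Q (\<lambda>m (i, j). s m i j)"
    unfolding s_def by (rule comp_smap [OF X0(1) \<omega>_smap])
  have s_in: "s m i j \<in> simplices ?Q m" if "i \<in> Delta m 1" "j \<in> Delta m 1" for m i j
    using smap_in [OF s_smap, of "(i, j)" m] that by simp
  have s_act: "act ?Q m \<beta> (s m i j) = s k (i \<odot> \<beta>) (j \<odot> \<beta>)" if "i \<in> Delta m 1" "j \<in> Delta m 1" "\<beta> \<in> Delta k m" for m k i j \<beta>
    using smap_act [OF s_smap that(3), of "(i, j)"] that by simp
  have s_i1: "s m (const m 1) j = act ?Q 1 j (post K X0 C A g 1 \<gamma>)" if j: "j \<in> Delta m 1" for m j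
    unfolding s_def \<gamma>_def using comp_1 [OF X0(1), of "res K X0 E 1 j \<omega>" m] X0 D \<omega>' j
    by (simp add: act_cells act_post)
  have \<omega>S: "res K X0 E 1 j \<omega> \<in> simplices (Fun S X E') m" if "j \<in> Delta m 1" for m j
    using ss_in [OF slice_set [OF X] that \<omega>] by (simp add: X0_def)
  have s_i0: "s m (const m 0) j = dg ?Q m (fcomp K X0 B A f (snd X))" if j: "j \<in> Delta m 1" for m j
    unfolding s_def using comp_0 [OF X \<omega>S [OF j]] by (simp add: X0_def)
  have L: "[0, 1] \<in> Delta 1 1" "[0, 0] \<in> Delta 1 1" "[1, 1] \<in> Delta 1 1" "[0, 1, 1] \<in> Delta 2 1" "[0, 0, 1] \<in> Delta 2 1"
    "[0, 1] \<in> Delta 1 2" "[0, 2] \<in> Delta 1 2" "[1, 2] \<in> Delta 1 2" "[0] \<in> Delta 0 1"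
    by (simp_all add: Delta_eval)
  note L3 = s_in [OF L(4,5)] s_in [OF L(5,4)]
  have s00: "s m i (const m 0) = act ?Q 1 i (act ?Q 2 [0, 1] \<sigma>)" if i: "i \<in> Delta m 1" for m i
    unfolding s_def comp_def \<sigma>01
    using act_pre [OF X0(1) D(1) obj(1) act_cells [OF X0(1) D(1) \<omega>' L(9)] D(4) i]
      act_const [OF fun_set [OF X0(1) D(1)] \<omega>', of 0 m]
    by (simp add: cmp_dg_right)
  define c where "c = act ?Q 1 [0, 1, 1] (post K X0 C A g 1 \<gamma>)"
  have c: "c \<in> simplices ?Q 2" unfolding c_def by (rule ss_in [OF Q(2) L(4) g\<gamma>])
  have gid: "act ?Q 1 [0, 1] (post K X0 C A g 1 \<gamma>) = post K X0 C A g 1 \<gamma>"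
    using ss_id [OF Q(2) g\<gamma>] by simp
  have c_edges: "act ?Q 2 [0, 1] c = post K X0 C A g 1 \<gamma>" "act ?Q 2 [0, 2] c = post K X0 C A g 1 \<gamma>"
    unfolding c_def using g\<gamma> gid by (simp_all add: act_act_list [OF Q(2)] monotone_list_def)
  have \<sigma>01_s: "act ?Q 2 [0, 1] \<sigma> = s 1 [0, 1] [0, 0]"
    using s00 [OF L(1)] ss_id [OF Q(2), of "act ?Q 2 [0, 1] \<sigma>" 1] ss_in [OF Q(2) L(6) \<sigma>] by (simp add: replicate_Suc)
  have "\<exists>\<rho>\<in>simplices ?Q 3. act ?Q 3 [0, 1, 2] \<rho> = \<sigma> \<and> act ?Q 3 [0, 1, 3] \<rho> = s 2 [0, 1, 1] [0, 0, 1] \<and>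
      act ?Q 3 [1, 2, 3] \<rho> = c"
  proof (rule fill3 [OF Q(1) \<sigma> L3(1) c])
    show "act ?Q 2 [0, 1] \<sigma> = act ?Q 2 [0, 1] (s 2 [0, 1, 1] [0, 0, 1])"
      unfolding \<sigma>01_s s_act [OF L(4,5,6)] by simp
    show "act ?Q 2 [1, 2] \<sigma> = act ?Q 2 [0, 1] c" unfolding \<sigma>12 c_edges ..
    show "act ?Q 2 [1, 2] (s 2 [0, 1, 1] [0, 0, 1]) = act ?Q 2 [0, 2] c"
      unfolding c_edges s_act [OF L(4,5,8)] using s_i1 [OF L(1)] gid by (simp add: replicate_Suc)
  qed
  then obtain \<rho> where \<rho>: "\<rho> \<in> simplices ?Q 3" "act ?Q 3 [0, 1, 2] \<rho> = \<sigma>"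
    "act ?Q 3 [0, 1, 3] \<rho> = s 2 [0, 1, 1] [0, 0, 1]" "act ?Q 3 [1, 2, 3] \<rho> = c" by blast
  let ?\<tau> = "s 2 [0, 0, 1] [0, 1, 1]"
  let ?\<phi> = "\<lambda>m (i, j, t). if corner m i j t then act ?Q 2 (tab m (\<lambda>l. i ! l + j ! l * t ! l)) ?\<tau>
    else act ?Q 3 (cube_index m i j t) \<rho>"
  have "act ?Q 3 [0, 3] \<rho> = act ?Q 2 [0, 2] (act ?Q 3 [0, 1, 3] \<rho>)"
    using \<rho>(1) by (simp add: act_act_list [OF Q(2)] monotone_list_def)
  then have eq: "act ?Q 2 [0, 2] ?\<tau> = act ?Q 3 [0, 3] \<rho>"
    unfolding \<rho>(3) s_act [OF L(4,5,7)] s_act [OF L(5,4,7)] by simp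
  have \<phi>: "smap (sprod (std 1) (sprod (std 1) (std 1))) ?Q ?\<phi>"
    by (rule corner_map [OF Q(2) L3(2) \<rho>(1) eq])
  have cm: "smap (sprod (std 1) (std 1)) (Fun K X0 C) (\<lambda>m (j, t). res K X0 C 1 j \<gamma>)"
    using smap_comp [OF fst_smap smap_of_simplex [OF fun_set [OF X0(1) obj(3)] \<gamma>]] by (simp add: case_prod_unfold)
  have en0: "?\<phi> m (const m 0, z) = dg ?Q m (fcomp K X0 B A f (snd X))"
    if z: "z \<in> simplices (sprod (std 1) (std 1)) m" for m z
  proof -
    obtain j t where jt: "z = (j, t)" "j \<in> Delta m 1" "t \<in> Delta m 1" using z by auto
    have c0: "const m 0 \<in> Delta m 1" by simp
    note w = corner_index_in [OF c0 jt(2,3)]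
    have "tab m (\<lambda>l. [0, 0, 1] ! (const m 0 ! l + j ! l * t ! l)) = const m 0"
      unfolding replicate_tab [of m 0] using bit [OF jt(2)] bit [OF jt(3)] by (intro tab_cong) fastforce
    then have "[0, 0, 1] \<odot> tab m (\<lambda>l. const m 0 ! l + j ! l * t ! l) = const m 0"
      unfolding reindex_tab_Delta [OF L(5) w] .
    then have 1: "act ?Q 2 (tab m (\<lambda>l. const m 0 ! l + j ! l * t ! l)) ?\<tau> = dg ?Q m (fcomp K X0 B A f (snd X))"
      unfolding s_act [OF L(5,4) w] using s_i0 [OF Delta_reindex [OF w L(4)]] by simp
    have v: "fcomp K X0 B A f (snd X) \<in> simplices ?Q 0" using X0 D by simp
    have "cube_index m (const m 0) j t = const m 0"
      by (simp add: replicate_tab tab_eq_iff)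
    then have "act ?Q 3 (cube_index m (const m 0) j t) \<rho> = dg ?Q m (act ?Q 3 [0] \<rho>)"
      using act_const [OF Q(2) \<rho>(1), of 0 m] by simp
    also have "act ?Q 3 [0] \<rho> = act ?Q 2 [0] (act ?Q 3 [0, 1, 3] \<rho>)"
      using \<rho>(1) by (simp add: act_act_list [OF Q(2)] monotone_list_def)
    also have "\<dots> = s 0 [0] [0]"
      unfolding \<rho>(3) using s_act [OF L(4,5), of "[0]" 0] by (simp add: Delta_eval)
    also have "\<dots> = fcomp K X0 B A f (snd X)"
      using s_i0 [OF L(9)] dg_0 [OF Q(2) v] by (simp add: replicate_Suc)
    finally show ?thesis using 1 by (simp add: jt)
  qed
  have en1: "?\<phi> m (const m 1, z) = post K X0 C A g m ((\<lambda>(j, t). res K X0 C 1 j \<gamma>) z)"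
    if z: "z \<in> simplices (sprod (std 1) (std 1)) m" for m z
  proof -
    obtain j t where jt: "z = (j, t)" "j \<in> Delta m 1" "t \<in> Delta m 1" using z by auto
    have nc: "\<not> corner m (const m 1) j t" by (auto simp: corner_def)
    have w: "prism_index m j t \<in> Delta m 2"
      using prism_index_in [OF jt(2,3)] by (simp add: numeral_2_eq_2)
    have "cube_index m (const m 1) j t = tab m (\<lambda>l. [1, 2, 3] ! (j ! l * (1 + t ! l)))"
      using bit [OF jt(2)] bit [OF jt(3)] by (intro tab_cong) (fastforce simp: nth_Cons')
    then have "act ?Q 3 (cube_index m (const m 1) j t) \<rho> = act ?Q 2 (prism_index m j t) c"
      using act_face [OF Q(2) \<rho>(1) _ w, of "[1, 2, 3]"] \<rho>(4) by (simp add: Delta_eval)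
    also have "\<dots> = act ?Q 1 (tab m (\<lambda>l. [0, 1, 1] ! (j ! l * (1 + t ! l)))) (post K X0 C A g 1 \<gamma>)"
      unfolding c_def by (rule act_face [OF Q(2) g\<gamma> L(4) w])
    also have "tab m (\<lambda>l. [0, 1, 1] ! (j ! l * (1 + t ! l))) = tab m (\<lambda>l. j ! l)"
      using bit [OF jt(2)] bit [OF jt(3)] by (intro tab_cong) (fastforce simp: nth_Cons')
    also have "\<dots> = j" using Delta_eq_tab [OF jt(2)] by simp
    finally show ?thesis
      using nc act_post [OF X0(1) obj(3,1) fg(2) \<gamma> jt(2)] by (simp add: jt)
  qed
  obtain \<theta> where \<theta>: "smap (sprod (std 1) (std 1)) (Fun S X E') \<theta>"
    "\<And>m z. z \<in> simplices (sprod (std 1) (std 1)) m ==> post K X0 E C e1 m (\<theta> m z) = (\<lambda>(j, t). res K X0 C 1 j \<gamma>) z \<and>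
        (\<forall>i\<in>Delta m 1. comp X0 m i (\<theta> m z) = ?\<phi> m (i, z))"
    using slice_cells_ex [OF X simplicial_set_sprod [OF simplicial_set_std simplicial_set_std], folded X0_def, OF cm \<phi> en0 en1] by blast
  show ?thesis
    unfolding X0_def [symmetric] \<gamma>_def [symmetric] s_def [symmetric] c_def [symmetric]
    by (rule bexI [OF _ \<rho>(1)], rule exI [of _ \<theta>]) (use \<theta> \<rho> in auto)
qed

end

context comma_slice
begin

lemma comp_reindex:
  assumes X: "X \<in> Obj S" and \<omega>: "\<omega> \<in> simplices (Fun S X E') 1"
    and i: "i \<in> Delta n 1" and j: "j \<in> Delta n 1" and w: "tab m F \<in> Delta m n"
  shows "res K (fst X) A n (tab m F) (comp (fst X) n i (res K (fst X) E 1 j \<omega>)) =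
    comp (fst X) m (tab m (\<lambda>l. i ! F l)) (res K (fst X) E 1 (tab m (\<lambda>l. j ! F l)) \<omega>)"
proof -
  have X0: "fst X \<in> Obj K" using obj_S [OF X] by simp
  have "smap (std 1) (Fun K (fst X) E) (\<lambda>m j. res K (fst X) E 1 j \<omega>)"
    by (rule smap_of_simplex) (use X0 D \<omega> in \<open>simp_all add: cells_S\<close>)
  from smap_act [OF comp_smap [OF X0 this] w, of "(i, j)"] show ?thesis
    using i j by (simp add: reindex_tab_Delta [OF i w] reindex_tab_Delta [OF j w])
qed

lemma comp_dg:
  assumes X: "ob X" and e: "e \<in> functors K X E" and i: "i \<in> Delta m 1"
  shows "comp X m i (dg (Fun K X E) m e) = res K X A 1 i (pre K X E A e 1 \<kappa>)"
  unfolding comp_def act_pre [OF X D(1) obj(1) e D(4) i] by (simp add: cmp_dg_right)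

lemma slice_dg_smap:
  assumes X: "X \<in> Obj S" and e: "e \<in> functors S X E'"
  shows "smap Z (Fun S X E') (\<lambda>m z. dg (Fun K (fst X) E) m e)"
  using enriched.dg_smap [OF enriched.intro [OF slice_category [OF obj(2)]] X E'_F'(1) e, of Z] by simp

lemma tab_id: "i \<in> Delta m n ==> tab m (\<lambda>l. i ! l) = i"
  using Delta_eq_tab [of i m n] by simp

text \<open>At t = 0 the component runs through the face 012, so it is the component of the lift. At t = 1 it consists of the two triangles of \<open>\<omega>\<close>. At j = 0 it runs
through the edge 01, which is constant in t.\<close>

lemma lift_square_faces:
  assumes X: "X \<in> Obj S" and \<omega>: "\<omega> \<in> simplices (Fun S X E') 1" and \<sigma>: "\<sigma> \<in> cells (fst X) A 2" and \<rho>: "\<rho> \<in> cells (fst X) A 3"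
    and \<sigma>01: "res K (fst X) A 2 [0, 1] \<sigma> = pre K (fst X) E A (res K (fst X) E 1 [0] \<omega>) 1 \<kappa>"
    and \<theta>: "smap (sprod (std 1) (std 1)) (Fun S X E') \<theta>"
    and \<rho>\<sigma>: "res K (fst X) A 3 [0, 1, 2] \<rho> = \<sigma>"
    and \<rho>\<omega>: "res K (fst X) A 3 [0, 1, 3] \<rho> = comp (fst X) 2 [0, 1, 1] (res K (fst X) E 1 [0, 0, 1] \<omega>)"
    and e1: "\<And>m j t. j \<in> Delta m 1 ==> t \<in> Delta m 1 ==>
      post K (fst X) E C e1 m (\<theta> m (j, t)) = res K (fst X) C 1 j (post K (fst X) E C e1 1 \<omega>)"
    and comp: "\<And>m i j t. i \<in> Delta m 1 ==> j \<in> Delta m 1 ==> t \<in> Delta m 1 ==> comp (fst X) m i (\<theta> m (j, t)) =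
        (if corner m i j t
         then res K (fst X) A 2 (tab m (\<lambda>l. i ! l + j ! l * t ! l))
            (comp (fst X) 2 [0, 0, 1] (res K (fst X) E 1 [0, 1, 1] \<omega>))
         else res K (fst X) A 3 (cube_index m i j t) \<rho>)"
  shows "\<chi> \<in> simplices (Fun S X E') 1 ==> post K (fst X) E C e1 1 \<chi> = post K (fst X) E C e1 1 \<omega> ==>
      (\<And>m i j. i \<in> Delta m 1 ==> j \<in> Delta m 1 ==>
        comp (fst X) m i (res K (fst X) E 1 j \<chi>) = res K (fst X) A 2 (prism_index m i j) \<sigma>) ==>
      j \<in> Delta m 1 ==> \<theta> m (j, const m 0) = res K (fst X) E 1 j \<chi>"
    and "j \<in> Delta m 1 ==> \<theta> m (j, const m 1) = res K (fst X) E 1 j \<omega>"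
    and "t \<in> Delta m 1 ==> \<theta> m (const m 0, t) = dg (Fun K (fst X) E) m (res K (fst X) E 1 [0] \<omega>)"
    and "j \<in> Delta m 1 ==> t \<in> Delta m 1 ==>
      post K (fst X) E CB r m (\<theta> m (j, t)) = res K (fst X) CB 1 j (post K (fst X) E CB r 1 \<omega>)"
proof -
  define X0 where "X0 = fst X"
  let ?Q = "Fun K X0 A"
  have X0: "ob X0" "snd X \<in> functors K X0 B" using obj_S [OF X] by (simp_all add: X0_def)
  have Q: "simplicial_set ?Q" using X0 obj by simp
  have \<omega>': "\<omega> \<in> cells X0 E 1" using \<omega> by (simp add: cells_S X0_def)
  define s where "s m i j = comp X0 m i (res K X0 E 1 j \<omega>)" for m i j
  note \<sigma> = \<sigma> [folded X0_def] and \<rho> = \<rho> [folded X0_def] and \<sigma>01 = \<sigma>01 [folded X0_def]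
    and \<rho>\<sigma> = \<rho>\<sigma> [folded X0_def] and \<rho>\<omega> = \<rho>\<omega> [folded X0_def, folded s_def]
    and e1 = e1 [folded X0_def] and comp = comp [folded X0_def, folded s_def]
  note s_tab = comp_reindex [OF X \<omega>, folded X0_def, folded s_def]
  note \<rho>_face = act_face [OF Q \<rho>]
  have L: "[0, 1, 1] \<in> Delta 2 1" "[0, 0, 1] \<in> Delta 2 1" "[0, 1, 2] \<in> Delta 2 3" "[0, 1, 3] \<in> Delta 2 3"
    "[0, 1] \<in> Delta 1 2" "[0, 1] \<in> Delta 1 3" "[0] \<in> Delta 0 1"
    by (simp_all add: Delta_eval)
  have c01: "const m 0 \<in> Delta m 1" "const m 1 \<in> Delta m 1" for m
    by simp_all
  have pr: "prism_index m i j \<in> Delta m 2" if "i \<in> Delta m 1" "j \<in> Delta m 1" for m i j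
    using prism_index_in [OF that] by (simp add: numeral_2_eq_2)
  have \<theta>_end: "smap (std 1) (Fun S X E') (\<lambda>m j. \<theta> m (j, const m v))" if "v \<le> 1" for v
    by (rule smap_comp [OF end_smap [OF that] \<theta>])
  have \<theta>_start: "smap (std 1) (Fun S X E') (\<lambda>m t. \<theta> m (const m 0, t))"
    by (rule smap_comp [OF start_smap \<theta>]) simp
  have e1_act: "post K X0 E C e1 m (res K X0 E 1 j x) = res K X0 C 1 j (post K X0 E C e1 1 x)"
    if "x \<in> cells X0 E 1" "j \<in> Delta m 1" for x j m
    using that X0 D by (simp add: act_post)
  {
    assume \<chi>: "\<chi> \<in> simplices (Fun S X E') 1" "post K (fst X) E C e1 1 \<chi> = post K (fst X) E C e1 1 \<omega>"
      "\<And>m i j. i \<in> Delta m 1 ==> j \<in> Delta m 1 ==>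
        comp (fst X) m i (res K (fst X) E 1 j \<chi>) = res K (fst X) A 2 (prism_index m i j) \<sigma>"
      and j: "j \<in> Delta m 1"
    note \<chi> = \<chi> [folded X0_def]
    have \<chi>': "\<chi> \<in> cells X0 E 1" using \<chi>(1) by (simp add: cells_S X0_def)
    show "\<theta> m (j, const m 0) = res K (fst X) E 1 j \<chi>"
      unfolding X0_def [symmetric]
    proof (rule slice_cells_unique [OF X simplicial_set_std [of 1] \<theta>_end simplex_smap [OF X \<chi>(1)], folded X0_def])
      fix m i j assume i: "i \<in> Delta m 1" and "j \<in> simplices (std 1) m"
      then have j: "j \<in> Delta m 1" by simp
      have nc: "\<not> corner m i j (const m 0)" by (auto simp: corner_def)
      have "cube_index m i j (const m 0) = tab m (\<lambda>l. [0, 1, 2] ! (i ! l * (1 + j ! l)))"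
        using bit [OF i] bit [OF j] by (intro tab_cong) (fastforce simp: nth_Cons')
      then show "comp X0 m i (\<theta> m (j, const m 0)) = comp X0 m i (res K X0 E 1 j \<chi>)"
        using nc \<chi>(3) [OF i j] \<rho>_face [OF L(3) pr [OF i j], unfolded \<rho>\<sigma>]
        by (simp add: comp [OF i j c01(1)])
    qed (use j c01 e1 e1_act [OF \<chi>'] \<chi>(2) in \<open>simp_all add: X0_def del: One_nat_def\<close>)
  }
  show "\<theta> m (j, const m 1) = res K (fst X) E 1 j \<omega>" if j: "j \<in> Delta m 1"
    unfolding X0_def [symmetric]
  proof (rule slice_cells_unique [OF X simplicial_set_std [of 1] \<theta>_end simplex_smap [OF X \<omega>], folded X0_def])
    fix m i j assume i: "i \<in> Delta m 1" and "j \<in> simplices (std 1) m"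
    then have j: "j \<in> Delta m 1" by simp
    show "comp X0 m i (\<theta> m (j, const m 1)) = comp X0 m i (res K X0 E 1 j \<omega>)"
    proof (cases "corner m i j (const m 1)")
      case True
      note w = corner_index_in [OF i j c01(2)]
      have j1: "j ! l = 1" if "i ! l = 1" "l \<le> m" for l using corner_after [OF i j c01(2) True that(2,1)] by simp
      have "tab m (\<lambda>l. [0, 0, 1] ! (i ! l + j ! l * const m 1 ! l)) = tab m (\<lambda>l. i ! l)"
        "tab m (\<lambda>l. [0, 1, 1] ! (i ! l + j ! l * const m 1 ! l)) = tab m (\<lambda>l. j ! l)"
        using bit [OF i] bit [OF j] j1 by (intro tab_cong; fastforce simp: nth_Cons')+
      then show ?thesis
        using True s_tab [OF L(2,1) w] unfolding comp [OF i j c01(2)] tab_id [OF i] tab_id [OF j] by (simp add: s_def)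
    next
      case False
      have j0: "j ! l = 0" if "i ! l = 0" "l \<le> m" for l
        using False that bit [OF j that(2)] unfolding corner_def by auto
      have 1: "cube_index m i j (const m 1) = tab m (\<lambda>l. [0, 1, 3] ! (i ! l * (1 + j ! l)))"
        using bit [OF i] bit [OF j] by (intro tab_cong) (fastforce simp: nth_Cons')
      have "tab m (\<lambda>l. [0, 1, 1] ! (i ! l * (1 + j ! l))) = tab m (\<lambda>l. i ! l)"
        "tab m (\<lambda>l. [0, 0, 1] ! (i ! l * (1 + j ! l))) = tab m (\<lambda>l. j ! l)"
        using bit [OF i] bit [OF j] j0 by (intro tab_cong; fastforce simp: nth_Cons')+
      then show ?thesis
        using False s_tab [OF L(1,2) pr [OF i j]] \<rho>_face [OF L(4) pr [OF i j]]
        unfolding comp [OF i j c01(2)] tab_id [OF i] tab_id [OF j] 1 \<rho>\<omega> by (simp add: s_def)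
    qed
  qed (use j c01 e1 e1_act [OF \<omega>'] in \<open>simp_all add: X0_def del: One_nat_def\<close>)
  show "\<theta> m (const m 0, t) = dg (Fun K (fst X) E) m (res K (fst X) E 1 [0] \<omega>)" if t: "t \<in> Delta m 1"
  proof -
    define e where "e = res K X0 E 1 [0] \<omega>"
    have e: "e \<in> functors S X E'"
      using ss_in [OF slice_set [OF X] L(7) \<omega>] by (simp add: e_def X0_def)
    then have e': "e \<in> functors K X0 E" by (simp add: cells_S X0_def)
    show ?thesis
      unfolding X0_def [symmetric] e_def [symmetric]
    proof (rule slice_cells_unique [OF X simplicial_set_std [of 1] \<theta>_start slice_dg_smap [OF X e], folded X0_def])
      fix m t assume "t \<in> simplices (std 1) m"
      then have t: "t \<in> Delta m 1" by simp
      have "res K X0 C 1 (const m 0) (post K X0 E C e1 1 \<omega>) =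
          dg (Fun K X0 C) m (res K X0 C 1 [0] (post K X0 E C e1 1 \<omega>))"
        using X0 D \<omega>' by (intro act_const) simp_all
      also have "res K X0 C 1 [0] (post K X0 E C e1 1 \<omega>) = fcomp K X0 E C e1 e"
        using e1_act [OF \<omega>' L(7)] X0 D e' by (simp add: e_def post_0)
      finally show "post K X0 E C e1 m (\<theta> m (const m 0, t)) = post K X0 E C e1 m (dg (Fun K X0 E) m e)"
        using e1 [OF c01(1) t] X0 D e' by (simp add: post_dg)
      fix i assume i: "i \<in> Delta m 1"
      have nc: "\<not> corner m i (const m 0) t" by (auto simp: corner_def)
      have "cube_index m i (const m 0) t = tab m (\<lambda>l. [0, 1] ! (i ! l))"
        using bit [OF i] by (intro tab_cong) (fastforce simp: nth_Cons')
      then have "comp X0 m i (\<theta> m (const m 0, t)) = act ?Q 1 i (act ?Q 3 [0, 1] \<rho>)"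
        using nc \<rho>_face [OF L(6), of m "\<lambda>l. i ! l"] i tab_id [OF i]
        by (simp add: comp [OF i c01(1) t])
      also have "act ?Q 3 [0, 1] \<rho> = act ?Q 2 [0, 1] (act ?Q 3 [0, 1, 2] \<rho>)"
        using \<rho> by (simp add: act_act_list [OF Q] monotone_list_def)
      also have "\<dots> = pre K X0 E A e 1 \<kappa>" unfolding \<rho>\<sigma> \<sigma>01 e_def ..
      finally show "comp X0 m i (\<theta> m (const m 0, t)) = comp X0 m i (dg (Fun K X0 E) m e)"
        using comp_dg [OF X0(1) e' i] by simp
    qed (use t in simp)
  qed
  show "post K (fst X) E CB r m (\<theta> m (j, t)) = res K (fst X) CB 1 j (post K (fst X) E CB r 1 \<omega>)"
    if j: "j \<in> Delta m 1" and t: "t \<in> Delta m 1"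
    unfolding X0_def [symmetric]
  proof (rule bin_product_unique [OF CB X0(1) obj(3,2), where n = m])
    have \<theta>S: "\<theta> m (j, t) \<in> simplices (Fun S X E') m" using smap_in [OF \<theta>, of "(j, t)" m] j t by simp
    have \<omega>j: "res K X0 E 1 j \<omega> \<in> simplices (Fun S X E') m" using ss_in [OF slice_set [OF X] j \<omega>] by (simp add: X0_def)
    have r\<omega>: "res K X0 CB 1 j (post K X0 E CB r 1 \<omega>) = post K X0 E CB r m (res K X0 E 1 j \<omega>)"
      using X0 D r_in(1) \<omega>' j by (simp add: act_post)
    show "post K X0 CB C \<pi>1 m (post K X0 E CB r m (\<theta> m (j, t))) =
        post K X0 CB C \<pi>1 m (res K X0 CB 1 j (post K X0 E CB r 1 \<omega>))"
      unfolding r\<omega> using e1_r [OF X \<theta>S] e1_r [OF X \<omega>j] e1 [OF j t] e1_act [OF \<omega>' j] by (simp add: X0_def)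
    show "post K X0 CB B \<pi>2 m (post K X0 E CB r m (\<theta> m (j, t))) =
        post K X0 CB B \<pi>2 m (res K X0 CB 1 j (post K X0 E CB r 1 \<omega>))"
      unfolding r\<omega> using \<theta>S \<omega>j X0 D r_in(1) by (simp add: cells_S X0_def [symmetric] post_post r2)
    show "post K X0 E CB r m (\<theta> m (j, t)) \<in> cells X0 CB m"
      using \<theta>S X0 D r_in(1) by (simp add: cells_S X0_def)
    show "res K X0 CB 1 j (post K X0 E CB r 1 \<omega>) \<in> cells X0 CB m"
      unfolding r\<omega> using \<omega>j X0 D r_in(1) by (simp add: cells_S X0_def)
  qed
qed

text \<open>When \<open>\<omega>\<close> is itself the lift, the face 013 of \<open>\<rho>\<close> is \<open>\<sigma>\<close> too. A 4-simplex with \<open>\<rho>\<close> as face 0123 and degenerate faces 0124, 0134 and 1234 then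
gives a homotopy from the comparison to a constant square.\<close>

lemma lift_cube:
  assumes X: "X \<in> Obj S" and \<chi>: "\<chi> \<in> simplices (Fun S X E') 1" and \<sigma>: "\<sigma> \<in> cells (fst X) A 2" and \<rho>: "\<rho> \<in> cells (fst X) A 3"
    and \<chi>_comp: "\<And>m i j. i \<in> Delta m 1 ==> j \<in> Delta m 1 ==>
        comp (fst X) m i (res K (fst X) E 1 j \<chi>) = res K (fst X) A 2 (prism_index m i j) \<sigma>"
    and \<rho>_faces: "res K (fst X) A 3 [0, 1, 2] \<rho> = \<sigma>" "res K (fst X) A 3 [0, 1, 3] \<rho> = \<sigma>"
      "res K (fst X) A 3 [1, 2, 3] \<rho> = res K (fst X) A 1 [0, 1, 1] (post K (fst X) C A g 1 (post K (fst X) E C e1 1 \<chi>))"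
    and \<theta>: "smap (sprod (std 1) (std 1)) (Fun S X E') \<theta>"
    and e1: "\<And>m j t. j \<in> Delta m 1 ==> t \<in> Delta m 1 ==>
      post K (fst X) E C e1 m (\<theta> m (j, t)) = res K (fst X) C 1 j (post K (fst X) E C e1 1 \<chi>)"
    and comp: "\<And>m i j t. i \<in> Delta m 1 ==> j \<in> Delta m 1 ==> t \<in> Delta m 1 ==>
      comp (fst X) m i (\<theta> m (j, t)) = res K (fst X) A 3 (cube_index m i j t) \<rho>"
  shows "\<exists>\<xi>. smap (sprod (std 1) (std 2)) (Fun S X E') \<xi> \<and>
    (\<forall>m. \<forall>j\<in>Delta m 1. \<forall>t\<in>Delta m 1. \<xi> m (j, [0, 1] \<odot> t) = \<theta> m (j, t) \<and>
      \<xi> m (j, [0, 2] \<odot> t) = res K (fst X) E 1 j \<chi> \<and> \<xi> m (j, [1, 2] \<odot> t) = res K (fst X) E 1 j \<chi>)"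
proof -
  define X0 where "X0 = fst X"
  let ?Q = "Fun K X0 A"
  have X0: "ob X0" "snd X \<in> functors K X0 B" using obj_S [OF X] by (simp_all add: X0_def)
  have Q: "quasi_category ?Q" "simplicial_set ?Q" using hom_quasi X0 obj by simp_all
  have \<chi>': "\<chi> \<in> cells X0 E 1" using \<chi> by (simp add: cells_S X0_def)
  define \<gamma> where "\<gamma> = post K X0 E C e1 1 \<chi>"
  have \<gamma>: "\<gamma> \<in> cells X0 C 1" using \<chi>' X0 D by (simp add: \<gamma>_def)
  have g\<gamma>: "post K X0 C A g 1 \<gamma> \<in> simplices ?Q 1" using \<gamma> X0 D by simp
  note \<sigma> = \<sigma> [folded X0_def] and \<rho> = \<rho> [folded X0_def] and \<chi>_comp = \<chi>_comp [folded X0_def]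
    and \<rho>_faces = \<rho>_faces [folded X0_def, folded \<gamma>_def]
    and e1 = e1 [folded X0_def, folded \<gamma>_def] and comp = comp [folded X0_def]
  note ev = act_act_list [OF Q(2)] act_list_in [OF Q(2)] monotone_list_def
  have L: "[0, 1, 2] \<in> Delta 2 3" "[0, 1] \<in> Delta 1 2" "[0, 2] \<in> Delta 1 2" "[1, 2] \<in> Delta 1 2"
    "[0, 1, 1, 1] \<in> Delta 3 1" "[0, 1, 2, 2] \<in> Delta 3 2" "[0] \<in> Delta 0 1"
    by (simp_all add: Delta_eval)
  have L4: "[0, 1, 2, 3] \<in> Delta 3 4" "[0, 1, 2, 4] \<in> Delta 3 4" "[0, 1, 3, 4] \<in> Delta 3 4" "[1, 2, 3, 4] \<in> Delta 3 4"
    by (simp_all add: Delta_eval)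
  define b where "b = act ?Q 2 [0, 1, 2, 2] \<sigma>"
  define c where "c = act ?Q 1 [0, 1, 1, 1] (post K X0 C A g 1 \<gamma>)"
  have b: "b \<in> simplices ?Q 3" unfolding b_def by (rule ss_in [OF Q(2) L(6) \<sigma>])
  have c: "c \<in> simplices ?Q 3" unfolding c_def by (rule ss_in [OF Q(2) L(5) g\<gamma>])
  have \<sigma>id: "act ?Q 2 [0, 1, 2] \<sigma> = \<sigma>" using ss_id [OF Q(2) \<sigma>] by (simp add: numeral_2_eq_2)
  have b_faces: "act ?Q 3 [0, 1, 2] b = \<sigma>" "act ?Q 3 [0, 1, 3] b = \<sigma>"
    using \<sigma> \<sigma>id by (simp_all add: b_def ev)
  have "act ?Q 2 [1, 2] \<sigma> = act ?Q 2 [1, 2] (act ?Q 3 [0, 1, 3] \<rho>)" by (simp only: \<rho>_faces)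
  also have "\<dots> = act ?Q 2 [0, 2] (act ?Q 3 [1, 2, 3] \<rho>)" using \<rho> by (simp add: ev)
  also have "\<dots> = act ?Q 1 [0, 1] (post K X0 C A g 1 \<gamma>)" unfolding \<rho>_faces using g\<gamma> by (simp add: ev)
  finally have \<sigma>12: "act ?Q 2 [1, 2] \<sigma> = act ?Q 1 [0, 1] (post K X0 C A g 1 \<gamma>)" .
  have "act ?Q 3 [1, 2, 3] b = act ?Q 1 [0, 1, 1] (act ?Q 2 [1, 2] \<sigma>)" using \<sigma> by (simp add: b_def ev)
  then have b123: "act ?Q 3 [1, 2, 3] b = act ?Q 1 [0, 1, 1] (post K X0 C A g 1 \<gamma>)"
    unfolding \<sigma>12 using g\<gamma> by (simp add: ev)
  have c_faces: "act ?Q 3 s c = act ?Q 1 [0, 1, 1] (post K X0 C A g 1 \<gamma>)" if "s \<in> {[0, 1, 2], [0, 1, 3], [0, 2, 3]}" for s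
    using that g\<gamma> by (auto simp: c_def ev)
  have "\<exists>\<Theta>\<in>simplices ?Q 4. act ?Q 4 [0, 1, 2, 3] \<Theta> = \<rho> \<and> act ?Q 4 [0, 1, 2, 4] \<Theta> = b \<and>
    act ?Q 4 [0, 1, 3, 4] \<Theta> = b \<and> act ?Q 4 [1, 2, 3, 4] \<Theta> = c"
    by (rule fill4 [OF Q(1) \<rho> b b c]) (simp_all only: \<rho>_faces b_faces b123 c_faces insertI1 insertI2)
  then obtain \<Theta> where \<Theta>: "\<Theta> \<in> simplices ?Q 4" "act ?Q 4 [0, 1, 2, 3] \<Theta> = \<rho>" "act ?Q 4 [0, 1, 2, 4] \<Theta> = b"
    "act ?Q 4 [0, 1, 3, 4] \<Theta> = b" "act ?Q 4 [1, 2, 3, 4] \<Theta> = c" by blast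
  let ?\<phi> = "\<lambda>m (i, j, t). act ?Q 4 (cube_index m i j t) \<Theta>"
  have n4: "Suc (Suc 2) = 4" by simp
  have \<phi>: "smap (sprod (std 1) (sprod (std 1) (std 2))) ?Q ?\<phi>"
    using smap_comp [OF cube_index_smap [of 2, unfolded n4] smap_of_simplex [OF Q(2) \<Theta>(1)]]
    by (simp add: case_prod_unfold)
  have cm: "smap (sprod (std 1) (std 2)) (Fun K X0 C) (\<lambda>m (j, t). res K X0 C 1 j \<gamma>)"
    using smap_comp [OF fst_smap smap_of_simplex [OF fun_set [OF X0(1) obj(3)] \<gamma>]] by (simp add: case_prod_unfold)
  have v: "fcomp K X0 B A f (snd X) \<in> simplices ?Q 0" using X0 D by simp
  have en0: "?\<phi> m (const m 0, z) = dg ?Q m (fcomp K X0 B A f (snd X))"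
    if z: "z \<in> simplices (sprod (std 1) (std 2)) m" for m z
  proof -
    obtain j t where jt: "z = (j, t)" by (cases z)
    have "cube_index m (const m 0) j t = const m 0"
      by (simp add: replicate_tab tab_eq_iff)
    then have "?\<phi> m (const m 0, z) = dg ?Q m (act ?Q 4 [0] \<Theta>)"
      using act_const [OF Q(2) \<Theta>(1), of 0 m] by (simp add: jt)
    also have "act ?Q 4 [0] \<Theta> = act ?Q 3 [0] (act ?Q 4 [0, 1, 2, 3] \<Theta>)"
      using \<Theta>(1) by (simp add: ev)
    also have "\<dots> = act ?Q 2 [0] \<sigma>" unfolding \<Theta>(2) \<rho>_faces(1) [symmetric] using \<rho> by (simp add: ev)
    also have "\<dots> = comp X0 0 [0] (res K X0 E 1 [0] \<chi>)"
      using \<chi>_comp [OF L(7) L(7)] by (simp add: tab_def)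
    also have "\<dots> = fcomp K X0 B A f (snd X)"
      using comp_0 [OF X, of "res K X0 E 1 [0] \<chi>" 0] ss_in [OF slice_set [OF X] L(7) \<chi>] dg_0 [OF Q(2) v]
      by (simp add: replicate_Suc X0_def)
    finally show ?thesis .
  qed
  have en1: "?\<phi> m (const m 1, z) = post K X0 C A g m ((\<lambda>(j, t). res K X0 C 1 j \<gamma>) z)"
    if z: "z \<in> simplices (sprod (std 1) (std 2)) m" for m z
  proof -
    obtain j t where jt: "z = (j, t)" "j \<in> Delta m 1" "t \<in> Delta m 2" using z by auto
    have t3: "t ! l = 0 \<or> t ! l = 1 \<or> t ! l = 2" if "l \<le> m" for l using Delta_nth_le [OF jt(3) that] by auto
    have w: "prism_index m j t \<in> Delta m 3"
      using prism_index_in [OF jt(2,3)] by (simp add: numeral_3_eq_3)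
    have "cube_index m (const m 1) j t = tab m (\<lambda>l. [1, 2, 3, 4] ! (j ! l * (1 + t ! l)))"
      using bit [OF jt(2)] t3 by (intro tab_cong) (fastforce simp: nth_Cons')
    then have "act ?Q 4 (cube_index m (const m 1) j t) \<Theta> = act ?Q 3 (prism_index m j t) c"
      using act_face [OF Q(2) \<Theta>(1) L4(4) w] \<Theta>(5) by simp
    also have "\<dots> = act ?Q 1 (tab m (\<lambda>l. [0, 1, 1, 1] ! (j ! l * (1 + t ! l)))) (post K X0 C A g 1 \<gamma>)"
      unfolding c_def by (rule act_face [OF Q(2) g\<gamma> L(5) w])
    also have "tab m (\<lambda>l. [0, 1, 1, 1] ! (j ! l * (1 + t ! l))) = tab m (\<lambda>l. j ! l)"
      using bit [OF jt(2)] t3 by (intro tab_cong) (fastforce simp: nth_Cons')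
    also have "\<dots> = j" by (rule tab_id [OF jt(2)])
    finally show ?thesis
      using act_post [OF X0(1) obj(3,1) fg(2) \<gamma> jt(2)] by (simp add: jt)
  qed
  obtain \<xi> where \<xi>: "smap (sprod (std 1) (std 2)) (Fun S X E') \<xi>"
    "\<And>m z. z \<in> simplices (sprod (std 1) (std 2)) m ==> post K X0 E C e1 m (\<xi> m z) = (\<lambda>(j, t). res K X0 C 1 j \<gamma>) z \<and>
        (\<forall>i\<in>Delta m 1. comp X0 m i (\<xi> m z) = ?\<phi> m (i, z))"
    using slice_cells_ex [OF X simplicial_set_sprod [OF simplicial_set_std simplicial_set_std], folded X0_def, OF cm \<phi> en0 en1] by blast
  have \<xi>_face: "smap (sprod (std 1) (std 1)) (Fun S X E') (\<lambda>m (j, t). \<xi> m (j, s \<odot> t))" if "s \<in> Delta 1 2" for s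
    using smap_comp [OF coord_smap [OF that] \<xi>(1)] by (simp add: case_prod_unfold)
  have \<chi>2: "smap (sprod (std 1) (std 1)) (Fun S X E') (\<lambda>m (j, t). res K X0 E 1 j \<chi>)"
    using smap_comp [OF fst_smap simplex_smap [OF X \<chi>]] by (simp add: case_prod_unfold X0_def)
  have e1\<chi>: "post K X0 E C e1 m (res K X0 E 1 j \<chi>) = res K X0 C 1 j \<gamma>" if "j \<in> Delta m 1" for j m
    using that X0 D \<chi>' by (simp add: act_post \<gamma>_def)
  have \<xi>2: "post K X0 E C e1 m (\<xi> m (j, s \<odot> t)) = res K X0 C 1 j \<gamma> \<and>
      (\<forall>i\<in>Delta m 1. comp X0 m i (\<xi> m (j, s \<odot> t)) = act ?Q 4 (cube_index m i j (tab m (\<lambda>l. s ! (t ! l)))) \<Theta>)"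
    if "j \<in> Delta m 1" "t \<in> Delta m 1" "s \<in> Delta 1 2" for m j t s
  proof -
    have "s \<odot> t = tab m (\<lambda>l. s ! (t ! l))"
      using reindex_tab_Delta [OF that(3), of m "\<lambda>l. t ! l"] tab_id [OF that(2)] that(2) by simp
    then show ?thesis using \<xi>(2) [of "(j, s \<odot> t)" m] Delta_reindex [OF that(2,3)] that(1) by simp
  qed
  have s_face: "act ?Q 4 (cube_index m i j (tab m (\<lambda>l. s ! (t ! l)))) \<Theta> = act ?Q 3 (cube_index m i j t) (act ?Q 4 [0, 1, s ! 0 + 2, s ! 1 + 2] \<Theta>)"
    if i: "i \<in> Delta m 1" and j: "j \<in> Delta m 1" and t: "t \<in> Delta m 1" and s: "s \<in> Delta 1 2" for m i j t s
  proof -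
    have cu: "cube_index m i j t \<in> Delta m 3" using cube_index_in [OF i j t] by (simp add: numeral_3_eq_3)
    have s4: "[0, 1, s ! 0 + 2, s ! 1 + 2] \<in> Delta 3 4"
      using Delta_nth_le [OF s, of 0] Delta_nth_le [OF s, of 1] Delta_mono [OF s, of 0 1] by (simp add: Delta_eval)
    have "cube_index m i j (tab m (\<lambda>l. s ! (t ! l))) = tab m (\<lambda>l. [0, 1, s ! 0 + 2, s ! 1 + 2] ! (i ! l * (1 + j ! l * (1 + t ! l))))"
      using bit [OF i] bit [OF j] bit [OF t] by (intro tab_cong) (fastforce simp: nth_Cons')
    then show ?thesis using act_face [OF Q(2) \<Theta>(1) s4 cu] by simp
  qed
  have b_cube: "act ?Q 3 (cube_index m i j t) b = act ?Q 2 (prism_index m i j) \<sigma>"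
    if i: "i \<in> Delta m 1" and j: "j \<in> Delta m 1" and t: "t \<in> Delta m 1" for m i j t
  proof -
    have cu: "cube_index m i j t \<in> Delta m 3" using cube_index_in [OF i j t] by (simp add: numeral_3_eq_3)
    have "tab m (\<lambda>l. [0, 1, 2, 2] ! (i ! l * (1 + j ! l * (1 + t ! l)))) = prism_index m i j"
      using bit [OF i] bit [OF j] bit [OF t] by (intro tab_cong) (fastforce simp: nth_Cons')
    then show ?thesis unfolding b_def using act_face [OF Q(2) \<sigma> L(6) cu] by simp
  qed
  have face01: "\<xi> m (j, [0, 1] \<odot> t) = \<theta> m (j, t)" if j: "j \<in> Delta m 1" and t: "t \<in> Delta m 1" for m j t
  proof -
    have s01: "act ?Q 4 [0, 1, [0, 1] ! 0 + 2, [0, 1] ! 1 + 2] \<Theta> = \<rho>" using \<Theta>(2) by (simp add: eval_nat_numeral)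
    have "(\<lambda>(j, t). \<xi> m (j, [0, 1] \<odot> t)) (j, t) = \<theta> m (j, t)"
    proof (rule slice_cells_unique [OF X simplicial_set_sprod [OF simplicial_set_std simplicial_set_std] \<xi>_face [OF L(2)] \<theta>, folded X0_def])
      fix m z assume "z \<in> simplices (sprod (std 1) (std 1)) m"
      then obtain j t where z: "z = (j, t)" "j \<in> Delta m 1" "t \<in> Delta m 1" by auto
      note * = \<xi>2 [OF z(2,3) L(2)]
      show "post K X0 E C e1 m ((\<lambda>(j, t). \<xi> m (j, [0, 1] \<odot> t)) z) = post K X0 E C e1 m (\<theta> m z)"
        using * e1 [OF z(2,3)] by (simp add: z(1))
      fix i assume i: "i \<in> Delta m 1"
      show "comp X0 m i ((\<lambda>(j, t). \<xi> m (j, [0, 1] \<odot> t)) z) = comp X0 m i (\<theta> m z)"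
        unfolding z(1) prod.case comp [OF i z(2,3)] *[THEN conjunct2, rule_format, OF i] s_face [OF i z(2,3) L(2)] s01 ..
    qed (use j t in simp)
    then show ?thesis by simp
  qed
  have face2: "\<xi> m (j, s \<odot> t) = res K X0 E 1 j \<chi>"
    if j: "j \<in> Delta m 1" and t: "t \<in> Delta m 1" and s: "s = [0, 2] \<or> s = [1, 2]" for m j t s
  proof -
    have s2: "s \<in> Delta 1 2" using s L by blast
    have sb: "act ?Q 4 [0, 1, s ! 0 + 2, s ! 1 + 2] \<Theta> = b" using s \<Theta> by (auto simp: eval_nat_numeral)
    have "(\<lambda>(j, t). \<xi> m (j, s \<odot> t)) (j, t) = (\<lambda>(j, t). res K X0 E 1 j \<chi>) (j, t)"
    proof (rule slice_cells_unique [OF X simplicial_set_sprod [OF simplicial_set_std simplicial_set_std] \<xi>_face [OF s2] \<chi>2, folded X0_def])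
      fix m z assume "z \<in> simplices (sprod (std 1) (std 1)) m"
      then obtain j t where z: "z = (j, t)" "j \<in> Delta m 1" "t \<in> Delta m 1" by auto
      note * = \<xi>2 [OF z(2,3) s2]
      show "post K X0 E C e1 m ((\<lambda>(j, t). \<xi> m (j, s \<odot> t)) z) = post K X0 E C e1 m ((\<lambda>(j, t). res K X0 E 1 j \<chi>) z)"
        using * e1\<chi> [OF z(2)] by (simp add: z(1))
      fix i assume i: "i \<in> Delta m 1"
      show "comp X0 m i ((\<lambda>(j, t). \<xi> m (j, s \<odot> t)) z) = comp X0 m i ((\<lambda>(j, t). res K X0 E 1 j \<chi>) z)"
        unfolding z(1) prod.case \<chi>_comp [OF i z(2)] *[THEN conjunct2, rule_format, OF i] s_face [OF i z(2,3) s2] sb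
          b_cube [OF i z(2,3)] ..
    qed (use j t in simp)
    then show ?thesis by simp
  qed
  show ?thesis
    unfolding X0_def [symmetric] using \<xi>(1) face01 face2 by blast
qed

end

context comma_slice
begin

lemma pre_comp:
  assumes "ob Z" "ob Y" "l \<in> functors K Z Y" "x \<in> cells Y E m" "i \<in> Delta m 1"
  shows "pre K Z Y A l m (comp Y m i x) = comp Z m i (pre K Z Y E l m x)"
  unfolding comp_def using assms D by (intro pre_cmp) (simp_all add: act_cells)

lemma pre_slice:
  assumes Z: "Z \<in> Obj S" and Y: "Y \<in> Obj S" and l: "l \<in> functors S Z Y" and x: "x \<in> simplices (Fun S Y E') n"
  shows "pre K (fst Z) (fst Y) E l n x \<in> simplices (Fun S Z E') n"
  using enriched.pre_in [OF enriched.intro [OF slice_category [OF obj(2)]] Z Y E'_F'(1) l x] by simp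

lemma slice_functor_in: "l \<in> functors S Z Y ==> l \<in> functors K (fst Z) (fst Y)"
  by (simp add: slice_simplices)

lemma comma_cocartesian_lifting: "cocartesian_lifting S E' F' r"
  unfolding cocartesian_lifting_def
proof (intro ballI impI)
  fix X e u
  assume X: "X \<in> Obj S" and e: "e \<in> functors S X E'" and u: "u \<in> simplices (Fun S X F') 1"
    and u0: "act (Fun S X F') 1 [0] u = fcomp S X E' F' r e"
  from lift_edge [OF X e u] u0
  obtain \<sigma> \<chi> where \<sigma>: "\<sigma> \<in> cells (fst X) A 2" and \<chi>: "\<chi> \<in> simplices (Fun S X E') 1"
    and \<sigma>01: "res K (fst X) A 2 [0, 1] \<sigma> = pre K (fst X) E A e 1 \<kappa>"
    and \<sigma>12: "res K (fst X) A 2 [1, 2] \<sigma> = post K (fst X) C A g 1 (post K (fst X) CB C \<pi>1 1 u)"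
    and \<chi>0: "res K (fst X) E 1 [0] \<chi> = e" and r\<chi>: "post K (fst X) E CB r 1 \<chi> = u"
    and \<chi>_comp: "\<And>m i j. i \<in> Delta m 1 ==> j \<in> Delta m 1 ==>
      comp (fst X) m i (res K (fst X) E 1 j \<chi>) = res K (fst X) A 2 (prism_index m i j) \<sigma>"
    by auto
  define X0 where "X0 = fst X"
  have X0: "ob X0" using obj_S [OF X] by (simp add: X0_def)
  note \<sigma> = \<sigma> [folded X0_def] and \<sigma>01 = \<sigma>01 [folded X0_def] and \<sigma>12 = \<sigma>12 [folded X0_def]
    and r\<chi> = r\<chi> [folded X0_def] and \<chi>_comp = \<chi>_comp [folded X0_def]
  have e': "e \<in> functors K X0 E" and u': "u \<in> cells X0 CB 1" and \<chi>': "\<chi> \<in> cells X0 E 1"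
    using e u \<chi> by (simp_all add: cells_S X0_def)
  have L: "[0, 1] \<in> Delta 1 2" "[0, 2] \<in> Delta 1 2" "[1, 2] \<in> Delta 1 2" "[0, 1, 1] \<in> Delta 2 1" "[0, 0, 1] \<in> Delta 2 1"
    "[0, 1, 2] \<in> Delta 2 3" "[0, 1, 3] \<in> Delta 2 3" "[1, 2, 3] \<in> Delta 2 3" "[0, 0, 2] \<in> Delta 2 2"
    by (simp_all add: Delta_eval)
  have pr: "prism_index m i j \<in> Delta m 2" if "i \<in> Delta m 1" "j \<in> Delta m 1" for m i j
    using prism_index_in [OF that] by (simp add: numeral_2_eq_2)
  have main: "\<exists>\<theta>. comparison_square S E' F' r Y (fcomp S Y X E' e h) (pre S Y X E' h 1 \<chi>) \<omega> \<theta>"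
    if Y: "Y \<in> Obj S" and h: "h \<in> functors S Y X" and \<omega>: "\<omega> \<in> simplices (Fun S Y E') 1"
      and \<omega>0: "act (Fun S Y E') 1 [0] \<omega> = fcomp S Y X E' e h"
      and r\<omega>: "post S Y E' F' r 1 \<omega> = pre S Y X F' h 1 u" for Y h \<omega>
  proof -
    define Y0 where "Y0 = fst Y"
    let ?Q = "Fun K Y0 A"
    have Y0: "ob Y0" using obj_S [OF Y] by (simp add: Y0_def)
    have h': "h \<in> functors K Y0 X0" and \<omega>': "\<omega> \<in> cells Y0 E 1"
      using slice_functor_in [OF h] \<omega> by (simp_all add: cells_S Y0_def X0_def)
    have \<omega>0': "res K Y0 E 1 [0] \<omega> = fcomp K Y0 X0 E e h" and r\<omega>': "post K Y0 E CB r 1 \<omega> = pre K Y0 X0 CB h 1 u"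
      using \<omega>0 r\<omega> by (simp_all add: Y0_def X0_def)
    have e1\<omega>: "post K Y0 E C e1 1 \<omega> = pre K Y0 X0 C h 1 (post K X0 CB C \<pi>1 1 u)"
      using e1_r [OF Y \<omega>] r\<omega>' Y0 X0 D h' u' by (simp add: Y0_def [symmetric] post_pre)
    define \<sigma>k where "\<sigma>k = pre K Y0 X0 A h 2 \<sigma>"
    have \<sigma>k: "\<sigma>k \<in> simplices ?Q 2" using Y0 X0 D h' \<sigma> by (simp add: \<sigma>k_def)
    have act_\<sigma>k: "act ?Q 2 \<alpha> \<sigma>k = pre K Y0 X0 A h m (res K X0 A 2 \<alpha> \<sigma>)" if "\<alpha> \<in> Delta m 2" for m \<alpha>
      unfolding \<sigma>k_def using Y0 X0 D h' \<sigma> that by (simp add: act_pre)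
    have s01: "act ?Q 2 [0, 1] \<sigma>k = pre K Y0 E A (res K Y0 E 1 [0] \<omega>) 1 \<kappa>"
      unfolding act_\<sigma>k [OF L(1)] \<sigma>01 \<omega>0' using Y0 X0 D h' e' by (simp add: pre_pre)
    have s12: "act ?Q 2 [1, 2] \<sigma>k = post K Y0 C A g 1 (post K Y0 E C e1 1 \<omega>)"
      unfolding act_\<sigma>k [OF L(3)] \<sigma>12 e1\<omega> using Y0 X0 D h' u' by (simp add: post_pre)
    obtain \<rho> \<theta> where \<rho>: "\<rho> \<in> simplices ?Q 3" and \<theta>: "smap (sprod (std 1) (std 1)) (Fun S Y E') \<theta>"
      and \<rho>1: "act ?Q 3 [0, 1, 2] \<rho> = \<sigma>k"
      and \<rho>2: "act ?Q 3 [0, 1, 3] \<rho> = comp Y0 2 [0, 1, 1] (res K Y0 E 1 [0, 0, 1] \<omega>)"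
      and \<rho>3: "act ?Q 3 [1, 2, 3] \<rho> = act ?Q 1 [0, 1, 1] (post K Y0 C A g 1 (post K Y0 E C e1 1 \<omega>))"
      and \<theta>_e1: "\<And>m j t. j \<in> Delta m 1 ==> t \<in> Delta m 1 ==>
        post K Y0 E C e1 m (\<theta> m (j, t)) = res K Y0 C 1 j (post K Y0 E C e1 1 \<omega>)"
      and \<theta>_comp: "\<And>m i j t. i \<in> Delta m 1 ==> j \<in> Delta m 1 ==> t \<in> Delta m 1 ==> comp Y0 m i (\<theta> m (j, t)) =
        (if corner m i j t then act ?Q 2 (tab m (\<lambda>l. i ! l + j ! l * t ! l))
            (comp Y0 2 [0, 0, 1] (res K Y0 E 1 [0, 1, 1] \<omega>))
         else act ?Q 3 (cube_index m i j t) \<rho>)"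
      using lift_square [OF Y \<omega>, folded Y0_def, OF \<sigma>k s01 s12] by blast
    note faces = lift_square_faces [OF Y \<omega>, folded Y0_def, OF \<sigma>k \<rho> s01 \<theta> \<rho>1 \<rho>2]
    define \<chi>h where "\<chi>h = pre K Y0 X0 E h 1 \<chi>"
    have \<chi>h: "\<chi>h \<in> simplices (Fun S Y E') 1"
      using pre_slice [OF Y X h \<chi>] by (simp add: \<chi>h_def X0_def Y0_def)
    have \<chi>h': "\<chi>h \<in> cells Y0 E 1" using \<chi>h by (simp add: cells_S Y0_def)
    have "post K X0 E C e1 1 \<chi> = post K X0 CB C \<pi>1 1 u"
      using e1_r [OF X \<chi>] r\<chi> by (simp add: X0_def)
    then have e1\<chi>h: "post K Y0 E C e1 1 \<chi>h = post K Y0 E C e1 1 \<omega>"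
      unfolding e1\<omega> \<chi>h_def using Y0 X0 D h' \<chi>' by (simp add: post_pre)
    have \<chi>h_comp: "comp Y0 m i (res K Y0 E 1 j \<chi>h) = act ?Q 2 (prism_index m i j) \<sigma>k"
      if i: "i \<in> Delta m 1" and j: "j \<in> Delta m 1" for m i j
    proof -
      have "comp Y0 m i (res K Y0 E 1 j \<chi>h) = comp Y0 m i (pre K Y0 X0 E h m (res K X0 E 1 j \<chi>))"
        unfolding \<chi>h_def using Y0 X0 D h' \<chi>' j by (simp add: act_pre)
      also have "\<dots> = pre K Y0 X0 A h m (comp X0 m i (res K X0 E 1 j \<chi>))"
        using Y0 X0 D h' \<chi>' i j by (intro pre_comp [symmetric]) (simp_all add: act_cells)
      finally show ?thesis unfolding \<chi>_comp [OF i j] act_\<sigma>k [OF pr [OF i j]] .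
    qed
    have cube: "\<exists>\<xi>. smap (sprod (std 1) (std 2)) (Fun S Z E') \<xi> \<and>
              (\<forall>m. \<forall>j\<in>Delta m 1. \<forall>t\<in>Delta m 1.
                 \<xi> m (j, [0, 1] \<odot> t) = pre K (fst Z) Y0 E l m (\<theta> m (j, t)) \<and>
                 \<xi> m (j, [0, 2] \<odot> t) = res K (fst Z) E 1 j (pre K (fst Z) Y0 E l 1 \<omega>) \<and>
                 \<xi> m (j, [1, 2] \<odot> t) = res K (fst Z) E 1 j (pre K (fst Z) Y0 E l 1 \<omega>))"
      if Z: "Z \<in> Obj S" and l: "l \<in> functors S Z Y" and l\<omega>: "pre K (fst Z) Y0 E l 1 \<omega> = pre K (fst Z) Y0 E l 1 \<chi>h" for Z l
    proof -
      define Z0 where "Z0 = fst Z"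
      let ?R = "Fun K Z0 A"
      have Z0: "ob Z0" using obj_S [OF Z] by (simp add: Z0_def)
      have l': "l \<in> functors K Z0 Y0" using slice_functor_in [OF l] by (simp add: Z0_def Y0_def)
      have R: "simplicial_set ?R" using Z0 obj by simp
      define \<eta> where "\<eta> = pre K Z0 Y0 E l 1 \<omega>"
      have \<eta>: "\<eta> \<in> simplices (Fun S Z E') 1"
        using pre_slice [OF Z Y l \<omega>] by (simp add: \<eta>_def Z0_def Y0_def)
      have \<eta>\<chi>: "\<eta> = pre K Z0 Y0 E l 1 \<chi>h" using l\<omega> by (simp add: \<eta>_def Z0_def)
      have act_\<eta>: "res K Z0 E 1 j \<eta> = pre K Z0 Y0 E l m (res K Y0 E 1 j \<omega>)" if "j \<in> Delta m 1" for m j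
        unfolding \<eta>_def using Z0 Y0 D l' \<omega>' that by (simp add: act_pre)
      define \<sigma>l where "\<sigma>l = pre K Z0 Y0 A l 2 \<sigma>k"
      define \<rho>l where "\<rho>l = pre K Z0 Y0 A l 3 \<rho>"
      have \<sigma>l: "\<sigma>l \<in> simplices ?R 2" using Z0 Y0 D l' \<sigma>k by (simp add: \<sigma>l_def)
      have \<rho>l: "\<rho>l \<in> simplices ?R 3" using Z0 Y0 D l' \<rho> by (simp add: \<rho>l_def)
      have act_\<sigma>l: "act ?R 2 \<alpha> \<sigma>l = pre K Z0 Y0 A l m (act ?Q 2 \<alpha> \<sigma>k)" if "\<alpha> \<in> Delta m 2" for m \<alpha>
        unfolding \<sigma>l_def using Z0 Y0 D l' \<sigma>k that by (simp add: act_pre)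
      have act_\<rho>l: "act ?R 3 \<alpha> \<rho>l = pre K Z0 Y0 A l m (act ?Q 3 \<alpha> \<rho>)" if "\<alpha> \<in> Delta m 3" for m \<alpha>
        unfolding \<rho>l_def using Z0 Y0 D l' \<rho> that by (simp add: act_pre)
      have \<eta>_comp: "comp Z0 m i (res K Z0 E 1 j \<eta>) = act ?R 2 (prism_index m i j) \<sigma>l"
        if i: "i \<in> Delta m 1" and j: "j \<in> Delta m 1" for m i j
      proof -
        have "comp Z0 m i (res K Z0 E 1 j \<eta>) = comp Z0 m i (pre K Z0 Y0 E l m (res K Y0 E 1 j \<chi>h))"
          unfolding \<eta>\<chi> using Z0 Y0 D l' \<chi>h' j by (simp add: act_pre)
        also have "\<dots> = pre K Z0 Y0 A l m (comp Y0 m i (res K Y0 E 1 j \<chi>h))"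
          using Z0 Y0 D l' \<chi>h' i j by (intro pre_comp [symmetric]) (simp_all add: act_cells)
        finally show ?thesis unfolding \<chi>h_comp [OF i j] act_\<sigma>l [OF pr [OF i j]] .
      qed
      have comp\<omega>: "pre K Z0 Y0 A l m (comp Y0 m i (res K Y0 E 1 j \<omega>)) = act ?R 2 (prism_index m i j) \<sigma>l"
        if i: "i \<in> Delta m 1" and j: "j \<in> Delta m 1" for m i j
        unfolding \<eta>_comp [OF that, symmetric] act_\<eta> [OF j]
        using Z0 Y0 D l' \<omega>' i j by (intro pre_comp) (simp_all add: act_cells)
      have e1\<eta>: "post K Z0 E C e1 1 \<eta> = pre K Z0 Y0 C l 1 (post K Y0 E C e1 1 \<omega>)"
        unfolding \<eta>_def using Z0 Y0 D l' \<omega>' by (simp add: post_pre)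
      have 1: "act ?R 3 [0, 1, 2] \<rho>l = \<sigma>l"
        unfolding act_\<rho>l [OF L(6)] \<rho>1 \<sigma>l_def ..
      have "prism_index 2 [0, 1, 1] [0, 0, 1] = [0..<Suc 2]" by (simp add: tab_def eval_nat_numeral)
      then have 2: "act ?R 3 [0, 1, 3] \<rho>l = \<sigma>l"
        unfolding act_\<rho>l [OF L(7)] \<rho>2 comp\<omega> [OF L(4,5)] using ss_id [OF R \<sigma>l] by simp
      have 3: "act ?R 3 [1, 2, 3] \<rho>l = act ?R 1 [0, 1, 1] (post K Z0 C A g 1 (post K Z0 E C e1 1 \<eta>))"
        unfolding act_\<rho>l [OF L(8)] \<rho>3 e1\<eta>
        using Z0 Y0 D l' \<omega>' L(4) by (simp add: post_pre act_pre)
      have \<theta>l: "smap (sprod (std 1) (std 1)) (Fun S Z E') (\<lambda>m z. pre K Z0 Y0 E l m (\<theta> m z))"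
        using smap_comp [OF \<theta> enriched.pre_smap [OF enriched.intro [OF slice_category [OF obj(2)]] Z Y E'_F'(1) l]]
        by (simp add: Z0_def Y0_def)
      have \<theta>_in: "\<theta> m (j, t) \<in> cells Y0 E m" if "j \<in> Delta m 1" "t \<in> Delta m 1" for m j t
        using smap_in [OF \<theta>, of "(j, t)" m] that by (simp add: cells_S Y0_def)
      have \<theta>l_e1: "post K Z0 E C e1 m (pre K Z0 Y0 E l m (\<theta> m (j, t))) = res K Z0 C 1 j (post K Z0 E C e1 1 \<eta>)"
        if j: "j \<in> Delta m 1" and t: "t \<in> Delta m 1" for m j t
        unfolding e1\<eta> using Z0 Y0 D l' \<omega>' \<theta>_in [OF that] \<theta>_e1 [OF that] j by (simp add: post_pre act_pre)
      have \<theta>l_comp: "comp Z0 m i (pre K Z0 Y0 E l m (\<theta> m (j, t))) = act ?R 3 (cube_index m i j t) \<rho>l"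
        if i: "i \<in> Delta m 1" and j: "j \<in> Delta m 1" and t: "t \<in> Delta m 1" for m i j t
      proof -
        have cu: "cube_index m i j t \<in> Delta m 3" using cube_index_in [OF i j t] by (simp add: numeral_3_eq_3)
        have c: "comp Z0 m i (pre K Z0 Y0 E l m (\<theta> m (j, t))) = pre K Z0 Y0 A l m (comp Y0 m i (\<theta> m (j, t)))"
          using Z0 Y0 l' \<theta>_in [OF j t] i by (intro pre_comp [symmetric])
        show ?thesis
        proof (cases "corner m i j t")
          case False
          then show ?thesis unfolding c \<theta>_comp [OF i j t] act_\<rho>l [OF cu] by simp
        next
          case True
          note w = corner_index_in [OF i j t]
          have jt: "j ! l = 1 \<and> t ! l = 1" if "i ! l = 1" "l \<le> m" for l using corner_after [OF i j t True that(2,1)] .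
          let ?\<tau> = "comp Y0 2 [0, 0, 1] (res K Y0 E 1 [0, 1, 1] \<omega>)"
          have "prism_index 2 [0, 0, 1] [0, 1, 1] = [0, 0, 2]" by (simp add: tab_def eval_nat_numeral)
          then have \<tau>: "pre K Z0 Y0 A l 2 ?\<tau> = act ?R 2 [0, 0, 2] \<sigma>l"
            using comp\<omega> [OF L(5,4)] by simp
          have \<tau>_in: "?\<tau> \<in> simplices ?Q 2"
            unfolding comp_def using Y0 D \<omega>' L by (intro cmp_in) (simp_all add: act_cells)
          have "comp Z0 m i (pre K Z0 Y0 E l m (\<theta> m (j, t))) = pre K Z0 Y0 A l m (act ?Q 2 (tab m (\<lambda>k. i ! k + j ! k * t ! k)) ?\<tau>)"
            unfolding c \<theta>_comp [OF i j t] using True by simp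
          also have "\<dots> = act ?R 2 (tab m (\<lambda>k. i ! k + j ! k * t ! k)) (pre K Z0 Y0 A l 2 ?\<tau>)"
            using Z0 Y0 D l' \<tau>_in w by (simp add: act_pre)
          also have "\<dots> = act ?R 2 (tab m (\<lambda>k. [0, 0, 2] ! (i ! k + j ! k * t ! k))) \<sigma>l"
            unfolding \<tau> by (rule act_face [OF R \<sigma>l L(9) w])
          also have "tab m (\<lambda>k. [0, 0, 2] ! (i ! k + j ! k * t ! k)) = tab m (\<lambda>k. 2 * i ! k)"
            using bit [OF i] bit [OF j] bit [OF t] jt by (intro tab_cong) (fastforce simp: nth_Cons')
          also have "act ?R 2 (tab m (\<lambda>k. 2 * i ! k)) \<sigma>l = act ?R 3 (tab m (\<lambda>k. 3 * i ! k)) \<rho>l"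
          proof (rule edge_of_triangle_and_tetrahedron [OF R \<sigma>l \<rho>l _ i])
            have "act ?R 2 [0, 2] \<sigma>l = act ?R 2 [0, 2] (act ?R 3 [0, 1, 3] \<rho>l)" by (simp only: 2)
            then show "act ?R 2 [0, 2] \<sigma>l = act ?R 3 [0, 3] \<rho>l"
              using \<rho>l by (simp add: act_act_list [OF R] monotone_list_def)
          qed
          also have "tab m (\<lambda>k. 3 * i ! k) = cube_index m i j t"
            using bit [OF i] jt by (intro tab_cong) fastforce
          finally show ?thesis .
        qed
      qed
      show ?thesis
        unfolding Z0_def [symmetric] \<eta>_def [symmetric]
        by (rule lift_cube [OF Z \<eta>, folded Z0_def, OF \<sigma>l \<rho>l _ 1 2 3 \<theta>l])
          ((rule \<eta>_comp \<theta>l_e1 \<theta>l_comp; assumption)+)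
    qed
    have face0: "\<theta> m (j, const m 0) = res K Y0 E 1 j \<chi>h" if "j \<in> Delta m 1" for m j
      by (rule faces(1) [OF _ _ \<chi>h e1\<chi>h _ that]) ((rule \<theta>_e1 \<theta>_comp \<chi>h_comp; assumption)+)
    have face1: "\<theta> m (j, const m 1) = res K Y0 E 1 j \<omega>" if "j \<in> Delta m 1" for m j
      by (rule faces(2) [OF _ _ that]) ((rule \<theta>_e1 \<theta>_comp; assumption)+)
    have face2: "\<theta> m (const m 0, t) = dg (Fun K Y0 E) m (res K Y0 E 1 [0] \<omega>)" if "t \<in> Delta m 1" for m t
      by (rule faces(3) [OF _ _ that]) ((rule \<theta>_e1 \<theta>_comp; assumption)+)
    have face3: "post K Y0 E CB r m (\<theta> m (j, t)) = res K Y0 CB 1 j (post K Y0 E CB r 1 \<omega>)"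
      if "j \<in> Delta m 1" "t \<in> Delta m 1" for m j t
      by (rule faces(4) [OF _ _ that]) ((rule \<theta>_e1 \<theta>_comp; assumption)+)
    show ?thesis
      unfolding comparison_square_def slice_simps slice_post slice_pre slice_dg fst_conv Y0_def [symmetric] X0_def [symmetric] \<chi>h_def [symmetric]
        \<omega>0' [symmetric]
    proof (rule exI [of _ \<theta>], intro conjI allI ballI impI)
      fix Z l assume Z: "Z \<in> {(E, p). ob E \<and> p \<in> Isofib K E B}" and l: "l \<in> functors S Z Y"
        and eq: "pre K (fst Z) Y0 E l 1 \<omega> = pre K (fst Z) Y0 E l 1 \<chi>h"
      from Z have "Z \<in> Obj S" by simp
      from cube [OF this l eq] show "\<exists>\<xi>. smap (sprod (std 1) (std 2)) (Fun S Z E') \<xi> \<and>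
              (\<forall>m. \<forall>j\<in>Delta m 1. \<forall>t\<in>Delta m 1.
                 \<xi> m (j, [0, 1] \<odot> t) = pre K (fst Z) Y0 E l m (\<theta> m (j, t)) \<and>
                 \<xi> m (j, [0, 2] \<odot> t) = res K (fst Z) E 1 j (pre K (fst Z) Y0 E l 1 \<omega>) \<and>
                 \<xi> m (j, [1, 2] \<odot> t) = res K (fst Z) E 1 j (pre K (fst Z) Y0 E l 1 \<omega>))" .
    qed (rule \<theta> face0 face1 face2 face3; assumption)+
  qed
  have "act (Fun S X E') 1 [0] \<chi> = e" "post S X E' F' r 1 \<chi> = u"
    using \<chi>0 r\<chi> by (simp_all add: X0_def)
  with \<chi> main show "\<exists>\<chi>\<in>simplices (Fun S X E') 1. act (Fun S X E') 1 [0] \<chi> = e \<and> post S X E' F' r 1 \<chi> = u \<and>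
           (\<forall>Y\<in>Obj S. \<forall>h\<in>functors S Y X. \<forall>\<omega>\<in>simplices (Fun S Y E') 1.
              act (Fun S Y E') 1 [0] \<omega> = fcomp S Y X E' e h \<longrightarrow> post S Y E' F' r 1 \<omega> = pre S Y X F' h 1 u \<longrightarrow>
              (\<exists>\<theta>. comparison_square S E' F' r Y (fcomp S Y X E' e h) (pre S Y X E' h 1 \<chi>) \<omega> \<theta>))"
    by (intro bexI [OF _ \<chi>] conjI ballI impI)
qed

theorem comma_cocartesian: "cocartesian_fibration S E' F' r"
  by (rule slice_cocartesian_fibration [OF obj(2) E'_F' r_in(2) comma_cocartesian_lifting])

end

context arrow_cosmos
begin

text \<open>The cartesian half is the cocartesian half in the dual, where the comma has its legs exchanged.\<close>

lemma comma_cocartesian_cartesian: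
  assumes obj: "ob A" "ob B" "ob C" and fg: "f \<in> functors K B A" "g \<in> functors K C A"
    and E: "is_comma K A B C f g E e0 e1 \<kappa>" and CB: "is_bin_product K C B CB \<pi>1 \<pi>2"
    and r: "r \<in> Isofib K E CB" "fcomp K E CB C \<pi>1 r = e1" "fcomp K E CB B \<pi>2 r = e0"
    and iso: "e0 \<in> Isofib K E B" "e1 \<in> Isofib K E C" "\<pi>1 \<in> Isofib K CB C" "\<pi>2 \<in> Isofib K CB B"
  shows "cocartesian_fibration (slice K B) (E, e0) (CB, \<pi>2) r"
    and "cartesian_fibration (slice K C) (E, e1) (CB, \<pi>1) r"
proof -
  show "cocartesian_fibration (slice K B) (E, e0) (CB, \<pi>2) r"
    by (rule comma_slice.comma_cocartesian, unfold_locales) (rule obj fg E CB r iso)+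
  interpret co: arrow_cosmos "co_dual K" by (rule arrow_cosmos_co_dual)
  have "comma_slice (co_dual K) A C B g f E e1 e0 \<kappa> CB \<pi>2 \<pi>1 r"
    by unfold_locales
      (use obj fg r iso co_dual_comma [OF K obj fg E] co_dual_bin_product [OF CB] in simp_all)
  then show "cartesian_fibration (slice K C) (E, e1) (CB, \<pi>1) r"
    unfolding cartesian_fibration_def co_dual_slice by (rule comma_slice.comma_cocartesian)
qed

end

section \<open>Consequences of the axioms of a cosmos\<close>

subsection \<open>Change of the type of simplices\<close>

text \<open>The axioms speak about simplicial sets with elements in the type that measures smallness. The standard simplices and their subsets have lists of numbers as
elements; they are made small by an injection of lists into that infinite type.\<close>

definition copy :: "('a \<Rightarrow> 'b) \<Rightarrow> 'a sset \<Rightarrow> 'b sset" where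
  "copy \<iota> U = \<lparr>simplices = (\<lambda>m. \<iota> ` simplices U m), act = (\<lambda>n \<alpha> x. \<iota> (act U n \<alpha> (inv \<iota> x)))\<rparr>"

lemma copy_simps [simp]: "simplices (copy \<iota> U) m = \<iota> ` simplices U m"
  "inj \<iota> ==> act (copy \<iota> U) n \<alpha> (\<iota> u) = \<iota> (act U n \<alpha> u)"
  by (simp_all add: copy_def)

lemma copy_set: "inj \<iota> ==> simplicial_set U ==> simplicial_set (copy \<iota> U)"
  by (rule simplicial_setI) (auto simp: ss_in ss_id ss_comp simp del: upt_Suc)

lemma copy_smap: "inj \<iota> ==> smap U (copy \<iota> U) (\<lambda>m. \<iota>)"
  by (rule simplicial_mapI) auto

lemma copy_mono: "inj \<iota> ==> simplicial_subset U V ==> simplicial_mono (copy \<iota> U) (copy \<iota> V) (\<lambda>m x. x)"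
  unfolding simplicial_mono_def
  by (auto intro!: simplicial_mapI imageI simp: simplicial_subset_act simplicial_subset_in)

context enriched
begin

lemma copy_cotensor:
  assumes \<iota>: "inj \<iota>" and P: "is_cotensor K A (copy \<iota> U) P \<epsilon>"
  shows "is_cotensor K A U P (\<lambda>m u. \<epsilon> m (\<iota> u))"
  unfolding is_cotensor_def
proof (intro conjI ballI allI impI)
  note D = cotensorD [OF P]
  show "ob P" by (rule D)
  show "smap U (Fun K P A) (\<lambda>m u. \<epsilon> m (\<iota> u))"
    by (rule smap_comp [OF copy_smap [OF \<iota>] D(2)])
  fix X n \<phi> assume X: "ob X" and \<phi>: "smap (sprod U (std n)) (Fun K X A) \<phi>"
  have "smap (sprod (copy \<iota> U) (std n)) (Fun K X A) (\<lambda>m (u, \<alpha>). \<phi> m (inv \<iota> u, \<alpha>))"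
    by (rule simplicial_mapI)
      (use \<iota> smap_in [OF \<phi>] smap_act [OF \<phi>, of _ _ _ "(u, v)" for u v] in auto)
  then have "\<exists>!x. x \<in> cells X P n \<and> (\<forall>m. \<forall>u\<in>simplices (copy \<iota> U) m. \<forall>\<alpha>\<in>Delta m n.
      Cmp K X P A m (\<epsilon> m u) (res K X P n \<alpha> x) = (\<lambda>(u, \<alpha>). \<phi> m (inv \<iota> u, \<alpha>)) (u, \<alpha>))"
    using P X unfolding is_cotensor_def by blast
  then show "\<exists>!x. x \<in> cells X P n \<and> (\<forall>m. \<forall>u\<in>simplices U m. \<forall>\<alpha>\<in>Delta m n.
      Cmp K X P A m (\<epsilon> m (\<iota> u)) (res K X P n \<alpha> x) = \<phi> m (u, \<alpha>))"
    using \<iota> by simp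
qed

lemma terminal_unique: "is_terminal K T ==> ob X ==> x \<in> cells X T n ==> y \<in> cells X T n ==> x = y"
  unfolding is_terminal_def by blast

lemma terminal_ex: "is_terminal K T ==> ob X ==> \<exists>x. x \<in> cells X T n"
  unfolding is_terminal_def by blast

lemma bin_product_iff_pullback:
  assumes T: "is_terminal K T" and obj: "ob A" "ob B"
    and p: "p \<in> functors K A T" and q: "q \<in> functors K B T"
  shows "is_bin_product K A B P a b \<longleftrightarrow> is_pullback K A B T p q P a b"
proof -
  have TO: "ob T" using T by (simp add: is_terminal_def)
  have eq: "post K X A T p n x = post K X B T q n y" if "ob X" "x \<in> cells X A n" "y \<in> cells X B n" for X n x y
    by (rule terminal_unique [OF T that(1)]; rule post_in; fact that obj p q TO)
  have eq0: "fcomp K P A T p a = fcomp K P B T q b" if "ob P" "a \<in> functors K P A" "b \<in> functors K P B"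
    by (rule terminal_unique [OF T that(1)]; rule cmp_in; fact that obj p q TO)
  show ?thesis
    unfolding is_bin_product_def is_pullback_def using eq eq0 by auto
qed

lemma bin_product_swap:
  assumes "is_bin_product K A B P a b"
  shows "is_bin_product K B A P b a"
  unfolding is_bin_product_def
proof (intro conjI ballI allI)
  fix X n x y assume "ob X" "x \<in> cells X B n" "y \<in> cells X A n"
  then have "\<exists>!z. z \<in> cells X P n \<and> post K X P A a n z = y \<and> post K X P B b n z = x"
    using assms unfolding is_bin_product_def by blast
  then show "\<exists>!z. z \<in> cells X P n \<and> post K X P B b n z = x \<and> post K X P A a n z = y"
    by (simp only: conj_ac)
qed (use assms in \<open>auto simp: is_bin_product_def\<close>)

lemma cotensor_terminal:
  fixes U :: "'w sset"
  assumes T: "is_terminal K T" and P: "is_cotensor K T U P \<epsilon>"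
  shows "is_terminal K P"
proof -
  have TO: "ob T" using T by (simp add: is_terminal_def)
  note D = cotensorD [OF P]
  have "\<exists>!x. x \<in> cells X P n" if X: "ob X" for X n
  proof -
    define \<phi> where "\<phi> m (z :: 'w \<times> nat list) = (SOME t. t \<in> cells X T m)" for m z
    have \<phi>: "\<phi> m z \<in> cells X T m" for m z
      unfolding \<phi>_def by (rule someI_ex [OF terminal_ex [OF T X]])
    have "smap (sprod U (std n)) (Fun K X T) \<phi>"
      by (rule simplicial_mapI) (auto intro!: \<phi> terminal_unique [OF T X] act_cells [OF X TO])
    from cotensor_cell [OF P TO X this] obtain x where x: "x \<in> cells X P n" by blast
    show ?thesis
    proof (rule ex1I [of "\<lambda>x. x \<in> cells X P n" x, OF x])
      fix y assume y: "y \<in> cells X P n"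
      show "y = x"
      proof (rule cotensor_unique [OF P TO X y x])
        fix m u \<alpha> assume "u \<in> simplices U m" "\<alpha> \<in> Delta m n"
        then show "Cmp K X P T m (\<epsilon> m u) (res K X P n \<alpha> y) = Cmp K X P T m (\<epsilon> m u) (res K X P n \<alpha> x)"
          using x y X D TO by (intro terminal_unique [OF T X, where n = m]) (simp_all add: act_cells)
      qed
    qed
  qed
  then show ?thesis using D(1) by (simp add: is_terminal_def)
qed

end

lemma infinite_type_embedding: "\<exists>\<iota> :: nat list \<Rightarrow> 'u::infinite. inj \<iota>"
proof -
  obtain h :: "nat \<Rightarrow> 'u" where "inj h"
    using infinite_countable_subset [OF infinite_UNIV] by blast
  then have "inj (h \<circ> to_nat)" by (intro inj_compose) auto
  then show ?thesis by blast
qed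

locale inf_cosmos =
  fixes K :: "('o, 's) cosmos" and small :: "'u::infinite itself"
  assumes cosmos: "infinity_cosmos small K"
begin

lemma hom_quasi: "A \<in> Obj K ==> B \<in> Obj K ==> quasi_category (Fun K A B)"
  using cosmos [unfolded infinity_cosmos_def, THEN conjunct2, THEN conjunct1] by blast

lemma isofib_subset: "A \<in> Obj K ==> B \<in> Obj K ==> p \<in> Isofib K A B ==> p \<in> functors K A B"
  using cosmos [unfolded infinity_cosmos_def, THEN conjunct2, THEN conjunct2, THEN conjunct1] by blast

lemma isofib_comp: "A \<in> Obj K ==> B \<in> Obj K ==> C \<in> Obj K ==> f \<in> Isofib K A B ==> g \<in> Isofib K B C ==>
    fcomp K A B C g f \<in> Isofib K A C"
  using cosmos [unfolded infinity_cosmos_def, THEN conjunct2, THEN conjunct2, THEN conjunct2, THEN conjunct2, THEN conjunct1] by blast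

lemma terminal: "\<exists>T. is_terminal K T"
  using cosmos [unfolded infinity_cosmos_def, THEN conjunct2, THEN conjunct2, THEN conjunct2, THEN conjunct2, THEN conjunct2, THEN conjunct1] .

lemma small_cotensors: "A \<in> Obj K ==> simplicial_set (U :: 'u sset) ==> \<exists>P \<epsilon>. is_cotensor K A U P \<epsilon>"
  using cosmos [unfolded infinity_cosmos_def, THEN conjunct2, THEN conjunct2, THEN conjunct2, THEN conjunct2, THEN conjunct2, THEN conjunct2, THEN conjunct2, THEN conjunct1] by blast

lemma pullbacks: "E \<in> Obj K ==> B \<in> Obj K ==> C \<in> Obj K ==> p \<in> Isofib K E B ==> f \<in> functors K C B ==>
    \<exists>P a b. is_pullback K E C B p f P a b"
  using cosmos [unfolded infinity_cosmos_def, THEN conjunct2, THEN conjunct2, THEN conjunct2, THEN conjunct2, THEN conjunct2, THEN conjunct2, THEN conjunct2, THEN conjunct2, THEN conjunct2, THEN conjunct1] by blast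

lemma iso_isofib: "A \<in> Obj K ==> B \<in> Obj K ==> isomorphism K A B f ==> f \<in> Isofib K A B"
  using cosmos [unfolded infinity_cosmos_def, THEN conjunct2, THEN conjunct2, THEN conjunct2, THEN conjunct2, THEN conjunct2, THEN conjunct2, THEN conjunct2, THEN conjunct2, THEN conjunct2, THEN conjunct2, THEN conjunct1] by blast

lemma terminal_isofib: "A \<in> Obj K ==> is_terminal K T ==> x \<in> functors K A T ==> x \<in> Isofib K A T"
  using cosmos [unfolded infinity_cosmos_def, THEN conjunct2, THEN conjunct2, THEN conjunct2, THEN conjunct2, THEN conjunct2, THEN conjunct2, THEN conjunct2, THEN conjunct2, THEN conjunct2, THEN conjunct2, THEN conjunct2, THEN conjunct1] by blast

lemma pullback_isofib: "E \<in> Obj K ==> B \<in> Obj K ==> C \<in> Obj K ==> p \<in> Isofib K E B ==> f \<in> functors K C B ==>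
    is_pullback K E C B p f P a b ==> b \<in> Isofib K P C"
  by (rule cosmos [unfolded infinity_cosmos_def, THEN conjunct2, THEN conjunct2, THEN conjunct2, THEN conjunct2, THEN conjunct2, THEN conjunct2, THEN conjunct2, THEN conjunct2, THEN conjunct2, THEN conjunct2, THEN conjunct2, THEN conjunct2, THEN conjunct1, rule_format])

lemmas leibniz_axiom = cosmos [unfolded infinity_cosmos_def, THEN conjunct2, THEN conjunct2, THEN conjunct2, THEN conjunct2, THEN conjunct2, THEN conjunct2, THEN conjunct2, THEN conjunct2, THEN conjunct2, THEN conjunct2, THEN conjunct2, THEN conjunct2, THEN conjunct2, THEN conjunct2, THEN conjunct1, rule_format]

lemma fun_isofib: "X \<in> Obj K ==> E \<in> Obj K ==> B \<in> Obj K ==> p \<in> Isofib K E B ==>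
    qcat_isofibration (Fun K X E) (Fun K X B) (post K X E B p)"
  by (rule cosmos [unfolded infinity_cosmos_def, THEN conjunct2, THEN conjunct2, THEN conjunct2, THEN conjunct2, THEN conjunct2, THEN conjunct2, THEN conjunct2, THEN conjunct2, THEN conjunct2, THEN conjunct2, THEN conjunct2, THEN conjunct2, THEN conjunct2, THEN conjunct2, THEN conjunct2, rule_format])

sublocale isofib_category
  by unfold_locales (rule cosmos [unfolded infinity_cosmos_def, THEN conjunct1], rule isofib_subset)

lemma terminal_object: "\<exists>T. is_terminal K T \<and> ob T"
  using terminal by (auto simp: is_terminal_def)

lemma bin_product_exists:
  assumes obj: "ob A" "ob B"
  shows "is_bin_product K A B (prod_ob K A B) (proj1 K A B) (proj2 K A B)"
proof -
  obtain T where T: "is_terminal K T" "ob T" using terminal_object by blast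
  obtain p q where pq: "p \<in> functors K A T" "q \<in> functors K B T"
    using terminal_ex [OF T(1) obj(1)] terminal_ex [OF T(1) obj(2)] by blast
  show ?thesis
    using pullbacks [OF obj(1) T(2) obj(2) terminal_isofib [OF obj(1) T(1) pq(1)] pq(2)]
    unfolding bin_product_iff_pullback [OF T(1) obj pq, symmetric] by (intro chosen_bin_product)
qed

lemma projections_isofib:
  assumes obj: "ob A" "ob B" and P: "is_bin_product K A B P a b"
  shows "a \<in> Isofib K P A" "b \<in> Isofib K P B"
proof -
  obtain T where T: "is_terminal K T" "ob T" using terminal_object by blast
  obtain p q where pq: "p \<in> functors K A T" "q \<in> functors K B T"
    using terminal_ex [OF T(1) obj(1)] terminal_ex [OF T(1) obj(2)] by blast
  show "b \<in> Isofib K P B"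
    by (rule pullback_isofib [OF obj(1) T(2) obj(2) terminal_isofib [OF obj(1) T(1) pq(1)] pq(2)
      P [unfolded bin_product_iff_pullback [OF T(1) obj pq]]])
  have P': "is_bin_product K B A P b a"
    by (rule bin_product_swap [OF P])
  show "a \<in> Isofib K P A"
    by (rule pullback_isofib [OF obj(2) T(2) obj(1) terminal_isofib [OF obj(2) T(1) pq(2)] pq(1)
      P' [unfolded bin_product_iff_pullback [OF T(1) obj(2,1) pq(2,1)]]])
qed

definition emb :: "nat list \<Rightarrow> 'u" where "emb = (SOME \<iota>. inj \<iota>)"

lemma inj_emb: "inj emb"
  unfolding emb_def by (rule someI_ex [OF infinite_type_embedding])

lemma finitary_cotensor:
  assumes A: "ob A" and U: "simplicial_set (U :: nat list sset)"
  shows "is_cotensor K A U (cotensor K A (copy emb U)) (\<lambda>m u. cotensor_ev K A (copy emb U) m (emb u))"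
  by (rule copy_cotensor [OF inj_emb chosen_cotensor [OF small_cotensors [OF A copy_set [OF inj_emb U]]]])

lemma finitary_cotensor_exists:
  assumes A: "ob A" and U: "simplicial_set (U :: nat list sset)"
  shows "is_cotensor K A U (cotensor K A U) (cotensor_ev K A U)"
  by (rule chosen_cotensor, rule exI, rule exI, rule finitary_cotensor [OF assms])

text \<open>The axiom is stated for the chosen cotensors; here all objects are given by their universal property, which allows the choice of convenient representatives.\<close>

lemma leibniz_isofib:
  assumes obj: "ob E" "ob B" and p: "p \<in> Isofib K E B" and UV: "simplicial_subset U (V :: nat list sset)"
    and EU: "is_cotensor K E U EU \<epsilon>EU" and EV: "is_cotensor K E V EV \<epsilon>EV"
    and BU: "is_cotensor K B U BU \<epsilon>BU" and BV: "is_cotensor K B V BV \<epsilon>BV"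
    and pU: "pU \<in> functors K EU BU" "\<And>m u. u \<in> simplices U m ==> pre K EU BU B pU m (\<epsilon>BU m u) = post K EU E B p m (\<epsilon>EU m u)"
    and rB: "rB \<in> functors K BV BU" "\<And>m u. u \<in> simplices U m ==> pre K BV BU B rB m (\<epsilon>BU m u) = \<epsilon>BV m u"
    and P: "is_pullback K EU BV BU pU rB P a b"
    and m: "m \<in> functors K EV P"
      "\<And>n u. u \<in> simplices U n ==> pre K EV EU E (fcomp K EV P EU a m) n (\<epsilon>EU n u) = \<epsilon>EV n u"
      "\<And>n v. v \<in> simplices V n ==> pre K EV BV B (fcomp K EV P BV b m) n (\<epsilon>BV n v) = post K EV E B p n (\<epsilon>EV n v)"
  shows "m \<in> Isofib K EV P"
proof -
  let ?U = "copy emb U" and ?V = "copy emb V"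
  have sU: "simplicial_set U" and sV: "simplicial_set V"
    using UV simplicial_subset_set by (auto simp: simplicial_subset_def)
  note cEU = finitary_cotensor [OF obj(1) sU] and cEV = finitary_cotensor [OF obj(1) sV]
    and cBU = finitary_cotensor [OF obj(2) sU] and cBV = finitary_cotensor [OF obj(2) sV]
  define XU where "XU = cotensor K E ?U"
  define XV where "XV = cotensor K E ?V"
  define YU where "YU = cotensor K B ?U"
  define YV where "YV = cotensor K B ?V"
  define eU where "eU m u = cotensor_ev K E ?U m (emb u)" for m u
  define eV where "eV m u = cotensor_ev K E ?V m (emb u)" for m u
  define fU where "fU m u = cotensor_ev K B ?U m (emb u)" for m u
  define fV where "fV m u = cotensor_ev K B ?V m (emb u)" for m u
  note cEU = cEU [folded XU_def eU_def] and cEV = cEV [folded XV_def eV_def]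
    and cBU = cBU [folded YU_def fU_def] and cBV = cBV [folded YV_def fV_def]
  obtain jEU kEU where jEU: "jEU \<in> functors K EU XU" "kEU \<in> functors K XU EU" "fcomp K EU XU EU kEU jEU = Idt K EU"
    "fcomp K XU EU XU jEU kEU = Idt K XU" "\<And>m u. u \<in> simplices U m ==> pre K EU XU E jEU m (eU m u) = \<epsilon>EU m u"
    using cotensor_iso [OF cEU EU obj(1)] by blast
  obtain jEV kEV where jEV: "jEV \<in> functors K EV XV" "kEV \<in> functors K XV EV" "fcomp K EV XV EV kEV jEV = Idt K EV"
    "fcomp K XV EV XV jEV kEV = Idt K XV" "\<And>m u. u \<in> simplices V m ==> pre K XV EV E kEV m (\<epsilon>EV m u) = eV m u"
    using cotensor_iso [OF cEV EV obj(1)] by blast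
  obtain jBU kBU where jBU: "jBU \<in> functors K BU YU" "kBU \<in> functors K YU BU" "fcomp K BU YU BU kBU jBU = Idt K BU"
    "\<And>m u. u \<in> simplices U m ==> pre K BU YU B jBU m (fU m u) = \<epsilon>BU m u"
    using cotensor_iso [OF cBU BU obj(2)] by blast
  obtain jBV kBV where jBV: "jBV \<in> functors K BV YV" "kBV \<in> functors K YV BV" "fcomp K BV YV BV kBV jBV = Idt K BV"
    "fcomp K YV BV YV jBV kBV = Idt K YV" "\<And>m u. u \<in> simplices V m ==> pre K BV YV B jBV m (fV m u) = \<epsilon>BV m u"
    using cotensor_iso [OF cBV BV obj(2)] by blast
  have pf: "p \<in> functors K E B" by (rule isofib_subset [OF obj p])
  note DXU = cotensorD [OF cEU] and DXV = cotensorD [OF cEV] and DYU = cotensorD [OF cBU] and DYV = cotensorD [OF cBV]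
    and DEU = cotensorD [OF EU] and DEV = cotensorD [OF EV] and DBU = cotensorD [OF BU] and DBV = cotensorD [OF BV]
  note O = DXU(1) DXV(1) DYU(1) DYV(1) DEU(1) DEV(1) DBU(1) DBV(1) obj pf pU(1) rB(1)
    jEU(1,2) jEV(1,2) jBU(1,2) jBV(1,2) pullbackD(1-3) [OF P] m(1)
  have sub: "u \<in> simplices V n" if "u \<in> simplices U n" for u n
    by (rule simplicial_subset_in [OF UV that])
  have ch: "is_cotensor K A (copy emb W) (cotensor K A (copy emb W)) (cotensor_ev K A (copy emb W))"
    if "ob A" "simplicial_set W" for A and W :: "nat list sset"
    by (rule chosen_cotensor [OF small_cotensors [OF that(1) copy_set [OF inj_emb that(2)]]])
  define pU' where "pU' = cotensor_map K E B ?U p"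
  define pV' where "pV' = cotensor_map K E B ?V p"
  define rB' where "rB' = cotensor_restrict K B ?U ?V (\<lambda>m x. x)"
  define rE' where "rE' = cotensor_restrict K E ?U ?V (\<lambda>m x. x)"
  have map: "cotensor_map K E B (copy emb W) p \<in> functors K (cotensor K E (copy emb W)) (cotensor K B (copy emb W))"
    "\<And>m u. u \<in> simplices W m ==> pre K (cotensor K E (copy emb W)) (cotensor K B (copy emb W)) B (cotensor_map K E B (copy emb W) p) m
      (cotensor_ev K B (copy emb W) m (emb u)) = post K (cotensor K E (copy emb W)) E B p m (cotensor_ev K E (copy emb W) m (emb u))"
    if W: "simplicial_set W" for W :: "nat list sset"
    by (simp_all add: cotensor_map [OF ch [OF obj(1) W] ch [OF obj(2) W] obj copy_set [OF inj_emb W] pf])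
  have ids: "smap ?U ?V (\<lambda>m x. x)" using copy_mono [OF inj_emb UV] by (simp add: simplicial_mono_def)
  have res: "cotensor_restrict K A ?U ?V (\<lambda>m x. x) \<in> functors K (cotensor K A ?V) (cotensor K A ?U)"
    "\<And>m u. u \<in> simplices U m ==> pre K (cotensor K A ?V) (cotensor K A ?U) A (cotensor_restrict K A ?U ?V (\<lambda>m x. x)) m
      (cotensor_ev K A ?U m (emb u)) = cotensor_ev K A ?V m (emb u)"
    if A: "ob A" for A
    by (simp_all add: cotensor_restrict [OF ch [OF A sU] ch [OF A sV] A copy_set [OF inj_emb sU] ids])
  note pU' = map [OF sU, folded pU'_def XU_def YU_def eU_def fU_def]
    and pV' = map [OF sV, folded pV'_def XV_def YV_def eV_def fV_def]
    and rB' = res [OF obj(2), folded rB'_def YU_def YV_def fU_def fV_def]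
    and rE' = res [OF obj(1), folded rE'_def XU_def XV_def eU_def eV_def]
  note O = O pU'(1) pV'(1) rB'(1) rE'(1)
  have sq1: "fcomp K EU XU YU pU' jEU = fcomp K EU BU YU jBU pU"
  proof (rule cotensor_functor_unique [OF cBU obj(2) DEU(1)])
    fix n u assume u: "u \<in> simplices U n"
    have "pre K EU YU B (fcomp K EU XU YU pU' jEU) n (fU n u) = pre K EU XU B jEU n (post K XU E B p n (eU n u))"
      unfolding pU'(2) [OF u, symmetric] using O DYU(3) [OF u] by (simp add: pre_pre)
    also have "\<dots> = post K EU E B p n (\<epsilon>EU n u)"
      unfolding jEU(5) [OF u, symmetric] using O DXU(3) [OF u] by (simp add: post_pre)
    also have "\<dots> = pre K EU BU B pU n (pre K BU YU B jBU n (fU n u))" unfolding jBU(4) [OF u] pU(2) [OF u] ..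
    also have "\<dots> = pre K EU YU B (fcomp K EU BU YU jBU pU) n (fU n u)"
      using O DYU(3) [OF u] by (simp add: pre_pre)
    finally show "pre K EU YU B (fcomp K EU XU YU pU' jEU) n (fU n u) = pre K EU YU B (fcomp K EU BU YU jBU pU) n (fU n u)" .
  qed (use O in simp_all)
  have sq2: "fcomp K BV YV YU rB' jBV = fcomp K BV BU YU jBU rB"
  proof (rule cotensor_functor_unique [OF cBU obj(2) DBV(1)])
    fix n u assume u: "u \<in> simplices U n"
    have "pre K BV YU B (fcomp K BV YV YU rB' jBV) n (fU n u) = pre K BV YV B jBV n (fV n u)"
      unfolding rB'(2) [OF u, symmetric] using O DYU(3) [OF u] by (simp add: pre_pre)
    also have "\<dots> = pre K BV BU B rB n (pre K BU YU B jBU n (fU n u))"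
      unfolding jBV(5) [OF sub [OF u]] jBU(4) [OF u] rB(2) [OF u] ..
    also have "\<dots> = pre K BV YU B (fcomp K BV BU YU jBU rB) n (fU n u)"
      using O DYU(3) [OF u] by (simp add: pre_pre)
    finally show "pre K BV YU B (fcomp K BV YV YU rB' jBV) n (fU n u) = pre K BV YU B (fcomp K BV BU YU jBU rB) n (fU n u)" .
  qed (use O in simp_all)
  have P': "is_pullback K XU YV YU pU' rB' P (fcomp K P EU XU jEU a) (fcomp K P BV YV jBV b)"
    by (rule pullback_iso [OF P _ _ _ _ _ _ _ _ _ _ jEU(1-4) jBV(1-4) jBU(1-3) sq1 sq2]) (use O in simp_all)
  define m' where "m' = fcomp K XV EV P m kEV"
  have m': "m' \<in> functors K XV P" using O by (simp add: m'_def)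
  have "m' \<in> Isofib K XV P"
  proof (rule leibniz_axiom [OF obj p copy_set [OF inj_emb sU] copy_set [OF inj_emb sV] copy_mono [OF inj_emb UV],
      folded XU_def XV_def YU_def YV_def pU'_def rB'_def pV'_def rE'_def, OF P' m'])
    define ma where "ma = fcomp K EV P EU a m"
    define mb where "mb = fcomp K EV P BV b m"
    have am: "ma \<in> functors K EV EU" "mb \<in> functors K EV BV" using O by (simp_all add: ma_def mb_def)
    have "fcomp K XV P XU (fcomp K P EU XU jEU a) m' = fcomp K XV EV XU (fcomp K EV EU XU jEU ma) kEV"
      using O by (simp add: m'_def ma_def fcomp_assoc)
    also have "\<dots> = rE'"
    proof (rule cotensor_functor_unique [OF cEU obj(1) DXV(1)])
      fix n u assume u: "u \<in> simplices U n"
      have "pre K XV XU E (fcomp K XV EV XU (fcomp K EV EU XU jEU ma) kEV) n (eU n u) =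
          pre K XV EV E kEV n (pre K EV EU E ma n (pre K EU XU E jEU n (eU n u)))"
        using O am DXU(3) [OF u] by (simp add: pre_pre)
      then show "pre K XV XU E (fcomp K XV EV XU (fcomp K EV EU XU jEU ma) kEV) n (eU n u) = pre K XV XU E rE' n (eU n u)"
        unfolding jEU(5) [OF u] m(2) [OF u, folded ma_def] jEV(5) [OF sub [OF u]] rE'(2) [OF u] .
    qed (use O am in simp_all)
    finally show "fcomp K XV P XU (fcomp K P EU XU jEU a) m' = rE'" .
    have "fcomp K XV P YV (fcomp K P BV YV jBV b) m' = fcomp K XV EV YV (fcomp K EV BV YV jBV mb) kEV"
      using O by (simp add: m'_def mb_def fcomp_assoc)
    also have "\<dots> = pV'"
    proof (rule cotensor_functor_unique [OF cBV obj(2) DXV(1)])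
      fix n u assume u: "u \<in> simplices V n"
      have "pre K XV YV B (fcomp K XV EV YV (fcomp K EV BV YV jBV mb) kEV) n (fV n u) =
          pre K XV EV B kEV n (pre K EV BV B mb n (pre K BV YV B jBV n (fV n u)))"
        using O am DYV(3) [OF u] by (simp add: pre_pre)
      also have "\<dots> = post K XV E B p n (pre K XV EV E kEV n (\<epsilon>EV n u))"
        unfolding jBV(5) [OF u] m(3) [OF u, folded mb_def] using O DEV(3) [OF u] by (simp add: post_pre)
      finally show "pre K XV YV B (fcomp K XV EV YV (fcomp K EV BV YV jBV mb) kEV) n (fV n u) = pre K XV YV B pV' n (fV n u)"
        unfolding jEV(5) [OF u] pV'(2) [OF u] .
    qed (use O am in simp_all)
    finally show "fcomp K XV P YV (fcomp K P BV YV jBV b) m' = pV'" .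
  qed
  moreover have "jEV \<in> Isofib K EV XV"
    by (rule iso_isofib) (use O jEV(3,4) in \<open>auto simp: isomorphism_def\<close>)
  moreover have "m = fcomp K EV XV P m' jEV"
    using O jEV(3) by (simp add: m'_def fcomp_assoc)
  ultimately show ?thesis using isofib_comp [OF O(6,2)] O by simp
qed

end

context inf_cosmos
begin

text \<open>This is the Leibniz axiom for the functor from A to the terminal object, for which the pullback is the cotensor by U.\<close>

lemma restriction_isofib:
  assumes A: "ob A" and UV: "simplicial_subset U (V :: nat list sset)"
    and AU: "is_cotensor K A U AU \<epsilon>" and AV: "is_cotensor K A V AV \<delta>"
    and \<rho>: "\<rho> \<in> functors K AV AU" "\<And>m u. u \<in> simplices U m ==> pre K AV AU A \<rho> m (\<epsilon> m u) = \<delta> m u"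
  shows "\<rho> \<in> Isofib K AV AU"
proof -
  obtain T where T: "is_terminal K T" "ob T" using terminal_object by blast
  obtain p where p: "p \<in> functors K A T" using terminal_ex [OF T(1) A] by blast
  have sU: "simplicial_set U" and sV: "simplicial_set V"
    using UV simplicial_subset_set by (auto simp: simplicial_subset_def)
  obtain TU \<eta> where TU: "is_cotensor K T U TU \<eta>" using finitary_cotensor [OF T(2) sU] by blast
  obtain TV \<zeta> where TV: "is_cotensor K T V TV \<zeta>" using finitary_cotensor [OF T(2) sV] by blast
  note tU = cotensor_terminal [OF T(1) TU] and tV = cotensor_terminal [OF T(1) TV]
  note O = A T(2) cotensorD(1) [OF AU] cotensorD(1) [OF AV] cotensorD(1) [OF TU] cotensorD(1) [OF TV]
  obtain pU where pU: "pU \<in> functors K AU TU" using terminal_ex [OF tU O(3)] by blast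
  obtain rT where rT: "rT \<in> functors K TV TU" using terminal_ex [OF tU O(6)] by blast
  obtain b where b: "b \<in> functors K AU TV" using terminal_ex [OF tV O(3)] by blast
  show ?thesis
  proof (rule leibniz_isofib [OF A T(2) terminal_isofib [OF A T(1) p] UV AU AV TU TV pU _ rT _ _ \<rho>(1), where a = "Idt K AU" and b = b])
    show "is_pullback K AU TV TU pU rT AU (Idt K AU) b"
      unfolding is_pullback_def
    proof (intro conjI ballI allI impI)
      show "fcomp K AU AU TU pU (Idt K AU) = fcomp K AU TV TU rT b"
        by (rule terminal_unique [OF tU O(3), where n = 0]) (use O pU rT b in simp_all)
      fix X n x y assume X: "ob X" and x: "x \<in> cells X AU n" and y: "y \<in> cells X TV n"
      have e: "post K X AU TV b n x = y" by (rule terminal_unique [OF tV X _ y]) (use X O b x in simp)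
      show "\<exists>!z. z \<in> cells X AU n \<and> post K X AU AU (Idt K AU) n z = x \<and> post K X AU TV b n z = y"
      proof (rule ex1I [of _ x])
        show "z = x" if "z \<in> cells X AU n \<and> post K X AU AU (Idt K AU) n z = x \<and> post K X AU TV b n z = y" for z
          using that post_idt [OF X O(3), of z n] by metis
      qed (use e X O(3) x in simp)
    qed (use O b in simp_all)
    fix n
    show "pre K AU TU T pU n (\<eta> n u) = post K AU A T p n (\<epsilon> n u)" if u: "u \<in> simplices U n" for u
      by (rule terminal_unique [OF T(1) O(3), where n = n])
        (use O pU p cotensorD(3) [OF TU u] cotensorD(3) [OF AU u] in simp_all)
    show "pre K TV TU T rT n (\<eta> n u) = \<zeta> n u" if u: "u \<in> simplices U n" for u
      by (rule terminal_unique [OF T(1) O(6), where n = n])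
        (use O rT cotensorD(3) [OF TU u] cotensorD(3) [OF TV simplicial_subset_in [OF UV u]] in simp_all)
    show "pre K AV AU A (fcomp K AV AU AU (Idt K AU) \<rho>) n (\<epsilon> n u) = \<delta> n u" if u: "u \<in> simplices U n" for u
      using \<rho>(2) [OF u] \<rho>(1) O by simp
    show "pre K AV TV T (fcomp K AV AU TV b \<rho>) n (\<zeta> n v) = post K AV A T p n (\<delta> n v)" if v: "v \<in> simplices V n" for v
      by (rule terminal_unique [OF T(1) O(4), where n = n])
        (use O b \<rho>(1) p cotensorD(3) [OF TV v] cotensorD(3) [OF AV v] in simp_all)
  qed
qed

definition endpoints :: "nat list sset" where
  "endpoints = \<lparr>simplices = (\<lambda>m. {const m 0, const m 1}), act = act (std 1)\<rparr>"

definition vertex :: "nat \<Rightarrow> nat list sset" where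
  "vertex v = \<lparr>simplices = (\<lambda>m. {const m v}), act = act (std 1)\<rparr>"

lemma endpoints_subset: "simplicial_subset endpoints (std 1)"
  unfolding simplicial_subset_def endpoints_def by auto

lemma vertex_subset: "v \<le> 1 ==> simplicial_subset (vertex v) (std 1)"
  unfolding simplicial_subset_def vertex_def by auto

lemma vertex_cotensor:
  assumes A: "ob A" and v: "v \<le> 1"
  shows "is_cotensor K A (vertex v) A (\<lambda>m u. dg (Fun K A A) m (Idt K A))"
  unfolding is_cotensor_def
proof (intro conjI ballI allI impI)
  show "smap (vertex v) (Fun K A A) (\<lambda>m u. dg (Fun K A A) m (Idt K A))" by (rule dg_smap [OF A A idt_in [OF A]])
  fix X n \<phi> assume X: "ob X" and \<phi>: "smap (sprod (vertex v) (std n)) (Fun K X A) \<phi>"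
  define x where "x = \<phi> n (const n v, [0..<Suc n])"
  have x: "x \<in> cells X A n" unfolding x_def by (rule smap_in [OF \<phi>]) (auto simp: vertex_def simp del: upt_Suc)
  have x_act: "res K X A n \<alpha> x = \<phi> m (const m v, \<alpha>)" if "\<alpha> \<in> Delta m n" for m \<alpha>
    using smap_act [OF \<phi> that, of "(const n v, [0..<Suc n])"] that
    by (simp add: x_def vertex_def del: upt_Suc)
  show "\<exists>!x. x \<in> cells X A n \<and> (\<forall>m. \<forall>u\<in>simplices (vertex v) m. \<forall>\<alpha>\<in>Delta m n.
      Cmp K X A A m (dg (Fun K A A) m (Idt K A)) (res K X A n \<alpha> x) = \<phi> m (u, \<alpha>))"
  proof (rule ex1I [of _ x])
    show "x \<in> cells X A n \<and> (\<forall>m. \<forall>u\<in>simplices (vertex v) m. \<forall>\<alpha>\<in>Delta m n.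
        Cmp K X A A m (dg (Fun K A A) m (Idt K A)) (res K X A n \<alpha> x) = \<phi> m (u, \<alpha>))"
      using A X x by (auto simp: cmp_dg_left act_cells x_act [symmetric] vertex_def)
    fix y assume y: "y \<in> cells X A n \<and> (\<forall>m. \<forall>u\<in>simplices (vertex v) m. \<forall>\<alpha>\<in>Delta m n.
        Cmp K X A A m (dg (Fun K A A) m (Idt K A)) (res K X A n \<alpha> y) = \<phi> m (u, \<alpha>))"
    have "const n v \<in> simplices (vertex v) n" by (simp add: vertex_def)
    with y have "Cmp K X A A n (dg (Fun K A A) n (Idt K A)) (res K X A n [0..<Suc n] y) = x"
      unfolding x_def by blast
    then show "y = x" using A X y ss_id [OF fun_set [OF X A], of y n] by (simp add: cmp_dg_left del: upt_Suc)
  qed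
qed (rule A)

lemma endpoints_cotensor:
  assumes A: "ob A" and AA: "is_bin_product K A A AA \<pi>1 \<pi>2"
  shows "is_cotensor K A endpoints AA (\<lambda>m u. dg (Fun K AA A) m (if hd u = 1 then \<pi>1 else \<pi>2))" (is "is_cotensor K A endpoints AA ?\<delta>")
  unfolding is_cotensor_def
proof (intro conjI ballI allI impI)
  note D = bin_productD [OF AA]
  have hd_act: "hd (u \<odot> \<alpha>) = hd u" if "\<alpha> \<in> Delta m n" "u \<in> simplices endpoints n" for u \<alpha> m n
    using that const_reindex [OF that(1)] by (auto simp: endpoints_def)
  show "ob AA" by (rule D)
  show "smap endpoints (Fun K AA A) ?\<delta>"
    by (rule simplicial_mapI) (use D A hd_act in \<open>auto simp: act_dg_cells, auto simp: endpoints_def\<close>)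
  fix X n \<phi> assume X: "ob X" and \<phi>: "smap (sprod endpoints (std n)) (Fun K X A) \<phi>"
  define x where "x v = \<phi> n (const n v, [0..<Suc n])" for v
  have v: "const m v \<in> simplices endpoints m" if "v \<le> 1" for m v
    using that by (cases v) (auto simp: endpoints_def)
  have x: "x v \<in> cells X A n" if "v \<le> 1" for v
    unfolding x_def by (rule smap_in [OF \<phi>]) (use v [OF that] in \<open>auto simp del: upt_Suc\<close>)
  have x_act: "res K X A n \<alpha> (x v) = \<phi> m (const m v, \<alpha>)" if "\<alpha> \<in> Delta m n" "v \<le> 1" for m \<alpha> v
    using smap_act [OF \<phi> that(1), of "(const n v, [0..<Suc n])"] that v
    by (simp add: x_def endpoints_def del: upt_Suc)
  have iff: "(\<forall>m. \<forall>u\<in>simplices endpoints m. \<forall>\<alpha>\<in>Delta m n. Cmp K X AA A m (?\<delta> m u) (res K X AA n \<alpha> y) = \<phi> m (u, \<alpha>)) \<longleftrightarrow>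
      post K X AA A \<pi>1 n y = x 1 \<and> post K X AA A \<pi>2 n y = x 0" if y: "y \<in> cells X AA n" for y
  proof -
    have c: "Cmp K X AA A m (?\<delta> m u) (res K X AA n \<alpha> y) = res K X A n \<alpha> (post K X AA A (if hd u = 1 then \<pi>1 else \<pi>2) n y)"
      if "\<alpha> \<in> Delta m n" for m u \<alpha>
      using that y X A D by (simp add: cmp_dg_left act_post)
    have \<delta>: "(if hd (const m v) = 1 then \<pi>1 else \<pi>2) = (if v = 1 then \<pi>1 else \<pi>2)" for m v by simp
    have id: "res K X A n [0..<Suc n] (post K X AA A \<pi> n y) = post K X AA A \<pi> n y" if "\<pi> = \<pi>1 \<or> \<pi> = \<pi>2" for \<pi>
      by (rule ss_id [OF fun_set [OF X A]]) (use that y X A D in auto)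
    show ?thesis
    proof
      assume *: "\<forall>m. \<forall>u\<in>simplices endpoints m. \<forall>\<alpha>\<in>Delta m n. Cmp K X AA A m (?\<delta> m u) (res K X AA n \<alpha> y) = \<phi> m (u, \<alpha>)"
      have "post K X AA A (if v = 1 then \<pi>1 else \<pi>2) n y = x v" if "v \<le> 1" for v
        using * [rule_format, OF v [OF that] Delta_id] unfolding c [OF Delta_id] unfolding \<delta> x_def using id [of \<pi>1] id [of \<pi>2] by (cases "v = 1") (simp_all del: upt_Suc)
      from this [of 1] this [of 0] show "post K X AA A \<pi>1 n y = x 1 \<and> post K X AA A \<pi>2 n y = x 0" by simp
    next
      assume *: "post K X AA A \<pi>1 n y = x 1 \<and> post K X AA A \<pi>2 n y = x 0"
      show "\<forall>m. \<forall>u\<in>simplices endpoints m. \<forall>\<alpha>\<in>Delta m n. Cmp K X AA A m (?\<delta> m u) (res K X AA n \<alpha> y) = \<phi> m (u, \<alpha>)"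
      proof (intro allI ballI)
        fix m u \<alpha> assume "u \<in> simplices endpoints m" and \<alpha>: "\<alpha> \<in> Delta m n"
        then obtain v where "v = 0 \<or> v = 1" "u = const m v" by (auto simp: endpoints_def)
        then show "Cmp K X AA A m (?\<delta> m u) (res K X AA n \<alpha> y) = \<phi> m (u, \<alpha>)"
          unfolding c [OF \<alpha>] using * x_act [OF \<alpha>, of v] \<delta> [of m v] by auto
      qed
    qed
  qed
  obtain y where y: "y \<in> cells X AA n" "post K X AA A \<pi>1 n y = x 1" "post K X AA A \<pi>2 n y = x 0"
    using bin_product_ex [OF AA X x x] by auto
  show "\<exists>!y. y \<in> cells X AA n \<and> (\<forall>m. \<forall>u\<in>simplices endpoints m. \<forall>\<alpha>\<in>Delta m n.
      Cmp K X AA A m (?\<delta> m u) (res K X AA n \<alpha> y) = \<phi> m (u, \<alpha>))"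
  proof (rule ex1I [of _ y])
    fix z assume z: "z \<in> cells X AA n \<and> (\<forall>m. \<forall>u\<in>simplices endpoints m. \<forall>\<alpha>\<in>Delta m n.
        Cmp K X AA A m (?\<delta> m u) (res K X AA n \<alpha> z) = \<phi> m (u, \<alpha>))"
    then have "post K X AA A \<pi>1 n z = x 1 \<and> post K X AA A \<pi>2 n z = x 0" using iff [of z] by blast
    then show "z = y" using bin_product_unique [OF AA X A A, of z n y] z y by simp
  qed (use y iff [OF y(1)] in blast)
qed

text \<open>The product of A with itself is the cotensor by the two endpoints of the 1-simplex.\<close>

lemma arrow_projection_isofib:
  assumes A: "ob A" and W: "is_cotensor K A (std 1) W \<epsilon>" and AA: "is_bin_product K A A AA \<pi>1 \<pi>2"
    and q: "q \<in> functors K W AA" "fcomp K W AA A \<pi>1 q = \<epsilon> 0 [1]" "fcomp K W AA A \<pi>2 q = \<epsilon> 0 [0]"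
  shows "q \<in> Isofib K W AA"
proof (rule restriction_isofib [OF A endpoints_subset endpoints_cotensor [OF A AA] W q(1)])
  note DW = cotensorD [OF W] and DA = bin_productD [OF AA]
  fix m u assume "u \<in> simplices endpoints m"
  moreover have "dg (Fun K W A) m (\<epsilon> 0 [v]) = \<epsilon> m (const m v)" if "v \<le> 1" for v
    using smap_dg [OF DW(2), of "[v]" m] that by (simp add: std_dg Delta_eval)
  ultimately show "pre K W AA A q m (dg (Fun K AA A) m (if hd u = 1 then \<pi>1 else \<pi>2)) = \<epsilon> m u"
    using A DA DW(1) q by (auto simp: pre_dg endpoints_def)
qed

lemma slice_quasi_category:
  assumes B: "ob B" and X: "X \<in> Obj (slice K B)" and Y: "Y \<in> Obj (slice K B)"
  shows "quasi_category (Fun (slice K B) X Y)"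
  unfolding quasi_category_def
proof (intro conjI allI impI)
  have o: "fst X \<in> Obj K" "fst Y \<in> Obj K" "snd Y \<in> Isofib K (fst Y) B" "snd X \<in> functors K (fst X) B"
    using X Y B isofib_functor by auto
  show "simplicial_set (Fun (slice K B) X Y)"
    using slice_category [OF B] X Y unfolding simplicial_category_def by blast
  fix n k :: nat assume k: "0 < k" "k < n"
  have l: "lifts_along (Fun K (fst X) (fst Y)) (Fun K (fst X) B) (post K (fst X) (fst Y) B (snd Y)) (horn n k) (std n)"
    using fun_isofib [OF o(1,2) B o(3)] k by (simp add: qcat_isofibration_def)
  show "extends_along (Fun (slice K B) X Y) (horn n k) (std n)"
    unfolding extends_along_def
  proof (intro allI impI)
    fix \<phi> assume \<phi>: "smap (horn n k) (Fun (slice K B) X Y) \<phi>"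
    have \<phi>': "smap (horn n k) (Fun K (fst X) (fst Y)) \<phi>"
      by (rule simplicial_mapI) (use smap_in [OF \<phi>] smap_act [OF \<phi>] in \<open>auto simp: slice_simplices simp del: simplices_horn\<close>)
    have "\<forall>m. \<forall>u\<in>simplices (horn n k) m. post K (fst X) (fst Y) B (snd Y) m (\<phi> m u) = dg (Fun K (fst X) B) m (snd X)"
      using smap_in [OF \<phi>] by (simp add: slice_simplices del: simplices_horn)
    then obtain \<psi> where \<psi>: "smap (std n) (Fun K (fst X) (fst Y)) \<psi>" "\<forall>m. \<forall>u\<in>simplices (horn n k) m. \<psi> m u = \<phi> m u"
      "\<forall>m. \<forall>v\<in>simplices (std n) m. post K (fst X) (fst Y) B (snd Y) m (\<psi> m v) = dg (Fun K (fst X) B) m (snd X)"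
      using l [unfolded lifts_along_def, rule_format, OF \<phi>' dg_smap [OF o(1) B o(4)]] by blast
    have "smap (std n) (Fun (slice K B) X Y) \<psi>"
      by (rule simplicial_mapI) (use smap_in [OF \<psi>(1)] smap_act [OF \<psi>(1)] \<psi>(3) in \<open>auto simp: slice_simplices\<close>)
    then show "\<exists>\<psi>. smap (std n) (Fun (slice K B) X Y) \<psi> \<and> (\<forall>m. \<forall>u\<in>simplices (horn n k) m. \<psi> m u = \<phi> m u)"
      using \<psi>(2) by blast
  qed
qed

text \<open>The arrow object of p in the slice over B consists of the arrows of F whose image in B is constant. Evaluation at a vertex v is a pullback of the Leibniz map of
p with the inclusion of v, so it is an isofibration.\<close>

lemma slice_arrow_object_isofib:
  assumes B: "ob B" and F: "ob F" and p: "p \<in> Isofib K F B" and v: "v \<le> 1"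
  shows "\<exists>W \<epsilon>. is_cotensor (slice K B) (F, p) (std 1) W \<epsilon> \<and> \<epsilon> 0 [v] \<in> Isofib K (fst W) F"
proof -
  interpret S: isofib_category "slice K B" by (rule slice_isofib_category [OF B])
  let ?U = "vertex v" and ?V = "std 1"
  note UV = vertex_subset [OF v]
  have pf: "p \<in> functors K F B" by (rule isofib_subset [OF F B p])
  have V0: "[v] \<in> simplices ?V 0" using v by (simp add: Delta_eval)
  obtain FV \<epsilon>FV where FV: "is_cotensor K F ?V FV \<epsilon>FV" using finitary_cotensor [OF F simplicial_set_std] by blast
  obtain BV \<epsilon>BV where BV: "is_cotensor K B ?V BV \<epsilon>BV" using finitary_cotensor [OF B simplicial_set_std] by blast
  note DFV = cotensorD [OF FV] and DBV = cotensorD [OF BV]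
  note O = B F pf DFV(1) DBV(1)
  obtain pV where pV: "pV \<in> functors K FV BV" "\<And>m u. u \<in> simplices ?V m ==> pre K FV BV B pV m (\<epsilon>BV m u) = post K FV F B p m (\<epsilon>FV m u)"
    using cotensor_functor [OF BV B DFV(1) smap_comp [OF DFV(2) post_smap [OF DFV(1) F B pf]]] by blast
  define evF where "evF = \<epsilon>FV 0 [v]"
  define evB where "evB = \<epsilon>BV 0 [v]"
  have ev: "evF \<in> functors K FV F" "evB \<in> functors K BV B"
    unfolding evF_def evB_def using DFV(3) [OF V0] DBV(3) [OF V0] by auto
  have evn: "\<epsilon>FV n (const n v) = dg (Fun K FV F) n evF" "\<epsilon>BV n (const n v) = dg (Fun K BV B) n evB" for n
    unfolding evF_def evB_def using smap_dg [OF DFV(2) V0, of n] smap_dg [OF DBV(2) V0, of n] by (simp_all only: std_dg)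
  (* P consists of an object of F and an arrow of B at its image; m sends an arrow of F to its value at v and its image *)
  obtain P a0 b0 where P: "is_pullback K F BV B p evB P a0 b0" "b0 \<in> Isofib K P BV"
    using pullbacks [OF F B DBV(1) p ev(2)] pullback_isofib [OF F B DBV(1) p ev(2)] by blast
  note DP = pullbackD [OF P(1)]
  have "fcomp K FV F B p evF = fcomp K FV BV B evB pV"
    using pV(2) [OF V0] O pV(1) ev by (simp add: pre_0 post_0 evB_def evF_def)
  then obtain m where m: "m \<in> functors K FV P" "fcomp K FV P F a0 m = evF" "fcomp K FV P BV b0 m = pV"
    using pullback_ex [OF P(1) DFV(1) ev(1) pV(1)] O DP ev pV(1) by (auto simp: post_0)
  have m_iso: "m \<in> Isofib K FV P"
  proof (rule leibniz_isofib [OF F B p UV vertex_cotensor [OF F v] FV vertex_cotensor [OF B v] BV pf _ ev(2) _ P(1) m(1)])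
    fix n u assume "u \<in> simplices ?U n"
    then have u: "u = const n v" by (simp add: vertex_def)
    show "pre K F B B p n (dg (Fun K B B) n (Idt K B)) = post K F F B p n (dg (Fun K F F) n (Idt K F))"
      "pre K BV B B evB n (dg (Fun K B B) n (Idt K B)) = \<epsilon>BV n u"
      "pre K FV F F (fcomp K FV P F a0 m) n (dg (Fun K F F) n (Idt K F)) = \<epsilon>FV n u"
      unfolding u evn m(2) using O ev by (simp_all add: pre_dg post_dg)
  next
    fix n u assume "u \<in> simplices ?V n"
    then show "pre K FV BV B (fcomp K FV P BV b0 m) n (\<epsilon>BV n u) = post K FV F B p n (\<epsilon>FV n u)"
      unfolding m(3) by (rule pV(2))
  qed
  (* h adds the constant arrow, so W is the object of arrows with constant image *)
  obtain c where c: "c \<in> functors K B BV" "\<And>m u. u \<in> simplices ?V m ==> pre K B BV B c m (\<epsilon>BV m u) = dg (Fun K B B) m (Idt K B)"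
    using cotensor_functor [OF BV B B dg_smap [OF B B idt_in [OF B]]] by blast
  have ec: "fcomp K B BV B evB c = Idt K B"
    using c(2) [OF V0] O c(1) ev by (simp add: pre_0 dg_0 evB_def)
  have "fcomp K F F B p (Idt K F) = fcomp K F BV B evB (fcomp K F B BV c p)"
    using O c(1) ev ec by (simp flip: fcomp_assoc)
  then obtain h where h: "h \<in> functors K F P" "fcomp K F P F a0 h = Idt K F" "fcomp K F P BV b0 h = fcomp K F B BV c p"
    using pullback_ex [OF P(1) F idt_in [OF F], of "fcomp K F B BV c p"] O DP ev c(1) by (auto simp: post_0)
  obtain W w1 w2 where W: "is_pullback K FV F P m h W w1 w2" "w2 \<in> Isofib K W F"
    using pullbacks [OF DFV(1) DP(1) F m_iso h(1)] pullback_isofib [OF DFV(1) DP(1) F m_iso h(1)] by blast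
  note DW = pullbackD [OF W(1)]
  define q where "q = fcomp K W F B p w2"
  have q: "q \<in> Isofib K W B" unfolding q_def by (rule isofib_comp [OF DW(1) F B W(2) p])
  have WO: "(W, q) \<in> Obj (slice K B)" using DW(1) q by simp
  define \<epsilon> where "\<epsilon> n u = pre K W FV F w1 n (\<epsilon>FV n u)" for n u
  have ew: "fcomp K W FV F evF w1 = w2"
  proof -
    have "fcomp K W FV F evF w1 = fcomp K W P F a0 (fcomp K W FV P m w1)"
      using O DP DW m by (simp flip: m(2) add: fcomp_assoc)
    also have "\<dots> = w2" unfolding DW(4) using O DP DW h by (simp flip: fcomp_assoc)
    finally show ?thesis .
  qed
  have \<epsilon>v: "\<epsilon> 0 [v] = w2"
    using O DW ev ew by (simp add: \<epsilon>_def evF_def [symmetric] pre_0)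
  have \<epsilon>p: "post K W F B p n (\<epsilon> n u) = dg (Fun K W B) n q" if u: "u \<in> simplices ?V n" for n u
  proof -
    have pVw: "fcomp K W FV BV pV w1 = fcomp K W B BV c q"
    proof -
      have "fcomp K W FV BV pV w1 = fcomp K W P BV b0 (fcomp K W FV P m w1)"
        using O DP DW m by (simp flip: m(3) add: fcomp_assoc)
      also have "\<dots> = fcomp K W F BV (fcomp K F P BV b0 h) w2"
        unfolding DW(4) using O DP DW h(1) by (simp add: fcomp_assoc)
      also have "\<dots> = fcomp K W B BV c q" unfolding h(3) q_def using O DW c(1) by (simp add: fcomp_assoc)
      finally show ?thesis .
    qed
    have "post K W F B p n (\<epsilon> n u) = pre K W FV B w1 n (pre K FV BV B pV n (\<epsilon>BV n u))"
      unfolding \<epsilon>_def pV(2) [OF u] using O DW DFV(3) [OF u] by (simp add: post_pre)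
    also have "\<dots> = pre K W B B q n (pre K B BV B c n (\<epsilon>BV n u))"
      using O DW DBV(3) [OF u] pV(1) c(1) isofib_subset [OF DW(1) B q] pVw by (simp add: pre_pre)
    also have "\<dots> = dg (Fun K W B) n q"
      unfolding c(2) [OF u] using O DW isofib_subset [OF DW(1) B q] by (simp add: pre_dg)
    finally show ?thesis .
  qed
  have \<epsilon>_smap: "smap ?V (Fun (slice K B) (W, q) (F, p)) \<epsilon>"
  proof -
    have "smap ?V (Fun K W F) \<epsilon>"
      unfolding \<epsilon>_def by (rule smap_comp [OF DFV(2) pre_smap [OF DW(1) DFV(1) F DW(2)]])
    from smap_in [OF this] smap_act [OF this] show ?thesis
      by (intro simplicial_mapI) (auto simp: slice_simplices \<epsilon>p)
  qed
  have "is_cotensor (slice K B) (F, p) ?V (W, q) \<epsilon>"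
    unfolding is_cotensor_def
  proof (intro conjI ballI allI impI)
    fix X n \<phi> assume X: "X \<in> Obj (slice K B)" and \<phi>: "smap (sprod ?V (std n)) (Fun (slice K B) X (F, p)) \<phi>"
    define X0 where "X0 = fst X"
    have X0: "ob X0" "snd X \<in> functors K X0 B" using X B isofib_functor by (auto simp: X0_def)
    have \<phi>': "smap (sprod ?V (std n)) (Fun K X0 F) \<phi>"
      by (rule simplicial_mapI) (use smap_in [OF \<phi>] smap_act [OF \<phi>] in \<open>auto simp: slice_simplices X0_def\<close>)
    have \<phi>p: "post K X0 F B p m (\<phi> m (u, \<alpha>)) = dg (Fun K X0 B) m (snd X)" if "u \<in> Delta m 1" "\<alpha> \<in> Delta m n" for m u \<alpha>
      using smap_in [OF \<phi>, of "(u, \<alpha>)" m] that by (simp add: slice_simplices X0_def)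
    obtain z where z: "z \<in> cells X0 FV n"
      "\<And>m u \<alpha>. u \<in> Delta m 1 ==> \<alpha> \<in> Delta m n ==> Cmp K X0 FV F m (\<epsilon>FV m u) (res K X0 FV n \<alpha> z) = \<phi> m (u, \<alpha>)"
      using cotensor_cell [OF FV F X0(1) \<phi>'] by auto
    define y where "y = post K X0 FV F evF n z"
    have y: "y \<in> cells X0 F n" using X0 z O ev by (simp add: y_def)
    have py: "post K X0 F B p n y = dg (Fun K X0 B) n (snd X)"
    proof -
      have "y = \<phi> n (const n v, [0..<Suc n])"
        using z(2) [of "const n v" n "[0..<Suc n]"] v X0 O z(1)
        by (simp add: y_def evn cmp_dg_left ss_id [OF fun_set] del: upt_Suc)
      then show ?thesis using \<phi>p [of "const n v" n "[0..<Suc n]"] v by (simp del: upt_Suc)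
    qed
    have "post K X0 FV BV pV n z = post K X0 B BV c n (post K X0 F B p n y)"
    proof (rule cotensor_unique [OF BV B X0(1)])
      fix m u \<alpha> assume "u \<in> simplices ?V m" and \<alpha>: "\<alpha> \<in> Delta m n"
      then have u: "u \<in> simplices ?V m" "u \<in> Delta m 1" by simp_all
      have "Cmp K X0 BV B m (\<epsilon>BV m u) (res K X0 BV n \<alpha> (post K X0 FV BV pV n z)) =
          Cmp K X0 FV B m (pre K FV BV B pV m (\<epsilon>BV m u)) (res K X0 FV n \<alpha> z)"
        using X0 O z(1) pV(1) \<alpha> DBV(3) [OF u(1)] by (simp add: act_post cmp_pre act_cells)
      also have "\<dots> = post K X0 F B p m (\<phi> m (u, \<alpha>))"
        unfolding pV(2) [OF u(1)] z(2) [OF u(2) \<alpha>, symmetric]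
        using X0 O z(1) \<alpha> DFV(3) [OF u(1)] by (simp add: cmp_post act_cells)
      also have "\<dots> = res K X0 B n \<alpha> (dg (Fun K X0 B) n (snd X))"
        using \<phi>p [OF u(2) \<alpha>] X0 O \<alpha> by (simp add: act_dg_cells)
      also have "\<dots> = Cmp K X0 B B m (dg (Fun K B B) m (Idt K B)) (res K X0 B n \<alpha> (post K X0 F B p n y))"
        unfolding py cmp_dg_left using X0 O \<alpha> by (simp add: act_dg_cells)
      also have "\<dots> = Cmp K X0 BV B m (\<epsilon>BV m u) (res K X0 BV n \<alpha> (post K X0 B BV c n (post K X0 F B p n y)))"
        unfolding c(2) [OF u(1), symmetric]
        using X0 O y c(1) \<alpha> DBV(3) [OF u(1)] by (simp add: act_post cmp_pre act_cells)
      finally show "Cmp K X0 BV B m (\<epsilon>BV m u) (res K X0 BV n \<alpha> (post K X0 FV BV pV n z)) =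
        Cmp K X0 BV B m (\<epsilon>BV m u) (res K X0 BV n \<alpha> (post K X0 B BV c n (post K X0 F B p n y)))" .
    qed (use X0 O z(1) pV(1) c(1) y in simp_all)
    then have m1: "post K X0 P BV b0 n (post K X0 FV P m n z) = post K X0 P BV b0 n (post K X0 F P h n y)"
      using X0 O DP m h z(1) y c(1) by (simp add: post_post)
    have m2: "post K X0 P F a0 n (post K X0 FV P m n z) = post K X0 P F a0 n (post K X0 F P h n y)"
      using X0 O DP m h z(1) y by (simp add: post_post y_def [symmetric])
    have "post K X0 FV P m n z = post K X0 F P h n y"
      by (rule pullback_unique [OF P(1) X0(1) F DBV(1) B pf ev(2), where n = n]) (use m1 m2 X0 O DP m(1) h(1) z(1) y in simp_all)
    then obtain w where w: "w \<in> cells X0 W n" "post K X0 W FV w1 n w = z" "post K X0 W F w2 n w = y"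
      using pullback_ex [OF W(1) X0(1) z(1) y] by blast
    have comp: "Cmp K X0 W F k (\<epsilon> k u) (res K X0 W n \<alpha> x) = Cmp K X0 FV F k (\<epsilon>FV k u) (res K X0 FV n \<alpha> (post K X0 W FV w1 n x))"
      if "x \<in> cells X0 W n" "u \<in> simplices ?V k" "\<alpha> \<in> Delta k n" for x u \<alpha> k
      unfolding \<epsilon>_def using that X0 O DW DFV(3) [OF that(2)] by (simp add: cmp_pre act_cells act_post)
    have "post K X0 W B q n w = dg (Fun K X0 B) n (snd X)"
      unfolding q_def using X0 O DW w py by (simp flip: post_post)
    then have wS: "w \<in> simplices (Fun (slice K B) X (W, q)) n" using w by (simp add: slice_simplices X0_def)
    show "\<exists>!x. x \<in> simplices (Fun (slice K B) X (W, q)) n \<and> (\<forall>m. \<forall>u\<in>simplices ?V m. \<forall>\<alpha>\<in>Delta m n.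
        Cmp (slice K B) X (W, q) (F, p) m (\<epsilon> m u) (act (Fun (slice K B) X (W, q)) n \<alpha> x) = \<phi> m (u, \<alpha>))"
    proof (rule ex1I [of _ w])
      show "w \<in> simplices (Fun (slice K B) X (W, q)) n \<and> (\<forall>m. \<forall>u\<in>simplices ?V m. \<forall>\<alpha>\<in>Delta m n.
        Cmp (slice K B) X (W, q) (F, p) m (\<epsilon> m u) (act (Fun (slice K B) X (W, q)) n \<alpha> w) = \<phi> m (u, \<alpha>))"
        using wS comp [OF w(1)] z(2) w(2) by (simp add: X0_def)
      fix x assume x: "x \<in> simplices (Fun (slice K B) X (W, q)) n \<and> (\<forall>m. \<forall>u\<in>simplices ?V m. \<forall>\<alpha>\<in>Delta m n.
        Cmp (slice K B) X (W, q) (F, p) m (\<epsilon> m u) (act (Fun (slice K B) X (W, q)) n \<alpha> x) = \<phi> m (u, \<alpha>))"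
      then have x': "x \<in> cells X0 W n" by (simp add: slice_simplices X0_def)
      have x1: "post K X0 W FV w1 n x = z"
        by (rule cotensor_unique [OF FV F X0(1)])
          (use x x' comp [OF x'] z X0 O DW in \<open>auto simp: X0_def\<close>)
      then have x2: "post K X0 W F w2 n x = post K X0 W F w2 n w"
        using w(2) x' w(1) X0 O DW ev by (simp flip: ew post_post)
      show "x = w"
        by (rule pullback_unique [OF W(1) X0(1) DFV(1) F DP(1) m(1) h(1) x' w(1)]) (use x1 x2 w x' O DP m(1) h(1) in simp_all)
    qed
  qed (use WO \<epsilon>_smap in simp_all)
  then show ?thesis using \<epsilon>v W(2) by (intro exI conjI) auto
qed

sublocale arrow_cosmos
proof unfold_locales
  fix B F v assume "ob B" "F \<in> Obj (slice K B)" "v \<le> (1::nat)"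
  then show "\<exists>W \<epsilon>. is_cotensor (slice K B) F (std 1) W \<epsilon> \<and> \<epsilon> 0 [v] \<in> Isofib K (fst W) (fst F)"
    using slice_arrow_object_isofib [of B "fst F" "snd F" v] by auto
next
  fix E B C p f assume "ob E" "ob B" "ob C" "p \<in> Isofib K E B" "f \<in> functors K C B"
  then show "\<exists>P a b. is_pullback K E C B p f P a b \<and> b \<in> Isofib K P C"
    using pullbacks [of E B C p f] pullback_isofib [of E B C p f] by blast
qed (rule hom_quasi isofib_comp slice_quasi_category; assumption)+

end

section \<open>Comma objects have groupoidal fibres\<close>

text \<open>The filler of a horn of edges can be chosen over a given triangle.\<close>

lemma lift2:
  assumes X: "simplicial_set X" and Y: "simplicial_set Y" and l: "lifts_along X Y \<pi> (horn 2 1) (std 2)" and \<pi>: "smap X Y \<pi>"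
    and ab: "a \<in> simplices X 1" "b \<in> simplices X 1" "act X 1 [1] a = act X 1 [0] b"
    and \<sigma>: "\<sigma> \<in> simplices Y 2" "act Y 2 [0, 1] \<sigma> = \<pi> 1 a" "act Y 2 [1, 2] \<sigma> = \<pi> 1 b"
  shows "\<exists>\<tau>\<in>simplices X 2. act X 2 [0, 1] \<tau> = a \<and> act X 2 [1, 2] \<tau> = b \<and> \<pi> 2 \<tau> = \<sigma>"
proof -
  let ?F = "\<lambda>i::nat. if i = 0 then b else a"
  have "\<exists>\<phi>. smap (horn (Suc (Suc 0)) 1) X \<phi> \<and> (\<forall>i\<le>Suc (Suc 0). i \<noteq> 1 \<longrightarrow> \<phi> (Suc 0) (coface (Suc 0) i) = ?F i)"
  proof (rule horn_map_of_faces [OF X])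
    fix i j :: nat assume "i < j" "j \<le> Suc (Suc 0)" "i \<noteq> 1" "j \<noteq> 1"
    then have "i = 0" "j = 2" by auto
    then show "act X (Suc 0) (coface 0 i) (?F j) = act X (Suc 0) (coface 0 (j - 1)) (?F i)"
      using ab(3) by (simp add: coface_eval [unfolded One_nat_def])
  qed (use ab in auto)
  then obtain \<phi> where \<phi>: "smap (horn 2 1) X \<phi>"
    "\<And>i. i \<le> 2 ==> i \<noteq> 1 ==> \<phi> 1 (coface 1 i) = ?F i" by (auto simp: numeral_2_eq_2)
  have faces: "\<phi> 1 [0, 1] = a" "\<phi> 1 [1, 2] = b"
    using \<phi>(2) [of 2] \<phi>(2) [of 0] unfolding coface_eval by simp_all
  have "\<forall>m. \<forall>u\<in>simplices (horn 2 1) m. \<pi> m (\<phi> m u) = act Y 2 u \<sigma>"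
  proof (intro allI ballI)
    fix m u assume u: "u \<in> simplices (horn 2 1) m"
    then obtain i where i: "i \<le> 2" "i \<noteq> 1" "i \<notin> set u" and u': "u \<in> Delta m 2" by auto
    have n2: "Suc 1 = 2" by simp
    have sq: "squash i u \<in> Delta m 1" "coface 1 i \<odot> squash i u = u"
      using squash_in [of u m 1 i] coface_squash [of u m 1 i] i u' by (simp_all add: n2 numeral_2_eq_2)
    have c: "coface 1 i \<in> simplices (horn 2 1) 1" using coface_in_horn [of i 1 1] i by (simp add: n2 numeral_2_eq_2)
    have "\<pi> m (\<phi> m u) = act Y 1 (squash i u) (\<pi> 1 (\<phi> 1 (coface 1 i)))"
      using smap_act [OF \<phi>(1) sq(1) c] sq smap_act [OF \<pi> sq(1) smap_in [OF \<phi>(1) c]] by simp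
    also have "\<pi> 1 (\<phi> 1 (coface 1 i)) = act Y 2 (coface 1 i) \<sigma>"
    proof -
      have "i = 0 \<or> i = 2" using i by auto
      then show ?thesis
      proof
        assume "i = 0"
        then show ?thesis unfolding coface_eval using faces(2) \<sigma>(3) by (simp only: coface_eval)
      next
        assume "i = 2"
        then show ?thesis unfolding coface_eval using faces(1) \<sigma>(2) by (simp only: coface_eval)
      qed
    qed
    also have "act Y 1 (squash i u) \<dots> = act Y 2 u \<sigma>"
      using ss_comp [OF Y sq(1) _ \<sigma>(1), of "coface 1 i"] sq(2) coface_in [of 1 i] by (simp add: n2 numeral_2_eq_2)
    finally show "\<pi> m (\<phi> m u) = act Y 2 u \<sigma>" .
  qed
  then obtain \<psi> where \<psi>: "smap (std 2) X \<psi>" "\<forall>m. \<forall>u\<in>simplices (horn 2 1) m. \<psi> m u = \<phi> m u"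
    "\<forall>m. \<forall>v\<in>simplices (std 2) m. \<pi> m (\<psi> m v) = act Y 2 v \<sigma>"
    using l [unfolded lifts_along_def, rule_format, OF \<phi>(1) smap_of_simplex [OF Y \<sigma>(1)]] by blast
  have i2: "[0, 1, 2] \<in> Delta 2 2" "[0, 1] \<in> Delta 1 2" "[1, 2] \<in> Delta 1 2"
    by (simp_all add: Delta_eval)
  have h: "[0, 1] \<in> simplices (horn 2 1) 1" "[1, 2] \<in> simplices (horn 2 1) 1"
    using i2 by (auto intro: exI [of _ 2] exI [of _ 0])
  show ?thesis
  proof (intro bexI conjI)
    show "\<psi> 2 [0, 1, 2] \<in> simplices X 2" using smap_in [OF \<psi>(1)] i2(1) by simp
    have "act X 2 s (\<psi> 2 [0, 1, 2]) = \<phi> 1 s" if "s \<in> simplices (horn 2 1) 1" "s \<in> Delta 1 2" "[0, 1, 2] \<odot> s = s" for s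
      using smap_act [OF \<psi>(1) that(2), of "[0, 1, 2]"] i2(1) that \<psi>(2) by simp
    from this [OF h(1) i2(2)] this [OF h(2) i2(3)] show "act X 2 [0, 1] (\<psi> 2 [0, 1, 2]) = a" "act X 2 [1, 2] (\<psi> 2 [0, 1, 2]) = b"
      using faces by simp_all
    have "[0..<Suc 2] = [0, 1, 2]" by (simp add: eval_nat_numeral)
    then show "\<pi> 2 (\<psi> 2 [0, 1, 2]) = \<sigma>"
      using \<psi>(3) i2(1) ss_id [OF Y \<sigma>(1)] by simp
  qed
qed

subsection \<open>Contracting a horn\<close>

text \<open>Both contract the horn, with parameter t: \<open>push\<close> moves the identity to the map that replaces v by the maximum of v and k, and \<open>pull\<close> leads from the constant
map with value k to the latter. The horn is preserved since k is the only vertex that is added.\<close>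

definition push :: "nat \<Rightarrow> nat \<Rightarrow> nat list \<Rightarrow> nat list \<Rightarrow> nat list" where
  "push k m v t = tab m (\<lambda>l. if t ! l = 0 then v ! l else max (v ! l) k)"

definition pull :: "nat \<Rightarrow> nat \<Rightarrow> nat list \<Rightarrow> nat list \<Rightarrow> nat list" where
  "pull k m v t = tab m (\<lambda>l. if t ! l = 0 then k else max (v ! l) k)"

lemma push_in:
  assumes v: "v \<in> Delta m n" and t: "t \<in> Delta m 1" and k: "k \<le> n"
  shows "push k m v t \<in> Delta m n"
proof -
  have "push k m v t ! l \<le> push k m v t ! l'" if "l \<le> l'" "l' \<le> m" for l l'
    using that Delta_mono [OF v that] Delta_mono [OF t that] by (auto simp: push_def)
  then show ?thesis
    using Delta_nth_le [OF v] k unfolding Delta_iff by (auto simp: push_def)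
qed

lemma pull_in:
  assumes v: "v \<in> Delta m n" and t: "t \<in> Delta m 1" and k: "k \<le> n"
  shows "pull k m v t \<in> Delta m n"
proof -
  have "pull k m v t ! l \<le> pull k m v t ! l'" if "l \<le> l'" "l' \<le> m" for l l'
    using that Delta_mono [OF v that] Delta_mono [OF t that] by (auto simp: pull_def)
  then show ?thesis
    using Delta_nth_le [OF v] k unfolding Delta_iff by (auto simp: pull_def)
qed

lemma set_push_pull:
  assumes v: "v \<in> Delta m n"
  shows "set (push k m v t) \<subseteq> insert k (set v)" "set (pull k m v t) \<subseteq> insert k (set v)"
proof -
  have "v ! l \<in> set v" if "l \<le> m" for l using that Delta_length [OF v] by simp
  then show "set (push k m v t) \<subseteq> insert k (set v)" "set (pull k m v t) \<subseteq> insert k (set v)"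
    by (auto simp: push_def pull_def set_tab max_def)
qed

lemma push_pull_horn:
  assumes v: "v \<in> simplices (horn n k) m" and t: "t \<in> Delta m 1" and k: "k \<le> n"
  shows "push k m v t \<in> simplices (horn n k) m" "pull k m v t \<in> simplices (horn n k) m"
proof -
  obtain i where i: "i \<le> n" "i \<noteq> k" "i \<notin> set v" and v': "v \<in> Delta m n" using v by auto
  then show "push k m v t \<in> simplices (horn n k) m" "pull k m v t \<in> simplices (horn n k) m"
    unfolding simplices_horn using set_push_pull [OF v'] push_in [OF v' t k] pull_in [OF v' t k]
    by (intro CollectI conjI exI [of _ i]; blast)+
qed

lemma push_smap: "k \<le> n ==> smap (sprod (horn n k) (std 1)) (horn n k) (\<lambda>m (v, t). push k m v t)"
proof (rule simplicial_mapI)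
  fix m m' \<alpha> x assume \<alpha>: "\<alpha> \<in> Delta m m'" and x: "x \<in> simplices (sprod (horn n k) (std 1)) m'"
  then show "(\<lambda>(v, t). push k m v t) (act (sprod (horn n k) (std 1)) m' \<alpha> x) = act (horn n k) m' \<alpha> ((\<lambda>(v, t). push k m' v t) x)"
    by (auto simp: push_def tab_reindex [OF \<alpha>] tab_eq_iff nth_reindex [OF \<alpha>])
qed (use push_pull_horn(1) in \<open>auto simp del: simplices_horn\<close>)

lemma pull_smap: "k \<le> n ==> smap (sprod (horn n k) (std 1)) (horn n k) (\<lambda>m (v, t). pull k m v t)"
proof (rule simplicial_mapI)
  fix m m' \<alpha> x assume \<alpha>: "\<alpha> \<in> Delta m m'" and x: "x \<in> simplices (sprod (horn n k) (std 1)) m'"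
  then show "(\<lambda>(v, t). pull k m v t) (act (sprod (horn n k) (std 1)) m' \<alpha> x) = act (horn n k) m' \<alpha> ((\<lambda>(v, t). pull k m' v t) x)"
    by (auto simp: pull_def tab_reindex [OF \<alpha>] tab_eq_iff nth_reindex [OF \<alpha>])
qed (use push_pull_horn(2) in \<open>auto simp del: simplices_horn\<close>)

context inf_cosmos
begin

text \<open>The square S, with coordinates i and t, is constant at i = 0 and i = 1, so its edges t = 0 and t = 1 are homotopic; this holds in the cotensor, hence for all members of the
family at once.\<close>

lemma family_homotopic:
  assumes A: "ob A" and X: "ob X" and P: "is_cotensor K A U P \<epsilon>" and U: "simplicial_set U"
    and S: "smap (sprod U (sprod (std 1) (std 1))) (Fun K X A) S"
    and u: "u \<in> functors K X A" and w: "w \<in> functors K X A"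
    and S0: "\<And>m z t. z \<in> simplices U m ==> t \<in> Delta m 1 ==> S m (z, const m 0, t) = dg (Fun K X A) m u"
    and S1: "\<And>m z t. z \<in> simplices U m ==> t \<in> Delta m 1 ==> S m (z, const m 1, t) = dg (Fun K X A) m w"
    and x: "x \<in> cells X P 1" "\<And>m z i. z \<in> simplices U m ==> i \<in> Delta m 1 ==>
      Cmp K X P A m (\<epsilon> m z) (res K X P 1 i x) = S m (z, i, const m 0)"
    and y: "y \<in> cells X P 1" "\<And>m z i. z \<in> simplices U m ==> i \<in> Delta m 1 ==>
      Cmp K X P A m (\<epsilon> m z) (res K X P 1 i y) = S m (z, i, const m 1)"
  shows "homotopic (Fun K X P) x y"
proof -
  note D = cotensorD [OF P]
  have QP: "quasi_category (Fun K X P)" by (rule hom_quasi [OF X D(1)])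
  obtain \<theta> where \<theta>: "smap (sprod (std 1) (std 1)) (Fun K X P) \<theta>"
    "\<And>m z q. z \<in> simplices U m ==> q \<in> simplices (sprod (std 1) (std 1)) m ==> Cmp K X P A m (\<epsilon> m z) (\<theta> m q) = S m (z, q)"
    using cotensor_transpose [OF P A X simplicial_set_sprod [OF simplicial_set_std simplicial_set_std] S] by blast
  have const: "\<exists>c\<in>functors K X P. \<forall>m. \<forall>t\<in>Delta m 1. \<theta> m (const m v, t) = dg (Fun K X P) m c"
    if v: "v \<le> 1" and s: "s \<in> functors K X A"
      and Sv: "\<And>m z t. z \<in> simplices U m ==> t \<in> Delta m 1 ==> S m (z, const m v, t) = dg (Fun K X A) m s" for v s
  proof -
    obtain c where c: "c \<in> functors K X P" "\<And>m z. z \<in> simplices U m ==> pre K X P A c m (\<epsilon> m z) = dg (Fun K X A) m s"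
      using cotensor_functor [OF P A X dg_smap [OF X A s]] by blast
    have "\<theta> m (const m v, t) = dg (Fun K X P) m c" if t: "t \<in> Delta m 1" for m t
    proof (rule cotensor_unique [OF P A X])
      have q: "(const m v, t) \<in> simplices (sprod (std 1) (std 1)) m" using t v by simp
      show "\<theta> m (const m v, t) \<in> cells X P m" by (rule smap_in [OF \<theta>(1) q])
      fix k z \<alpha> assume z: "z \<in> simplices U k" and \<alpha>: "\<alpha> \<in> Delta k m"
      have "Cmp K X P A k (\<epsilon> k z) (res K X P m \<alpha> (\<theta> m (const m v, t))) = S k (z, const k v, t \<odot> \<alpha>)"
        using smap_act [OF \<theta>(1) \<alpha> q] \<theta>(2) [OF z, of "(const k v, t \<odot> \<alpha>)"] \<alpha> t v by simp
      also have "\<dots> = dg (Fun K X A) k s" by (rule Sv [OF z Delta_reindex [OF \<alpha> t]])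
      also have "\<dots> = Cmp K X P A k (\<epsilon> k z) (res K X P m \<alpha> (dg (Fun K X P) m c))"
        using c(2) [OF z] X D(1) c(1) \<alpha> by (simp add: act_dg_cells cmp_dg_right)
      finally show "Cmp K X P A k (\<epsilon> k z) (res K X P m \<alpha> (\<theta> m (const m v, t))) =
        Cmp K X P A k (\<epsilon> k z) (res K X P m \<alpha> (dg (Fun K X P) m c))" .
    qed (use X D(1) c(1) in simp)
    then show ?thesis using c(1) by blast
  qed
  obtain c0 where c0: "\<And>m t. t \<in> Delta m 1 ==> \<theta> m (const m 0, t) = dg (Fun K X P) m c0"
    using const [of 0, OF _ u S0] by blast
  obtain c1 where c1: "\<And>m t. t \<in> Delta m 1 ==> \<theta> m (const m 1, t) = dg (Fun K X P) m c1"
    using const [of 1, OF _ w S1] by blast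
  have edge: "\<theta> 1 ([0, 1], replicate 2 v) = e"
    if v: "v \<le> 1" and e: "e \<in> cells X P 1" "\<And>m z i. z \<in> simplices U m ==> i \<in> Delta m 1 ==>
      Cmp K X P A m (\<epsilon> m z) (res K X P 1 i e) = S m (z, i, const m v)" for v e
  proof (rule cotensor_unique [OF P A X _ e(1)])
    have n2: "replicate 2 v = const 1 v" by (simp add: numeral_2_eq_2)
    have q: "([0, 1], replicate 2 v) \<in> simplices (sprod (std 1) (std 1)) 1"
      unfolding n2 using v by (simp add: Delta_eval)
    show "\<theta> 1 ([0, 1], replicate 2 v) \<in> cells X P 1" by (rule smap_in [OF \<theta>(1) q])
    fix k z i assume z: "z \<in> simplices U k" and i: "i \<in> Delta k 1"
    have "res K X P 1 i (\<theta> 1 ([0, 1], replicate 2 v)) = \<theta> k (i, const k v)"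
      using smap_act [OF \<theta>(1) i q] std_1_id [OF i] const_reindex [OF i, of v] unfolding n2 by simp
    then show "Cmp K X P A k (\<epsilon> k z) (res K X P 1 i (\<theta> 1 ([0, 1], replicate 2 v))) = Cmp K X P A k (\<epsilon> k z) (res K X P 1 i e)"
      using \<theta>(2) [OF z, of "(i, const k v)"] e(2) [OF z i] i v by simp
  qed
  have "homotopic (Fun K X P) (\<theta> 1 ([0, 1], [0, 0])) (\<theta> 1 ([0, 1], [1, 1]))"
    by (rule square_homotopic [OF QP \<theta>(1) c0 c1])
  then show ?thesis
    using edge [of 0, OF _ x] edge [of 1, OF _ y] by (simp add: replicate_Suc numeral_2_eq_2)
qed

text \<open>A simplex of the fibre has constant feet, so it is given by its component alone: a family, indexed by the horn, of edges of Fun(X,A) with common ends.\<close>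

lemma comma_groupoidal:
  assumes obj: "ob A" "ob B" "ob C" and fg: "f \<in> functors K B A" "g \<in> functors K C A"
    and E: "is_comma K A B C f g E e0 e1 \<kappa>" and CB: "is_bin_product K C B CB \<pi>1 \<pi>2"
    and r: "r \<in> Isofib K E CB" "fcomp K E CB C \<pi>1 r = e1" "fcomp K E CB B \<pi>2 r = e0"
  shows "groupoidal (slice K CB) (E, r)"
  unfolding groupoidal_def kan_complex_def extends_along_def
proof (intro ballI conjI allI impI)
  note D = commaD [OF E] and DC = bin_productD [OF CB]
  have rf: "r \<in> functors K E CB" by (rule isofib_functor [OF D(1) DC(1) r(1)])
  fix X assume X: "X \<in> Obj (slice K CB)"
  define X0 where "X0 = fst X"
  have X0: "ob X0" "snd X \<in> functors K X0 CB" using X DC isofib_functor by (auto simp: X0_def)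
  have EO: "(E, r) \<in> Obj (slice K CB)" using D r by simp
  show "simplicial_set (Fun (slice K CB) X (E, r))"
    using slice_category [OF DC(1)] X EO unfolding simplicial_category_def by blast
  let ?Q = "Fun K X0 A"
  define xb where "xb = fcomp K X0 CB B \<pi>2 (snd X)"
  define xc where "xc = fcomp K X0 CB C \<pi>1 (snd X)"
  define u where "u = fcomp K X0 B A f xb"
  define w where "w = fcomp K X0 C A g xc"
  have xbc: "xb \<in> functors K X0 B" "xc \<in> functors K X0 C" using X0 DC obj by (simp_all add: xb_def xc_def)
  have uw: "u \<in> functors K X0 A" "w \<in> functors K X0 A" using X0 xbc obj fg by (simp_all add: u_def w_def)
  have cell: "e \<in> simplices (Fun (slice K CB) X (E, r)) m \<longleftrightarrow> e \<in> cells X0 E m \<and>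
      post K X0 E B e0 m e = dg (Fun K X0 B) m xb \<and> post K X0 E C e1 m e = dg (Fun K X0 C) m xc" for e m
  proof (cases "e \<in> cells X0 E m")
    case e: True
    have "post K X0 E CB r m e = dg (Fun K X0 CB) m (snd X) \<longleftrightarrow>
        post K X0 E B e0 m e = dg (Fun K X0 B) m xb \<and> post K X0 E C e1 m e = dg (Fun K X0 C) m xc"
    proof
      assume "post K X0 E CB r m e = dg (Fun K X0 CB) m (snd X)"
      then have "post K X0 CB B \<pi>2 m (post K X0 E CB r m e) = dg (Fun K X0 B) m xb"
        "post K X0 CB C \<pi>1 m (post K X0 E CB r m e) = dg (Fun K X0 C) m xc"
        using X0 DC obj by (simp_all add: post_dg xb_def xc_def)
      then show "post K X0 E B e0 m e = dg (Fun K X0 B) m xb \<and> post K X0 E C e1 m e = dg (Fun K X0 C) m xc"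
        using e X0 DC D rf obj r by (simp add: post_post)
    next
      assume a: "post K X0 E B e0 m e = dg (Fun K X0 B) m xb \<and> post K X0 E C e1 m e = dg (Fun K X0 C) m xc"
      show "post K X0 E CB r m e = dg (Fun K X0 CB) m (snd X)"
        by (rule bin_product_unique [OF CB X0(1) obj(3,2), where n = m])
          (use a e X0 DC D rf obj r in \<open>simp_all add: post_post post_dg xb_def xc_def\<close>)
    qed
    then show ?thesis using e by (simp add: slice_simplices X0_def)
  qed (simp add: slice_simplices X0_def)
  fix n k :: nat and \<phi> assume n: "1 \<le> n" and k: "k \<le> n" and \<phi>: "smap (horn n k) (Fun (slice K CB) X (E, r)) \<phi>"
  let ?H = "horn n k"
  have sH: "simplicial_set ?H" by (rule simplicial_subset_set [OF horn_subset])
  have kH: "const m k \<in> simplices ?H m" for m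
  proof -
    have "\<exists>i\<le>n. i \<noteq> k" using n by (cases "k = 0") auto
    then show ?thesis using k by auto
  qed
  have \<phi>c: "\<phi> m v \<in> cells X0 E m" "post K X0 E B e0 m (\<phi> m v) = dg (Fun K X0 B) m xb"
    "post K X0 E C e1 m (\<phi> m v) = dg (Fun K X0 C) m xc" if "v \<in> simplices ?H m" for m v
    using smap_in [OF \<phi> that] cell by blast+
  have \<phi>': "smap ?H (Fun K X0 E) \<phi>"
    by (rule simplicial_mapI) (use \<phi>c(1) smap_act [OF \<phi>] in \<open>auto simp: X0_def simp del: simplices_horn\<close>)
  define a where "a m i v = Cmp K X0 E A m (res K E A 1 i \<kappa>) (\<phi> m v)" for m i v
  have a_smap: "smap (sprod (std 1) ?H) ?Q (\<lambda>m (i, v). a m i v)"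
    unfolding a_def by (rule comma_component_smap [OF obj(1) X0(1) D(1,4) \<phi>'])
  have a0: "a m (const m 0) v = dg ?Q m u" "a m (const m 1) v = dg ?Q m w" if "v \<in> simplices ?H m" for m v
    unfolding a_def comma_ends [OF E obj X0(1) fg \<phi>c(1) [OF that]] \<phi>c(2,3) [OF that]
    using X0 obj fg xbc by (simp_all add: post_dg u_def w_def)
  obtain PH \<epsilon> where PH: "is_cotensor K A ?H PH \<epsilon>" using finitary_cotensor [OF obj(1) sH] by blast
  obtain PV \<delta> where PV: "is_cotensor K A (std n) PV \<delta>" using finitary_cotensor [OF obj(1) simplicial_set_std] by blast
  note DH = cotensorD [OF PH] and DV = cotensorD [OF PV]
  have "smap ?H (Fun K PV A) \<delta>"
    by (rule simplicial_mapI)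
      (use smap_in [OF DV(2)] smap_act [OF DV(2)] simplicial_subset_in [OF horn_subset] simplicial_subset_act [OF horn_subset] in
        \<open>auto simp del: simplices_horn\<close>)
  then obtain \<rho> where \<rho>: "\<rho> \<in> functors K PV PH" "\<And>m v. v \<in> simplices ?H m ==> pre K PV PH A \<rho> m (\<epsilon> m v) = \<delta> m v"
    using cotensor_functor [OF PH obj(1) DV(1)] by blast
  have \<rho>_iso: "\<rho> \<in> Isofib K PV PH" by (rule restriction_isofib [OF obj(1) horn_subset PH PV \<rho>])
  have qc: "quasi_category (Fun K X0 PH)" "quasi_category (Fun K X0 PV)" "quasi_category ?Q"
    by (rule hom_quasi; fact X0 DH(1) DV(1) obj)+
  (* such a family, restricted along a self-map h of the horn, is an edge of the cotensor by the horn *)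
  have transpose: "\<exists>x\<in>cells X0 PH 1. \<forall>m. \<forall>v\<in>simplices ?H m. \<forall>i\<in>Delta m 1. Cmp K X0 PH A m (\<epsilon> m v) (res K X0 PH 1 i x) = a m i (h m v)"
    if h: "smap ?H ?H h" for h
  proof -
    have "smap (sprod ?H (std 1)) (sprod (std 1) ?H) (\<lambda>m (v, i). (i, h m v))"
      by (rule simplicial_mapI) (use smap_in [OF h] smap_act [OF h] in \<open>auto simp del: simplices_horn\<close>)
    from smap_comp [OF this a_smap] have "smap (sprod ?H (std 1)) ?Q (\<lambda>m (v, i). a m i (h m v))"
      by (simp add: case_prod_unfold)
    from cotensor_cell [OF PH obj(1) X0(1) this] show ?thesis by auto
  qed
  have homot: "homotopic (Fun K X0 PH) x y"
    if H: "smap (sprod ?H (std 1)) ?H (\<lambda>m (v, t). H m v t)"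
      and x: "x \<in> cells X0 PH 1" "\<And>m v i. v \<in> simplices ?H m ==> i \<in> Delta m 1 ==>
        Cmp K X0 PH A m (\<epsilon> m v) (res K X0 PH 1 i x) = a m i (H m v (const m 0))"
      and y: "y \<in> cells X0 PH 1" "\<And>m v i. v \<in> simplices ?H m ==> i \<in> Delta m 1 ==>
        Cmp K X0 PH A m (\<epsilon> m v) (res K X0 PH 1 i y) = a m i (H m v (const m 1))" for H x y
  proof -
    have "smap (sprod ?H (sprod (std 1) (std 1))) (sprod (std 1) ?H) (\<lambda>m (v, i, t). (i, H m v t))"
    proof (rule simplicial_mapI)
      fix m q assume "q \<in> simplices (sprod ?H (sprod (std 1) (std 1))) m"
      then show "(\<lambda>(v, i, t). (i, H m v t)) q \<in> simplices (sprod (std 1) ?H) m"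
        using smap_in [OF H, of "(fst q, snd (snd q))" m] by (auto simp: case_prod_unfold simp del: simplices_horn)
    next
      fix m m' \<alpha> q assume "\<alpha> \<in> Delta m m'" "q \<in> simplices (sprod ?H (sprod (std 1) (std 1))) m'"
      then show "(\<lambda>(v, i, t). (i, H m v t)) (act (sprod ?H (sprod (std 1) (std 1))) m' \<alpha> q) =
          act (sprod (std 1) ?H) m' \<alpha> ((\<lambda>(v, i, t). (i, H m' v t)) q)"
        using smap_act [OF H, of \<alpha> m m' "(fst q, snd (snd q))"] by (auto simp del: simplices_horn)
    qed
    from smap_comp [OF this a_smap] have S: "smap (sprod ?H (sprod (std 1) (std 1))) ?Q (\<lambda>m (v, i, t). a m i (H m v t))"
      by (simp add: case_prod_unfold)
    have Hin: "H m v t \<in> simplices ?H m" if "v \<in> simplices ?H m" "t \<in> Delta m 1" for m v t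
      using smap_in [OF H, of "(v, t)" m] that by (simp del: simplices_horn)
    show ?thesis
      by (rule family_homotopic [OF obj(1) X0(1) PH sH S uw _ _ x(1) _ y(1)])
        (use x(2) y(2) a0 Hin in \<open>simp_all del: simplices_horn One_nat_def\<close>)
  qed
  obtain xa where xa: "xa \<in> cells X0 PH 1" "\<And>m v i. v \<in> simplices ?H m ==> i \<in> Delta m 1 ==>
      Cmp K X0 PH A m (\<epsilon> m v) (res K X0 PH 1 i xa) = a m i v"
  proof -
    have "smap ?H ?H (\<lambda>m v. v)" by (rule simplicial_mapI) auto
    from transpose [OF this] show thesis using that by blast
  qed
  define top where "top m v = push k m v (const m 1)" for m and v :: "nat list"
  obtain xm where xm: "xm \<in> cells X0 PH 1" "\<And>m v i. v \<in> simplices ?H m ==> i \<in> Delta m 1 ==>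
      Cmp K X0 PH A m (\<epsilon> m v) (res K X0 PH 1 i xm) = a m i (top m v)"
  proof -
    have "smap ?H ?H top"
      using smap_comp [OF end_smap [of 1 1 ?H] push_smap [OF k]] unfolding top_def by simp
    from transpose [OF this] show thesis using that by blast
  qed
  obtain xk where xk: "xk \<in> cells X0 PH 1" "\<And>m v i. v \<in> simplices ?H m ==> i \<in> Delta m 1 ==>
      Cmp K X0 PH A m (\<epsilon> m v) (res K X0 PH 1 i xk) = a m i (const m k)"
  proof -
    have "smap ?H ?H (\<lambda>m v. const m k)"
      by (rule simplicial_mapI) (use kH in \<open>simp_all del: simplices_horn\<close>)
    from transpose [OF this] show thesis using that by blast
  qed
  have push0: "push k m v (const m 0) = v" if "v \<in> simplices ?H m" for m v
  proof -
    have "push k m v (const m 0) = tab m (\<lambda>l. v ! l)"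
      unfolding push_def by (intro tab_cong) simp
    then show ?thesis using that Delta_eq_tab [of v m n] by simp
  qed
  have pull01: "pull k m v (const m 0) = const m k" "pull k m v (const m 1) = top m v" for m v
    unfolding pull_def top_def push_def replicate_tab [of m k] by (intro tab_cong; simp)+
  have h1: "homotopic (Fun K X0 PH) xa xm"
    by (rule homot [OF push_smap [OF k] xa(1) _ xm(1)])
      (simp_all only: xa(2) xm(2) push0 top_def)
  have h2: "homotopic (Fun K X0 PH) xk xm"
    by (rule homot [OF pull_smap [OF k] xk(1) _ xm(1)])
      (simp_all only: xk(2) xm(2) pull01)
  have h: "homotopic (Fun K X0 PH) xk xa"
    by (rule homotopic_trans [OF qc(1) h2 homotopic_sym [OF qc(1) h1]])
  (* the family that is constant at the vertex k extends from the horn to the simplex *)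
  define ak where "ak = a 1 [0, 1] (const 1 k)"
  have i01: "[0, 1] \<in> Delta 1 1" by (simp add: Delta_eval)
  have ak: "ak \<in> simplices ?Q 1"
    using smap_in [OF a_smap, of "([0, 1], const 1 k)" 1] i01 kH [of 1] by (simp add: ak_def del: simplices_horn)
  have ak_act: "a m i (const m k) = act ?Q 1 i ak" if i: "i \<in> Delta m 1" for m i
    using smap_act [OF a_smap i, of "([0, 1], const 1 k)"] i01 kH [of 1] std_1_id [OF i] const_reindex [OF i, of k]
    by (simp add: ak_def del: simplices_horn)
  have "smap (sprod (std n) (std 1)) ?Q (\<lambda>m (v, i). act ?Q 1 i ak)"
    using smap_comp [OF snd_smap smap_of_simplex [OF fun_set [OF X0(1) obj(1)] ak]] by (simp add: case_prod_unfold)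
  from cotensor_cell [OF PV obj(1) X0(1) this]
  obtain c where c: "c \<in> cells X0 PV 1" "\<And>m v i. v \<in> Delta m n ==> i \<in> Delta m 1 ==>
      Cmp K X0 PV A m (\<delta> m v) (res K X0 PV 1 i c) = act ?Q 1 i ak" by auto
  have restr: "Cmp K X0 PH A m (\<epsilon> m v) (res K X0 PH 1 i (post K X0 PV PH \<rho> 1 x)) = Cmp K X0 PV A m (\<delta> m v) (res K X0 PV 1 i x)"
    if "x \<in> cells X0 PV 1" "v \<in> simplices ?H m" "i \<in> Delta m 1" for x m v i
    unfolding \<rho>(2) [OF that(2), symmetric] using that(1,3) X0 DH(1) DV(1) \<rho>(1) obj DH(3) [OF that(2)]
    by (simp add: act_post cmp_pre act_cells)
  have \<rho>c: "post K X0 PV PH \<rho> 1 c = xk"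
  proof (rule cotensor_unique [OF PH obj(1) X0(1) _ xk(1)])
    fix m v i assume v: "v \<in> simplices ?H m" and i: "i \<in> Delta m 1"
    have v': "v \<in> Delta m n" using v by simp
    show "Cmp K X0 PH A m (\<epsilon> m v) (res K X0 PH 1 i (post K X0 PV PH \<rho> 1 c)) = Cmp K X0 PH A m (\<epsilon> m v) (res K X0 PH 1 i xk)"
      unfolding restr [OF c(1) v i] xk(2) [OF v i] c(2) [OF v' i] ak_act [OF i] ..
  qed (use X0 DH(1) DV(1) \<rho>(1) c(1) in simp)
  note sPH = quasi_category_set [OF qc(1)] and sPV = quasi_category_set [OF qc(2)]
  obtain \<sigma> where \<sigma>: "\<sigma> \<in> cells X0 PH 2" "res K X0 PH 2 [0, 1] \<sigma> = xk" "res K X0 PH 2 [0, 2] \<sigma> = xa"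
    "res K X0 PH 2 [1, 2] \<sigma> = res K X0 PH 1 [1, 1] xk"
    using h unfolding homotopic_iff [OF sPH] by blast
  have L: "[1, 1] \<in> Delta 1 1" "[0, 2] \<in> Delta 1 2" by (simp_all add: Delta_eval)
  have c11: "res K X0 PV 1 [1, 1] c \<in> cells X0 PV 1" by (rule ss_in [OF sPV L(1) c(1)])
  have \<rho>_smap: "smap (Fun K X0 PV) (Fun K X0 PH) (post K X0 PV PH \<rho>)"
    by (rule post_smap [OF X0(1) DV(1) DH(1) \<rho>(1)])
  have lift: "lifts_along (Fun K X0 PV) (Fun K X0 PH) (post K X0 PV PH \<rho>) (horn 2 1) (std 2)"
    using fun_isofib [OF X0(1) DV(1) DH(1) \<rho>_iso] by (simp add: qcat_isofibration_def)
  have "\<exists>\<tau>\<in>cells X0 PV 2. res K X0 PV 2 [0, 1] \<tau> = c \<and> res K X0 PV 2 [1, 2] \<tau> = res K X0 PV 1 [1, 1] c \<and>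
      post K X0 PV PH \<rho> 2 \<tau> = \<sigma>"
  proof (rule lift2 [OF sPV sPH lift \<rho>_smap c(1) c11 _ \<sigma>(1)])
    show "res K X0 PV 1 [1] c = res K X0 PV 1 [0] (res K X0 PV 1 [1, 1] c)"
      using c(1) by (simp add: act_act_list [OF sPV] monotone_list_def)
    show "res K X0 PH 2 [0, 1] \<sigma> = post K X0 PV PH \<rho> 1 c" unfolding \<sigma>(2) \<rho>c ..
    show "res K X0 PH 2 [1, 2] \<sigma> = post K X0 PV PH \<rho> 1 (res K X0 PV 1 [1, 1] c)"
      unfolding \<sigma>(4) smap_act [OF \<rho>_smap L(1) c(1)] \<rho>c ..
  qed
  then obtain \<tau> where \<tau>: "\<tau> \<in> cells X0 PV 2" "res K X0 PV 2 [0, 1] \<tau> = c"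
    "res K X0 PV 2 [1, 2] \<tau> = res K X0 PV 1 [1, 1] c" "post K X0 PV PH \<rho> 2 \<tau> = \<sigma>" by blast
  define h where "h = res K X0 PV 2 [0, 2] \<tau>"
  have h: "h \<in> cells X0 PV 1" unfolding h_def by (rule ss_in [OF sPV L(2) \<tau>(1)])
  have \<rho>h: "post K X0 PV PH \<rho> 1 h = xa"
    unfolding h_def smap_act [OF \<rho>_smap L(2) \<tau>(1)] \<tau>(4) \<sigma>(3) ..
  have h_ends: "res K X0 PV 1 [0] h = res K X0 PV 1 [0] c" "res K X0 PV 1 [1] h = res K X0 PV 1 [1] c"
  proof -
    have "res K X0 PV 1 [1] (res K X0 PV 2 [1, 2] \<tau>) = res K X0 PV 1 [1] c"
      unfolding \<tau>(3) using c(1) by (simp add: act_act_list [OF sPV] monotone_list_def)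
    then show "res K X0 PV 1 [0] h = res K X0 PV 1 [0] c" "res K X0 PV 1 [1] h = res K X0 PV 1 [1] c"
      using \<tau>(1) unfolding h_def \<tau>(2) [symmetric] by (simp_all add: act_act_list [OF sPV] monotone_list_def)
  qed
  have h_const: "Cmp K X0 PV A m (\<delta> m z) (res K X0 PV 1 (const m v) h) = a m (const m v) (const m k)"
    if z: "z \<in> Delta m n" and v: "v = 0 \<or> v = 1" for m z v
  proof -
    have v1: "v \<le> 1" using v by auto
    have "res K X0 PV 1 (const m v) h = res K X0 PV 1 (const m v) c"
      unfolding act_const [OF sPV h v1] act_const [OF sPV c(1) v1] using h_ends v by auto
    then show ?thesis using c(2) [OF z, of "const m v"] ak_act [of "const m v" m] v1
      by simp
  qed
  define b where "b m q = Cmp K X0 PV A m (\<delta> m (snd q)) (res K X0 PV 1 (fst q) h)" for m and q :: "nat list \<times> nat list"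
  have b_smap: "smap (sprod (std 1) (std n)) ?Q b"
  proof -
    have "smap (sprod (std 1) (std n)) (sprod (std n) (std 1)) (\<lambda>m (i, v). (v, i))"
      by (rule simplicial_mapI) auto
    from smap_comp [OF this cotensor_transpose_smap [OF PV obj(1) X0(1) smap_of_simplex [OF sPV h]]]
    show ?thesis by (simp add: b_def [abs_def] case_prod_unfold)
  qed
  have b0: "b m (const m 0, z) = post K X0 B A f m (dg (Fun K X0 B) m xb)"
    "b m (const m 1, z) = post K X0 C A g m (dg (Fun K X0 C) m xc)" if z: "z \<in> simplices (std n) m" for m z
    using h_const [of z m 0] h_const [of z m 1] a0 [OF kH, of m] z X0 obj fg xbc
    by (simp_all add: b_def post_dg u_def w_def del: One_nat_def)
  obtain \<psi> where \<psi>: "smap (std n) (Fun K X0 E) \<psi>" "\<And>m z. z \<in> Delta m n ==>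
      post K X0 E B e0 m (\<psi> m z) = dg (Fun K X0 B) m xb \<and> post K X0 E C e1 m (\<psi> m z) = dg (Fun K X0 C) m xc \<and>
      (\<forall>i\<in>Delta m 1. Cmp K X0 E A m (res K E A 1 i \<kappa>) (\<psi> m z) = b m (i, z))"
    using comma_cells [OF E obj X0(1) fg simplicial_set_std dg_smap [OF X0(1) obj(2) xbc(1)] dg_smap [OF X0(1) obj(3) xbc(2)] b_smap b0]
    by auto
  have "\<psi> m v = \<phi> m v" if v: "v \<in> simplices ?H m" for m v
  proof (rule comma_smap_unique [OF E obj X0(1) sH _ \<phi>' _ _ _ v])
    show "smap ?H (Fun K X0 E) \<psi>"
      by (rule simplicial_mapI) (use smap_in [OF \<psi>(1)] smap_act [OF \<psi>(1)] in auto)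
    fix m z assume z: "z \<in> simplices ?H m"
    have z': "z \<in> Delta m n" using z by simp
    show "post K X0 E B e0 m (\<psi> m z) = post K X0 E B e0 m (\<phi> m z)" "post K X0 E C e1 m (\<psi> m z) = post K X0 E C e1 m (\<phi> m z)"
      unfolding \<phi>c(2,3) [OF z] using \<psi>(2) [OF z'] by blast+
    fix i assume i: "i \<in> Delta m 1"
    have "b m (i, z) = a m i z"
      unfolding xa(2) [OF z i, symmetric] \<rho>h [symmetric] restr [OF h z i] by (simp add: b_def)
    then show "Cmp K X0 E A m (res K E A 1 i \<kappa>) (\<psi> m z) = Cmp K X0 E A m (res K E A 1 i \<kappa>) (\<phi> m z)"
      using \<psi>(2) [OF z'] i by (simp add: a_def)
  qed
  moreover have "smap (std n) (Fun (slice K CB) X (E, r)) \<psi>"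
    by (rule simplicial_mapI) (use smap_in [OF \<psi>(1)] smap_act [OF \<psi>(1)] \<psi>(2) in \<open>auto simp: cell X0_def\<close>)
  ultimately show "\<exists>\<psi>. smap (std n) (Fun (slice K CB) X (E, r)) \<psi> \<and> (\<forall>m. \<forall>u\<in>simplices ?H m. \<psi> m u = \<phi> m u)"
    by blast
qed

end

section \<open>Colimits of small simplicial sets\<close>

text \<open>An infinite set is equipollent to its square.\<close>

lemma infinite_pairing: "\<exists>p :: 'u::infinite \<times> 'u \<Rightarrow> 'u. inj p"
proof -
  have "\<not> finite (UNIV :: 'u set)" by (rule infinite_UNIV)
  from card_of_Times_same_infinite [OF this] obtain p :: "'u \<times> 'u \<Rightarrow> 'u" where "bij_betw p (UNIV \<times> UNIV) UNIV"
    unfolding card_of_ordIso [symmetric] by blast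
  then show ?thesis by (auto simp: bij_betw_def)
qed

text \<open>A colimit of small simplicial sets is tested against small targets only. This suffices for an arbitrary target Y, because the part of Y that the cocone reaches is
indexed by pairs of an object c and a simplex of S c, hence is small: \<open>rep\<close> and \<open>val\<close> translate between this part and its small copy.\<close>

lemma colimit_universal:
  fixes S :: "'u::infinite \<Rightarrow> 'u sset" and Y :: "'y sset"
  assumes J: "sset_diagram J S Sm" and T: "sset_colimit J S Sm T \<pi>" and Y: "simplicial_set Y"
    and \<psi>: "\<And>c. c \<in> cobj J ==> smap (S c) Y (\<psi> c)"
    and compat: "\<And>f n x. f \<in> carr J ==> x \<in> simplices (S (ccod J f)) n ==>
      \<psi> (cdom J f) n (Sm f n x) = \<psi> (ccod J f) n x"
  shows "\<exists>\<phi>. smap T Y \<phi> \<and> (\<forall>c\<in>cobj J. \<forall>n. \<forall>x\<in>simplices (S c) n. \<phi> n (\<pi> c n x) = \<psi> c n x) \<and>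
    (\<forall>n. \<forall>t\<in>simplices T n. \<exists>c\<in>cobj J. \<exists>x\<in>simplices (S c) n. \<phi> n t = \<psi> c n x)"
proof -
  obtain p :: "'u \<times> 'u \<Rightarrow> 'u" where p: "inj p" using infinite_pairing by blast
  have sS: "simplicial_set (S c)" if "c \<in> cobj J" for c using J that by (simp add: sset_diagram_def)
  define src where "src n y q \<longleftrightarrow> fst q \<in> cobj J \<and> snd q \<in> simplices (S (fst q)) n \<and> \<psi> (fst q) n (snd q) = y" for n y q
  define rep where "rep n y = p (SOME q. src n y q)" for n y
  define val where "val n z = \<psi> (fst (inv p z)) n (snd (inv p z))" for n z
  define I where "I n = {y. \<exists>q. src n y q}" for n
  have val_rep: "val n (rep n y) = y" if "y \<in> I n" for n y
  proof -
    have "src n y (SOME q. src n y q)" using that unfolding I_def mem_Collect_eq by (rule someI_ex)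
    then show ?thesis using p by (simp add: val_def rep_def src_def)
  qed
  have IY: "y \<in> simplices Y n" if "y \<in> I n" for n y
    using that smap_in [OF \<psi>] unfolding I_def src_def by blast
  have \<psi>I: "\<psi> c n x \<in> I n" if "c \<in> cobj J" "x \<in> simplices (S c) n" for c n x
    unfolding I_def mem_Collect_eq by (rule exI [of _ "(c, x)"]) (use that in \<open>simp add: src_def\<close>)
  have actI: "act Y n \<alpha> y \<in> I m" if y: "y \<in> I n" and \<alpha>: "\<alpha> \<in> Delta m n" for m n \<alpha> y
  proof -
    obtain c x where c: "c \<in> cobj J" "x \<in> simplices (S c) n" "y = \<psi> c n x"
      using y unfolding I_def src_def by blast
    then have "act Y n \<alpha> y = \<psi> c m (act (S c) n \<alpha> x)" using smap_act [OF \<psi>] \<alpha> by simp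
    then show ?thesis using \<psi>I c sS \<alpha> by (simp add: ss_in)
  qed
  define Z where "Z = \<lparr>simplices = (\<lambda>n. rep n ` I n), act = (\<lambda>n \<alpha> z. rep (length \<alpha> - 1) (act Y n \<alpha> (val n z)))\<rparr>"
  have actZ: "act Z n \<alpha> (rep n y) = rep m (act Y n \<alpha> y)" if "y \<in> I n" "\<alpha> \<in> Delta m n" for m n \<alpha> y
    using that by (simp add: Z_def val_rep Delta_def)
  have Z0: "simplices Z n = rep n ` I n" for n by (simp add: Z_def)
  have sZ: "simplicial_set Z"
    unfolding simplicial_set_def
  proof (intro conjI allI impI)
    fix m n \<alpha> z assume "\<alpha> \<in> Delta m n" "z \<in> simplices Z n"
    then show "act Z n \<alpha> z \<in> simplices Z m" using actI by (auto simp: Z0 actZ)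
  next
    fix n z assume "z \<in> simplices Z n"
    then show "act Z n [0..<Suc n] z = z"
      using actZ [OF _ Delta_id] IY ss_id [OF Y] by (auto simp: Z0 simp del: upt_Suc)
  next
    fix k m n \<alpha> \<beta> z assume a: "\<beta> \<in> Delta k m" "\<alpha> \<in> Delta m n" "z \<in> simplices Z n"
    then obtain y where y: "y \<in> I n" "z = rep n y" by (auto simp: Z0)
    show "act Z m \<beta> (act Z n \<alpha> z) = act Z n (\<alpha> \<odot> \<beta>) z"
      unfolding y(2) actZ [OF y(1) a(2)] actZ [OF actI [OF y(1) a(2)] a(1)] actZ [OF y(1) Delta_reindex [OF a(1,2)]]
        ss_comp [OF Y a(1,2) IY [OF y(1)]] ..
  qed
  have "sset_cocone J S Sm Z (\<lambda>c n x. rep n (\<psi> c n x))"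
    unfolding sset_cocone_def
  proof (intro conjI ballI allI sZ)
    fix c assume c: "c \<in> cobj J"
    show "smap (S c) Z (\<lambda>n x. rep n (\<psi> c n x))"
      by (rule simplicial_mapI) (use c \<psi>I smap_act [OF \<psi> [OF c]] in \<open>auto simp: Z0 actZ\<close>)
  qed (simp add: compat)
  then obtain \<phi> where \<phi>: "smap T Z \<phi>" "\<forall>c\<in>cobj J. \<forall>n. \<forall>x\<in>simplices (S c) n. \<phi> n (\<pi> c n x) = rep n (\<psi> c n x)"
    using T unfolding sset_colimit_def by blast
  show ?thesis
  proof (intro exI [of _ "\<lambda>n t. val n (\<phi> n t)"] conjI ballI allI)
    show "smap T Y (\<lambda>n t. val n (\<phi> n t))"
    proof (rule simplicial_mapI)
      fix n t assume "t \<in> simplices T n"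
      then show "val n (\<phi> n t) \<in> simplices Y n" using smap_in [OF \<phi>(1), of t n] IY by (auto simp: Z0 val_rep)
    next
      fix m n \<alpha> t assume a: "\<alpha> \<in> Delta m n" "t \<in> simplices T n"
      obtain y where y: "y \<in> I n" "\<phi> n t = rep n y" using smap_in [OF \<phi>(1) a(2)] by (auto simp: Z0)
      then show "val m (\<phi> m (act T n \<alpha> t)) = act Y n \<alpha> (val n (\<phi> n t))"
        using smap_act [OF \<phi>(1) a] actI [OF y(1) a(1)] a(1) by (simp add: actZ val_rep)
    qed
    fix n t assume "t \<in> simplices T n"
    then have "val n (\<phi> n t) \<in> I n" using smap_in [OF \<phi>(1), of t n] by (auto simp: Z0 val_rep)
    then obtain q where "src n (val n (\<phi> n t)) q" unfolding I_def by blast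
    then show "\<exists>c\<in>cobj J. \<exists>x\<in>simplices (S c) n. val n (\<phi> n t) = \<psi> c n x"
      by (intro bexI [of _ "fst q"] bexI [of _ "snd q"]) (simp_all add: src_def)
  next
    fix c n x assume "c \<in> cobj J" "x \<in> simplices (S c) n"
    then show "val n (\<phi> n (\<pi> c n x)) = \<psi> c n x" using \<phi>(2) \<psi>I by (simp add: val_rep)
  qed
qed

text \<open>The endomorphism of T that the cocone induces has all its values in the image of the cocone, and by uniqueness it is the identity.\<close>

lemma colimit_jointly_surjective:
  fixes S :: "'u::infinite \<Rightarrow> 'u sset"
  assumes J: "sset_diagram J S Sm" and T: "sset_colimit J S Sm T \<pi>" and t: "t \<in> simplices T n"
  shows "\<exists>c\<in>cobj J. \<exists>x\<in>simplices (S c) n. t = \<pi> c n x"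
proof -
  have cocone: "sset_cocone J S Sm T \<pi>" using T by (simp add: sset_colimit_def)
  then have "\<exists>\<phi>. smap T T \<phi> \<and> (\<forall>c\<in>cobj J. \<forall>n. \<forall>x\<in>simplices (S c) n. \<phi> n (\<pi> c n x) = \<pi> c n x) \<and>
      (\<forall>n. \<forall>t\<in>simplices T n. \<exists>c\<in>cobj J. \<exists>x\<in>simplices (S c) n. \<phi> n t = \<pi> c n x)"
    by (intro colimit_universal [OF J T]) (simp_all add: sset_cocone_def)
  then obtain \<phi> where \<phi>: "smap T T \<phi>" "\<forall>c\<in>cobj J. \<forall>n. \<forall>x\<in>simplices (S c) n. \<phi> n (\<pi> c n x) = \<pi> c n x"
    "\<forall>n. \<forall>t\<in>simplices T n. \<exists>c\<in>cobj J. \<exists>x\<in>simplices (S c) n. \<phi> n t = \<pi> c n x" by blast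
  obtain \<chi> where \<chi>: "\<And>\<phi>'. smap T T \<phi>' \<and> (\<forall>c\<in>cobj J. \<forall>n. \<forall>x\<in>simplices (S c) n. \<phi>' n (\<pi> c n x) = \<pi> c n x) ==>
      \<forall>n. \<forall>t\<in>simplices T n. \<phi>' n t = \<chi> n t"
    using T cocone unfolding sset_colimit_def by blast
  have "\<phi> n t = \<chi> n t" using \<chi> [of \<phi>] \<phi>(1,2) t by blast
  moreover have "smap T T (\<lambda>n t. t)" by (rule simplicial_mapI) auto
  then have "t = \<chi> n t" using \<chi> [of "\<lambda>n t. t"] t by blast
  ultimately show ?thesis using \<phi>(3) t by metis
qed

section \<open>Cotensors take colimits to limits\<close>

lemma swap_smap: "smap (sprod X Y) (sprod Y X) (\<lambda>m (x, y). (y, x))"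
  by (rule simplicial_mapI) auto

context enriched
begin

lemma cotensor_post_component:
  assumes obj: "ob A" "ob X" "ob P" "ob F" and \<rho>: "\<rho> \<in> functors K P F"
    and e: "e \<in> cells F A m" and y: "y \<in> cells X P n" and \<alpha>: "\<alpha> \<in> Delta m n"
  shows "Cmp K X F A m e (res K X F n \<alpha> (post K X P F \<rho> n y)) =
    Cmp K X P A m (pre K P F A \<rho> m e) (res K X P n \<alpha> y)"
  using assms by (simp add: act_post cmp_pre act_cells)

text \<open>An n-simplex of functors into the cotensor by U is a map from U to the functors into the cotensor by the n-simplex. In this form the colimit property of T applies to a
cone of n-simplices.\<close>

lemma cotensor_colimit_cells:
  fixes S :: "'u::infinite \<Rightarrow> 'u sset"
  assumes J: "sset_diagram J S Sm" "category J" and T: "sset_colimit J S Sm T \<pi>"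
    and obj: "ob A" "ob X"
    and P: "is_cotensor K A T P \<epsilon>" and F: "\<And>c. c \<in> cobj J ==> is_cotensor K A (S c) (F c) (\<delta> c)"
    and W: "is_cotensor K A (std n) W \<omega>"
    and \<rho>: "\<And>c. c \<in> cobj J ==> \<rho> c \<in> functors K P (F c)"
      "\<And>c m u. c \<in> cobj J ==> u \<in> simplices (S c) m ==> pre K P (F c) A (\<rho> c) m (\<delta> c m u) = \<epsilon> m (\<pi> c m u)"
    and R: "\<And>f. f \<in> carr J ==> R f \<in> functors K (F (cdom J f)) (F (ccod J f))"
      "\<And>f m u. f \<in> carr J ==> u \<in> simplices (S (ccod J f)) m ==>
        pre K (F (cdom J f)) (F (ccod J f)) A (R f) m (\<delta> (ccod J f) m u) = \<delta> (cdom J f) m (Sm f m u)"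
    and x: "is_cone K J F R X n x"
  shows "\<exists>!y. y \<in> cells X P n \<and> (\<forall>c\<in>cobj J. post K X P (F c) (\<rho> c) n y = x c)"
proof -
  note D = cotensorD [OF P] and DF = cotensorD [OF F] and DW = cotensorD [OF W]
  have cocone: "sset_cocone J S Sm T \<pi>" using T by (simp add: sset_colimit_def)
  then have sT: "simplicial_set T" and \<pi>: "\<And>c. c \<in> cobj J ==> smap (S c) T (\<pi> c)"
    by (simp_all add: sset_cocone_def)
  have sS: "simplicial_set (S c)" if "c \<in> cobj J" for c using J(1) that by (simp add: sset_diagram_def)
  have Sm: "smap (S (ccod J f)) (S (cdom J f)) (Sm f)" if "f \<in> carr J" for f
    using J(1) that by (simp add: sset_diagram_def)
  have ends: "cdom J f \<in> cobj J" "ccod J f \<in> cobj J" if "f \<in> carr J" for f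
    using J(2) that by (simp_all add: category_def)
  have xc: "x c \<in> cells X (F c) n" if "c \<in> cobj J" for c using x that by (simp add: is_cone_def)
  have xR: "post K X (F (cdom J f)) (F (ccod J f)) (R f) n (x (cdom J f)) = x (ccod J f)" if "f \<in> carr J" for f
    using x that by (simp add: is_cone_def)
  define a where "a c m u \<alpha> = Cmp K X (F c) A m (\<delta> c m u) (res K X (F c) n \<alpha> (x c))" for c m u \<alpha>
  have "\<exists>\<psi>. smap (S c) (Fun K X W) \<psi> \<and>
      (\<forall>m. \<forall>\<alpha>\<in>Delta m n. \<forall>u\<in>simplices (S c) m. Cmp K X W A m (\<omega> m \<alpha>) (\<psi> m u) = a c m u \<alpha>)" if c: "c \<in> cobj J" for c
  proof -
    have "smap (std n) (Fun K X (F c)) (\<lambda>m \<alpha>. res K X (F c) n \<alpha> (x c))"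
      by (rule smap_of_simplex) (use obj DF(1) xc c in simp_all)
    from smap_comp [OF swap_smap cotensor_transpose_smap [OF F obj this]] c
    have "smap (sprod (std n) (S c)) (Fun K X A) (\<lambda>m (\<alpha>, u). a c m u \<alpha>)"
      by (simp add: case_prod_unfold a_def)
    from cotensor_transpose [OF W obj sS [OF c] this] show ?thesis by simp
  qed
  then obtain \<psi> where \<psi>: "\<And>c. c \<in> cobj J ==> smap (S c) (Fun K X W) (\<psi> c)"
    "\<And>c m \<alpha> u. c \<in> cobj J ==> \<alpha> \<in> Delta m n ==> u \<in> simplices (S c) m ==> Cmp K X W A m (\<omega> m \<alpha>) (\<psi> c m u) = a c m u \<alpha>"
    by metis
  have compat: "\<psi> (cdom J f) m (Sm f m u) = \<psi> (ccod J f) m u" if f: "f \<in> carr J" and u: "u \<in> simplices (S (ccod J f)) m" for f m u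
  proof (rule cotensor_unique [OF W obj])
    note c = ends [OF f]
    have su: "Sm f m u \<in> simplices (S (cdom J f)) m" by (rule smap_in [OF Sm [OF f] u])
    fix k \<alpha> \<beta> assume b: "\<alpha> \<in> simplices (std n) k" "\<beta> \<in> Delta k m"
    let ?u = "act (S (ccod J f)) m \<beta> u"
    have u': "?u \<in> simplices (S (ccod J f)) k" using sS [OF c(2)] u b(2) by (simp add: ss_in)
    have su': "Sm f k ?u \<in> simplices (S (cdom J f)) k" by (rule smap_in [OF Sm [OF f] u'])
    have "a (ccod J f) k ?u \<alpha> = a (cdom J f) k (Sm f k ?u) \<alpha>"
      unfolding a_def xR [OF f, symmetric]
      using cotensor_post_component [OF obj DF(1) [OF c(1)] DF(1) [OF c(2)] R(1) [OF f] DF(3) [OF c(2) u'] xc [OF c(1)]] b(1)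
        R(2) [OF f u'] by simp
    then show "Cmp K X W A k (\<omega> k \<alpha>) (res K X W m \<beta> (\<psi> (cdom J f) m (Sm f m u))) =
        Cmp K X W A k (\<omega> k \<alpha>) (res K X W m \<beta> (\<psi> (ccod J f) m u))"
      using b \<psi>(2) [OF c(1) _ su'] \<psi>(2) [OF c(2) _ u'] smap_act [OF \<psi>(1) [OF c(1)] b(2) su] smap_act [OF \<psi>(1) [OF c(2)] b(2) u]
        smap_act [OF Sm [OF f] b(2) u] by simp
  next
    show "\<psi> (cdom J f) m (Sm f m u) \<in> cells X W m" "\<psi> (ccod J f) m u \<in> cells X W m"
      using smap_in [OF \<psi>(1)] smap_in [OF Sm [OF f] u] ends [OF f] u by blast+
  qed
  obtain \<phi> where \<phi>: "smap T (Fun K X W) \<phi>"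
    "\<And>c m u. c \<in> cobj J ==> u \<in> simplices (S c) m ==> \<phi> m (\<pi> c m u) = \<psi> c m u"
    using colimit_universal [OF J(1) T fun_set [OF obj(2) DW(1)] \<psi>(1) compat] by blast
  from smap_comp [OF swap_smap cotensor_transpose_smap [OF W obj \<phi>(1)]]
  have "smap (sprod T (std n)) (Fun K X A) (\<lambda>m (t, \<alpha>). Cmp K X W A m (\<omega> m \<alpha>) (\<phi> m t))"
    by (simp add: case_prod_unfold)
  from cotensor_cell [OF P obj this] obtain y where y: "y \<in> cells X P n"
    "\<And>m t \<alpha>. t \<in> simplices T m ==> \<alpha> \<in> Delta m n ==> Cmp K X P A m (\<epsilon> m t) (res K X P n \<alpha> y) = Cmp K X W A m (\<omega> m \<alpha>) (\<phi> m t)"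
    by auto
  have comp: "Cmp K X (F c) A m (\<delta> c m u) (res K X (F c) n \<alpha> (post K X P (F c) (\<rho> c) n z)) =
      Cmp K X P A m (\<epsilon> m (\<pi> c m u)) (res K X P n \<alpha> z)"
    if "c \<in> cobj J" "u \<in> simplices (S c) m" "\<alpha> \<in> Delta m n" "z \<in> cells X P n" for c m u \<alpha> z
    using cotensor_post_component [OF obj D(1) DF(1) [OF that(1)] \<rho>(1) [OF that(1)] DF(3) [OF that(1,2)] that(4,3)]
      \<rho>(2) [OF that(1,2)] by simp
  have py: "post K X P (F c) (\<rho> c) n y = x c" if c: "c \<in> cobj J" for c
  proof (rule cotensor_unique [OF F [OF c] obj _ xc [OF c]])
    show "post K X P (F c) (\<rho> c) n y \<in> cells X (F c) n" using obj D(1) DF(1) \<rho>(1) c y(1) by simp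
    fix m u \<alpha> assume u: "u \<in> simplices (S c) m" "\<alpha> \<in> Delta m n"
    show "Cmp K X (F c) A m (\<delta> c m u) (res K X (F c) n \<alpha> (post K X P (F c) (\<rho> c) n y)) =
        Cmp K X (F c) A m (\<delta> c m u) (res K X (F c) n \<alpha> (x c))"
      using comp [OF c u y(1)] y(2) [OF smap_in [OF \<pi> [OF c] u(1)] u(2)] \<phi>(2) [OF c u(1)] \<psi>(2) [OF c u(2,1)]
      by (simp add: a_def)
  qed
  show ?thesis
  proof (rule ex1I [of _ y])
    show "y \<in> cells X P n \<and> (\<forall>c\<in>cobj J. post K X P (F c) (\<rho> c) n y = x c)" using y(1) py by blast
    fix z assume z: "z \<in> cells X P n \<and> (\<forall>c\<in>cobj J. post K X P (F c) (\<rho> c) n z = x c)"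
    show "z = y"
    proof (rule cotensor_unique [OF P obj _ y(1)])
      show "z \<in> cells X P n" using z by blast
      fix m t \<alpha> assume t: "t \<in> simplices T m" and \<alpha>: "\<alpha> \<in> Delta m n"
      obtain c u where c: "c \<in> cobj J" "u \<in> simplices (S c) m" "t = \<pi> c m u"
        using colimit_jointly_surjective [OF J(1) T t] by blast
      have e: "post K X P (F c) (\<rho> c) n z = post K X P (F c) (\<rho> c) n y" using z py [OF c(1)] c(1) by simp
      have "z \<in> cells X P n" using z by blast
      from comp [OF c(1,2) \<alpha> this] comp [OF c(1,2) \<alpha> y(1)] e
      show "Cmp K X P A m (\<epsilon> m t) (res K X P n \<alpha> z) = Cmp K X P A m (\<epsilon> m t) (res K X P n \<alpha> y)"
        unfolding c(3) by simp
    qed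
  qed
qed

theorem cotensor_of_colimit:
  fixes S :: "'u::infinite \<Rightarrow> 'u sset"
  assumes J: "sset_diagram J S Sm" "category J" and T: "sset_colimit J S Sm T \<pi>" and A: "ob A"
    and P: "is_cotensor K A T P \<epsilon>" and F: "\<And>c. c \<in> cobj J ==> is_cotensor K A (S c) (F c) (\<delta> c)"
    and W: "\<And>n. \<exists>W \<omega>. is_cotensor K A (std n) W \<omega>"
    and \<rho>: "\<And>c. c \<in> cobj J ==> \<rho> c \<in> functors K P (F c)"
      "\<And>c m u. c \<in> cobj J ==> u \<in> simplices (S c) m ==> pre K P (F c) A (\<rho> c) m (\<delta> c m u) = \<epsilon> m (\<pi> c m u)"
    and R: "\<And>f. f \<in> carr J ==> R f \<in> functors K (F (cdom J f)) (F (ccod J f))"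
      "\<And>f m u. f \<in> carr J ==> u \<in> simplices (S (ccod J f)) m ==>
        pre K (F (cdom J f)) (F (ccod J f)) A (R f) m (\<delta> (ccod J f) m u) = \<delta> (cdom J f) m (Sm f m u)"
  shows "is_limit K J F R P \<rho>"
proof -
  note D = cotensorD [OF P] and DF = cotensorD [OF F]
  have ends: "cdom J f \<in> cobj J" "ccod J f \<in> cobj J" if "f \<in> carr J" for f
    using J(2) that by (simp_all add: category_def)
  have Sm: "Sm f m u \<in> simplices (S (cdom J f)) m" if "f \<in> carr J" "u \<in> simplices (S (ccod J f)) m" for f m u
    using J(1) that smap_in by (fastforce simp: sset_diagram_def)
  have \<pi>Sm: "\<pi> (cdom J f) m (Sm f m u) = \<pi> (ccod J f) m u" if "f \<in> carr J" "u \<in> simplices (S (ccod J f)) m" for f m u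
    using T that by (simp add: sset_colimit_def sset_cocone_def)
  have "diagram_in K J F R"
    unfolding diagram_in_def
  proof (intro conjI ballI impI)
    fix c assume c: "c \<in> cobj J"
    then have i: "cid J c \<in> carr J" "cdom J (cid J c) = c" "ccod J (cid J c) = c"
      using J(2) by (simp_all add: category_def)
    show "R (cid J c) = Idt K (F c)"
    proof (rule cotensor_functor_unique [OF F [OF c] A DF(1) [OF c]])
      fix m u assume u: "u \<in> simplices (S c) m"
      have "Sm (cid J c) m u = u" using J(1) c u by (simp add: sset_diagram_def)
      then show "pre K (F c) (F c) A (R (cid J c)) m (\<delta> c m u) = pre K (F c) (F c) A (Idt K (F c)) m (\<delta> c m u)"
        using R(2) [OF i(1), of u m] i c u A DF(1) [OF c] DF(3) [OF c u] by simp
    qed (use R(1) [OF i(1)] i DF(1) [OF c] in simp_all)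
  next
    fix f g assume f: "f \<in> carr J" and g: "g \<in> carr J" and fg: "ccod J f = cdom J g"
    then have gf: "ccomp J g f \<in> carr J" "cdom J (ccomp J g f) = cdom J f" "ccod J (ccomp J g f) = ccod J g"
      using J(2) by (simp_all add: category_def)
    note e = ends [OF f] ends(2) [OF g]
    have Rg: "R g \<in> functors K (F (ccod J f)) (F (ccod J g))" using R(1) [OF g] fg by simp
    show "R (ccomp J g f) = fcomp K (F (cdom J f)) (F (ccod J f)) (F (ccod J g)) (R g) (R f)"
    proof (rule cotensor_functor_unique [OF F [OF e(3)] A DF(1) [OF e(1)]])
      fix m u assume u: "u \<in> simplices (S (ccod J g)) m"
      have "Sm (ccomp J g f) m u = Sm f m (Sm g m u)" using J(1) f g fg u by (simp add: sset_diagram_def)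
      moreover have "Sm g m u \<in> simplices (S (ccod J f)) m" using Sm [OF g u] fg by simp
      ultimately show "pre K (F (cdom J f)) (F (ccod J g)) A (R (ccomp J g f)) m (\<delta> (ccod J g) m u) =
          pre K (F (cdom J f)) (F (ccod J g)) A (fcomp K (F (cdom J f)) (F (ccod J f)) (F (ccod J g)) (R g) (R f)) m (\<delta> (ccod J g) m u)"
        using R(2) [OF gf(1), of u m] R(2) [OF g u] R(2) [OF f, of "Sm g m u" m] gf fg u A e DF(1) DF(3) [OF e(3) u] R(1) [OF f] Rg
        by (simp flip: pre_pre)
    qed (use R(1) [OF gf(1)] R(1) [OF f] Rg gf DF(1) e in simp_all)
  qed (use DF(1) R(1) in simp_all)
  moreover have "is_cone K J F R P 0 \<rho>"
    unfolding is_cone_def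
  proof (intro conjI ballI)
    fix f assume f: "f \<in> carr J"
    note e = ends [OF f]
    have "fcomp K P (F (cdom J f)) (F (ccod J f)) (R f) (\<rho> (cdom J f)) = \<rho> (ccod J f)"
    proof (rule cotensor_functor_unique [OF F [OF e(2)] A D(1)])
      fix m u assume u: "u \<in> simplices (S (ccod J f)) m"
      show "pre K P (F (ccod J f)) A (fcomp K P (F (cdom J f)) (F (ccod J f)) (R f) (\<rho> (cdom J f))) m (\<delta> (ccod J f) m u) =
          pre K P (F (ccod J f)) A (\<rho> (ccod J f)) m (\<delta> (ccod J f) m u)"
        using R(2) [OF f u] \<rho>(2) [OF e(1) Sm [OF f u]] \<rho>(2) [OF e(2) u] \<pi>Sm [OF f u] A D(1) DF(1) e DF(3) [OF e(2) u] R(1) [OF f] \<rho>(1)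
        by (simp flip: pre_pre)
    qed (use D(1) DF(1) e R(1) [OF f] \<rho>(1) in simp_all)
    then show "post K P (F (cdom J f)) (F (ccod J f)) (R f) 0 (\<rho> (cdom J f)) = \<rho> (ccod J f)"
      using D(1) DF(1) e R(1) [OF f] \<rho>(1) by (simp add: post_0)
  qed (use \<rho>(1) in simp)
  moreover have "\<exists>!y. y \<in> cells X P n \<and> (\<forall>c\<in>cobj J. post K X P (F c) (\<rho> c) n y = x c)"
    if X: "ob X" and x: "is_cone K J F R X n x" for X n x
  proof -
    obtain Wn \<omega> where Wn: "is_cotensor K A (std n) Wn \<omega>" using W by blast
    show ?thesis by (rule cotensor_colimit_cells [OF J T A X P F Wn \<rho> R x]) assumption+
  qed
  ultimately show ?thesis unfolding is_limit_def using D(1) by blast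
qed

end

section \<open>Limits of comma objects\<close>

context enriched
begin

text \<open>The functor m between commas over fixed feet that h induces, in terms of the 2-cells.\<close>

definition comma_morphism where
  "comma_morphism A A' B C h E e0 e1 \<kappa> E' e0' e1' \<kappa>' m \<longleftrightarrow> m \<in> functors K E E' \<and>
     fcomp K E E' B e0' m = e0 \<and> fcomp K E E' C e1' m = e1 \<and> pre K E E' A' m 1 \<kappa>' = post K E A A' h 1 \<kappa>"

lemma comma_morphism_component:
  assumes m: "comma_morphism A A' B C h E e0 e1 \<kappa> E' e0' e1' \<kappa>' m"
    and obj: "ob A" "ob A'" "ob X" and h: "h \<in> functors K A A'"
    and E: "is_comma K A B C f g E e0 e1 \<kappa>" and E': "is_comma K A' B C f' g' E' e0' e1' \<kappa>'"
    and x: "x \<in> cells X E n" and i: "i \<in> Delta k 1" and \<alpha>: "\<alpha> \<in> Delta k n"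
  shows "Cmp K X E' A' k (res K E' A' 1 i \<kappa>') (res K X E' n \<alpha> (post K X E E' m n x)) =
    post K X A A' h k (cpt K X E A \<kappa> n k i \<alpha> x)"
proof -
  note D = commaD [OF E] and D' = commaD [OF E']
  have m': "m \<in> functors K E E'" "pre K E E' A' m 1 \<kappa>' = post K E A A' h 1 \<kappa>"
    using m by (simp_all add: comma_morphism_def)
  have "Cmp K X E' A' k (res K E' A' 1 i \<kappa>') (res K X E' n \<alpha> (post K X E E' m n x)) =
      Cmp K X E A' k (pre K E E' A' m k (res K E' A' 1 i \<kappa>')) (res K X E n \<alpha> x)"
    using D(1) D'(1,4) obj m'(1) x i \<alpha> by (simp add: act_post cmp_pre act_cells)
  also have "pre K E E' A' m k (res K E' A' 1 i \<kappa>') = res K E A' 1 i (pre K E E' A' m 1 \<kappa>')"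
    using D(1) D'(1,4) obj m'(1) i by (simp add: act_pre)
  also have "\<dots> = post K E A A' h k (res K E A 1 i \<kappa>)"
    unfolding m'(2) using D(1,4) obj h i by (simp add: act_post)
  also have "Cmp K X E A' k (post K E A A' h k (res K E A 1 i \<kappa>)) (res K X E n \<alpha> x) =
      post K X A A' h k (cpt K X E A \<kappa> n k i \<alpha> x)"
    using D(1,4) obj h x i \<alpha> by (simp add: cmp_post act_cells)
  finally show ?thesis .
qed

text \<open>The components of the members of a cone form, at each simplex of the prism, a cone over the vertices of the cospans. Its unique lift to P is simplicial by uniqueness.
The feet b and d have to be given in addition since the index category may be empty.\<close>

lemma comma_limit:
  assumes J: "category J" and obj: "ob B" "ob C" "ob X"
    and lim: "is_limit K J F R P \<rho>" and fg: "f \<in> functors K B P" "g \<in> functors K C P"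
    and E: "is_comma K P B C f g E e0 e1 \<kappa>"
    and E': "\<And>c. c \<in> cobj J ==> is_comma K (F c) B C (fcomp K B P (F c) (\<rho> c) f) (fcomp K C P (F c) (\<rho> c) g) (E' c) (e0' c) (e1' c) (\<kappa>' c)"
    and l: "\<And>c. c \<in> cobj J ==> comma_morphism P (F c) B C (\<rho> c) E e0 e1 \<kappa> (E' c) (e0' c) (e1' c) (\<kappa>' c) (l c)"
    and M: "\<And>h. h \<in> carr J ==> comma_morphism (F (cdom J h)) (F (ccod J h)) B C (R h)
      (E' (cdom J h)) (e0' (cdom J h)) (e1' (cdom J h)) (\<kappa>' (cdom J h))
      (E' (ccod J h)) (e0' (ccod J h)) (e1' (ccod J h)) (\<kappa>' (ccod J h)) (M h)"
    and x: "is_cone K J E' M X n x" and bd: "b \<in> cells X B n" "d \<in> cells X C n"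
    and xb: "\<And>c. c \<in> cobj J ==> post K X (E' c) B (e0' c) n (x c) = b"
    and xd: "\<And>c. c \<in> cobj J ==> post K X (E' c) C (e1' c) n (x c) = d"
  shows "\<exists>!y. y \<in> cells X E n \<and> post K X E B e0 n y = b \<and> post K X E C e1 n y = d \<and>
    (\<forall>c\<in>cobj J. post K X E (E' c) (l c) n y = x c)"
proof -
  note D = commaD [OF E] and D' = commaD [OF E']
  have P: "ob P" and F: "\<And>c. c \<in> cobj J ==> F c \<in> Obj K"
    and R: "\<And>h. h \<in> carr J ==> R h \<in> functors K (F (cdom J h)) (F (ccod J h))"
    and \<rho>: "\<And>c. c \<in> cobj J ==> \<rho> c \<in> functors K P (F c)"
    and R\<rho>: "\<And>h. h \<in> carr J ==> post K P (F (cdom J h)) (F (ccod J h)) (R h) 0 (\<rho> (cdom J h)) = \<rho> (ccod J h)"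
    using lim by (simp_all add: is_limit_def diagram_in_def is_cone_def)
  have univ: "\<exists>!y. y \<in> cells X P m \<and> (\<forall>c\<in>cobj J. post K X P (F c) (\<rho> c) m y = z c)" if "is_cone K J F R X m z" for m z
    using lim obj(3) that by (simp add: is_limit_def)
  have ends: "cdom J h \<in> cobj J" "ccod J h \<in> cobj J" if "h \<in> carr J" for h
    using J that by (simp_all add: category_def)
  have xc: "x c \<in> cells X (E' c) n" if "c \<in> cobj J" for c using x that by (simp add: is_cone_def)
  have xM: "post K X (E' (cdom J h)) (E' (ccod J h)) (M h) n (x (cdom J h)) = x (ccod J h)" if "h \<in> carr J" for h
    using x that by (simp add: is_cone_def)
  have l': "l c \<in> functors K E (E' c)" "fcomp K E (E' c) B (e0' c) (l c) = e0" "fcomp K E (E' c) C (e1' c) (l c) = e1"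
    if "c \<in> cobj J" for c
    using l [OF that] by (simp_all add: comma_morphism_def)
  have joint: "y = z" if yz: "y \<in> cells X P m" "z \<in> cells X P m"
    and e: "\<And>c. c \<in> cobj J ==> post K X P (F c) (\<rho> c) m y = post K X P (F c) (\<rho> c) m z" for y z m
  proof -
    have "is_cone K J F R X m (\<lambda>c. post K X P (F c) (\<rho> c) m z)"
      unfolding is_cone_def
    proof (intro conjI ballI)
      fix h assume h: "h \<in> carr J"
      note c = ends [OF h]
      have "fcomp K P (F (cdom J h)) (F (ccod J h)) (R h) (\<rho> (cdom J h)) = \<rho> (ccod J h)"
        using R\<rho> [OF h] P F c R [OF h] \<rho> by (simp add: post_0)
      then show "post K X (F (cdom J h)) (F (ccod J h)) (R h) m (post K X P (F (cdom J h)) (\<rho> (cdom J h)) m z) =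
          post K X P (F (ccod J h)) (\<rho> (ccod J h)) m z"
        using obj P F c R [OF h] \<rho> yz by (simp add: post_post)
    qed (use obj P F \<rho> yz in simp)
    from univ [OF this] show ?thesis using yz e by (elim ex1E) blast
  qed
  define a where "a c m i \<alpha> = Cmp K X (E' c) (F c) m (act (Fun K (E' c) (F c)) 1 i (\<kappa>' c)) (act (Fun K X (E' c)) n \<alpha> (x c))" for c m i \<alpha>
  have a_smap: "smap (sprod (std 1) (std n)) (Fun K X (F c)) (\<lambda>m (i, \<alpha>). a c m i \<alpha>)" if c: "c \<in> cobj J" for c
    unfolding a_def
    by (rule comma_component_smap [OF F [OF c] obj(3) D'(1,4) [OF c]], rule smap_of_simplex)
      (use obj D'(1) xc c in simp_all)
  have a_in: "a c m i \<alpha> \<in> cells X (F c) m" if "c \<in> cobj J" "i \<in> Delta m 1" "\<alpha> \<in> Delta m n" for c m i \<alpha>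
    using smap_in [OF a_smap [OF that(1)], of "(i, \<alpha>)" m] that by simp
  have a_cone: "is_cone K J F R X m (\<lambda>c. a c m i \<alpha>)" if i: "i \<in> Delta m 1" "\<alpha> \<in> Delta m n" for m i \<alpha>
    unfolding is_cone_def
  proof (intro conjI ballI)
    fix h assume h: "h \<in> carr J"
    note c = ends [OF h]
    show "post K X (F (cdom J h)) (F (ccod J h)) (R h) m (a (cdom J h) m i \<alpha>) = a (ccod J h) m i \<alpha>"
      using comma_morphism_component [OF M [OF h] F [OF c(1)] F [OF c(2)] obj(3) R [OF h] E' [OF c(1)] E' [OF c(2)] xc [OF c(1)] i]
      unfolding xM [OF h] a_def by simp
  qed (use a_in i in simp)
  define \<Phi> where "\<Phi> m q = (THE y. y \<in> cells X P m \<and> (\<forall>c\<in>cobj J. post K X P (F c) (\<rho> c) m y = a c m (fst q) (snd q)))" for m q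
  have \<Phi>: "\<Phi> m (i, \<alpha>) \<in> cells X P m" "\<And>c. c \<in> cobj J ==> post K X P (F c) (\<rho> c) m (\<Phi> m (i, \<alpha>)) = a c m i \<alpha>"
    if "i \<in> Delta m 1" "\<alpha> \<in> Delta m n" for m i \<alpha>
    using theI' [OF univ [OF a_cone [OF that]]] unfolding \<Phi>_def by simp_all
  have \<Phi>_smap: "smap (sprod (std 1) (std n)) (Fun K X P) \<Phi>"
  proof (rule simplicial_mapI)
    show "\<Phi> m q \<in> cells X P m" if "q \<in> simplices (sprod (std 1) (std n)) m" for m q
      using \<Phi>(1) that by (cases q) simp
    fix m k \<beta> q assume \<beta>: "\<beta> \<in> Delta m k" and q: "q \<in> simplices (sprod (std 1) (std n)) k"
    obtain i \<alpha> where q': "q = (i, \<alpha>)" "i \<in> Delta k 1" "\<alpha> \<in> Delta k n" using q by (cases q) simp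
    have r: "i \<odot> \<beta> \<in> Delta m 1" "\<alpha> \<odot> \<beta> \<in> Delta m n" using \<beta> q' by auto
    have "\<Phi> m (i \<odot> \<beta>, \<alpha> \<odot> \<beta>) = res K X P k \<beta> (\<Phi> k (i, \<alpha>))"
    proof (rule joint)
      show "res K X P k \<beta> (\<Phi> k (i, \<alpha>)) \<in> cells X P m"
        by (rule act_cells [OF obj(3) P \<Phi>(1) [OF q'(2,3)] \<beta>])
      fix c assume c: "c \<in> cobj J"
      show "post K X P (F c) (\<rho> c) m (\<Phi> m (i \<odot> \<beta>, \<alpha> \<odot> \<beta>)) = post K X P (F c) (\<rho> c) m (res K X P k \<beta> (\<Phi> k (i, \<alpha>)))"
        using smap_act [OF a_smap [OF c] \<beta>, of "(i, \<alpha>)"] q'(2,3) \<Phi>(2) [OF r c] \<Phi>(2) [OF q'(2,3) c]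
          act_post [OF obj(3) P F [OF c] \<rho> [OF c] \<Phi>(1) [OF q'(2,3)] \<beta>] by simp
    qed (rule \<Phi>(1) [OF r])
    then show "\<Phi> m (act (sprod (std 1) (std n)) k \<beta> q) = res K X P k \<beta> (\<Phi> k q)" unfolding q'(1) by simp
  qed
  have \<Phi>_end: "\<Phi> m (const m 0, \<alpha>) = res K X P n \<alpha> (post K X B P f n b)"
      "\<Phi> m (const m 1, \<alpha>) = res K X P n \<alpha> (post K X C P g n d)"
    if \<alpha>: "\<alpha> \<in> Delta m n" for m \<alpha>
  proof -
    have v: "const m 0 \<in> Delta m 1" "const m 1 \<in> Delta m 1" by simp_all
    have act_b: "res K X B n \<alpha> b \<in> cells X B m" "res K X C n \<alpha> d \<in> cells X C m"
      using bd obj \<alpha> by (simp_all add: act_cells)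
    have *: "a c m (const m 0) \<alpha> = post K X P (F c) (\<rho> c) m (post K X B P f m (res K X B n \<alpha> b)) \<and>
        a c m (const m 1) \<alpha> = post K X P (F c) (\<rho> c) m (post K X C P g m (res K X C n \<alpha> d))" if c: "c \<in> cobj J" for c
    proof -
      have "act (Fun K X (E' c)) n \<alpha> (x c) \<in> cells X (E' c) m" using obj D'(1) c xc \<alpha> by (simp add: act_cells)
      from comma_ends [OF E' [OF c] F [OF c] obj _ _ this] show ?thesis
        unfolding a_def using obj P F [OF c] \<rho> [OF c] fg c D' [OF c] xc [OF c] \<alpha> xb [OF c] xd [OF c] act_b
        by (simp add: post_post del: One_nat_def flip: act_post)
    qed
    show "\<Phi> m (const m 0, \<alpha>) = res K X P n \<alpha> (post K X B P f n b)"
      by (rule joint, rule \<Phi>(1) [OF v(1) \<alpha>])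
        (use * \<Phi>(2) [OF v(1) \<alpha>] obj P bd fg \<alpha> act_b in \<open>simp_all add: act_post del: One_nat_def\<close>)
    show "\<Phi> m (const m 1, \<alpha>) = res K X P n \<alpha> (post K X C P g n d)"
      by (rule joint, rule \<Phi>(1) [OF v(2) \<alpha>])
        (use * \<Phi>(2) [OF v(2) \<alpha>] obj P bd fg \<alpha> act_b in \<open>simp_all add: act_post del: One_nat_def\<close>)
  qed
  obtain y where y: "y \<in> cells X E n" "post K X E B e0 n y = b" "post K X E C e1 n y = d"
    "\<And>m i \<alpha>. i \<in> Delta m 1 ==> \<alpha> \<in> Delta m n ==>
      cpt K X E P \<kappa> n m i \<alpha> y = \<Phi> m (i, \<alpha>)"
    using comma_ex [OF E obj(3) bd \<Phi>_smap \<Phi>_end] by blast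
  have comp: "Cmp K X (E' c) (F c) m (act (Fun K (E' c) (F c)) 1 i (\<kappa>' c)) (act (Fun K X (E' c)) n \<alpha> (post K X E (E' c) (l c) n z)) =
      post K X P (F c) (\<rho> c) m (cpt K X E P \<kappa> n m i \<alpha> z)"
    if "c \<in> cobj J" "z \<in> cells X E n" "i \<in> Delta m 1" "\<alpha> \<in> Delta m n" for c m i \<alpha> z
    by (rule comma_morphism_component [OF l [OF that(1)] P F [OF that(1)] obj(3) \<rho> [OF that(1)] E E' [OF that(1)] that(2-4)])
  show ?thesis
  proof (rule ex1I [of _ y], intro conjI ballI y(1-3))
    fix c assume c: "c \<in> cobj J"
    show "post K X E (E' c) (l c) n y = x c"
    proof (rule comma_unique [OF E' [OF c] obj(3) _ xc [OF c]])
      show "post K X E (E' c) (l c) n y \<in> cells X (E' c) n" using obj D(1) D'(1) [OF c] l' [OF c] y(1) by simp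
      show "post K X (E' c) B (e0' c) n (post K X E (E' c) (l c) n y) = post K X (E' c) B (e0' c) n (x c)"
        "post K X (E' c) C (e1' c) n (post K X E (E' c) (l c) n y) = post K X (E' c) C (e1' c) n (x c)"
        using obj D(1) D' [OF c] l' [OF c] y(1-3) xb [OF c] xd [OF c] by (simp_all add: post_post)
    qed (use comp [OF c y(1)] y(4) \<Phi>(2) c in \<open>simp add: a_def\<close>)
  next
    fix z assume z: "z \<in> cells X E n \<and> post K X E B e0 n z = b \<and> post K X E C e1 n z = d \<and>
      (\<forall>c\<in>cobj J. post K X E (E' c) (l c) n z = x c)"
    then have z1: "z \<in> cells X E n" by blast
    show "z = y"
    proof (rule comma_unique [OF E obj(3) z1 y(1)])
      fix m i \<alpha> assume i: "i \<in> Delta m 1" "\<alpha> \<in> Delta m n"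
      show "cpt K X E P \<kappa> n m i \<alpha> z = cpt K X E P \<kappa> n m i \<alpha> y"
      proof (rule joint)
        fix c assume c: "c \<in> cobj J"
        have "post K X E (E' c) (l c) n z = x c" using z c by blast
        then show "post K X P (F c) (\<rho> c) m (cpt K X E P \<kappa> n m i \<alpha> z) =
            post K X P (F c) (\<rho> c) m (cpt K X E P \<kappa> n m i \<alpha> y)"
          using comp [OF c z1 i] y(4) [OF i] \<Phi>(2) [OF i c] by (simp add: a_def)
      qed (use obj P D(1,4) z1 y(1) i in \<open>simp_all add: act_cells\<close>)
    qed (use z y in simp_all)
  qed
qed

end

section \<open>Functors between comma objects\<close>

context enriched
begin

lemma comma_morphism_unique:
  assumes m: "comma_morphism A A' B C h E e0 e1 \<kappa> E' e0' e1' \<kappa>' m"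
    and m': "comma_morphism A A' B C h E e0 e1 \<kappa> E' e0' e1' \<kappa>' m'"
    and obj: "ob A" "ob A'" "ob B" "ob C" and h: "h \<in> functors K A A'"
    and E: "is_comma K A B C f g E e0 e1 \<kappa>" and E': "is_comma K A' B C f' g' E' e0' e1' \<kappa>'"
  shows "m = m'"
proof (rule comma_unique [OF E' commaD(1) [OF E], where n = 0])
  note D = commaD [OF E] and D' = commaD [OF E']
  have f: "m \<in> functors K E E'" "m' \<in> functors K E E'" using m m' by (simp_all add: comma_morphism_def)
  then have id: "post K E E E' m 0 (Idt K E) = m" "post K E E E' m' 0 (Idt K E) = m'"
    using D(1) D'(1) by (simp_all add: post_0)
  fix k i \<alpha> assume i: "i \<in> Delta k 1" "\<alpha> \<in> Delta k 0"
  show "cpt K E E' A' \<kappa>' 0 k i \<alpha> m =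
      cpt K E E' A' \<kappa>' 0 k i \<alpha> m'"
    using comma_morphism_component [OF m obj(1,2) D(1) h E E' idt_in [OF D(1)] i]
      comma_morphism_component [OF m' obj(1,2) D(1) h E E' idt_in [OF D(1)] i] by (simp add: id)
next
  note D = commaD [OF E] and D' = commaD [OF E']
  show "post K E E' B e0' 0 m = post K E E' B e0' 0 m'" "post K E E' C e1' 0 m = post K E E' C e1' 0 m'"
    using m m' obj D(1) D'(1-3) by (simp_all add: comma_morphism_def post_0)
qed (use m m' in \<open>simp_all add: comma_morphism_def\<close>)

lemma comma_morphism_id:
  assumes "ob A" "ob B" "ob C" "is_comma K A B C f g E e0 e1 \<kappa>"
  shows "comma_morphism A A B C (Idt K A) E e0 e1 \<kappa> E e0 e1 \<kappa> (Idt K E)"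
  using assms commaD [OF assms(4)] by (simp add: comma_morphism_def)

lemma comma_morphism_comp:
  assumes m: "comma_morphism A A' B C h E e0 e1 \<kappa> E' e0' e1' \<kappa>' m"
    and m': "comma_morphism A' A'' B C h' E' e0' e1' \<kappa>' E'' e0'' e1'' \<kappa>'' m'"
    and obj: "ob A" "ob A'" "ob A''" "ob B" "ob C"
    and h: "h \<in> functors K A A'" "h' \<in> functors K A' A''"
    and E: "is_comma K A B C f g E e0 e1 \<kappa>" and E': "is_comma K A' B C f' g' E' e0' e1' \<kappa>'"
    and E'': "is_comma K A'' B C f'' g'' E'' e0'' e1'' \<kappa>''"
  shows "comma_morphism A A'' B C (fcomp K A A' A'' h' h) E e0 e1 \<kappa> E'' e0'' e1'' \<kappa>'' (fcomp K E E' E'' m' m)"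
proof -
  note D = commaD [OF E] and D' = commaD [OF E'] and D'' = commaD [OF E'']
  have M: "m \<in> functors K E E'" "fcomp K E E' B e0' m = e0" "fcomp K E E' C e1' m = e1"
    "pre K E E' A' m 1 \<kappa>' = post K E A A' h 1 \<kappa>"
    using m by (simp_all add: comma_morphism_def)
  have M': "m' \<in> functors K E' E''" "fcomp K E' E'' B e0'' m' = e0'" "fcomp K E' E'' C e1'' m' = e1'"
    "pre K E' E'' A'' m' 1 \<kappa>'' = post K E' A' A'' h' 1 \<kappa>'"
    using m' by (simp_all add: comma_morphism_def)
  have "pre K E E'' A'' (fcomp K E E' E'' m' m) 1 \<kappa>'' = pre K E E' A'' m 1 (pre K E' E'' A'' m' 1 \<kappa>'')"
    using D(1) D'(1) D''(1,4) obj M(1) M'(1) by (simp add: pre_pre)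
  also have "\<dots> = post K E A' A'' h' 1 (pre K E E' A' m 1 \<kappa>')"
    unfolding M'(4) using D(1) D'(1,4) obj M(1) h by (simp add: post_pre)
  also have "\<dots> = post K E A A'' (fcomp K A A' A'' h' h) 1 \<kappa>"
    unfolding M(4) using D(1,4) obj h by (simp add: post_post)
  finally show ?thesis
    unfolding comma_morphism_def using M M' D(1) D'(1) D''(1-3) obj by (simp flip: fcomp_assoc)
qed

end

context inf_cosmos
begin

lemma arrow_object: "ob A ==> is_cotensor K A (std 1) (arr_ob K A) (cotensor_ev K A (std 1))"
  by (rule finitary_cotensor_exists) simp_all

lemma comma_pullback:
  assumes obj: "ob A" "ob B" "ob C" and fg: "f \<in> functors K B A" "g \<in> functors K C A"
  shows "is_pullback K (arr_ob K A) (prod_ob K C B) (prod_ob K A A)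
     (pairing K (arr_ob K A) A A (arr_cod K A) (arr_dom K A)) (prod_map K C A B A g f)
     (comma_ob K A B C f g) (comma_arr K A B C f g) (comma_proj K A B C f g)"
    "pairing K (arr_ob K A) A A (arr_cod K A) (arr_dom K A) \<in> Isofib K (arr_ob K A) (prod_ob K A A)"
    "prod_map K C A B A g f \<in> functors K (prod_ob K C B) (prod_ob K A A)"
proof -
  note W = arrow_object [OF obj(1)] and AA = bin_product_exists [OF obj(1,1)] and CB = bin_product_exists [OF obj(3,2)]
  note q = pairing [OF AA obj(1,1) cotensorD(1) [OF W] arr_ends(2,1) [OF W]]
  show iso: "pairing K (arr_ob K A) A A (arr_cod K A) (arr_dom K A) \<in> Isofib K (arr_ob K A) (prod_ob K A A)"
    by (rule arrow_projection_isofib [OF obj(1) W AA q(1)]) (use q(2,3) in \<open>simp_all add: arr_cod_def arr_dom_def\<close>)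
  show pm: "prod_map K C A B A g f \<in> functors K (prod_ob K C B) (prod_ob K A A)"
    by (rule prod_map(1) [OF CB AA obj(3,2,1,1) fg(2,1)])
  show "is_pullback K (arr_ob K A) (prod_ob K C B) (prod_ob K A A)
     (pairing K (arr_ob K A) A A (arr_cod K A) (arr_dom K A)) (prod_map K C A B A g f)
     (comma_ob K A B C f g) (comma_arr K A B C f g) (comma_proj K A B C f g)"
    by (intro chosen_comma_pullback pullbacks [OF cotensorD(1) [OF W] bin_productD(1) [OF AA] bin_productD(1) [OF CB] iso pm])
qed

lemma comma:
  assumes obj: "ob A" "ob B" "ob C" and fg: "f \<in> functors K B A" "g \<in> functors K C A"
  shows "is_comma K A B C f g (comma_ob K A B C f g) (comma_src A B C f g) (comma_tgt A B C f g) (comma_edge A B C f g)"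
  by (rule chosen_comma [OF arrow_object [OF obj(1)] bin_product_exists [OF obj(1,1)] bin_product_exists [OF obj(3,2)]
      obj fg comma_pullback(1) [OF obj fg]])

lemma comma_proj_isofib:
  assumes obj: "ob A" "ob B" "ob C" and fg: "f \<in> functors K B A" "g \<in> functors K C A"
  shows "comma_proj K A B C f g \<in> Isofib K (comma_ob K A B C f g) (prod_ob K C B)"
  by (rule pullback_isofib [OF _ _ _ comma_pullback(2,3) [OF obj fg] comma_pullback(1) [OF obj fg]])
    (use cotensorD(1) [OF arrow_object] bin_productD(1) [OF bin_product_exists] obj in simp_all)

text \<open>Apart from the two fibrations and the fibres, this needs that the projections of the comma are isofibrations, which holds because the map to the product is a pullback of an isofibration.\<close>

theorem comma_is_module:
  assumes obj: "ob A" "ob B" "ob C" and fg: "f \<in> functors K B A" "g \<in> functors K C A"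
  shows "is_module K C B (comma_ob K A B C f g) (comma_proj K A B C f g)"
proof -
  let ?E = "comma_ob K A B C f g" and ?r = "comma_proj K A B C f g"
  note CB = bin_product_exists [OF obj(3,2)] and E = comma [OF obj fg] and r = comma_proj_isofib [OF obj fg]
  note o = bin_productD(1) [OF CB] commaD(1) [OF E] and pr = projections_isofib [OF obj(3,2) CB]
  have ends: "comma_src A B C f g \<in> Isofib K ?E B" "comma_tgt A B C f g \<in> Isofib K ?E C"
    unfolding comma_src_def comma_tgt_def using isofib_comp [OF o(2,1) _ r] obj pr by simp_all
  note rp = comma_tgt_def [symmetric, of A B C f g] comma_src_def [symmetric, of A B C f g]
  show ?thesis
    unfolding is_module_def Let_def rp
    using o(2) r comma_cocartesian_cartesian [OF obj fg E CB r rp ends pr] comma_groupoidal [OF obj fg E CB r rp]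
    by blast
qed

lemma comma_map:
  assumes obj: "ob A" "ob A'" "ob B" "ob C" and fg: "f \<in> functors K B A" "g \<in> functors K C A"
    and h: "h \<in> functors K A A'" and f': "f' = fcomp K B A A' h f" and g': "g' = fcomp K C A A' h g"
  shows "comma_morphism A A' B C h
      (comma_ob K A B C f g) (comma_src A B C f g) (comma_tgt A B C f g) (comma_edge A B C f g)
      (comma_ob K A' B C f' g') (comma_src A' B C f' g') (comma_tgt A' B C f' g') (comma_edge A' B C f' g')
      (comma_map K A B C f g A' f' g' h)" (is ?morphism)
    and "fcomp K (comma_ob K A B C f g) (comma_ob K A' B C f' g') (prod_ob K C B)
      (comma_proj K A' B C f' g') (comma_map K A B C f g A' f' g' h) = comma_proj K A B C f g" (is ?over)
proof -
  let ?E = "comma_ob K A B C f g" and ?E' = "comma_ob K A' B C f' g'" and ?m = "comma_map K A B C f g A' f' g' h"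
  let ?a = "comma_arr K A B C f g" and ?r = "comma_proj K A B C f g"
  let ?a' = "comma_arr K A' B C f' g'" and ?r' = "comma_proj K A' B C f' g'"
  let ?W = "arr_ob K A" and ?W' = "arr_ob K A'" and ?CB = "prod_ob K C B" and ?AA = "prod_ob K A' A'"
  let ?\<epsilon> = "cotensor_ev K A (std 1)" and ?\<epsilon>' = "cotensor_ev K A' (std 1)" and ?H = "cotensor_map K A A' (std 1) h"
  let ?q = "pairing K ?W A A (arr_cod K A) (arr_dom K A)" and ?q' = "pairing K ?W' A' A' (arr_cod K A') (arr_dom K A')"
  let ?n = "prod_map K C A B A g f" and ?n' = "prod_map K C A' B A' g' f'"
  have fg': "f' \<in> functors K B A'" "g' \<in> functors K C A'" using f' g' fg h obj by simp_all
  note W = arrow_object [OF obj(1)] and W' = arrow_object [OF obj(2)]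
  note AA = bin_product_exists [OF obj(1,1)] and AA' = bin_product_exists [OF obj(2,2)] and CB = bin_product_exists [OF obj(4,3)]
  note DW = cotensorD [OF W] and DW' = cotensorD [OF W'] and DAA = bin_productD [OF AA] and DAA' = bin_productD [OF AA'] and DCB = bin_productD [OF CB]
  note E = comma_pullback [OF obj(1,3,4) fg] and E' = comma_pullback [OF obj(2,3,4) fg']
  note DE = pullbackD [OF E(1)] and DE' = pullbackD [OF E'(1)]
  note q = pairing [OF AA obj(1,1) DW(1) arr_ends(2,1) [OF W]] and q' = pairing [OF AA' obj(2,2) DW'(1) arr_ends(2,1) [OF W']]
  note n = prod_map [OF CB AA obj(4,3,1,1) fg(2,1)] and n' = prod_map [OF CB AA' obj(4,3,2,2) fg'(2,1)]
  have H: "?H \<in> functors K ?W ?W'" "\<And>m u. u \<in> Delta m 1 ==> pre K ?W ?W' A' ?H m (?\<epsilon>' m u) = post K ?W A A' h m (?\<epsilon> m u)"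
    using cotensor_map [OF W W' obj(1,2) simplicial_set_std h] by simp_all
  have v: "[0] \<in> Delta 0 1" "[1] \<in> Delta 0 1" "[0, 1] \<in> Delta 1 1" by (simp_all add: Delta_eval)
  have dc: "arr_dom K A \<in> functors K ?W A" "arr_cod K A \<in> functors K ?W A" "arr_dom K A' \<in> functors K ?W' A'" "arr_cod K A' \<in> functors K ?W' A'"
    using arr_ends [OF W] arr_ends [OF W'] by simp_all
  have Hdc: "fcomp K ?W ?W' A' (arr_dom K A') ?H = fcomp K ?W A A' h (arr_dom K A)"
    "fcomp K ?W ?W' A' (arr_cod K A') ?H = fcomp K ?W A A' h (arr_cod K A)"
    using H(2) [OF v(1)] H(2) [OF v(2)] dc DW(1) DW'(1) obj h H(1) by (simp_all add: arr_dom_def arr_cod_def pre_0 post_0)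
  have dca: "fcomp K ?E ?W A (arr_cod K A) ?a = fcomp K ?E C A g (fcomp K ?E ?CB C (proj1 K C B) ?r)"
    "fcomp K ?E ?W A (arr_dom K A) ?a = fcomp K ?E B A f (fcomp K ?E ?CB B (proj2 K C B) ?r)"
  proof -
    note * = DE(4) DE(1-3) DAA DCB DW(1) q(1) n(1) obj fg
    have "fcomp K ?E ?W A (fcomp K ?W (prod_ob K A A) A (proj1 K A A) ?q) ?a =
        fcomp K ?E ?CB A (fcomp K ?CB (prod_ob K A A) A (proj1 K A A) ?n) ?r"
      using * by (simp add: fcomp_assoc)
    then show "fcomp K ?E ?W A (arr_cod K A) ?a = fcomp K ?E C A g (fcomp K ?E ?CB C (proj1 K C B) ?r)"
      using q(2) n(2) * by (simp add: fcomp_assoc)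
    have "fcomp K ?E ?W A (fcomp K ?W (prod_ob K A A) A (proj2 K A A) ?q) ?a =
        fcomp K ?E ?CB A (fcomp K ?CB (prod_ob K A A) A (proj2 K A A) ?n) ?r"
      using * by (simp add: fcomp_assoc)
    then show "fcomp K ?E ?W A (arr_dom K A) ?a = fcomp K ?E B A f (fcomp K ?E ?CB B (proj2 K C B) ?r)"
      using q(3) n(3) * by (simp add: fcomp_assoc)
  qed
  have Ha: "fcomp K ?E ?W ?W' ?H ?a \<in> functors K ?E ?W'" using DE(1,2) DW(1) DW'(1) H(1) by simp
  have sq: "fcomp K ?E ?W' ?AA ?q' (fcomp K ?E ?W ?W' ?H ?a) = fcomp K ?E ?CB ?AA ?n' ?r"
  proof (rule bin_product_unique [OF AA' DE(1) obj(2,2), where n = 0])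
    show "post K ?E ?AA A' (proj1 K A' A') 0 (fcomp K ?E ?W' ?AA ?q' (fcomp K ?E ?W ?W' ?H ?a)) =
        post K ?E ?AA A' (proj1 K A' A') 0 (fcomp K ?E ?CB ?AA ?n' ?r)"
    proof -
      have "fcomp K ?E ?W' A' (fcomp K ?W' ?AA A' (proj1 K A' A') ?q') (fcomp K ?E ?W ?W' ?H ?a) =
          fcomp K ?E ?W A' (fcomp K ?W ?W' A' (arr_cod K A') ?H) ?a"
        unfolding q'(2) using DE(1,2) DW(1) DW'(1) H(1) dc obj by (simp add: fcomp_assoc)
      also have "\<dots> = fcomp K ?E A A' h (fcomp K ?E ?W A (arr_cod K A) ?a)"
        unfolding Hdc using DE(1,2) DW(1) dc obj h by (simp add: fcomp_assoc)
      also have "\<dots> = fcomp K ?E ?CB A' (fcomp K ?CB ?AA A' (proj1 K A' A') ?n') ?r"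
        unfolding dca n'(2) unfolding g' using DE(1,3) DCB obj h fg by (simp add: fcomp_assoc)
      finally show ?thesis
        using DE(1-3) DW'(1) DAA' DCB(1) Ha q'(1) n'(1) obj by (simp add: post_0 flip: fcomp_assoc)
    qed
    show "post K ?E ?AA A' (proj2 K A' A') 0 (fcomp K ?E ?W' ?AA ?q' (fcomp K ?E ?W ?W' ?H ?a)) =
        post K ?E ?AA A' (proj2 K A' A') 0 (fcomp K ?E ?CB ?AA ?n' ?r)"
    proof -
      have "fcomp K ?E ?W' A' (fcomp K ?W' ?AA A' (proj2 K A' A') ?q') (fcomp K ?E ?W ?W' ?H ?a) =
          fcomp K ?E ?W A' (fcomp K ?W ?W' A' (arr_dom K A') ?H) ?a"
        unfolding q'(3) using DE(1,2) DW(1) DW'(1) H(1) dc obj by (simp add: fcomp_assoc)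
      also have "\<dots> = fcomp K ?E A A' h (fcomp K ?E ?W A (arr_dom K A) ?a)"
        unfolding Hdc using DE(1,2) DW(1) dc obj h by (simp add: fcomp_assoc)
      also have "\<dots> = fcomp K ?E ?CB A' (fcomp K ?CB ?AA A' (proj2 K A' A') ?n') ?r"
        unfolding dca n'(3) unfolding f' using DE(1,3) DCB obj h fg by (simp add: fcomp_assoc)
      finally show ?thesis
        using DE(1-3) DW'(1) DAA' DCB(1) Ha q'(1) n'(1) obj by (simp add: post_0 flip: fcomp_assoc)
    qed
  qed (use DE(1-3) DW'(1) DAA'(1) DCB(1) Ha q'(1) n'(1) in simp_all)
  let ?p = "\<lambda>m. m \<in> functors K ?E ?E' \<and> fcomp K ?E ?E' ?W' ?a' m = fcomp K ?E ?W ?W' ?H ?a \<and> fcomp K ?E ?E' ?CB ?r' m = ?r"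
  have "\<exists>m\<in>cells ?E ?E' 0. post K ?E ?E' ?W' ?a' 0 m = fcomp K ?E ?W ?W' ?H ?a \<and> post K ?E ?E' ?CB ?r' 0 m = ?r"
    by (rule pullback_ex [OF E'(1) DE(1) Ha DE(3)])
      (use sq DE(1,3) DW'(1) DAA'(1) DCB(1) Ha q'(1) n'(1) in \<open>simp add: post_0\<close>)
  then obtain m where m: "?p m" using DE(1) DE'(1-3) DW'(1) DCB(1) by (auto simp: post_0)
  have "m' = m" if "?p m'" for m'
    by (rule pullback_unique [OF E'(1) DE(1) DW'(1) DCB(1) DAA'(1) q'(1) n'(1), where n = 0])
      (use that m DE(1) DE'(1-3) DW'(1) DCB(1) in \<open>simp_all add: post_0\<close>)
  with m have "\<exists>!m. ?p m" by blast
  from theI' [OF this] have M: "?p ?m" unfolding comma_map_def Let_def .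
  then show ?over by blast
  have "pre K ?E ?E' A' ?m 1 (comma_edge A' B C f' g') = pre K ?E ?W' A' (fcomp K ?E ?E' ?W' ?a' ?m) 1 (?\<epsilon>' 1 [0, 1])"
    unfolding comma_edge_def using M DE(1) DE'(1,2) DW'(1) DW'(3) v(3) obj by (simp add: pre_pre)
  also have "\<dots> = pre K ?E ?W A' ?a 1 (pre K ?W ?W' A' ?H 1 (?\<epsilon>' 1 [0, 1]))"
    using M DE(1,2) DW(1) DW'(1) DW'(3) v(3) obj H(1) by (simp add: pre_pre)
  also have "\<dots> = post K ?E A A' h 1 (comma_edge A B C f g)"
    unfolding H(2) [OF v(3)] comma_edge_def using DE(1,2) DW(1) DW(3) v(3) obj h by (simp add: post_pre)
  finally show ?morphism
    unfolding comma_morphism_def comma_src_def comma_tgt_def using M DE(1,3) DE'(1,3) DCB obj by (simp add: fcomp_assoc)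
qed

end

section \<open>Limits of modules\<close>

lemma Mod_simps [simp]:
  "Obj (Mod K A B) = {(E, r). is_module K A B E r}" "Fun (Mod K A B) = Fun (slice K (prod_ob K A B))"
  "Cmp (Mod K A B) = Cmp (slice K (prod_ob K A B))" "Idt (Mod K A B) = Idt (slice K (prod_ob K A B))"
  "post (Mod K A B) = post (slice K (prod_ob K A B))"
  by (simp_all add: Mod_def full_sub_def post_def fun_eq_iff)

text \<open>Lying over the product of C and B means having prescribed feet.\<close>

lemma (in enriched) bin_product_eq_iff:
  assumes P: "is_bin_product K A B P a b" and obj: "ob A" "ob B" "ob E" "ob X"
    and r: "r \<in> functors K E P" and x: "x \<in> cells X E n" and s: "s \<in> cells X P n"
  shows "post K X E P r n x = s \<longleftrightarrow>
    post K X E A (fcomp K E P A a r) n x = post K X P A a n s \<and> post K X E B (fcomp K E P B b r) n x = post K X P B b n s"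
proof
  note D = bin_productD [OF P]
  assume "post K X E A (fcomp K E P A a r) n x = post K X P A a n s \<and> post K X E B (fcomp K E P B b r) n x = post K X P B b n s"
  then show "post K X E P r n x = s"
    by (intro bin_product_unique [OF P obj(4,1,2) _ s]) (use D obj r x in \<open>simp_all add: post_post\<close>)
qed (use bin_productD [OF P] obj r x in \<open>auto simp: post_post\<close>)

context inf_cosmos
begin

text \<open>The structure map of an n-simplex over the product is equivalent to its two feet, and the feet of the degenerate simplices on the structure map of X serve as b and d in
\<open>comma_limit\<close>.\<close>

theorem comma_module_limit:
  assumes J: "category J" and obj: "ob B" "ob C"
    and lim: "is_limit K J F R P \<rho>" and fg: "f \<in> functors K B P" "g \<in> functors K C P"
    and f': "\<And>c. c \<in> cobj J ==> f' c = fcomp K B P (F c) (\<rho> c) f"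
    and g': "\<And>c. c \<in> cobj J ==> g' c = fcomp K C P (F c) (\<rho> c) g"
  shows "is_limit (Mod K C B) J
    (\<lambda>c. (comma_ob K (F c) B C (f' c) (g' c), comma_proj K (F c) B C (f' c) (g' c)))
    (\<lambda>h. comma_map K (F (cdom J h)) B C (f' (cdom J h)) (g' (cdom J h)) (F (ccod J h)) (f' (ccod J h)) (g' (ccod J h)) (R h))
    (comma_ob K P B C f g, comma_proj K P B C f g)
    (\<lambda>c. comma_map K P B C f g (F c) (f' c) (g' c) (\<rho> c))"
proof -
  define E where "E c = comma_ob K (F c) B C (f' c) (g' c)" for c
  define r where "r c = comma_proj K (F c) B C (f' c) (g' c)" for c
  define e0 where "e0 c = comma_src (F c) B C (f' c) (g' c)" for c
  define e1 where "e1 c = comma_tgt (F c) B C (f' c) (g' c)" for c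
  define \<kappa> where "\<kappa> c = comma_edge (F c) B C (f' c) (g' c)" for c
  define M where "M h = comma_map K (F (cdom J h)) B C (f' (cdom J h)) (g' (cdom J h)) (F (ccod J h)) (f' (ccod J h)) (g' (ccod J h)) (R h)" for h
  define l where "l c = comma_map K P B C f g (F c) (f' c) (g' c) (\<rho> c)" for c
  let ?E = "comma_ob K P B C f g" and ?r = "comma_proj K P B C f g" and ?CB = "prod_ob K C B"
  let ?e0 = "comma_src P B C f g" and ?e1 = "comma_tgt P B C f g" and ?\<kappa> = "comma_edge P B C f g"
  have P: "ob P" and F: "\<And>c. c \<in> cobj J ==> F c \<in> Obj K"
    and R: "\<And>h. h \<in> carr J ==> R h \<in> functors K (F (cdom J h)) (F (ccod J h))"
    and \<rho>: "\<And>c. c \<in> cobj J ==> \<rho> c \<in> functors K P (F c)"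
    and Rid: "\<And>c. c \<in> cobj J ==> R (cid J c) = Idt K (F c)"
    and Rcomp: "\<And>h k. h \<in> carr J ==> k \<in> carr J ==> ccod J h = cdom J k ==>
      R (ccomp J k h) = fcomp K (F (cdom J h)) (F (ccod J h)) (F (ccod J k)) (R k) (R h)"
    and cone: "\<And>h. h \<in> carr J ==> post K P (F (cdom J h)) (F (ccod J h)) (R h) 0 (\<rho> (cdom J h)) = \<rho> (ccod J h)"
    using lim by (simp_all add: is_limit_def diagram_in_def is_cone_def)
  have ends: "cdom J h \<in> cobj J" "ccod J h \<in> cobj J" if "h \<in> carr J" for h
    using J that by (simp_all add: category_def)
  have R\<rho>: "fcomp K P (F (cdom J h)) (F (ccod J h)) (R h) (\<rho> (cdom J h)) = \<rho> (ccod J h)" if h: "h \<in> carr J" for h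
    using cone [OF h] P F R [OF h] \<rho> ends [OF h] by (simp add: post_0)
  have fg': "f' c \<in> functors K B (F c)" "g' c \<in> functors K C (F c)" if "c \<in> cobj J" for c
    using f' g' that obj P F \<rho> fg by simp_all
  note CB = bin_product_exists [OF obj(2,1)]
  note DCB = bin_productD [OF CB]
  note E = comma [OF P obj fg]
  have E': "is_comma K (F c) B C (f' c) (g' c) (E c) (e0 c) (e1 c) (\<kappa> c)" if "c \<in> cobj J" for c
    unfolding E_def e0_def e1_def \<kappa>_def using comma F fg' obj that by simp
  note D = commaD [OF E] and D' = commaD [OF E']
  have mod: "is_module K C B ?E ?r" "\<And>c. c \<in> cobj J ==> is_module K C B (E c) (r c)"
    unfolding E_def r_def using comma_is_module P F fg fg' obj by simp_all
  have iso: "?r \<in> Isofib K ?E ?CB" "\<And>c. c \<in> cobj J ==> r c \<in> Isofib K (E c) ?CB"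
    unfolding E_def r_def using comma_proj_isofib P F fg fg' obj by simp_all
  have rf: "?r \<in> functors K ?E ?CB" "\<And>c. c \<in> cobj J ==> r c \<in> functors K (E c) ?CB"
    using iso isofib_functor D(1) D'(1) DCB(1) by simp_all
  have l: "comma_morphism P (F c) B C (\<rho> c) ?E ?e0 ?e1 ?\<kappa> (E c) (e0 c) (e1 c) (\<kappa> c) (l c)" if c: "c \<in> cobj J" for c
    unfolding E_def e0_def e1_def \<kappa>_def l_def by (rule comma_map(1) [OF P F [OF c] obj fg \<rho> [OF c] f' [OF c] g' [OF c]])
  have l_over: "fcomp K ?E (E c) ?CB (r c) (l c) = ?r" if c: "c \<in> cobj J" for c
    unfolding E_def r_def l_def by (rule comma_map(2) [OF P F [OF c] obj fg \<rho> [OF c] f' [OF c] g' [OF c]])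
  have R_fg: "f' (ccod J h) = fcomp K B (F (cdom J h)) (F (ccod J h)) (R h) (f' (cdom J h))"
    "g' (ccod J h) = fcomp K C (F (cdom J h)) (F (ccod J h)) (R h) (g' (cdom J h))" if h: "h \<in> carr J" for h
    using f' g' R\<rho> [OF h] ends [OF h] obj P F \<rho> R [OF h] fg by (simp_all flip: fcomp_assoc)
  have M: "comma_morphism (F (cdom J h)) (F (ccod J h)) B C (R h)
      (E (cdom J h)) (e0 (cdom J h)) (e1 (cdom J h)) (\<kappa> (cdom J h))
      (E (ccod J h)) (e0 (ccod J h)) (e1 (ccod J h)) (\<kappa> (ccod J h)) (M h)" if h: "h \<in> carr J" for h
    unfolding E_def e0_def e1_def \<kappa>_def M_def
    by (rule comma_map(1) [OF F F obj fg' R [OF h] R_fg [OF h]]) (use ends [OF h] in simp_all)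
  have M_over: "fcomp K (E (cdom J h)) (E (ccod J h)) ?CB (r (ccod J h)) (M h) = r (cdom J h)" if h: "h \<in> carr J" for h
    unfolding E_def r_def M_def
    by (rule comma_map(2) [OF F F obj fg' R [OF h] R_fg [OF h]]) (use ends [OF h] in simp_all)
  have Mf: "M h \<in> functors K (E (cdom J h)) (E (ccod J h))" if "h \<in> carr J" for h
    using M [OF that] by (simp add: comma_morphism_def)
  have lf: "l c \<in> functors K ?E (E c)" if "c \<in> cobj J" for c
    using l [OF that] by (simp add: comma_morphism_def)
  have "diagram_in (Mod K C B) J (\<lambda>c. (E c, r c)) M"
    unfolding diagram_in_def
  proof (intro conjI ballI impI)
    fix h assume h: "h \<in> carr J"
    show "M h \<in> functors (Mod K C B) (E (cdom J h), r (cdom J h)) (E (ccod J h), r (ccod J h))"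
      using slice_functor [OF DCB(1), of "(E (cdom J h), r (cdom J h))" "(E (ccod J h), r (ccod J h))" "M h"]
        Mf [OF h] M_over [OF h] D'(1) iso(2) ends [OF h] by simp
  next
    fix c assume c: "c \<in> cobj J"
    then have i: "cid J c \<in> carr J" "cdom J (cid J c) = c" "ccod J (cid J c) = c"
      using J by (simp_all add: category_def)
    have "M (cid J c) = Idt K (E c)"
      by (rule comma_morphism_unique [OF _ comma_morphism_id [OF F [OF c] obj E' [OF c]] F [OF c] F [OF c] obj _ E' [OF c] E' [OF c]])
        (use M [OF i(1)] Rid [OF c] i F [OF c] in simp_all)
    then show "M (cid J c) = Idt (Mod K C B) (E c, r c)" by simp
  next
    fix h k assume h: "h \<in> carr J" and k: "k \<in> carr J" and hk: "ccod J h = cdom J k"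
    then have kh: "ccomp J k h \<in> carr J" "cdom J (ccomp J k h) = cdom J h" "ccod J (ccomp J k h) = ccod J k"
      using J by (simp_all add: category_def)
    note c = ends [OF h] ends(2) [OF k]
    have Rk: "R k \<in> functors K (F (ccod J h)) (F (ccod J k))" using R [OF k] hk by simp
    have Mk: "comma_morphism (F (ccod J h)) (F (ccod J k)) B C (R k) (E (ccod J h)) (e0 (ccod J h)) (e1 (ccod J h)) (\<kappa> (ccod J h))
        (E (ccod J k)) (e0 (ccod J k)) (e1 (ccod J k)) (\<kappa> (ccod J k)) (M k)"
      using M [OF k] hk by simp
    have Mkh: "comma_morphism (F (cdom J h)) (F (ccod J k)) B C (fcomp K (F (cdom J h)) (F (ccod J h)) (F (ccod J k)) (R k) (R h))
        (E (cdom J h)) (e0 (cdom J h)) (e1 (cdom J h)) (\<kappa> (cdom J h))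
        (E (ccod J k)) (e0 (ccod J k)) (e1 (ccod J k)) (\<kappa> (ccod J k)) (M (ccomp J k h))"
      using M [OF kh(1)] Rcomp [OF h k hk] kh(2,3) by simp
    have "M (ccomp J k h) = fcomp K (E (cdom J h)) (E (ccod J h)) (E (ccod J k)) (M k) (M h)"
      by (rule comma_morphism_unique [OF Mkh comma_morphism_comp [OF M [OF h] Mk F [OF c(1)] F [OF c(2)] F [OF c(3)] obj
              R [OF h] Rk E' [OF c(1)] E' [OF c(2)] E' [OF c(3)]] F [OF c(1)] F [OF c(3)] obj _ E' [OF c(1)] E' [OF c(3)]])
        (use F c R [OF h] Rk in simp)
    then show "M (ccomp J k h) = fcomp (Mod K C B) (E (cdom J h), r (cdom J h)) (E (ccod J h), r (ccod J h)) (E (ccod J k), r (ccod J k)) (M k) (M h)"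
      by simp
  qed (use mod in simp)
  moreover have "is_cone (Mod K C B) J (\<lambda>c. (E c, r c)) M (?E, ?r) 0 l"
    unfolding is_cone_def
  proof (intro conjI ballI)
    fix c assume c: "c \<in> cobj J"
    show "l c \<in> functors (Mod K C B) (?E, ?r) (E c, r c)"
      using slice_functor [OF DCB(1), of "(?E, ?r)" "(E c, r c)" "l c"] lf [OF c] l_over [OF c] D(1) D'(1) [OF c] iso c by simp
  next
    fix h assume h: "h \<in> carr J"
    note c = ends [OF h]
    have "fcomp K ?E (E (cdom J h)) (E (ccod J h)) (M h) (l (cdom J h)) = l (ccod J h)"
      by (rule comma_morphism_unique [OF comma_morphism_comp [OF l [OF c(1)] M [OF h] P F [OF c(1)] F [OF c(2)] obj
              \<rho> [OF c(1)] R [OF h] E E' [OF c(1)] E' [OF c(2)]] _ P F [OF c(2)] obj _ E E' [OF c(2)]])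
        (use l [OF c(2)] R\<rho> [OF h] \<rho> [OF c(2)] in simp_all)
    then show "post (Mod K C B) (?E, ?r) (E (cdom J h), r (cdom J h)) (E (ccod J h), r (ccod J h)) (M h) 0 (l (cdom J h)) = l (ccod J h)"
      using D(1) D'(1) c Mf [OF h] lf by (simp add: post_0)
  qed
  moreover have "\<exists>!y. y \<in> simplices (Fun (Mod K C B) X (?E, ?r)) n \<and>
      (\<forall>c\<in>cobj J. post (Mod K C B) X (?E, ?r) (E c, r c) (l c) n y = x c)"
    if X: "X \<in> Obj (Mod K C B)" and x: "is_cone (Mod K C B) J (\<lambda>c. (E c, r c)) M X n x" for X n x
  proof -
    obtain X0 s where X0: "X = (X0, s)" "ob X0" "s \<in> Isofib K X0 ?CB"
      using X by (auto simp: is_module_def Let_def)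
    have s: "s \<in> functors K X0 ?CB" by (rule isofib_functor [OF X0(2) DCB(1) X0(3)])
    define b where "b = post K X0 ?CB B (proj2 K C B) n (dg (Fun K X0 ?CB) n s)"
    define d where "d = post K X0 ?CB C (proj1 K C B) n (dg (Fun K X0 ?CB) n s)"
    have bd: "b \<in> cells X0 B n" "d \<in> cells X0 C n" unfolding b_def d_def using X0(2) s DCB obj by simp_all
    have over: "y \<in> simplices (Fun (slice K ?CB) X (E', r')) n \<longleftrightarrow> y \<in> cells X0 E' n \<and>
        post K X0 E' B (fcomp K E' ?CB B (proj2 K C B) r') n y = b \<and> post K X0 E' C (fcomp K E' ?CB C (proj1 K C B) r') n y = d"
      if "ob E'" "r' \<in> functors K E' ?CB" for E' r' y
      unfolding X0(1) b_def d_def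
      using bin_product_eq_iff [OF CB obj(2,1) that(1) X0(2) that(2), of y n "dg (Fun K X0 ?CB) n s"] X0(2) s DCB(1)
      by (auto simp: slice_simplices)
    have src: "fcomp K ?E ?CB B (proj2 K C B) ?r = ?e0" "fcomp K ?E ?CB C (proj1 K C B) ?r = ?e1"
      "fcomp K (E c) ?CB B (proj2 K C B) (r c) = e0 c" "fcomp K (E c) ?CB C (proj1 K C B) (r c) = e1 c" for c
      by (simp_all add: comma_src_def comma_tgt_def E_def r_def e0_def e1_def)
    have xc: "x c \<in> cells X0 (E c) n" "post K X0 (E c) B (e0 c) n (x c) = b" "post K X0 (E c) C (e1 c) n (x c) = d"
      if c: "c \<in> cobj J" for c
    proof -
      have "x c \<in> simplices (Fun (slice K ?CB) X (E c, r c)) n" using x c by (simp add: is_cone_def)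
      then show "x c \<in> cells X0 (E c) n" "post K X0 (E c) B (e0 c) n (x c) = b" "post K X0 (E c) C (e1 c) n (x c) = d"
        unfolding over [OF D'(1) [OF c] rf(2) [OF c]] src by blast+
    qed
    have cone': "is_cone K J E M X0 n x"
      using x xc(1) by (simp add: is_cone_def X0(1))
    have "\<exists>!y. y \<in> cells X0 ?E n \<and> post K X0 ?E B ?e0 n y = b \<and> post K X0 ?E C ?e1 n y = d \<and>
        (\<forall>c\<in>cobj J. post K X0 ?E (E c) (l c) n y = x c)"
    proof (rule comma_limit [OF J obj X0(2) lim fg E _ l M cone' bd xc(2,3)])
      show "is_comma K (F c) B C (fcomp K B P (F c) (\<rho> c) f) (fcomp K C P (F c) (\<rho> c) g) (E c) (e0 c) (e1 c) (\<kappa> c)"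
        if "c \<in> cobj J" for c
        using E' [OF that] f' [OF that] g' [OF that] by simp
    qed
    then show ?thesis unfolding Mod_simps over [OF D(1) rf(1)] src slice_post conj_assoc unfolding X0(1) fst_conv .
  qed
  ultimately show ?thesis
    unfolding is_limit_def E_def [symmetric] r_def [symmetric] M_def [symmetric] l_def [symmetric]
    using mod(1) by simp
qed

subsection \<open>Constant diagrams and restriction\<close>

lemma small_cotensor: "ob A ==> simplicial_set (U :: 'u sset) ==> is_cotensor K A U (cotensor K A U) (cotensor_ev K A U)"
  by (intro chosen_cotensor small_cotensors)

lemma constant_diagram:
  fixes U :: "'u sset"
  assumes A: "ob A" and U: "simplicial_set U"
  shows "constant_diagram K A U \<in> functors K A (cotensor K A U)"
    "u \<in> simplices U m ==> pre K A (cotensor K A U) A (constant_diagram K A U) m (cotensor_ev K A U m u) = dg (Fun K A A) m (Idt K A)"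
proof -
  have "smap U (Fun K A A) (\<lambda>m u. dg (Fun K A A) m (Idt K A))"
    by (rule simplicial_mapI) (use A in \<open>simp_all add: act_dg_cells\<close>)
  from cotensor_lift [OF small_cotensor [OF A U] A A U this]
  show "constant_diagram K A U \<in> functors K A (cotensor K A U)"
    "u \<in> simplices U m ==> pre K A (cotensor K A U) A (constant_diagram K A U) m (cotensor_ev K A U m u) = dg (Fun K A A) m (Idt K A)"
    by (simp_all add: constant_diagram_def)
qed

lemma restrict_constant_diagram:
  fixes U V :: "'u sset"
  assumes A: "ob A" and UV: "simplicial_set U" "simplicial_set V" and i: "smap U V i"
  shows "constant_diagram K A U =
    fcomp K A (cotensor K A V) (cotensor K A U) (cotensor_restrict K A U V i) (constant_diagram K A V)"
proof -
  note CU = cotensorD [OF small_cotensor [OF A UV(1)]] and CV = cotensorD [OF small_cotensor [OF A UV(2)]]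
  note \<rho> = cotensor_restrict [OF small_cotensor [OF A UV(1)] small_cotensor [OF A UV(2)] A UV(1) i]
  show ?thesis
  proof (rule cotensor_functor_unique [OF small_cotensor [OF A UV(1)] A A])
    fix m u assume u: "u \<in> simplices U m"
    show "pre K A (cotensor K A U) A (constant_diagram K A U) m (cotensor_ev K A U m u) =
      pre K A (cotensor K A U) A (fcomp K A (cotensor K A V) (cotensor K A U) (cotensor_restrict K A U V i) (constant_diagram K A V)) m (cotensor_ev K A U m u)"
    using constant_diagram [OF A UV(1)] constant_diagram [OF A UV(2)] \<rho> u A CU(1) CU(3) [OF u] CV(1) smap_in [OF i u]
      by (simp flip: pre_pre)
  qed (use constant_diagram(1) [OF A] \<rho>(1) UV A cotensorD(1) [OF small_cotensor] in simp_all)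
qed

end

theorem lemma6p3p3:
  fixes K :: "('o, 's) cosmos"
    and J :: "('u::infinite, 'u) cat"
    and S :: "'u \<Rightarrow> 'u sset"
    and Sm :: "'u \<Rightarrow> nat \<Rightarrow> 'u \<Rightarrow> 'u"
    and T :: "'u sset"
    and \<pi> :: "'u \<Rightarrow> nat \<Rightarrow> 'u \<Rightarrow> 'u"
    and A D :: 'o
    and d :: 's
    and dc :: "'u \<Rightarrow> 's"
  assumes cosmos: "infinity_cosmos TYPE('u) K"
    and shape_cat: "category J"
    and diagram: "sset_diagram J S Sm"
    and shape: "coproduct_shape J \<or> pushout_shape J S Sm \<or> sequence_shape J S Sm"
    and colimit: "sset_colimit J S Sm T \<pi>"
    and objects: "A \<in> Obj K" "D \<in> Obj K"
    and d: "d \<in> functors K D (cotensor K A T)"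
    and dc: "\<And>c. c \<in> cobj J \<Longrightarrow> dc c = restricted_diagram K A D (S c) T (\<pi> c) d"
  shows "is_limit (Mod K D A) J
           (\<lambda>c. cone_module K A D (S c) (dc c))
           (\<lambda>f. cone_module_map K A D (S (ccod J f)) (S (cdom J f)) (Sm f)
                  (dc (cdom J f)) (dc (ccod J f)))
           (cone_module K A D T d)
           (\<lambda>c. cone_module_map K A D (S c) T (\<pi> c) d (dc c))"
proof -
  interpret inf_cosmos K "TYPE('u)" by unfold_locales (rule cosmos)
  have sT: "simplicial_set T" and \<pi>: "\<And>c. c \<in> cobj J ==> smap (S c) T (\<pi> c)"
    using colimit by (simp_all add: sset_colimit_def sset_cocone_def)
  have sS: "\<And>c. c \<in> cobj J ==> simplicial_set (S c)"
    and Sm: "\<And>f. f \<in> carr J ==> smap (S (ccod J f)) (S (cdom J f)) (Sm f)"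
    using diagram by (simp_all add: sset_diagram_def)
  have ends: "cdom J f \<in> cobj J" "ccod J f \<in> cobj J" if "f \<in> carr J" for f
    using shape_cat that by (simp_all add: category_def)
  note TC = small_cotensor [OF objects(1) sT] and SC = small_cotensor [OF objects(1) sS]
  let ?\<rho> = "\<lambda>c. cotensor_restrict K A (S c) T (\<pi> c)"
  let ?R = "\<lambda>f. cotensor_restrict K A (S (ccod J f)) (S (cdom J f)) (Sm f)"
  have lim: "is_limit K J (\<lambda>c. cotensor K A (S c)) ?R (cotensor K A T) ?\<rho>"
  proof (rule cotensor_of_colimit [OF diagram shape_cat colimit objects(1) TC SC])
    show "\<exists>W \<omega>. is_cotensor K A (std n) W \<omega>" for n
      using finitary_cotensor [OF objects(1) simplicial_set_std] by blast
    show "?\<rho> c \<in> functors K (cotensor K A T) (cotensor K A (S c))" if "c \<in> cobj J" for c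
      by (rule cotensor_restrict(1) [OF SC [OF that] TC objects(1) sS [OF that] \<pi> [OF that]])
    show "pre K (cotensor K A T) (cotensor K A (S c)) A (?\<rho> c) m (cotensor_ev K A (S c) m u) = cotensor_ev K A T m (\<pi> c m u)"
      if "c \<in> cobj J" "u \<in> simplices (S c) m" for c m u
      by (rule cotensor_restrict(2) [OF SC [OF that(1)] TC objects(1) sS [OF that(1)] \<pi> [OF that(1)] that(2)])
    show "?R f \<in> functors K (cotensor K A (S (cdom J f))) (cotensor K A (S (ccod J f)))" if "f \<in> carr J" for f
      by (rule cotensor_restrict(1) [OF SC [OF ends(2) [OF that]] SC [OF ends(1) [OF that]] objects(1) sS [OF ends(2) [OF that]] Sm [OF that]])
    show "pre K (cotensor K A (S (cdom J f))) (cotensor K A (S (ccod J f))) A (?R f) m (cotensor_ev K A (S (ccod J f)) m u) =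
        cotensor_ev K A (S (cdom J f)) m (Sm f m u)" if "f \<in> carr J" "u \<in> simplices (S (ccod J f)) m" for f m u
      by (rule cotensor_restrict(2) [OF SC [OF ends(2) [OF that(1)]] SC [OF ends(1) [OF that(1)]] objects(1) sS [OF ends(2) [OF that(1)]] Sm [OF that(1)] that(2)])
  qed
  show ?thesis
    unfolding cone_module_def cone_module_map_def
    by (rule comma_module_limit [OF shape_cat objects lim constant_diagram(1) [OF objects(1) sT] d])
      (use restrict_constant_diagram [OF objects(1) sS sT \<pi>] dc in \<open>simp_all add: restricted_diagram_def\<close>)
qed

end
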